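(* Let $H$ and $K$ be finitely presented locally tame groups. Then the free product $G = H * K$ is locally tame.
   Context: Let $G = \langle X \mid R\rangle$ be a finitely presented group (with a finite presentation), and let $T$ be its standard presentation $2$-complex: $T$ has one vertex, one edge (a loop) for each generator $x \in X$, and one $2$-cell for each relator $r \in R$. For a subgroup $H \le G = \pi_1(T)$, $Cayley_2(G,H)$ denotes the covering space of $T$ corresponding to $H$ (a $2$-complex with fundamental group $H$); $Cayley_2(G)$ is the universal cover of $T$. Tame subgroup: a finitely generated subgroup $H$ of a finitely presented group $G$ is tame in $G$ if for every finite subcomplex $C$ of $Cayley_2(G,H)$ and every connected component $L$ of $Cayley_2(G,H) - C$, the group $\pi_1(L)$ is finitely generated. (This property is independent of the chosen finite presentation of $G$.) Locally tame: a finitely presented group $G$ is locally tame if all finitely generated subgroups of $G$ are tame in $G$. *)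

theory Defs
  imports "HOL-Analysis.Analysis" "HOL-Algebra.Generated_Groups"
begin

section \<open>Groups presented by words\<close>

text \<open>The least congruence on the free monoid \<open>lists A\<close> containing the pairs in \<open>S\<close>.\<close>

inductive word_cong :: "'a set \<Rightarrow> ('a list \<times> 'a list) set \<Rightarrow> 'a list \<Rightarrow> 'a list \<Rightarrow> bool"
  for A S where
  refl: "w \<in> lists A \<Longrightarrow> word_cong A S w w"
| sym: "word_cong A S v w \<Longrightarrow> word_cong A S w v"
| trans: "word_cong A S u v \<Longrightarrow> word_cong A S v w \<Longrightarrow> word_cong A S u w"
| rewrite: "(u, v) \<in> S \<Longrightarrow> u \<in> lists A \<Longrightarrow> v \<in> lists A \<Longrightarrow> p \<in> lists A \<Longrightarrow> q \<in> lists A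
    \<Longrightarrow> word_cong A S (p @ u @ q) (p @ v @ q)"

definition word_class :: "'a set \<Rightarrow> ('a list \<times> 'a list) set \<Rightarrow> 'a list \<Rightarrow> 'a list set" where
  "word_class A S w = {v. word_cong A S w v}"

definition word_monoid :: "'a set \<Rightarrow> ('a list \<times> 'a list) set \<Rightarrow> 'a list set monoid" where
  "word_monoid A S =
    \<lparr>carrier = word_class A S ` lists A,
     mult = (\<lambda>a b. \<Union>u\<in>a. \<Union>v\<in>b. word_class A S (u @ v)),
     one = word_class A S []\<rparr>"

text \<open>The letters \<open>(x, True)\<close> and \<open>(x, False)\<close> stand for the generator \<open>x\<close> and its formal
  inverse; a relator \<open>r\<close> is a word in these letters, not necessarily reduced.\<close>

definition letters :: "'x set \<Rightarrow> ('x \<times> bool) set" where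
  "letters X = X \<times> UNIV"

definition group_relations ::
    "'x set \<Rightarrow> ('x \<times> bool) list set \<Rightarrow> (('x \<times> bool) list \<times> ('x \<times> bool) list) set" where
  "group_relations X R =
    {([(x, b), (x, \<not> b)], []) | x b. x \<in> X} \<union> {(r, []) | r. r \<in> R}"

definition presented_group ::
    "'x set \<Rightarrow> ('x \<times> bool) list set \<Rightarrow> ('x \<times> bool) list set monoid" where
  "presented_group X R = word_monoid (letters X) (group_relations X R)"

text \<open>\<open>finite_presentation G X R \<phi>\<close>: the map \<open>\<phi>\<close> on generators induces an isomorphism from
  \<open>\<langle>X | R\<rangle>\<close> onto \<open>G\<close>.\<close>

definition finite_presentation ::
    "('a, 'm) monoid_scheme \<Rightarrow> 'x set \<Rightarrow> ('x \<times> bool) list set \<Rightarrow> ('x \<Rightarrow> 'a) \<Rightarrow> bool" where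
  "finite_presentation G X R \<phi> \<longleftrightarrow>
    group G \<and> finite X \<and> finite R \<and> R \<subseteq> lists (letters X) \<and>
    (\<exists>f \<in> iso (presented_group X R) G.
       \<forall>x\<in>X. f (word_class (letters X) (group_relations X R) [(x, True)]) = \<phi> x)"

text \<open>The free product: words in the disjoint union of the two groups, modulo multiplying
  adjacent letters from the same factor and deleting the identities.\<close>

definition free_product_relations ::
    "('a, 'm) monoid_scheme \<Rightarrow> ('b, 'n) monoid_scheme
      \<Rightarrow> (('a + 'b) list \<times> ('a + 'b) list) set" where
  "free_product_relations H K =
    {([Inl a, Inl b], [Inl (a \<otimes>\<^bsub>H\<^esub> b)]) | a b. a \<in> carrier H \<and> b \<in> carrier H} \<union>
    {([Inr a, Inr b], [Inr (a \<otimes>\<^bsub>K\<^esub> b)]) | a b. a \<in> carrier K \<and> b \<in> carrier K} \<union>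
    {([Inl \<one>\<^bsub>H\<^esub>], []), ([Inr \<one>\<^bsub>K\<^esub>], [])}"

definition free_product ::
    "('a, 'm) monoid_scheme \<Rightarrow> ('b, 'n) monoid_scheme \<Rightarrow> ('a + 'b) list set monoid" where
  "free_product H K = word_monoid (carrier H <+> carrier K) (free_product_relations H K)"

definition finitely_generated :: "('a, 'm) monoid_scheme \<Rightarrow> bool" where
  "finitely_generated G \<longleftrightarrow> (\<exists>S. finite S \<and> S \<subseteq> carrier G \<and> generate G S = carrier G)"

lemma word_cong_in_lists: "word_cong A S u v \<Longrightarrow> u \<in> lists A \<and> v \<in> lists A"
  by (induction rule: word_cong.induct) auto

lemma word_cong_append_left:
  "word_cong A S u v \<Longrightarrow> p \<in> lists A \<Longrightarrow> word_cong A S (p @ u) (p @ v)"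
proof (induction rule: word_cong.induct)
  case (rewrite u v p' q)
  then show ?case using word_cong.rewrite[of u v S A "p @ p'" q] by auto
next
  case (refl w)
  then show ?case by (intro word_cong.refl) auto
qed (auto intro: word_cong.sym word_cong.trans)

lemma word_cong_append_right:
  "word_cong A S u v \<Longrightarrow> q \<in> lists A \<Longrightarrow> word_cong A S (u @ q) (v @ q)"
proof (induction rule: word_cong.induct)
  case (rewrite u v p q')
  then show ?case using word_cong.rewrite[of u v S A p "q' @ q"] by auto
next
  case (refl w)
  then show ?case by (intro word_cong.refl) auto
qed (auto intro: word_cong.sym word_cong.trans)

lemma word_cong_append:
  "word_cong A S u u' \<Longrightarrow> word_cong A S v v' \<Longrightarrow> word_cong A S (u @ v) (u' @ v')"
  by (meson word_cong.trans word_cong_append_left word_cong_append_right word_cong_in_lists)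

lemma word_class_eq_iff:
  "u \<in> lists A \<Longrightarrow> word_class A S u = word_class A S v \<longleftrightarrow> word_cong A S u v"
  by (auto simp: word_class_def set_eq_iff intro: word_cong.refl word_cong.sym word_cong.trans)

lemma mult_word_monoid:
  assumes "u \<in> lists A" "v \<in> lists A"
  shows "word_class A S u \<otimes>\<^bsub>word_monoid A S\<^esub> word_class A S v = word_class A S (u @ v)"
proof -
  have eq: "word_class A S (u' @ v') = word_class A S (u @ v)"
    if "u' \<in> word_class A S u" "v' \<in> word_class A S v" for u' v'
  proof -
    have "word_cong A S (u @ v) (u' @ v')"
      using that by (auto simp: word_class_def intro: word_cong_append)
    then show ?thesis using assms word_class_eq_iff[of "u @ v" A S "u' @ v'"] by simp
  qed
  have "word_class A S u \<noteq> {}" "word_class A S v \<noteq> {}"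
    using assms by (auto simp: word_class_def intro: word_cong.refl)
  moreover have "(\<Union>u'\<in>word_class A S u. \<Union>v'\<in>word_class A S v. word_class A S (u' @ v')) =
      (\<Union>u'\<in>word_class A S u. \<Union>v'\<in>word_class A S v. word_class A S (u @ v))"
    by (intro SUP_cong HOL.refl eq)
  ultimately show ?thesis by (simp add: word_monoid_def UN_constant)
qed

lemma monoid_word_monoid: "monoid (word_monoid A S)"
proof
  fix a b c
  assume "a \<in> carrier (word_monoid A S)" "b \<in> carrier (word_monoid A S)"
    "c \<in> carrier (word_monoid A S)"
  then obtain u v w where u: "u \<in> lists A" "v \<in> lists A" "w \<in> lists A"
    and a: "a = word_class A S u" "b = word_class A S v" "c = word_class A S w"
    by (auto simp: word_monoid_def)
  have app: "u @ v \<in> lists A" "v @ w \<in> lists A" using u by auto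
  show "a \<otimes>\<^bsub>word_monoid A S\<^esub> b \<in> carrier (word_monoid A S)"
    unfolding a using u app by (simp only: mult_word_monoid) (simp add: word_monoid_def)
  show "a \<otimes>\<^bsub>word_monoid A S\<^esub> b \<otimes>\<^bsub>word_monoid A S\<^esub> c =
      a \<otimes>\<^bsub>word_monoid A S\<^esub> (b \<otimes>\<^bsub>word_monoid A S\<^esub> c)"
    unfolding a using u app by (simp only: mult_word_monoid append_assoc)
next
  have one: "\<one>\<^bsub>word_monoid A S\<^esub> = word_class A S []" by (simp add: word_monoid_def)
  show "\<one>\<^bsub>word_monoid A S\<^esub> \<in> carrier (word_monoid A S)"
    by (auto simp: word_monoid_def)
  fix a assume "a \<in> carrier (word_monoid A S)"
  then obtain u where u: "u \<in> lists A" "a = word_class A S u"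
    by (auto simp: word_monoid_def)
  show "\<one>\<^bsub>word_monoid A S\<^esub> \<otimes>\<^bsub>word_monoid A S\<^esub> a = a"
    using mult_word_monoid[of "[]" A u S] u by (simp add: one)
  show "a \<otimes>\<^bsub>word_monoid A S\<^esub> \<one>\<^bsub>word_monoid A S\<^esub> = a"
    using mult_word_monoid[of u A "[]" S] u by (simp add: one)
qed

lemma group_word_monoid:
  assumes "\<And>x. x \<in> A \<Longrightarrow> \<exists>y\<in>A. word_cong A S [y, x] []"
  shows "group (word_monoid A S)"
proof (rule monoid.group_l_invI[OF monoid_word_monoid])
  fix a assume "a \<in> carrier (word_monoid A S)"
  then obtain u where u: "u \<in> lists A" "a = word_class A S u"
    by (auto simp: word_monoid_def)
  have "\<exists>v\<in>lists A. word_cong A S (v @ u) []"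
    using u(1)
  proof (induction u)
    case Nil
    show ?case by (intro bexI[of _ "[]"]) (auto intro: word_cong.refl)
  next
    case (Cons x u)
    then obtain y where y: "y \<in> A" "word_cong A S [y, x] []"
      using assms[of x] by auto
    obtain v where v: "v \<in> lists A" "word_cong A S (v @ u) []"
      using Cons by auto
    have "word_cong A S ([y, x] @ u) ([] @ u)"
      using word_cong_append_right[OF y(2)] Cons by auto
    then have "word_cong A S ((v @ [y]) @ x # u) (v @ u)"
      using word_cong_append_left[of A S _ _ v] v(1) by force
    then show ?case
      using v y by (intro bexI[of _ "v @ [y]"]) (auto intro: word_cong.trans)
  qed
  then obtain v where v: "v \<in> lists A" "word_cong A S (v @ u) []" by blast
  then have "word_class A S v \<otimes>\<^bsub>word_monoid A S\<^esub> a = \<one>\<^bsub>word_monoid A S\<^esub>"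
    using u mult_word_monoid[of v A u S] word_class_eq_iff[of "v @ u" A S "[]"]
    by (simp add: word_monoid_def)
  then show "\<exists>b\<in>carrier (word_monoid A S). b \<otimes>\<^bsub>word_monoid A S\<^esub> a = \<one>\<^bsub>word_monoid A S\<^esub>"
    using v(1) by (auto simp: word_monoid_def)
qed

lemma group_presented_group: "group (presented_group X R)"
  unfolding presented_group_def
proof (rule group_word_monoid)
  fix l assume "l \<in> letters X"
  then obtain x b where l: "l = (x, b)" "x \<in> X" by (auto simp: letters_def)
  have "([(x, \<not> b), (x, \<not> \<not> b)], []) \<in> group_relations X R"
    using l by (fastforce simp: group_relations_def)
  then have "word_cong (letters X) (group_relations X R) [(x, \<not> b), l] []"
    using word_cong.rewrite[of "[(x, \<not> b), (x, b)]" "[]" _ "letters X" "[]" "[]"] l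
    by (simp add: letters_def)
  then show "\<exists>m\<in>letters X. word_cong (letters X) (group_relations X R) [m, l] []"
    using l by (intro bexI[of _ "(x, \<not> b)"]) (auto simp: letters_def)
qed

lemma group_free_product:
  fixes H :: "('a, 'm) monoid_scheme" and K :: "('b, 'n) monoid_scheme"
  assumes "group H" "group K"
  shows "group (free_product H K)"
  unfolding free_product_def
proof (rule group_word_monoid)
  let ?A = "carrier H <+> carrier K" and ?S = "free_product_relations H K"
  interpret H: group H by fact
  interpret K: group K by fact
  fix l assume "l \<in> ?A"
  then show "\<exists>m\<in>?A. word_cong ?A ?S [m, l] []"
  proof
    fix a assume a: "l = Inl a" "a \<in> carrier H"
    have "([Inl (inv\<^bsub>H\<^esub> a), Inl a], [Inl \<one>\<^bsub>H\<^esub>]) \<in> ?S"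
      unfolding free_product_relations_def using a H.l_inv[of a] H.inv_closed[of a] by fastforce
    then have "word_cong ?A ?S [Inl (inv\<^bsub>H\<^esub> a), l] [Inl \<one>\<^bsub>H\<^esub>]"
      using word_cong.rewrite[of _ _ ?S ?A "[]" "[]"] a by fastforce
    moreover have "word_cong ?A ?S [Inl \<one>\<^bsub>H\<^esub>] []"
      using word_cong.rewrite[of "[Inl \<one>\<^bsub>H\<^esub>]" "[]" ?S ?A "[]" "[]"]
      by (auto simp: free_product_relations_def)
    ultimately show ?thesis
      using a by (intro bexI[of _ "Inl (inv\<^bsub>H\<^esub> a)"]) (auto intro: word_cong.trans)
  next
    fix a assume a: "l = Inr a" "a \<in> carrier K"
    have "([Inr (inv\<^bsub>K\<^esub> a), Inr a], [Inr \<one>\<^bsub>K\<^esub>]) \<in> ?S"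
      unfolding free_product_relations_def using a K.l_inv[of a] K.inv_closed[of a] by fastforce
    then have "word_cong ?A ?S [Inr (inv\<^bsub>K\<^esub> a), l] [Inr \<one>\<^bsub>K\<^esub>]"
      using word_cong.rewrite[of _ _ ?S ?A "[]" "[]"] a by fastforce
    moreover have "word_cong ?A ?S [Inr \<one>\<^bsub>K\<^esub>] []"
      using word_cong.rewrite[of "[Inr \<one>\<^bsub>K\<^esub>]" "[]" ?S ?A "[]" "[]"]
      by (auto simp: free_product_relations_def)
    ultimately show ?thesis
      using a by (intro bexI[of _ "Inr (inv\<^bsub>K\<^esub> a)"]) (auto intro: word_cong.trans)
  qed
qed


section \<open>Two-dimensional cell complexes\<close>

text \<open>Attaching data of a 2-complex. The 2-cell \<open>f\<close> is attached along the closed edge path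
  \<open>bdry f\<close> based at \<open>base f\<close>; a pair \<open>(e, True)\<close> traverses \<open>e\<close> from \<open>src e\<close> to \<open>tgt e\<close>
  and \<open>(e, False)\<close> traverses it backwards. The field \<open>base\<close> matters only if \<open>bdry f\<close> is empty.\<close>

record ('v, 'e, 'f) two_complex =
  verts :: "'v set"
  edges :: "'e set"
  faces :: "'f set"
  src :: "'e \<Rightarrow> 'v"
  tgt :: "'e \<Rightarrow> 'v"
  base :: "'f \<Rightarrow> 'v"
  bdry :: "'f \<Rightarrow> ('e \<times> bool) list"

text \<open>Points of the geometric realization: vertices, points of the open edges
  (\<open>0 < t < 1\<close>) and points of the open 2-cells (\<open>\<bar>z\<bar> < 1\<close>).\<close>

datatype ('v, 'e, 'f) point = VertexPt 'v | EdgePt 'e real | FacePt 'f complex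

definition cell_points :: "'v set \<Rightarrow> 'e set \<Rightarrow> 'f set \<Rightarrow> ('v, 'e, 'f) point set" where
  "cell_points V E F =
    VertexPt ` V \<union> {EdgePt e t | e t. e \<in> E \<and> 0 < t \<and> t < 1} \<union>
    {FacePt f z | f z. f \<in> F \<and> cmod z < 1}"

definition edge_map :: "('v, 'e, 'f) two_complex \<Rightarrow> 'e \<Rightarrow> real \<Rightarrow> ('v, 'e, 'f) point" where
  "edge_map T e t =
    (if t \<le> 0 then VertexPt (src T e) else if t \<ge> 1 then VertexPt (tgt T e) else EdgePt e t)"

text \<open>The attaching map of \<open>f\<close>, on the circle parametrized by \<open>[0, 1)\<close>: each letter of the
  boundary word is traversed at constant speed on a subinterval of length \<open>1 / n\<close>.\<close>

definition attaching_map :: "('v, 'e, 'f) two_complex \<Rightarrow> 'f \<Rightarrow> real \<Rightarrow> ('v, 'e, 'f) point" where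
  "attaching_map T f s =
    (let n = length (bdry T f) in
     if n = 0 then VertexPt (base T f)
     else let (e, d) = bdry T f ! nat \<lfloor>real n * s\<rfloor>; t = frac (real n * s)
          in edge_map T e (if d then t else 1 - t))"

definition face_map :: "('v, 'e, 'f) two_complex \<Rightarrow> 'f \<Rightarrow> complex \<Rightarrow> ('v, 'e, 'f) point" where
  "face_map T f z =
    (if cmod z < 1 then FacePt f z else attaching_map T f (Arg2pi z / (2 * pi)))"

text \<open>The weak (quotient) topology with respect to the characteristic maps of all cells.\<close>

definition realization_open :: "('v, 'e, 'f) two_complex \<Rightarrow> ('v, 'e, 'f) point set \<Rightarrow> bool" where
  "realization_open T U \<longleftrightarrow>
    U \<subseteq> cell_points (verts T) (edges T) (faces T) \<and>
    (\<forall>e\<in>edges T. openin (top_of_set {0..1}) {t \<in> {0..1}. edge_map T e t \<in> U}) \<and>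
    (\<forall>f\<in>faces T. openin (top_of_set (cball 0 1)) {z \<in> cball 0 1. face_map T f z \<in> U})"

definition realization :: "('v, 'e, 'f) two_complex \<Rightarrow> ('v, 'e, 'f) point topology" where
  "realization T = topology (realization_open T)"

lemma openin_realization: "openin (realization T) U \<longleftrightarrow> realization_open T U"
proof -
  have "istopology (realization_open T)"
    unfolding istopology_def
  proof (intro conjI allI impI)
    fix U V assume *: "realization_open T U" "realization_open T V"
    have "{t \<in> {0..1}. edge_map T e t \<in> U \<inter> V} =
        {t \<in> {0..1}. edge_map T e t \<in> U} \<inter> {t \<in> {0..1}. edge_map T e t \<in> V}"
      "{z \<in> cball 0 1. face_map T f z \<in> U \<inter> V} =
        {z \<in> cball 0 1. face_map T f z \<in> U} \<inter> {z \<in> cball 0 1. face_map T f z \<in> V}" for e f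
      by auto
    then show "realization_open T (U \<inter> V)"
      using * unfolding realization_open_def by (metis (no_types, lifting) le_infI1 openin_Int)
  next
    fix \<U> assume *: "\<forall>U\<in>\<U>. realization_open T U"
    have "{t \<in> {0..1}. edge_map T e t \<in> \<Union>\<U>} = (\<Union>U\<in>\<U>. {t \<in> {0..1}. edge_map T e t \<in> U})"
      "{z \<in> cball 0 1. face_map T f z \<in> \<Union>\<U>} = (\<Union>U\<in>\<U>. {z \<in> cball 0 1. face_map T f z \<in> U})"
      for e f by auto
    then show "realization_open T (\<Union>\<U>)"
      using * unfolding realization_open_def by (auto simp del: Union_iff)
  qed
  then show ?thesis by (simp add: realization_def topology_inverse')
qed

definition finite_subcomplex ::
    "('v, 'e, 'f) two_complex \<Rightarrow> 'v set \<Rightarrow> 'e set \<Rightarrow> 'f set \<Rightarrow> bool" where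
  "finite_subcomplex T V E F \<longleftrightarrow>
    finite V \<and> finite E \<and> finite F \<and> V \<subseteq> verts T \<and> E \<subseteq> edges T \<and> F \<subseteq> faces T \<and>
    (\<forall>e\<in>E. src T e \<in> V \<and> tgt T e \<in> V) \<and>
    (\<forall>f\<in>F. base T f \<in> V \<and> fst ` set (bdry T f) \<subseteq> E)"


section \<open>The fundamental group\<close>

definition loops :: "'a topology \<Rightarrow> 'a \<Rightarrow> (real \<Rightarrow> 'a) set" where
  "loops X x = {p. pathin X p \<and> p 0 = x \<and> p 1 = x}"

definition loop_class :: "'a topology \<Rightarrow> 'a \<Rightarrow> (real \<Rightarrow> 'a) \<Rightarrow> (real \<Rightarrow> 'a) set" where
  "loop_class X x p =
    {q \<in> loops X x. homotopic_with (\<lambda>r. r 0 = x \<and> r 1 = x) (top_of_set {0..1}) X p q}"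

definition join_loops :: "(real \<Rightarrow> 'a) \<Rightarrow> (real \<Rightarrow> 'a) \<Rightarrow> real \<Rightarrow> 'a" where
  "join_loops p q t = (if t \<le> 1 / 2 then p (2 * t) else q (2 * t - 1))"

definition fundamental_group :: "'a topology \<Rightarrow> 'a \<Rightarrow> (real \<Rightarrow> 'a) set monoid" where
  "fundamental_group X x =
    \<lparr>carrier = loop_class X x ` loops X x,
     mult = (\<lambda>a b. \<Union>p\<in>a. \<Union>q\<in>b. loop_class X x (join_loops p q)),
     one = loop_class X x (\<lambda>_. x)\<rparr>"


section \<open>Coverings of the presentation complex and tame subgroups\<close>

text \<open>The edge path labelled by a word and starting at the coset \<open>c\<close>. The edge \<open>(c, x)\<close>
  leads from \<open>c\<close> to \<open>c #> \<phi> x\<close>.\<close>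

primrec coset_path ::
    "('a, 'm) monoid_scheme \<Rightarrow> ('x \<Rightarrow> 'a) \<Rightarrow> 'a set \<Rightarrow> ('x \<times> bool) list
      \<Rightarrow> (('a set \<times> 'x) \<times> bool) list" where
  "coset_path G \<phi> c [] = []"
| "coset_path G \<phi> c (l # w) =
    (if snd l
     then ((c, fst l), True) # coset_path G \<phi> (c #>\<^bsub>G\<^esub> \<phi> (fst l)) w
     else ((c #>\<^bsub>G\<^esub> inv\<^bsub>G\<^esub> \<phi> (fst l), fst l), False)
       # coset_path G \<phi> (c #>\<^bsub>G\<^esub> inv\<^bsub>G\<^esub> \<phi> (fst l)) w)"

text \<open>The covering space, corresponding to the subgroup \<open>A\<close>, of the standard 2-complex of
  the presentation \<open>\<langle>X | R\<rangle>\<close> of \<open>G\<close>. The fibre over the vertex is the set of right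
  cosets \<open>A g\<close>, with \<open>A\<close> itself as base vertex; the fibres over an edge \<open>x\<close> and over a
  2-cell \<open>r\<close> are indexed by the cosets at which the lifts of the loop \<open>x\<close> and of the
  boundary path \<open>r\<close> start. The lift at \<open>A\<close> of a word is closed iff the word represents an
  element of \<open>A\<close>. For \<open>A = carrier G\<close> this is the standard 2-complex itself, and for the
  trivial subgroup its universal covering.\<close>

definition cayley2 ::
    "('a, 'm) monoid_scheme \<Rightarrow> 'x set \<Rightarrow> ('x \<times> bool) list set \<Rightarrow> ('x \<Rightarrow> 'a) \<Rightarrow> 'a set
      \<Rightarrow> ('a set, 'a set \<times> 'x, 'a set \<times> ('x \<times> bool) list) two_complex" where
  "cayley2 G X R \<phi> A =
    \<lparr>verts = rcosets\<^bsub>G\<^esub> A,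
     edges = (rcosets\<^bsub>G\<^esub> A) \<times> X,
     faces = (rcosets\<^bsub>G\<^esub> A) \<times> R,
     src = fst,
     tgt = (\<lambda>(c, x). c #>\<^bsub>G\<^esub> \<phi> x),
     base = fst,
     bdry = (\<lambda>(c, r). coset_path G \<phi> c r)\<rparr>"

definition tame_wrt ::
    "('a, 'm) monoid_scheme \<Rightarrow> 'x set \<Rightarrow> ('x \<times> bool) list set \<Rightarrow> ('x \<Rightarrow> 'a) \<Rightarrow> 'a set \<Rightarrow> bool" where
  "tame_wrt G X R \<phi> A \<longleftrightarrow>
    (\<forall>V E F L.
       finite_subcomplex (cayley2 G X R \<phi> A) V E F \<longrightarrow>
       L \<in> connected_components_of
             (subtopology (realization (cayley2 G X R \<phi> A)) (- cell_points V E F)) \<longrightarrow>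
       (\<forall>x\<in>L. finitely_generated
          (fundamental_group (subtopology (realization (cayley2 G X R \<phi> A)) L) x)))"

text \<open>Locally tame: \<open>G\<close> has a finite presentation with respect to which every finitely
  generated subgroup is tame. Tameness is independent of the finite presentation, so one fixed
  choice serves all subgroups. Every finite generating set may be indexed by natural numbers.\<close>

definition locally_tame :: "('a, 'm) monoid_scheme \<Rightarrow> bool" where
  "locally_tame G \<longleftrightarrow>
    (\<exists>(X :: nat set) R \<phi>. finite_presentation G X R \<phi> \<and>
       (\<forall>A. subgroup A G \<and> finitely_generated (G\<lparr>carrier := A\<rparr>) \<longrightarrow> tame_wrt G X R \<phi> A))"

end

(* Let Y be the covering of the presentation complex of G = H * K that belongs to a finitely
   generated subgroup A, and let C be a finite subcomplex. Cutting Y along its vertices splits it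
   into pieces; each piece is the covering of the presentation complex of H (or K) that belongs to
   the stabilizer B in H (or K) of a coset A g, embedded by B h |-> A g h. The words of a finite
   generating set of A visit finitely many cosets. Restricting the paths of these generators to the
   orbit of A g shows that B is finitely generated, hence tame, and that B = 1 if the orbit is not
   visited. So a component of the complement of C meets each piece in sets with finitely generated
   loop groups, and all but finitely many of these sets contribute only null-homotopic loops,
   because the piece is simply connected and disjoint from C.
   It remains to see that the pieces are glued along a graph with finitely generated fundamental
   group. For a coset e that is not visited, the cocycle on words counting the passages through e
   inside an H-piece vanishes on A, so it is the coboundary of an integer potential on the cosets;
   this potential shows that the vertex e separates the graph of pieces. Hence only the finitely
   many visited cosets can lie on cycles, and finitely many additional loops suffice.
   Paths in the complement of C are reduced to concatenations of half edges and radii of 2-cells by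
   contracting neighbourhoods of the cells to their centres. *)
theory Submission
  imports Defs
begin

section \<open>Path homotopy in abstract topological spaces\<close>

text \<open>The complement of \<open>C\<close> is not a subcomplex: a cell outside \<open>C\<close>
  may have lost part of its boundary. Cells are therefore represented by their centres. Since the
  open star of a cell outside \<open>C\<close> also lies outside \<open>C\<close>, paths can be
  pushed to centres, half edges and radii without entering \<open>C\<close>. Removing
  \<open>C\<close> may also break a piece apart, so the graph to be studied has as vertices not the
  pieces, but the classes of centres that can be joined within a piece outside \<open>C\<close>;
  each centre lies in one class of either type and links the two. A spanning tree of this graph
  yields generators: the loops of the classes, and one loop for each link outside the tree. Both
  families must be made finite. For the loops, a finite set of centres (\<open>guards\<close>) meets
  every class whose orbit touches \<open>C\<close> or a visited coset. For the links, a potential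
  shows that an unvisited vertex is a bridge, hence part of the tree. Stabilizers and potentials
  come from the same device, a weight on pairs (coset, letter) that respects the defining relations
  of the free product: with values in a factor it produces Schreier generators, with values in the
  integers it produces potentials.\<close>

definition hp :: "'a topology \<Rightarrow> (real \<Rightarrow> 'a) \<Rightarrow> (real \<Rightarrow> 'a) \<Rightarrow> bool" where
  "hp X p q \<longleftrightarrow> p 0 = q 0 \<and> p 1 = q 1 \<and>
     homotopic_with (\<lambda>r. r 0 = p 0 \<and> r 1 = p 1) (top_of_set {0..1}) X p q"

definition rv :: "(real \<Rightarrow> 'a) \<Rightarrow> real \<Rightarrow> 'a" where
  "rv p = (\<lambda>t. p (1 - t))"

lemma join_loops_0 [simp]: "join_loops p q 0 = p 0"
  and join_loops_1 [simp]: "join_loops p q 1 = q 1"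
  and rv_0 [simp]: "rv p 0 = p 1"
  and rv_1 [simp]: "rv p 1 = p 0"
  and rv_rv [simp]: "rv (rv p) = p"
  by (simp_all add: join_loops_def rv_def)

lemma rv_const [simp]: "rv (\<lambda>_. x) = (\<lambda>_. x)"
  by (simp add: rv_def)

lemma rv_join: "p 1 = q 0 \<Longrightarrow> rv (join_loops p q) = join_loops (rv q) (rv p)"
  by (auto simp: rv_def join_loops_def fun_eq_iff algebra_simps intro!: arg_cong[where f = p])

lemma hp_path1: "hp X p q \<Longrightarrow> pathin X p"
  and hp_path2: "hp X p q \<Longrightarrow> pathin X q"
  by (auto simp: hp_def pathin_def dest: homotopic_with_imp_continuous_maps)

lemma hp_0: "hp X p q \<Longrightarrow> p 0 = q 0"
  and hp_1: "hp X p q \<Longrightarrow> p 1 = q 1"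
  by (auto simp: hp_def)

lemma hp_refl: "pathin X p \<Longrightarrow> hp X p p"
  by (auto simp: hp_def pathin_def)

lemma hp_sym: "hp X p q \<Longrightarrow> hp X q p"
  by (auto simp: hp_def intro: homotopic_with_symD)

lemma hp_trans [trans]: "hp X p q \<Longrightarrow> hp X q r \<Longrightarrow> hp X p r"
  by (auto simp: hp_def intro: homotopic_with_trans)

lemma hp_map:
  assumes "hp X p q" "continuous_map X Y f"
  shows "hp Y (f \<circ> p) (f \<circ> q)"
  using assms unfolding hp_def
  by (auto intro: homotopic_with_compose_continuous_map_left)

lemma pathin_const: "x \<in> topspace X \<Longrightarrow> pathin X (\<lambda>_. x)"
  by (simp add: pathin_def)

lemma pathin_in: "pathin X p \<Longrightarrow> t \<in> {0..1} \<Longrightarrow> p t \<in> topspace X"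
  by (auto simp: pathin_def continuous_map_def)

lemma pathin_ends: "pathin X p \<Longrightarrow> p 0 \<in> topspace X" "pathin X p \<Longrightarrow> p 1 \<in> topspace X"
  by (auto intro: pathin_in)

lemma pathin_rv: "pathin X p \<Longrightarrow> pathin X (rv p)"
  unfolding pathin_def rv_def
  by (rule continuous_map_compose[unfolded o_def, of _ "top_of_set {0..1}" "\<lambda>t. 1 - t"])
    (auto intro!: continuous_intros)

lemma hp_rv:
  assumes "hp X p q" shows "hp X (rv p) (rv q)"
proof -
  have c: "continuous_map (top_of_set {0..1}) (top_of_set {0..1::real}) (\<lambda>t. 1 - t)"
    by (auto intro!: continuous_intros)
  have "homotopic_with (\<lambda>r. r 0 = p 0 \<and> r 1 = p 1) (top_of_set {0..1}) X p q"
    using assms unfolding hp_def by blast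
  then have "homotopic_with (\<lambda>r. r 0 = p 1 \<and> r 1 = p 0) (top_of_set {0..1}) X
      (p \<circ> (\<lambda>t. 1 - t)) (q \<circ> (\<lambda>t. 1 - t))"
    by (rule homotopic_with_compose_continuous_map_right[OF _ c]) auto
  then show ?thesis using assms by (auto simp: hp_def rv_def o_def)
qed

text \<open>The straight-line homotopy stays in \<open>S\<close> and is pushed forward by
  \<open>f\<close>. Every homotopy inside a single edge or sector below is an instance, and so are
  the groupoid laws, with \<open>S\<close> the unit interval and \<open>f\<close> the path
  itself.\<close>

lemma hp_convex:
  fixes S :: "'b::real_normed_vector set"
  assumes f: "continuous_map (top_of_set S) X f" and "convex S"
    and a: "path \<alpha>" "path_image \<alpha> \<subseteq> S" and b: "path \<beta>" "path_image \<beta> \<subseteq> S"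
    and "\<alpha> 0 = \<beta> 0" "\<alpha> 1 = \<beta> 1"
  shows "hp X (f \<circ> \<alpha>) (f \<circ> \<beta>)"
proof -
  have "closed_segment (\<alpha> t) (\<beta> t) \<subseteq> S" if "t \<in> {0..1}" for t
    using that assms by (intro closed_segment_subset) (auto simp: path_image_def)
  then have "homotopic_paths S \<alpha> \<beta>"
    using assms by (intro homotopic_paths_linear) (auto simp: pathstart_def pathfinish_def)
  then have "homotopic_with (\<lambda>r. r 0 = f (\<alpha> 0) \<and> r 1 = f (\<alpha> 1)) (top_of_set {0..1}) X (f \<circ> \<alpha>) (f \<circ> \<beta>)"
    unfolding homotopic_paths_def
    by (rule homotopic_with_compose_continuous_map_left[OF _ f])
      (auto simp: pathstart_def pathfinish_def)
  then show ?thesis using assms by (simp add: hp_def)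
qed

lemma pathin_o:
  assumes "continuous_map (top_of_set S) X f" "path \<alpha>" "path_image \<alpha> \<subseteq> S"
  shows "pathin X (f \<circ> \<alpha>)"
  using assms unfolding pathin_def path_def
  by (intro continuous_map_compose) (auto simp: path_image_def image_subset_iff)

lemma join_o: "join_loops (f \<circ> \<alpha>) (f \<circ> \<beta>) = f \<circ> (\<alpha> +++ \<beta>)"
  by (auto simp: join_loops_def joinpaths_def)

lemma rv_o: "rv (f \<circ> \<alpha>) = f \<circ> reversepath \<alpha>"
  by (auto simp: rv_def reversepath_def)

lemma pathin_join:
  assumes "pathin X p" "pathin X q" "p 1 = q 0"
  shows "pathin X (join_loops p q)"
  unfolding pathin_def join_loops_def
proof (rule continuous_map_cases_le)
  have A: "continuous_map (subtopology (top_of_set {0..1}) {t. t \<le> 1 / 2}) (top_of_set {0..1}) (\<lambda>t::real. 2 * t)"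
    and B: "continuous_map (subtopology (top_of_set {0..1}) {t. 1 / 2 \<le> t}) (top_of_set {0..1}) (\<lambda>t::real. 2 * t - 1)"
    by (auto simp: subtopology_subtopology intro!: continuous_intros)
  have "{t \<in> topspace (top_of_set {0..1}). t \<le> 1/2} = topspace (top_of_set {0..1}) \<inter> {t. t \<le> (1/2::real)}"
    "{t \<in> topspace (top_of_set {0..1}). 1/2 \<le> t} = topspace (top_of_set {0..1}) \<inter> {t. 1/2 \<le> (t::real)}"
    by auto
  then show "continuous_map (subtopology (top_of_set {0..1}) {t \<in> topspace (top_of_set {0..1}). t \<le> 1/2}) X (\<lambda>t. p (2 * t))"
    "continuous_map (subtopology (top_of_set {0..1}) {t \<in> topspace (top_of_set {0..1}). 1/2 \<le> t}) X (\<lambda>t. q (2 * t - 1))"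
    using continuous_map_compose[OF A assms(1)[unfolded pathin_def]]
      continuous_map_compose[OF B assms(2)[unfolded pathin_def]]
    by (simp_all only: o_def subtopology_restrict)
  show "p (2 * t) = q (2 * t - 1)" if "t = 1 / 2" for t
    unfolding that using assms(3) by simp
qed auto

lemma hp_join:
  assumes "hp X p p'" "hp X q q'" "p 1 = q 0"
  shows "hp X (join_loops p q) (join_loops p' q')"
proof -
  let ?I = "top_of_set {0..1::real}"
  obtain h where h: "continuous_map (prod_topology ?I ?I) X h" "\<And>x. h (0, x) = p x" "\<And>x. h (1, x) = p' x"
    "\<And>t. t \<in> {0..1} \<Longrightarrow> h (t, 0) = p 0 \<and> h (t, 1) = p 1"
    using assms(1) unfolding hp_def homotopic_with_def by blast
  obtain k where k: "continuous_map (prod_topology ?I ?I) X k" "\<And>x. k (0, x) = q x" "\<And>x. k (1, x) = q' x"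
    "\<And>t. t \<in> {0..1} \<Longrightarrow> k (t, 0) = q 0 \<and> k (t, 1) = q 1"
    using assms(2) unfolding hp_def homotopic_with_def by blast
  let ?g = "\<lambda>z. if snd z \<le> (1/2::real) then h (fst z, 2 * snd z) else k (fst z, 2 * snd z - 1)"
  have A: "continuous_map (subtopology (prod_topology ?I ?I) {z. snd z \<le> 1/2}) (prod_topology ?I ?I) (\<lambda>z. (fst z, 2 * snd z))"
    and B: "continuous_map (subtopology (prod_topology ?I ?I) {z. 1/2 \<le> snd z}) (prod_topology ?I ?I) (\<lambda>z. (fst z, 2 * snd z - 1))"
    unfolding prod_topology_subtopology_eu subtopology_subtopology
    by (auto intro!: continuous_intros)
  have "continuous_map (prod_topology ?I ?I) X ?g"
  proof (rule continuous_map_cases_le)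
    have "{z \<in> topspace (prod_topology ?I ?I). snd z \<le> 1/2} = topspace (prod_topology ?I ?I) \<inter> {z. snd z \<le> 1/2}"
     "{z \<in> topspace (prod_topology ?I ?I). 1/2 \<le> snd z} = topspace (prod_topology ?I ?I) \<inter> {z. 1/2 \<le> snd z}"
      by auto
    then show "continuous_map (subtopology (prod_topology ?I ?I) {z \<in> topspace (prod_topology ?I ?I). snd z \<le> 1/2}) X (\<lambda>z. h (fst z, 2 * snd z))"
      "continuous_map (subtopology (prod_topology ?I ?I) {z \<in> topspace (prod_topology ?I ?I). 1/2 \<le> snd z}) X (\<lambda>z. k (fst z, 2 * snd z - 1))"
      using continuous_map_compose[OF A h(1)] continuous_map_compose[OF B k(1)]
      by (simp_all only: o_def subtopology_restrict)
    show "continuous_map (prod_topology ?I ?I) euclideanreal snd"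
      by (metis continuous_map_into_fulltopology continuous_map_snd)
    show "h (fst z, 2 * snd z) = k (fst z, 2 * snd z - 1)"
      if "z \<in> topspace (prod_topology ?I ?I)" "snd z = 1 / 2" for z
      unfolding that(2) using h(4)[of "fst z"] k(4)[of "fst z"] assms(3) that(1) by auto
  qed auto
  then have "homotopic_with (\<lambda>r. r 0 = p 0 \<and> r 1 = q 1) ?I X (join_loops p q) (join_loops p' q')"
    unfolding homotopic_with_def
    by (intro exI[of _ ?g]) (use h k in \<open>auto simp: join_loops_def\<close>)
  then show ?thesis using assms by (auto simp: hp_def)
qed

lemma hp_reparam:
  assumes "pathin X p" "path \<phi>" "path_image \<phi> \<subseteq> {0..1}" "\<phi> 0 = 0" "\<phi> 1 = 1"
  shows "hp X p (p \<circ> \<phi>)"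
proof -
  have "hp X (p \<circ> (\<lambda>t. t)) (p \<circ> \<phi>)"
    using assms by (intro hp_convex[of "{0..1}"]) (auto simp: pathin_def path_def path_image_def)
  then show ?thesis by (simp add: o_def)
qed

lemma hp_assoc:
  assumes "pathin X p" "pathin X q" "pathin X r" "p 1 = q 0" "q 1 = r 0"
  shows "hp X (join_loops (join_loops p q) r) (join_loops p (join_loops q r))"
proof -
  \<comment> \<open>The left bracketing finishes \<open>p\<close>, \<open>q\<close>,
    \<open>r\<close> at the times 1/4, 1/2, 1, the right one at 1/2, 3/4, 1; \<open>?\<phi>\<close>
    carries the second subdivision to the first.\<close>
  let ?\<phi> = "linepath 0 (1/4) +++ (linepath (1/4) (1/2) +++ linepath (1/2) (1::real))"
  have eq: "join_loops p (join_loops q r) = join_loops (join_loops p q) r \<circ> ?\<phi>"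
    by (auto simp: join_loops_def joinpaths_def linepath_def fun_eq_iff field_simps
        intro!: arg_cong[where f = q] arg_cong[where f = r] arg_cong[where f = p])
  have 1: "path ?\<phi>" by (intro path_join_imp) auto
  have 2: "path_image ?\<phi> \<subseteq> {0..1}"
    by (intro subset_path_image_join) (auto simp: closed_segment_eq_real_ivl)
  have 3: "?\<phi> 0 = 0" "?\<phi> 1 = 1" by (simp_all add: joinpaths_def linepath_def)
  show ?thesis
    unfolding eq using assms 1 2 3
    by (intro hp_reparam pathin_join) simp_all
qed

lemma hp_lunit:
  assumes "pathin X p" "x = p 0" shows "hp X (join_loops (\<lambda>_. x) p) p"
proof -
  let ?\<phi> = "linepath 0 0 +++ linepath 0 (1::real)"
  have eq: "join_loops (\<lambda>_. x) p = p \<circ> ?\<phi>"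
    using assms(2) by (auto simp: join_loops_def joinpaths_def linepath_def fun_eq_iff)
  have 1: "path ?\<phi>" by (intro path_join_imp) auto
  have 2: "path_image ?\<phi> \<subseteq> {0..1}"
    by (intro subset_path_image_join) (auto simp: closed_segment_eq_real_ivl)
  show ?thesis
    unfolding eq using assms
    by (intro hp_sym[OF hp_reparam]) (use 1 2 in \<open>simp_all, simp_all add: joinpaths_def linepath_def\<close>)
qed

lemma hp_runit:
  assumes "pathin X p" "x = p 1" shows "hp X (join_loops p (\<lambda>_. x)) p"
proof -
  let ?\<phi> = "linepath 0 1 +++ linepath 1 (1::real)"
  have eq: "join_loops p (\<lambda>_. x) = p \<circ> ?\<phi>"
    using assms(2) by (auto simp: join_loops_def joinpaths_def linepath_def fun_eq_iff)
  have 1: "path ?\<phi>" by (intro path_join_imp) auto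
  have 2: "path_image ?\<phi> \<subseteq> {0..1}"
    by (intro subset_path_image_join) (auto simp: closed_segment_eq_real_ivl)
  show ?thesis
    unfolding eq using assms
    by (intro hp_sym[OF hp_reparam]) (use 1 2 in \<open>simp_all, simp_all add: joinpaths_def linepath_def\<close>)
qed

text \<open>The loop is \<open>p\<close> after the parameter path from 0 to 1 and back, which
  contracts inside the unit interval.\<close>

lemma hp_rinv:
  assumes "pathin X p" "x = p 0" shows "hp X (join_loops p (rv p)) (\<lambda>_. x)"
proof -
  have eq: "join_loops p (rv p) = p \<circ> (linepath 0 1 +++ linepath 1 0)" "(\<lambda>_. x) = p \<circ> linepath 0 0"
    using assms(2) by (auto simp: join_loops_def joinpaths_def linepath_def rv_def fun_eq_iff)
  have 1: "path (linepath 0 1 +++ linepath 1 (0::real))" by (intro path_join_imp) auto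
  have 2: "path_image (linepath 0 1 +++ linepath 1 (0::real)) \<subseteq> {0..1}"
    by (intro subset_path_image_join) (auto simp: closed_segment_eq_real_ivl)
  have 3: "(linepath 0 1 +++ linepath 1 0) 0 = linepath 0 (0::real) 0"
    "(linepath 0 1 +++ linepath 1 0) 1 = linepath 0 (0::real) 1"
    by (simp_all add: joinpaths_def linepath_def)
  show ?thesis
    unfolding eq using assms 1 2 3
    by (intro hp_convex[of "{0..1}"]) (simp_all add: pathin_def)
qed

lemma hp_linv:
  assumes "pathin X p" "x = p 1" shows "hp X (join_loops (rv p) p) (\<lambda>_. x)"
  using hp_rinv[OF pathin_rv[OF assms(1)], of x] assms(2) by simp

lemma hp_cancel_left:
  assumes "pathin X p" "pathin X q" "p 1 = q 0"
  shows "hp X (join_loops (rv p) (join_loops p q)) q"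
proof -
  have "hp X (join_loops (rv p) (join_loops p q)) (join_loops (join_loops (rv p) p) q)"
    using assms by (intro hp_sym[OF hp_assoc] pathin_rv) auto
  also have "hp X \<dots> (join_loops (\<lambda>_. q 0) q)"
    using assms by (intro hp_join hp_linv hp_refl) auto
  also have "hp X \<dots> q" using assms by (intro hp_lunit) auto
  finally show ?thesis .
qed

lemma hp_cancel_right:
  assumes "pathin X p" "pathin X q" "p 1 = q 0"
  shows "hp X (join_loops (join_loops p q) (rv q)) p"
proof -
  have "hp X (join_loops (join_loops p q) (rv q)) (join_loops p (join_loops q (rv q)))"
    using assms by (intro hp_assoc pathin_rv) auto
  also have "hp X \<dots> (join_loops p (\<lambda>_. p 1))"
    using assms by (intro hp_join hp_rinv hp_refl) auto
  also have "hp X \<dots> p" using assms by (intro hp_runit) auto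
  finally show ?thesis .
qed

lemma hp_solve_left:
  assumes "hp X (join_loops p q) r" "pathin X p" "pathin X q" "p 1 = q 0"
  shows "hp X q (join_loops (rv p) r)"
proof -
  have "hp X (join_loops (rv p) (join_loops p q)) (join_loops (rv p) r)"
    using assms by (intro hp_join hp_refl pathin_rv) auto
  then show ?thesis using hp_cancel_left[OF assms(2-4)] hp_sym hp_trans by metis
qed

section \<open>The fundamental group\<close>

lemma loops_iff: "p \<in> loops X x \<longleftrightarrow> pathin X p \<and> p 0 = x \<and> p 1 = x"
  by (simp add: loops_def)

lemma loops_const: "x \<in> topspace X \<Longrightarrow> (\<lambda>_. x) \<in> loops X x"
  by (simp add: loops_iff pathin_const)

lemma loops_join: "p \<in> loops X x \<Longrightarrow> q \<in> loops X x \<Longrightarrow> join_loops p q \<in> loops X x"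
  by (simp add: loops_iff pathin_join)

lemma loops_rv: "p \<in> loops X x \<Longrightarrow> rv p \<in> loops X x"
  by (simp add: loops_iff pathin_rv)

lemma in_loop_class: "p \<in> loops X x \<Longrightarrow> q \<in> loop_class X x p \<longleftrightarrow> hp X p q"
  by (auto simp: loop_class_def hp_def loops_iff pathin_def dest: homotopic_with_imp_continuous_maps)

lemma loop_class_eq:
  assumes "p \<in> loops X x" "q \<in> loops X x"
  shows "loop_class X x p = loop_class X x q \<longleftrightarrow> hp X p q"
proof
  show "hp X p q" if "loop_class X x p = loop_class X x q"
    using that assms in_loop_class[OF assms(1), of q] in_loop_class[OF assms(2), of q] hp_refl
    by (auto simp: loops_iff)
  show "loop_class X x p = loop_class X x q" if "hp X p q"
    using that unfolding set_eq_iff by (metis assms hp_sym hp_trans in_loop_class)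
qed

lemma mult_fundamental_group:
  assumes "p \<in> loops X x" "q \<in> loops X x"
  shows "loop_class X x p \<otimes>\<^bsub>fundamental_group X x\<^esub> loop_class X x q = loop_class X x (join_loops p q)"
proof -
  have eq: "loop_class X x (join_loops p' q') = loop_class X x (join_loops p q)"
    if "p' \<in> loop_class X x p" "q' \<in> loop_class X x q" for p' q'
  proof -
    have "hp X p p'" "hp X q q'" using that assms by (auto simp: in_loop_class)
    moreover have "p' \<in> loops X x" "q' \<in> loops X x" using that by (auto simp: loop_class_def)
    ultimately show ?thesis
      using assms by (subst loop_class_eq) (auto intro!: loops_join hp_sym[OF hp_join] simp: loops_iff pathin_join)
  qed
  moreover have "p \<in> loop_class X x p" "q \<in> loop_class X x q"
    using assms by (auto simp: in_loop_class loops_iff hp_refl)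
  ultimately have "(\<Union>p'\<in>loop_class X x p. \<Union>q'\<in>loop_class X x q. loop_class X x (join_loops p' q'))
      = loop_class X x (join_loops p q)"
    by blast
  then show ?thesis by (simp add: fundamental_group_def)
qed

lemma carrier_fundamental_group: "carrier (fundamental_group X x) = loop_class X x ` loops X x"
  and one_fundamental_group: "\<one>\<^bsub>fundamental_group X x\<^esub> = loop_class X x (\<lambda>_. x)"
  by (simp_all add: fundamental_group_def)

lemma group_fundamental_group:
  assumes "x \<in> topspace X" shows "group (fundamental_group X x)"
proof (rule groupI)
  let ?G = "fundamental_group X x"
  show "\<one>\<^bsub>?G\<^esub> \<in> carrier ?G"
    using assms by (auto simp: carrier_fundamental_group one_fundamental_group loops_const)
  fix a assume "a \<in> carrier ?G"
  then obtain p where p: "p \<in> loops X x" "a = loop_class X x p" by (auto simp: carrier_fundamental_group)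
  show "\<one>\<^bsub>?G\<^esub> \<otimes>\<^bsub>?G\<^esub> a = a"
    using p assms
    by (auto simp: one_fundamental_group mult_fundamental_group loops_const loop_class_eq loops_join
        loops_iff pathin_const pathin_join intro!: hp_lunit)
  have "rv p \<in> loops X x" using p by (simp add: loops_rv)
  moreover from this have "loop_class X x (rv p) \<otimes>\<^bsub>?G\<^esub> a = \<one>\<^bsub>?G\<^esub>"
    using p assms
    by (auto simp: one_fundamental_group mult_fundamental_group loop_class_eq loops_join loops_const
        loops_iff pathin_const pathin_join intro!: hp_linv)
  ultimately show "\<exists>b\<in>carrier ?G. b \<otimes>\<^bsub>?G\<^esub> a = \<one>\<^bsub>?G\<^esub>"
    by (auto simp: carrier_fundamental_group)
  fix b assume "b \<in> carrier ?G"
  then obtain q where q: "q \<in> loops X x" "b = loop_class X x q" by (auto simp: carrier_fundamental_group)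
  show "a \<otimes>\<^bsub>?G\<^esub> b \<in> carrier ?G"
    using p q by (simp add: mult_fundamental_group) (auto simp: carrier_fundamental_group intro: loops_join)
  fix c assume "c \<in> carrier ?G"
  then obtain r where r: "r \<in> loops X x" "c = loop_class X x r" by (auto simp: carrier_fundamental_group)
  show "a \<otimes>\<^bsub>?G\<^esub> b \<otimes>\<^bsub>?G\<^esub> c = a \<otimes>\<^bsub>?G\<^esub> (b \<otimes>\<^bsub>?G\<^esub> c)"
    using p q r
    by (auto simp: mult_fundamental_group loop_class_eq loops_join)
      (auto simp: loops_iff intro!: hp_assoc)
qed

lemma inv_fundamental_group:
  assumes "p \<in> loops X x"
  shows "inv\<^bsub>fundamental_group X x\<^esub> (loop_class X x p) = loop_class X x (rv p)"
proof -
  have x: "x \<in> topspace X" using assms by (auto simp: loops_iff dest: pathin_ends)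
  interpret group "fundamental_group X x" using x by (rule group_fundamental_group)
  have "loop_class X x (rv p) \<otimes>\<^bsub>fundamental_group X x\<^esub> loop_class X x p = \<one>\<^bsub>fundamental_group X x\<^esub>"
    using assms x
    by (auto simp: one_fundamental_group mult_fundamental_group loop_class_eq loops_join loops_const loops_rv)
      (auto simp: loops_iff intro!: hp_linv)
  then show ?thesis
    using assms loops_rv[OF assms] by (intro inv_equality) (auto simp: carrier_fundamental_group)
qed

text \<open>Loop-level counterpart of \<open>generate\<close>, with matching clauses: for a set
  \<open>S\<close> of loops at \<open>x\<close> it consists of the loops whose classes lie in the
  subgroup generated by \<open>S\<close>. Speaking of loops rather than classes allows generators to
  be carried along continuous maps.\<close>

inductive_set loop_span :: "'a topology \<Rightarrow> 'a \<Rightarrow> (real \<Rightarrow> 'a) set \<Rightarrow> (real \<Rightarrow> 'a) set"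
  for X x S where
  const: "(\<lambda>_. x) \<in> loop_span X x S"
| incl: "p \<in> S \<Longrightarrow> p \<in> loop_span X x S"
| rv: "p \<in> S \<Longrightarrow> rv p \<in> loop_span X x S"
| join: "p \<in> loop_span X x S \<Longrightarrow> q \<in> loop_span X x S \<Longrightarrow> join_loops p q \<in> loop_span X x S"
| hp: "p \<in> loop_span X x S \<Longrightarrow> hp X p q \<Longrightarrow> q \<in> loop_span X x S"

lemma loop_span_loops:
  "p \<in> loop_span X x S \<Longrightarrow> S \<subseteq> loops X x \<Longrightarrow> x \<in> topspace X \<Longrightarrow> p \<in> loops X x"
proof (induction rule: loop_span.induct)
  case (hp p q)
  then show ?case
    using hp_0[OF hp(2)] hp_1[OF hp(2)] hp_path2[OF hp(2)] by (simp add: loops_iff)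
qed (blast intro: loops_const loops_join loops_rv)+

lemma loop_span_generate:
  assumes x: "x \<in> topspace X" and S: "S \<subseteq> loops X x"
  shows "p \<in> loop_span X x S \<Longrightarrow>
    loop_class X x p \<in> generate (fundamental_group X x) (loop_class X x ` S)"
proof (induction rule: loop_span.induct)
  case const
  show ?case by (metis generate.one one_fundamental_group)
next
  case (rv p)
  then show ?case using generate.inv[of "loop_class X x p" "loop_class X x ` S"]
    by (metis S image_eqI inv_fundamental_group subsetD)
next
  case (join p q)
  then show ?case
    using loop_span_loops[OF join(1) S x] loop_span_loops[OF join(2) S x]
    by (metis generate.eng mult_fundamental_group)
next
  case (hp p q)
  moreover have "q \<in> loops X x"
    using loop_span_loops[OF loop_span.hp[OF hp(1,2)] S x] .
  ultimately show ?case using loop_span_loops[OF hp(1) S x] loop_class_eq by metis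
qed (auto intro: generate.incl)

text \<open>Each class of a finite generating set is replaced by one representing loop; inductions
  over \<open>generate\<close> and over \<open>loop_span\<close> translate between the two notions
  of span.\<close>

lemma finitely_generated_fundamental_group_iff:
  assumes x: "x \<in> topspace X"
  shows "finitely_generated (fundamental_group X x) \<longleftrightarrow>
    (\<exists>S. finite S \<and> S \<subseteq> loops X x \<and> loops X x \<subseteq> loop_span X x S)"
proof
  let ?G = "fundamental_group X x"
  interpret group ?G using x by (rule group_fundamental_group)
  assume "finitely_generated ?G"
  then obtain S' where S': "finite S'" "S' \<subseteq> loop_class X x ` loops X x" "generate ?G S' = carrier ?G"
    by (auto simp: finitely_generated_def carrier_fundamental_group)
  then obtain S where S: "S \<subseteq> loops X x" "finite S" "S' = loop_class X x ` S"
    by (meson finite_subset_image)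
  have "\<exists>p\<in>loop_span X x S. a = loop_class X x p" if "a \<in> generate ?G S'" for a
    using that
  proof (induction rule: generate.induct)
    case one
    show ?case unfolding one_fundamental_group by (rule bexI[OF _ loop_span.const]) (rule HOL.refl)
  next
    case (incl h)
    then obtain p where "p \<in> S" "h = loop_class X x p" using S(3) by blast
    then show ?case by (intro bexI[of _ p] loop_span.incl)
  next
    case (inv h)
    then obtain p where p: "p \<in> S" "h = loop_class X x p" using S(3) by blast
    have "inv\<^bsub>?G\<^esub> h = loop_class X x (rv p)"
      unfolding p(2) by (rule inv_fundamental_group) (use p S(1) in auto)
    then show ?case using loop_span.rv[OF p(1)] by blast
  next
    case (eng h1 h2)
    then obtain p q where pq: "p \<in> loop_span X x S" "h1 = loop_class X x p"
      "q \<in> loop_span X x S" "h2 = loop_class X x q" by blast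
    have "h1 \<otimes>\<^bsub>?G\<^esub> h2 = loop_class X x (join_loops p q)"
      unfolding pq(2,4) using loop_span_loops[OF _ S(1) x] pq(1,3) by (intro mult_fundamental_group)
    then show ?case using loop_span.join[OF pq(1,3)] by blast
  qed
  moreover have "loop_class X x p \<in> generate ?G S'" if "p \<in> loops X x" for p
    using that S'(3) by (simp add: carrier_fundamental_group)
  ultimately have *: "\<exists>q\<in>loop_span X x S. loop_class X x p = loop_class X x q"
    if "p \<in> loops X x" for p
    using that by blast
  have "p \<in> loop_span X x S" if p: "p \<in> loops X x" for p
  proof -
    obtain q where q: "q \<in> loop_span X x S" "loop_class X x p = loop_class X x q"
      using *[OF p] by blast
    then have "hp X p q" using loop_class_eq[OF p loop_span_loops[OF q(1) S(1) x]] by blast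
    then show ?thesis using loop_span.hp[OF q(1) hp_sym] by blast
  qed
  then show "\<exists>S. finite S \<and> S \<subseteq> loops X x \<and> loops X x \<subseteq> loop_span X x S"
    using S by blast
next
  let ?G = "fundamental_group X x"
  interpret group ?G using x by (rule group_fundamental_group)
  assume "\<exists>S. finite S \<and> S \<subseteq> loops X x \<and> loops X x \<subseteq> loop_span X x S"
  then obtain S where S: "finite S" "S \<subseteq> loops X x" "loops X x \<subseteq> loop_span X x S" by blast
  have "loop_class X x ` S \<subseteq> carrier ?G" using S(2) by (auto simp: carrier_fundamental_group)
  moreover have "generate ?G (loop_class X x ` S) = carrier ?G"
  proof
    show "generate ?G (loop_class X x ` S) \<subseteq> carrier ?G"
      using calculation by (rule generate_incl)
    show "carrier ?G \<subseteq> generate ?G (loop_class X x ` S)"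
      using loop_span_generate[OF x S(2)] S(3) unfolding carrier_fundamental_group by auto
  qed
  ultimately show "finitely_generated ?G"
    unfolding finitely_generated_def using S(1) by blast
qed

lemma o_join: "f \<circ> join_loops p q = join_loops (f \<circ> p) (f \<circ> q)"
  and o_rv: "f \<circ> rv p = rv (f \<circ> p)"
  and o_const: "f \<circ> (\<lambda>_. x) = (\<lambda>_. f x)"
  by (simp_all add: fun_eq_iff join_loops_def rv_def)

text \<open>Generators found in the covering complex of a factor reach the covering of the free
  product in this way.\<close>

lemma loop_span_map:
  assumes "continuous_map X Y f"
  shows "p \<in> loop_span X x S \<Longrightarrow> f \<circ> p \<in> loop_span Y (f x) ((\<circ>) f ` S)"
proof (induction rule: loop_span.induct)
  case const
  show ?case unfolding o_const by (rule loop_span.const)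
next
  case (incl p)
  then show ?case by (intro loop_span.incl imageI)
next
  case (rv p)
  then show ?case unfolding o_rv by (intro loop_span.rv imageI)
next
  case (join p q)
  show ?case unfolding o_join by (rule loop_span.join[OF join(3,4)])
next
  case (hp p q)
  show ?case by (rule loop_span.hp[OF hp(3) hp_map[OF hp(2) assms]])
qed

section \<open>A criterion for finite generation\<close>

text \<open>Abstract form of the graph of pieces. \<open>W\<close> will be the set of cell centres
  in one component of the complement, \<open>Q True\<close> and \<open>Q False\<close> the arc paths
  that run in pieces of type \<open>H\<close> and of type \<open>K\<close>. The last assumption says
  that all centres are reached from \<open>c0\<close> by chains of such paths.\<close>

locale path_system =
  fixes X :: "'p topology" and W :: "'p set" and Q :: "bool \<Rightarrow> (real \<Rightarrow> 'p) set" and c0 :: 'p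
  assumes W_sub: "W \<subseteq> topspace X" and c0_W: "c0 \<in> W"
    and Q_path: "p \<in> Q i \<Longrightarrow> pathin X p" and Q_W: "p \<in> Q i \<Longrightarrow> p 0 \<in> W \<and> p 1 \<in> W"
    and Q_const: "d \<in> W \<Longrightarrow> (\<lambda>_. d) \<in> Q i"
    and Q_rv: "p \<in> Q i \<Longrightarrow> rv p \<in> Q i"
    and Q_join: "p \<in> Q i \<Longrightarrow> q \<in> Q i \<Longrightarrow> p 1 = q 0 \<Longrightarrow> join_loops p q \<in> Q i"
    and conn: "d \<in> W \<Longrightarrow> (c0, d) \<in> (\<Union>i. {(p 0, p 1) |p. p \<in> Q i})\<^sup>*"
begin

text \<open>For each \<open>i\<close> an equivalence relation on \<open>W\<close>. Its classes are
  the vertices of the graph, and each point of \<open>W\<close> connects its two classes.\<close>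

definition lnk :: "bool \<Rightarrow> ('p \<times> 'p) set" where
  "lnk i = {(p 0, p 1) |p. p \<in> Q i}"

lemma lnk_refl: "d \<in> W \<Longrightarrow> (d, d) \<in> lnk i"
  unfolding lnk_def using Q_const[of d i] by force

lemma lnk_sym: "(a, b) \<in> lnk i \<Longrightarrow> (b, a) \<in> lnk i"
  unfolding lnk_def using Q_rv[of _ i] rv_0 rv_1 by (smt (verit) mem_Collect_eq prod.inject)

lemma lnk_trans: "(a, b) \<in> lnk i \<Longrightarrow> (b, c) \<in> lnk i \<Longrightarrow> (a, c) \<in> lnk i"
  unfolding lnk_def using Q_join[of _ i] join_loops_0 join_loops_1 by (smt (verit) mem_Collect_eq prod.inject)

lemma lnk_W: "(a, b) \<in> lnk i \<Longrightarrow> a \<in> W \<and> b \<in> W"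
  unfolding lnk_def using Q_W by blast

definition dst :: "'p \<Rightarrow> nat" where
  "dst d = (LEAST n. (c0, d) \<in> (\<Union>i. lnk i) ^^ n)"

lemma dst_rel:
  assumes "d \<in> W" shows "(c0, d) \<in> (\<Union>i. lnk i) ^^ dst d"
proof -
  have "\<exists>n. (c0, d) \<in> (\<Union>i. lnk i) ^^ n"
    using conn[OF assms] unfolding lnk_def[symmetric] by (rule rtrancl_imp_relpow)
  then show ?thesis unfolding dst_def by (rule LeastI_ex)
qed

lemma dst_le: "(c0, d) \<in> (\<Union>i. lnk i) ^^ n \<Longrightarrow> dst d \<le> n"
  unfolding dst_def by (rule Least_le)

lemma dst_c0 [simp]: "dst c0 = 0"
  using dst_le[of c0 0] by simp

lemma dst_0: "d \<in> W \<Longrightarrow> dst d = 0 \<Longrightarrow> d = c0"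
  using dst_rel[of d] by simp

lemma dst_lnk: "(a, b) \<in> lnk i \<Longrightarrow> dst b \<le> Suc (dst a)"
  using dst_rel[of a] lnk_W[of a b i] by (intro dst_le) (auto intro: relpow_Suc_I)

lemma dst_pred:
  assumes "d \<in> W" "d \<noteq> c0"
  shows "\<exists>i y. (d, y) \<in> lnk i \<and> dst y < dst d"
proof -
  obtain n where n: "dst d = Suc n" using assms dst_0 by (cases "dst d") auto
  then obtain y i where "(c0, y) \<in> (\<Union>i. lnk i) ^^ n" "(y, d) \<in> lnk i"
    using dst_rel[OF assms(1)] by auto
  then show ?thesis using n dst_le[of y n] lnk_sym[of y d i] by (intro exI[of _ i] exI[of _ y]) auto
qed

text \<open>The chosen point depends only on the class of \<open>d\<close>
  (\<open>near_cong\<close>): it serves as the representative of the class and as its point of entry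
  from \<open>c0\<close>.\<close>

definition near :: "bool \<Rightarrow> 'p \<Rightarrow> 'p" where
  "near i d = arg_min dst (\<lambda>y. (d, y) \<in> lnk i)"

lemma near_lnk: "d \<in> W \<Longrightarrow> (d, near i d) \<in> lnk i"
  unfolding near_def using lnk_refl by (rule arg_min_natI)

lemma near_le: "(d, y) \<in> lnk i \<Longrightarrow> dst (near i d) \<le> dst y"
  unfolding near_def by (rule arg_min_nat_le)

lemma near_W: "d \<in> W \<Longrightarrow> near i d \<in> W"
  using near_lnk lnk_W by blast

lemma near_cong: "(d, d') \<in> lnk i \<Longrightarrow> near i d = near i d'"
proof -
  assume "(d, d') \<in> lnk i"
  then have "(\<lambda>y. (d, y) \<in> lnk i) = (\<lambda>y. (d', y) \<in> lnk i)"
    using lnk_sym lnk_trans by (intro ext) blast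
  then show ?thesis unfolding near_def by simp
qed

text \<open>The type of the last step on a shortest route from \<open>c0\<close>. For
  \<open>d\<close> other than \<open>c0\<close> at least one of its two classes contains a closer
  point.\<close>

definition via :: "'p \<Rightarrow> bool" where
  "via d = (SOME i. dst (near i d) < dst d)"

lemma via_less:
  assumes "d \<in> W" "d \<noteq> c0" shows "dst (near (via d) d) < dst d"
proof -
  obtain i y where "(d, y) \<in> lnk i" "dst y < dst d" using dst_pred[OF assms] by blast
  then have "dst (near i d) < dst d" using near_le[of d y i] by simp
  then show ?thesis unfolding via_def by (rule someI)
qed

lemma via_dst:
  assumes "d \<in> W" "d \<noteq> c0" shows "dst d = Suc (dst (near (via d) d))"
  using via_less[OF assms] dst_lnk[OF lnk_sym[OF near_lnk[OF assms(1)]], of "via d"] by linarith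

text \<open>The case distinction makes the path literally constant at a representative, so that
  closing it up gives the identity.\<close>

definition con :: "bool \<Rightarrow> 'p \<Rightarrow> real \<Rightarrow> 'p" where
  "con i d = (if near i d = d then (\<lambda>_. d) else SOME p. p \<in> Q i \<and> p 0 = near i d \<and> p 1 = d)"

lemma con:
  assumes "d \<in> W" shows "con i d \<in> Q i \<and> con i d 0 = near i d \<and> con i d 1 = d"
proof (cases "near i d = d")
  case True
  then show ?thesis using Q_const[OF assms] by (simp add: con_def)
next
  case False
  have "\<exists>p. p \<in> Q i \<and> p 0 = near i d \<and> p 1 = d"
    using lnk_sym[OF near_lnk[OF assms, of i]] unfolding lnk_def by fastforce
  then have "(SOME p. p \<in> Q i \<and> p 0 = near i d \<and> p 1 = d) \<in> Q i \<and>
      (SOME p. p \<in> Q i \<and> p 0 = near i d \<and> p 1 = d) 0 = near i d \<and>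
      (SOME p. p \<in> Q i \<and> p 0 = near i d \<and> p 1 = d) 1 = d"
    by (rule someI_ex)
  then show ?thesis using False by (simp add: con_def)
qed

text \<open>The number is fuel: \<open>tree\<close> supplies the distance of \<open>d\<close>, which
  drops by exactly one at each predecessor (\<open>via_dst\<close>).\<close>

primrec tree_aux :: "nat \<Rightarrow> 'p \<Rightarrow> real \<Rightarrow> 'p" where
  "tree_aux 0 d = (\<lambda>_. c0)"
| "tree_aux (Suc n) d = join_loops (tree_aux n (near (via d) d)) (con (via d) d)"

definition tree :: "'p \<Rightarrow> real \<Rightarrow> 'p" where
  "tree d = tree_aux (dst d) d"

lemma tree_c0: "tree c0 = (\<lambda>_. c0)"
  by (simp add: tree_def)

lemma tree_step:
  assumes "d \<in> W" "d \<noteq> c0"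
  shows "tree d = join_loops (tree (near (via d) d)) (con (via d) d)"
  unfolding tree_def via_dst[OF assms] by simp

lemma tree: "d \<in> W \<Longrightarrow> pathin X (tree d) \<and> tree d 0 = c0 \<and> tree d 1 = d"
proof (induction "dst d" arbitrary: d)
  case 0
  then have "d = c0" using dst_0 by simp
  then show ?case using c0_W W_sub by (auto simp: tree_c0 intro: pathin_const)
next
  case (Suc n)
  then have d: "d \<noteq> c0" by auto
  then have "dst (near (via d) d) = n" using Suc via_dst by force
  then have "pathin X (tree (near (via d) d)) \<and> tree (near (via d) d) 0 = c0
      \<and> tree (near (via d) d) 1 = near (via d) d"
    using Suc near_W by blast
  then show ?case
    using con[OF Suc(3), of "via d"] Q_path d Suc(3) by (auto simp: tree_step intro!: pathin_join)
qed

text \<open>Closing up along the tree turns paths between points of \<open>W\<close> into group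
  elements, compatibly with concatenation (\<open>hat_join\<close>) and without changing loops at
  \<open>c0\<close> (\<open>hat_loop\<close>).\<close>

definition hat :: "(real \<Rightarrow> 'p) \<Rightarrow> (real \<Rightarrow> 'p) set" where
  "hat p = loop_class X c0 (join_loops (join_loops (tree (p 0)) p) (rv (tree (p 1))))"

abbreviation "Pi1 \<equiv> fundamental_group X c0"

sublocale Pi1: group Pi1
  using c0_W W_sub by (intro group_fundamental_group) auto

lemma hat_loops:
  assumes "pathin X p" "p 0 \<in> W" "p 1 \<in> W"
  shows "join_loops (join_loops (tree (p 0)) p) (rv (tree (p 1))) \<in> loops X c0"
  using assms tree[of "p 0"] tree[of "p 1"] by (auto simp: loops_iff intro!: pathin_join pathin_rv)

lemma hat_closed: "pathin X p \<Longrightarrow> p 0 \<in> W \<Longrightarrow> p 1 \<in> W \<Longrightarrow> hat p \<in> carrier Pi1"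
  unfolding hat_def carrier_fundamental_group using hat_loops by (intro imageI)

lemma hat_hp:
  assumes "hp X p q" "p 0 \<in> W" "p 1 \<in> W" shows "hat p = hat q"
proof -
  note * = hp_0[OF assms(1)] hp_1[OF assms(1)] hp_path1[OF assms(1)] hp_path2[OF assms(1)]
  have "hp X (join_loops (join_loops (tree (p 0)) p) (rv (tree (p 1))))
     (join_loops (join_loops (tree (p 0)) q) (rv (tree (p 1))))"
    using assms * tree[of "p 0"] tree[of "p 1"] by (intro hp_join hp_refl pathin_rv) auto
  then show ?thesis
    unfolding hat_def using hat_loops[of p] hat_loops[of q] * assms by (subst loop_class_eq) auto
qed

lemma hat_join:
  assumes "pathin X p" "pathin X q" "p 1 = q 0" "p 0 \<in> W" "p 1 \<in> W" "q 1 \<in> W"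
  shows "hat (join_loops p q) = hat p \<otimes>\<^bsub>Pi1\<^esub> hat q"
proof -
  let ?A = "tree (p 0)" and ?B = "tree (p 1)" and ?C = "tree (q 1)"
  have t: "pathin X ?A" "?A 0 = c0" "?A 1 = p 0" "pathin X ?B" "?B 0 = c0" "?B 1 = p 1"
      "pathin X ?C" "?C 0 = c0" "?C 1 = q 1"
    using assms tree by auto
  note pi = pathin_join pathin_rv
  have "hp X (join_loops (join_loops (join_loops ?A p) (rv ?B)) (join_loops (join_loops ?B q) (rv ?C)))
     (join_loops (join_loops (join_loops ?A p) (rv ?B)) (join_loops ?B (join_loops q (rv ?C))))"
    using assms t by (intro hp_join hp_refl hp_assoc pi) auto
  also have "hp X \<dots> (join_loops (join_loops ?A p) (join_loops (rv ?B) (join_loops ?B (join_loops q (rv ?C)))))"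
    using assms t by (intro hp_assoc pi) auto
  also have "hp X \<dots> (join_loops (join_loops ?A p) (join_loops q (rv ?C)))"
    using assms t by (intro hp_join hp_refl hp_cancel_left pi) auto
  also have "hp X \<dots> (join_loops (join_loops (join_loops ?A p) q) (rv ?C))"
    using assms t by (intro hp_sym[OF hp_assoc] pi) auto
  also have "hp X \<dots> (join_loops (join_loops ?A (join_loops p q)) (rv ?C))"
    using assms t by (intro hp_join hp_refl hp_assoc pi) auto
  finally have "hp X (join_loops (join_loops (join_loops ?A p) (rv ?B)) (join_loops (join_loops ?B q) (rv ?C)))
      (join_loops (join_loops ?A (join_loops p q)) (rv ?C))" .
  moreover have "hat p \<otimes>\<^bsub>Pi1\<^esub> hat q = loop_class X c0
      (join_loops (join_loops (join_loops ?A p) (rv ?B)) (join_loops (join_loops ?B q) (rv ?C)))"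
    unfolding hat_def using hat_loops[of p] hat_loops[of q] assms
    by (simp add: mult_fundamental_group)
  ultimately show ?thesis
    unfolding hat_def using hat_loops[of p] hat_loops[of q] hat_loops[of "join_loops p q"] assms
    by (simp add: loop_class_eq loops_join pathin_join hp_sym)
qed

lemma hat_const:
  assumes "d \<in> W" shows "hat (\<lambda>_. d) = \<one>\<^bsub>Pi1\<^esub>"
proof -
  have c: "pathin X (\<lambda>_. d)" using assms W_sub by (auto intro: pathin_const)
  have "hat (\<lambda>_. d) \<otimes>\<^bsub>Pi1\<^esub> hat (\<lambda>_. d) = hat (\<lambda>_. d)"
    using hat_join[OF c c] hat_hp[OF hp_lunit[OF c, of d]] assms by simp
  moreover have "hat (\<lambda>_. d) \<in> carrier Pi1" using hat_closed[OF c] assms by simp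
  ultimately show ?thesis by (simp add: Pi1.l_cancel_one)
qed

lemma hat_rv:
  assumes "pathin X p" "p 0 \<in> W" "p 1 \<in> W"
  shows "hat (rv p) = inv\<^bsub>Pi1\<^esub> hat p"
proof -
  have "hat (rv p) \<otimes>\<^bsub>Pi1\<^esub> hat p = \<one>\<^bsub>Pi1\<^esub>"
    using hat_join[OF pathin_rv[OF assms(1)] assms(1)] assms hat_hp[OF hp_linv[OF assms(1) HOL.refl]] hat_const
    by simp
  then show ?thesis
    using hat_closed[OF assms] hat_closed[of "rv p"] assms pathin_rv by (metis Pi1.inv_equality rv_0 rv_1)
qed

lemma hat_loop:
  assumes "p \<in> loops X c0" shows "hat p = loop_class X c0 p"
proof -
  have p: "pathin X p" "p 0 = c0" "p 1 = c0" using assms by (auto simp: loops_iff)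
  have "hp X (join_loops (join_loops (\<lambda>_. c0) p) (\<lambda>_. c0)) (join_loops (\<lambda>_. c0) p)"
    using p c0_W W_sub by (intro hp_runit pathin_join pathin_const) auto
  also have "hp X \<dots> p" using p by (intro hp_lunit) auto
  finally show ?thesis
    unfolding hat_def using p hat_loops[of p] c0_W assms by (simp add: tree_c0 loop_class_eq)
qed

inductive_set comp :: "(real \<Rightarrow> 'p) set" where
  base: "p \<in> Q i \<Longrightarrow> p \<in> comp"
| join: "p \<in> comp \<Longrightarrow> q \<in> comp \<Longrightarrow> p 1 = q 0 \<Longrightarrow> join_loops p q \<in> comp"

lemma comp_path: "p \<in> comp \<Longrightarrow> pathin X p \<and> p 0 \<in> W \<and> p 1 \<in> W"
  by (induction rule: comp.induct) (simp_all add: Q_path Q_W pathin_join)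

text \<open>Potentials detect bridges: the tree paths to \<open>near i d\<close> and to the predecessor of \<open>d\<close>
  avoid \<open>d\<close>, so they cannot reach \<open>d\<close> through two different classes.\<close>

lemma con_tree:
  assumes d: "d \<in> W" "d \<noteq> c0" and ne: "near i d \<noteq> d" "via d \<noteq> i"
    and s: "\<And>a b. (a, b) \<in> lnk False \<Longrightarrow> s a = s b"
      "\<And>a b. (a, b) \<in> lnk True \<Longrightarrow> s a + of_bool (a = d) = s b + (of_bool (b = d) :: int)"
  shows False
proof -
  have s_c0: "s x = s c0" if "x \<in> W" "x \<noteq> d" "dst x \<le> dst d" for x
    using that
  proof (induction "dst x" arbitrary: x)
    case 0
    then show ?case using dst_0[of x] by simp
  next
    case (Suc n)
    then have x: "x \<noteq> c0" by auto
    let ?y = "near (via x) x"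
    have y: "dst ?y = n" using Suc via_dst[OF Suc(3) x] by simp
    moreover have "?y \<noteq> d" using y Suc by auto
    ultimately have "s ?y = s c0" using Suc near_W[OF Suc(3)] by auto
    moreover have "s x = s ?y"
      using near_lnk[OF Suc(3), of "via x"] s[of x ?y] \<open>?y \<noteq> d\<close> Suc(4) by (cases "via x") auto
    ultimately show ?case by simp
  qed
  have "dst (near i d) \<le> dst d" using near_le lnk_refl d by blast
  then have 1: "s (near i d) = s c0" using s_c0 near_W d ne by blast
  have "near (via d) d \<noteq> d" using via_less[OF d] by auto
  then have 2: "s (near (via d) d) = s c0" using s_c0 near_W d via_less[OF d] by (meson less_imp_le)
  \<comment> \<open>One of the two neighbours is linked to \<open>d\<close> with type
    \<open>True\<close>, which forces its potential to be \<open>s d + 1\<close>; the other is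
    linked with type \<open>False\<close> and has potential \<open>s d\<close>. Both were shown to
    equal \<open>s c0\<close>.\<close>
  show False
    using ne 1 2 near_lnk[OF d(1), of i] near_lnk[OF d(1), of "via d"] s[of d "near i d"]
      s[of d "near (via d) d"] \<open>near (via d) d \<noteq> d\<close>
    by (cases i; cases "via d") auto
qed

text \<open>The tree path to \<open>d\<close> ends with this very connecting path, so closing it up
  yields the tree path followed by its reverse.\<close>

lemma hat_con_tree:
  assumes d: "d \<in> W" "d \<noteq> c0"
  shows "hat (con (via d) d) = \<one>\<^bsub>Pi1\<^esub>"
proof -
  let ?q = "con (via d) d"
  have q: "?q \<in> Q (via d)" "?q 0 = near (via d) d" "?q 1 = d" using con[OF d(1)] by auto
  have "hat ?q = loop_class X c0 (join_loops (tree d) (rv (tree d)))"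
    unfolding hat_def using q tree_step[OF d] by simp
  also have "\<dots> = loop_class X c0 (\<lambda>_. c0)"
    using tree[OF d(1)] c0_W W_sub
    by (subst loop_class_eq) (auto simp: loops_iff intro!: pathin_join pathin_rv pathin_const hp_rinv)
  finally show ?thesis by (simp add: one_fundamental_group)
qed

text \<open>The generators are those of the fundamental group of a graph of spaces: the loops of
  each class, carried to \<open>c0\<close> along the tree, and one element for each connecting path
  outside the tree. \<open>F\<close> bounds the classes with essential loops, and \<open>Om\<close>
  the points where a connecting path can lie outside the tree; any other point is alone in one of
  its classes or is a bridge, as witnessed by a potential \<open>s\<close>.\<close>

theorem finitely_generated_criterion:
  fixes F Om :: "'p set"
  assumes loops: "\<And>p. p \<in> loops X c0 \<Longrightarrow> \<exists>q\<in>comp. hp X p q"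
    and fg: "\<And>i d. d \<in> W \<Longrightarrow> \<exists>S. finite S \<and> S \<subseteq> loops X d \<and> Q i \<inter> loops X d \<subseteq> loop_span X d S"
    and F: "finite F" "\<And>i d p. d \<in> W \<Longrightarrow> (\<And>y. y \<in> F \<Longrightarrow> (d, y) \<notin> lnk i) \<Longrightarrow> p \<in> Q i \<Longrightarrow>
        p \<in> loops X d \<Longrightarrow> hp X p (\<lambda>_. d)"
    and Om: "finite Om" "\<And>d. d \<in> W - Om \<Longrightarrow>
       (\<exists>i. \<forall>y. (d, y) \<in> lnk i \<longrightarrow> y = d) \<or>
       (\<exists>s. (\<forall>(a, b) \<in> lnk False. s a = s b) \<and>
          (\<forall>(a, b) \<in> lnk True. s a + of_bool (a = d) = s b + (of_bool (b = d) :: int)))"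
  shows "finitely_generated Pi1"
proof -
  \<comment> \<open>Local generators, to be used at the representative of a class. They are set to
    be empty when the class misses \<open>F\<close>, which leaves only finitely many nonempty
    choices at representatives.\<close>
  define Sg where "Sg i m = (if \<exists>y\<in>F. (m, y) \<in> lnk i
     then SOME S. finite S \<and> S \<subseteq> loops X m \<and> Q i \<inter> loops X m \<subseteq> loop_span X m S else {})" for i m
  have Sg: "finite (Sg i m) \<and> Sg i m \<subseteq> loops X m \<and> Q i \<inter> loops X m \<subseteq> loop_span X m (Sg i m)"
    if "m \<in> W" for i m
  proof (cases "\<exists>y\<in>F. (m, y) \<in> lnk i")
    case True
    then show ?thesis using someI_ex[OF fg[OF that, of i]] by (simp add: Sg_def)
  next
    case False
    have "p \<in> loop_span X m {}" if p: "p \<in> Q i" "p \<in> loops X m" for p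
      by (rule loop_span.hp[OF loop_span.const hp_sym[OF F(2)[OF \<open>m \<in> W\<close> _ p]]])
        (use False in blast)
    then show ?thesis using False by (auto simp: Sg_def)
  qed
  \<comment> \<open>The first set accounts for cycles of the graph, the second for the loops of the
    classes that meet \<open>F\<close>; these classes are enumerated through the points of
    \<open>F\<close>.\<close>
  define Gen where "Gen = (\<lambda>(i, d). hat (con i d)) ` (UNIV \<times> (insert c0 Om \<inter> W))
     \<union> (\<Union>(i, y) \<in> UNIV \<times> (F \<inter> W). hat ` Sg i (near i y))"
  define N where "N = generate Pi1 Gen"
  have "finite Gen"
    unfolding Gen_def using F(1) Om(1) Sg near_W by (auto intro!: finite_UN_I finite_imageI)
  have Gen_c: "Gen \<subseteq> carrier Pi1"
  proof -
    have "hat (con i d) \<in> carrier Pi1" if "d \<in> W" for i d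
      using con[OF that, of i] Q_path[of _ i] near_W[OF that] that by (intro hat_closed) auto
    moreover have "hat p \<in> carrier Pi1" if "p \<in> Sg i (near i y)" "y \<in> W" for p i y
      using that Sg[OF near_W[OF that(2)], of i i] near_W[OF that(2), of i]
      by (intro hat_closed) (auto simp: loops_iff)
    ultimately show ?thesis unfolding Gen_def by auto
  qed
  interpret N: subgroup N Pi1 unfolding N_def using Gen_c by (rule Pi1.generate_is_subgroup)
  \<comment> \<open>A connecting path can contribute a new element only at \<open>c0\<close> or at a
    point of \<open>Om\<close>. Elsewhere it is constant, belongs to the tree, or is excluded by
    \<open>con_tree\<close>.\<close>
  have con_N: "hat (con i d) \<in> N" if d: "d \<in> W" for i d
  proof (cases "near i d = d \<or> d \<in> insert c0 Om \<or> via d = i")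
    case True
    moreover have ?thesis if "d \<in> insert c0 Om"
      using that d unfolding N_def Gen_def by (intro generate.incl) auto
    moreover have ?thesis if "near i d = d"
      using that d hat_const N.one_closed by (simp add: con_def)
    moreover have ?thesis if "via d = i" "d \<noteq> c0"
      using hat_con_tree[OF d that(2)] that(1) N.one_closed by simp
    ultimately show ?thesis by blast
  next
    case False
    then have dO: "d \<in> W - Om" using d by auto
    have c0: "d \<noteq> c0" using False by auto
    have "near (via d) d \<noteq> d" using via_less[OF d c0] by auto
    \<comment> \<open>The class of type \<open>via d\<close> contains a closer point, and in the
      other class, that of type \<open>i\<close>, the representative differs from \<open>d\<close>
      by assumption. So \<open>d\<close> is alone in neither class, and the second alternative for
      points outside \<open>Om\<close> must hold.\<close>
    then have n: "near j d \<noteq> d" for j using False by (cases "j = i") auto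
    then have "\<not> (\<forall>y. (d, y) \<in> lnk j \<longrightarrow> y = d)" for j using near_lnk[OF d, of j] by blast
    then obtain s where s: "\<forall>(a, b) \<in> lnk False. s a = s b"
      "\<forall>(a, b) \<in> lnk True. s a + of_bool (a = d) = s b + (of_bool (b = d) :: int)"
      using Om(2)[OF dO] by blast
    have False using con_tree[OF d c0 n, of i s] False s by blast
    then show ?thesis ..
  qed
  have span_N: "hat p \<in> N" if "p \<in> loop_span X m S" "m \<in> W" "S \<subseteq> loops X m" "hat ` S \<subseteq> N" for p m S
    using that(1)
  proof (induction rule: loop_span.induct)
    case const
    then show ?case using hat_const[OF that(2)] N.one_closed by simp
  next
    case (incl p)
    then show ?case using that(4) by auto
  next
    case (rv p)
    then have "hat (rv p) = inv\<^bsub>Pi1\<^esub> hat p" using that(2,3) by (intro hat_rv) (auto simp: loops_iff)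
    then show ?case using rv that(4) N.m_inv_closed by auto
  next
    case (join p q)
    then have "p \<in> loops X m" "q \<in> loops X m"
      using loop_span_loops[OF _ that(3)] that(2) W_sub by auto
    then have "hat (join_loops p q) = hat p \<otimes>\<^bsub>Pi1\<^esub> hat q"
      using that(2) by (intro hat_join) (auto simp: loops_iff)
    then show ?case using join N.m_closed by simp
  next
    case (hp p q)
    then have "p \<in> loops X m"
      using loop_span_loops[OF _ that(3)] that(2) W_sub by auto
    then have "hat p = hat q" using hp(2) that(2) by (intro hat_hp) (auto simp: loops_iff)
    then show ?case using hp(3) by simp
  qed
  have Q_N: "hat p \<in> N" if p: "p \<in> Q i" for p i
  proof -
    let ?d = "p 0" and ?d' = "p 1"
    have d: "?d \<in> W" "?d' \<in> W" using Q_W[OF p] by auto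
    let ?m = "near i ?d"
    have "(?d, ?d') \<in> lnk i" unfolding lnk_def using p by (intro CollectI exI[of _ p]) simp
    then have m: "near i ?d' = ?m" by (rule near_cong[symmetric])
    have mW: "?m \<in> W" using near_W d by auto
    note c = con[OF d(1), of i] con[OF d(2), of i]
    \<comment> \<open>Both ends of \<open>p\<close> have the same representative \<open>?m\<close>,
      so adding the connecting paths at its ends gives a loop at \<open>?m\<close>, where the local
      generators apply.\<close>
    let ?l = "join_loops (join_loops (con i ?d) p) (rv (con i ?d'))"
    have lQ: "?l \<in> Q i" using c p by (intro Q_join Q_rv) auto
    then have "?l \<in> loops X ?m" using c m Q_path by (auto simp: loops_iff)
    then have "?l \<in> loop_span X ?m (Sg i ?m)" using Sg[OF mW, of i] lQ by blast
    moreover have "hat ` Sg i ?m \<subseteq> N"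
    proof (cases "\<exists>y\<in>F. (?m, y) \<in> lnk i")
      case True
      then obtain y where y: "y \<in> F" "(?m, y) \<in> lnk i" by blast
      then have "y \<in> W" "near i y = ?m"
        using lnk_W near_cong[OF lnk_trans[OF near_lnk[OF d(1)] y(2)]] by auto
      then have "(i, y) \<in> UNIV \<times> (F \<inter> W)" "hat ` Sg i ?m \<subseteq> hat ` Sg i (near i y)"
        using y by auto
      then have "hat ` Sg i ?m \<subseteq> Gen"
        unfolding Gen_def by (intro subsetI UnI2 UN_I[of "(i, y)"]) auto
      then show ?thesis unfolding N_def by (auto intro: generate.incl)
    qed (simp add: Sg_def)
    ultimately have l: "hat ?l \<in> N"
      using span_N[of ?l ?m "Sg i ?m", OF _ mW] Sg[OF mW, of i] by simp
    have cl: "hat p \<in> carrier Pi1" "hat (con i ?d) \<in> carrier Pi1" "hat (con i ?d') \<in> carrier Pi1"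
      using Q_path p c d m mW con_N N.subset by (auto intro: hat_closed)
    have "hat ?l = hat (con i ?d) \<otimes>\<^bsub>Pi1\<^esub> hat p \<otimes>\<^bsub>Pi1\<^esub> inv\<^bsub>Pi1\<^esub> hat (con i ?d')"
      using Q_path[OF p] Q_path[of "con i ?d" i] Q_path[of "con i ?d'" i] c d m mW
      by (simp add: hat_join hat_rv pathin_join pathin_rv)
    then have eq: "hat p = inv\<^bsub>Pi1\<^esub> hat (con i ?d) \<otimes>\<^bsub>Pi1\<^esub> hat ?l \<otimes>\<^bsub>Pi1\<^esub> hat (con i ?d')"
      using cl by (simp add: Pi1.m_assoc Pi1.inv_solve_left)
    show ?thesis
      by (subst eq) (intro N.m_closed N.m_inv_closed l con_N d)
  qed
  have comp_N: "hat p \<in> N" if "p \<in> comp" for p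
    using that
  proof (induction rule: comp.induct)
    case (base p i)
    then show ?case by (rule Q_N)
  next
    case (join p q)
    then have "hat (join_loops p q) = hat p \<otimes>\<^bsub>Pi1\<^esub> hat q"
      using comp_path[OF join(1)] comp_path[OF join(2)] by (intro hat_join) auto
    then show ?case using join N.m_closed by simp
  qed
  have "loop_class X c0 p \<in> N" if p: "p \<in> loops X c0" for p
  proof -
    obtain q where q: "q \<in> comp" "hp X p q" using loops[OF p] by blast
    have "hat p = hat q" using q(2) p c0_W by (intro hat_hp) (auto simp: loops_iff)
    then show ?thesis using comp_N[OF q(1)] hat_loop[OF p] by simp
  qed
  then have "carrier Pi1 \<subseteq> N" unfolding carrier_fundamental_group by (rule image_subsetI)
  then have "generate Pi1 Gen = carrier Pi1"
    using N.subset unfolding N_def by (intro subset_antisym)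
  then show ?thesis
    unfolding finitely_generated_def using \<open>finite Gen\<close> Gen_c by (intro exI[of _ Gen] conjI)
qed

end

section \<open>Charts of a two-dimensional complex\<close>

definition letter_map :: "('v, 'e, 'f) two_complex \<Rightarrow> 'e \<times> bool \<Rightarrow> real \<Rightarrow> ('v, 'e, 'f) point" where
  "letter_map T l t = edge_map T (fst l) (if snd l then t else 1 - t)"

text \<open>The closed 2-cell is cut into one sector for each letter of its boundary word, and into
  a single sector if that word is empty.\<close>

definition sectors :: "('v, 'e, 'f) two_complex \<Rightarrow> 'f \<Rightarrow> nat" where
  "sectors T f = max 1 (length (bdry T f))"

definition polar :: "nat \<Rightarrow> nat \<Rightarrow> real \<times> real \<Rightarrow> complex" where
  "polar n i v = of_real (fst v) * cis (2 * pi * (real i + snd v) / real n)"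

definition sector :: "('v, 'e, 'f) two_complex \<Rightarrow> 'f \<Rightarrow> nat \<Rightarrow> real \<times> real \<Rightarrow> ('v, 'e, 'f) point" where
  "sector T f i v = face_map T f (polar (sectors T f) i v)"

abbreviation "sq \<equiv> {0..1::real} \<times> {0..1::real}"

lemma norm_polar: "0 \<le> \<rho> \<Longrightarrow> cmod (polar n i (\<rho>, a)) = \<rho>"
  by (simp add: polar_def norm_mult)

lemma polar_0 [simp]: "polar n i (0, a) = 0"
  by (simp add: polar_def)

lemma polar_glue: "i < n \<Longrightarrow> polar n i (\<rho>, 1) = polar n (Suc i mod n) (\<rho>, 0)"
  by (cases "Suc i = n") (auto simp: polar_def add.commute)

lemma Arg2pi_polar:
  assumes "0 < \<rho>" "i < n" "0 \<le> a" "a < 1"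
  shows "Arg2pi (polar n i (\<rho>, a)) = 2 * pi * (real i + a) / real n"
proof (rule Arg2pi_unique[of \<rho>])
  have "real i + a < real n" "0 < real n" using assms by linarith+
  then have "(real i + a) / real n < 1" by (simp only: divide_less_eq_1_pos)
  then have "2 * pi * ((real i + a) / real n) < 2 * pi * 1" by (intro mult_strict_left_mono) auto
  then show "2 * pi * (real i + a) / real n < 2 * pi" by simp
qed (use assms in \<open>auto simp: polar_def cis_conv_exp\<close>)

lemma polar_surj:
  assumes "0 < n"
  shows "\<exists>i<n. \<exists>a\<in>{0..<1}. z = polar n i (cmod z, a)"
proof -
  define s where "s = real n * Arg2pi z / (2 * pi)"
  have s: "0 \<le> s" "s < real n"
    using assms Arg2pi_ge_0[of z] Arg2pi_lt_2pi[of z] by (auto simp: s_def field_simps)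
  have fl: "real (nat \<lfloor>s\<rfloor>) + frac s = s" using s by (simp add: frac_def)
  have "nat \<lfloor>s\<rfloor> < n" using s by linarith
  moreover have "z = polar n (nat \<lfloor>s\<rfloor>) (cmod z, frac s)"
    unfolding polar_def fst_conv snd_conv fl
    using Arg2pi_eq[of z] assms by (simp add: s_def cis_conv_exp)
  moreover have "frac s \<in> {0..<1}" by (simp add: frac_lt_1)
  ultimately show ?thesis by blast
qed

lemma continuous_on_polar: "continuous_on S (polar n i)"
  unfolding polar_def by (cases "n = 0") (auto intro!: continuous_intros)

lemma edge_map_simps [simp]:
  "edge_map T e 0 = VertexPt (src T e)" "edge_map T e 1 = VertexPt (tgt T e)"
  "0 < t \<Longrightarrow> t < 1 \<Longrightarrow> edge_map T e t = EdgePt e t"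
  by (simp_all add: edge_map_def)

lemma sectors_pos [simp]: "0 < sectors T f"
  by (simp add: sectors_def)

lemma sector_inner:
  "0 \<le> \<rho> \<Longrightarrow> \<rho> < 1 \<Longrightarrow> sector T f i (\<rho>, a) = FacePt f (polar (sectors T f) i (\<rho>, a))"
  by (simp add: sector_def face_map_def norm_polar)

lemma sector_0 [simp]: "sector T f i (0, a) = FacePt f 0"
  by (simp add: sector_inner)

lemma sector_glue:
  "i < sectors T f \<Longrightarrow> sector T f i (\<rho>, 1) = sector T f (Suc i mod sectors T f) (\<rho>, 0)"
  unfolding sector_def by (simp add: polar_glue)

text \<open>Well-formedness conditions that the record cannot enforce. Closedness of a boundary word
  is expressed through the points at the ends of its letters, which is what gluing adjacent sectors
  requires; the index modulo the length treats the last letter.\<close>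

locale complex2 =
  fixes T :: "('v, 'e, 'f) two_complex"
  assumes ends: "e \<in> edges T \<Longrightarrow> src T e \<in> verts T \<and> tgt T e \<in> verts T"
    and base_in: "f \<in> faces T \<Longrightarrow> base T f \<in> verts T"
    and bdry_in: "f \<in> faces T \<Longrightarrow> l \<in> set (bdry T f) \<Longrightarrow> fst l \<in> edges T"
    and bdry_closed: "f \<in> faces T \<Longrightarrow> i < length (bdry T f) \<Longrightarrow>
      letter_map T (bdry T f ! i) 1 = letter_map T (bdry T f ! (Suc i mod length (bdry T f))) 0"
    and bdry_base: "f \<in> faces T \<Longrightarrow> bdry T f \<noteq> [] \<Longrightarrow>
      letter_map T (bdry T f ! 0) 0 = VertexPt (base T f)"
begin

abbreviation "cells \<equiv> cell_points (verts T) (edges T) (faces T)"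

lemma sector_rim_half_open:
  assumes "i < sectors T f" "0 \<le> a" "a < 1"
  shows "sector T f i (1, a) =
    (if bdry T f = [] then VertexPt (base T f) else letter_map T (bdry T f ! i) a)"
proof (cases "bdry T f = []")
  case True
  then show ?thesis by (simp add: sector_def face_map_def norm_polar attaching_map_def)
next
  case False
  let ?n = "length (bdry T f)"
  have n: "sectors T f = ?n" "0 < ?n" using False by (auto simp: sectors_def Suc_le_eq)
  then have "real ?n * (Arg2pi (polar ?n i (1, a)) / (2 * pi)) = real i + a"
    using assms Arg2pi_polar[of 1 i ?n a] by simp
  moreover have "\<lfloor>real i + a\<rfloor> = int i" "frac (real i + a) = a"
    using assms by (auto simp: floor_unique frac_unique_iff)
  ultimately show ?thesis
    using False n
    by (simp add: sector_def face_map_def norm_polar attaching_map_def Let_def letter_map_def split_def)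
qed

text \<open>The attaching map takes a floor, so at \<open>a = 1\<close> it already reads the next
  letter at its start; closedness of the boundary word identifies this point with the end of letter
  \<open>i\<close>.\<close>

lemma sector_rim:
  assumes "f \<in> faces T" "i < sectors T f" "0 \<le> a" "a \<le> 1"
  shows "sector T f i (1, a) =
    (if bdry T f = [] then VertexPt (base T f) else letter_map T (bdry T f ! i) a)"
proof (cases "a = 1")
  case True
  have "Suc i mod sectors T f < sectors T f" by simp
  then have *: "sector T f i (1, a) = (if bdry T f = [] then VertexPt (base T f)
      else letter_map T (bdry T f ! (Suc i mod sectors T f)) 0)"
    using True assms sector_glue[of i T f 1] sector_rim_half_open[of "Suc i mod sectors T f" f 0] by simp
  show ?thesis
  proof (cases "bdry T f = []")
    case False
    then have "sectors T f = length (bdry T f)" by (auto simp: sectors_def Suc_le_eq)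
    then show ?thesis using * False True assms bdry_closed[of f i] by simp
  qed (use * in simp)
qed (use assms sector_rim_half_open in auto)

lemma edge_map_cells: "e \<in> edges T \<Longrightarrow> edge_map T e t \<in> cells"
  using ends[of e] by (auto simp: edge_map_def cell_points_def)

lemma sector_cells:
  assumes "f \<in> faces T" "i < sectors T f" "v \<in> sq"
  shows "sector T f i v \<in> cells"
proof (cases "fst v = 1")
  case True
  then have v: "v = (1, snd v)" "0 \<le> snd v" "snd v \<le> 1" using assms(3) by auto
  have "letter_map T (bdry T f ! i) (snd v) \<in> cells" if "bdry T f \<noteq> []"
  proof -
    have "i < length (bdry T f)" using that assms(2) by (simp add: sectors_def max_def split: if_splits)
    then show ?thesis
      using bdry_in[OF assms(1), of "bdry T f ! i"] by (simp add: letter_map_def edge_map_cells)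
  qed
  moreover have "VertexPt (base T f) \<in> cells" using base_in[OF assms(1)] by (simp add: cell_points_def)
  ultimately show ?thesis by (subst v(1)) (simp add: sector_rim[OF assms(1,2) v(2,3)])
next
  case False
  then show ?thesis using assms by (cases v) (auto simp: sector_inner cell_points_def norm_polar)
qed

lemma face_map_cells:
  assumes "f \<in> faces T" "z \<in> cball 0 1" shows "face_map T f z \<in> cells"
proof -
  obtain i a where "i < sectors T f" "a \<in> {0..<1}" "z = polar (sectors T f) i (cmod z, a)"
    using polar_surj[of "sectors T f" z] by auto
  then show ?thesis
    using sector_cells[of f i "(cmod z, a)"] assms by (simp add: sector_def)
qed

lemma topspace_realization: "topspace (realization T) = cells"
proof
  show "topspace (realization T) \<subseteq> cells"
    using openin_realization[of T "topspace (realization T)"] by (simp add: realization_open_def)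
  have "openin (realization T) cells"
    unfolding openin_realization realization_open_def
  proof (intro conjI ballI order_refl)
    fix e assume "e \<in> edges T"
    then have "{t \<in> {0..1}. edge_map T e t \<in> cells} = {0..1}" using edge_map_cells by auto
    then show "openin (top_of_set {0..1}) {t \<in> {0..1}. edge_map T e t \<in> cells}" by simp
  next
    fix f assume "f \<in> faces T"
    then have "{z \<in> cball 0 1. face_map T f z \<in> cells} = cball 0 1" using face_map_cells by auto
    then show "openin (top_of_set (cball 0 1)) {z \<in> cball 0 1. face_map T f z \<in> cells}" by simp
  qed
  then show "cells \<subseteq> topspace (realization T)" by (rule openin_subset)
qed

text \<open>The disc is a finite union of compact images of the square under \<open>polar\<close>,
  so its topology is the quotient topology from the squares. Afterwards continuity is always checked
  in the rectangular coordinates (radius, position in the sector).\<close>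

lemma openin_charts:
  "openin (realization T) W \<longleftrightarrow> W \<subseteq> cells \<and>
    (\<forall>e\<in>edges T. openin (top_of_set {0..1}) {t \<in> {0..1}. edge_map T e t \<in> W}) \<and>
    (\<forall>f\<in>faces T. \<forall>i<sectors T f. openin (top_of_set sq) {v \<in> sq. sector T f i v \<in> W})"
proof -
  have "openin (top_of_set (cball 0 1)) {z \<in> cball 0 1. face_map T f z \<in> W} \<longleftrightarrow>
     (\<forall>i<sectors T f. openin (top_of_set sq) {v \<in> sq. sector T f i v \<in> W})"
    if f: "f \<in> faces T" for f
  proof
    assume o: "openin (top_of_set (cball 0 1)) {z \<in> cball 0 1. face_map T f z \<in> W}"
    show "\<forall>i<sectors T f. openin (top_of_set sq) {v \<in> sq. sector T f i v \<in> W}"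
    proof (intro allI impI)
      fix i assume "i < sectors T f"
      have "polar (sectors T f) i \<in> sq \<rightarrow> cball 0 1" by (auto simp: norm_polar)
      then have "openin (top_of_set sq) (sq \<inter> polar (sectors T f) i -` {z \<in> cball 0 1. face_map T f z \<in> W})"
        using continuous_openin_preimage[OF continuous_on_polar _ o] by blast
      moreover have "sq \<inter> polar (sectors T f) i -` {z \<in> cball 0 1. face_map T f z \<in> W} =
         {v \<in> sq. sector T f i v \<in> W}"
        by (auto simp: sector_def norm_polar)
      ultimately show "openin (top_of_set sq) {v \<in> sq. sector T f i v \<in> W}" by simp
    qed
  next
    assume o: "\<forall>i<sectors T f. openin (top_of_set sq) {v \<in> sq. sector T f i v \<in> W}"
    let ?K = "\<Union>i<sectors T f. polar (sectors T f) i ` {v \<in> sq. sector T f i v \<notin> W}"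
    have "compact (polar (sectors T f) i ` {v \<in> sq. sector T f i v \<notin> W})" if "i < sectors T f" for i
    proof (rule compact_continuous_image[OF continuous_on_polar])
      have "closedin (top_of_set sq) (sq - {v \<in> sq. sector T f i v \<in> W})"
        using o that by (intro closedin_diff) auto
      moreover have "sq - {v \<in> sq. sector T f i v \<in> W} = {v \<in> sq. sector T f i v \<notin> W}" by auto
      ultimately show "compact {v \<in> sq. sector T f i v \<notin> W}"
        using closedin_compact[of sq] by (simp add: compact_Times)
    qed
    then have "closed ?K" by (intro compact_imp_closed compact_UN) auto
    moreover have "{z \<in> cball 0 1. face_map T f z \<in> W} = cball 0 1 \<inter> - ?K"
    proof (rule subset_antisym; rule subsetI)
      fix z assume z: "z \<in> {z \<in> cball 0 1. face_map T f z \<in> W}"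
      then have "z \<notin> ?K" unfolding sector_def by blast
      then show "z \<in> cball 0 1 \<inter> - ?K" using z by blast
    next
      fix z assume z: "z \<in> cball 0 1 \<inter> - ?K"
      obtain i a where ia: "i < sectors T f" "a \<in> {0..<1}" "z = polar (sectors T f) i (cmod z, a)"
        using polar_surj[of "sectors T f" z] by auto
      moreover have "(cmod z, a) \<in> sq" using ia(2) z by auto
      ultimately have "sector T f i (cmod z, a) \<in> W" using z by blast
      then show "z \<in> {z \<in> cball 0 1. face_map T f z \<in> W}" using ia z by (simp add: sector_def)
    qed
    ultimately show "openin (top_of_set (cball 0 1)) {z \<in> cball 0 1. face_map T f z \<in> W}"
      by (simp only: openin_open_Int open_Compl)
  qed
  then show ?thesis unfolding openin_realization realization_open_def by auto
qed

lemma continuous_edge_map: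
  "e \<in> edges T \<Longrightarrow> continuous_map (top_of_set {0..1}) (realization T) (edge_map T e)"
  unfolding continuous_map_def topspace_realization
  by (auto simp: edge_map_cells openin_charts)

lemma continuous_sector:
  "f \<in> faces T \<Longrightarrow> i < sectors T f \<Longrightarrow> continuous_map (top_of_set sq) (realization T) (sector T f i)"
  unfolding continuous_map_def topspace_realization
  by (auto simp: sector_cells openin_charts simp del: mem_Sigma_iff)

end

section \<open>Deformations\<close>

text \<open>A homotopy performed in the charts: \<Phi> moves the radius, \<Psi> moves the position
  within a sector as well as the position on an edge. The same \<Psi> has to serve for both in order
  that a 2-cell and its rim move consistently.\<close>

definition deform :: "('v, 'e, 'f) two_complex \<Rightarrow> (real \<Rightarrow> real \<Rightarrow> real) \<Rightarrow> (real \<Rightarrow> real \<Rightarrow> real) \<Rightarrow>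
    ('v, 'e, 'f) point \<times> real \<Rightarrow> ('v, 'e, 'f) point" where
  "deform T \<Phi> \<Psi> = (\<lambda>(x, u). case x of
      VertexPt v \<Rightarrow> VertexPt v
    | EdgePt e t \<Rightarrow> edge_map T e (\<Psi> u t)
    | FacePt f z \<Rightarrow> (let s = real (sectors T f) * Arg2pi z / (2 * pi)
        in sector T f (nat \<lfloor>s\<rfloor>) (\<Phi> u (cmod z), \<Psi> u (frac s))))"

text \<open>The end points are fixed at all times so that neighbouring charts remain glued. Interior
  parameters may be pushed to 0 or 1, and this is how a contraction leaves an open cell.\<close>

definition reparam :: "(real \<Rightarrow> real \<Rightarrow> real) \<Rightarrow> bool" where
  "reparam \<Phi> \<longleftrightarrow> continuous_on sq (\<lambda>v. \<Phi> (fst v) (snd v)) \<and>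
     (\<forall>u\<in>{0..1}. \<Phi> u 0 = 0 \<and> \<Phi> u 1 = 1 \<and> (\<forall>t\<in>{0..1}. \<Phi> u t \<in> {0..1})) \<and> (\<forall>t. \<Phi> 0 t = t)"

text \<open>Tube lemma: projection along a compact factor is a closed map, so the points with a bad
  partner in \<open>K\<close> form a closed set.\<close>

lemma tube_openin:
  fixes S :: "'a::euclidean_space set" and K :: "'b::euclidean_space set"
  assumes "compact K" "continuous_map (top_of_set (S \<times> K)) X g" "openin X W"
  shows "openin (top_of_set S) {s \<in> S. \<forall>u\<in>K. g (s, u) \<in> W}"
proof -
  have "openin (top_of_set (S \<times> K)) {v \<in> S \<times> K. g v \<in> W}"
    using openin_continuous_map_preimage[OF assms(2,3)] by simp
  then have "closedin (top_of_set (S \<times> K)) (S \<times> K - {v \<in> S \<times> K. g v \<in> W})"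
    by (intro closedin_diff) auto
  then have "closedin (top_of_set S) (fst ` (S \<times> K - {v \<in> S \<times> K. g v \<in> W}))"
    by (rule Starlike.closed_map_fst[OF assms(1)])
  then have "openin (top_of_set S) (S - fst ` (S \<times> K - {v \<in> S \<times> K. g v \<in> W}))"
    by (intro openin_diff) auto
  moreover have "S - fst ` (S \<times> K - {v \<in> S \<times> K. g v \<in> W}) = {s \<in> S. \<forall>u\<in>K. g (s, u) \<in> W}"
    by force
  ultimately show ?thesis by simp
qed

context complex2 begin

lemma deform_vertex [simp]: "deform T \<Phi> \<Psi> (VertexPt v, u) = VertexPt v"
  by (simp add: deform_def)

lemma deform_edge:
  assumes "reparam \<Psi>" "t \<in> {0..1}" "u \<in> {0..1}"
  shows "deform T \<Phi> \<Psi> (edge_map T e t, u) = edge_map T e (\<Psi> u t)"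
proof -
  have "\<Psi> u 0 = 0" "\<Psi> u 1 = 1" using assms by (auto simp: reparam_def)
  then show ?thesis
    using assms by (cases "t = 0 \<or> t = 1") (auto simp: deform_def)
qed

text \<open>On the rim a letter may traverse its edge backwards; \<open>odd\<close> says that \<Psi>
  commutes with this reversal. At \<open>a = 1\<close> the formula is taken from the next
  sector.\<close>

lemma deform_sector:
  assumes "f \<in> faces T" "i < sectors T f" "\<rho> \<in> {0..1}" "a \<in> {0..1}" "u \<in> {0..1}"
    and \<Phi>: "reparam \<Phi>" and \<Psi>: "reparam \<Psi>" and odd: "\<And>u t. \<Psi> u (1 - t) = 1 - \<Psi> u t"
  shows "deform T \<Phi> \<Psi> (sector T f i (\<rho>, a), u) = sector T f i (\<Phi> u \<rho>, \<Psi> u a)"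
proof -
  have e: "\<Phi> u 0 = 0" "\<Phi> u 1 = 1" "\<Psi> u 0 = 0" "\<Psi> u 1 = 1" "\<Psi> u a \<in> {0..1}"
    using assms by (auto simp: reparam_def)
  consider "\<rho> = 1" | "\<rho> = 0" | "0 < \<rho>" "\<rho> < 1" using assms(3) by fastforce
  then show ?thesis
  proof cases
    case 1
    then show ?thesis
      using assms(1-5) e odd[of u a] deform_edge[OF \<Psi>, of a u] deform_edge[OF \<Psi>, of "1 - a" u]
      by (simp add: sector_rim letter_map_def)
  next
    case 2
    then show ?thesis using e by (simp add: deform_def Let_def)
  next
    case 3
    have half: "deform T \<Phi> \<Psi> (sector T f j (\<rho>, b), u) = sector T f j (\<Phi> u \<rho>, \<Psi> u b)"
      if "j < sectors T f" "0 \<le> b" "b < 1" for j b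
    proof -
      have "\<lfloor>real j + b\<rfloor> = int j" "frac (real j + b) = b"
        using that by (auto simp: floor_unique frac_unique_iff)
      then show ?thesis
        using 3 that by (simp add: sector_inner deform_def Arg2pi_polar norm_polar Let_def)
    qed
    show ?thesis
    proof (cases "a = 1")
      case True
      then show ?thesis
        using half[of "Suc i mod sectors T f" 0] assms(2) e sector_glue[of i T f] by simp
    next
      case False
      then show ?thesis using half[of i a] assms(2,4) by simp
    qed
  qed
qed

lemma cells_cases:
  assumes "x \<in> cells"
  obtains v where "v \<in> verts T" "x = VertexPt v"
    | e t where "e \<in> edges T" "t \<in> {0<..<1}" "x = edge_map T e t"
    | f i \<rho> a where "f \<in> faces T" "i < sectors T f" "\<rho> \<in> {0..<1}" "a \<in> {0..<1}" "x = sector T f i (\<rho>, a)"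
proof -
  consider v where "v \<in> verts T" "x = VertexPt v"
    | e t where "e \<in> edges T" "0 < t" "t < 1" "x = EdgePt e t"
    | f z where "f \<in> faces T" "cmod z < 1" "x = FacePt f z"
    using assms by (auto simp: cell_points_def)
  then show ?thesis
  proof cases
    case 3
    obtain i a where "i < sectors T f" "a \<in> {0..<1}" "z = polar (sectors T f) i (cmod z, a)"
      using polar_surj[of "sectors T f" z] by auto
    then show ?thesis using 3 that(3)[of f i "cmod z" a] by (simp add: sector_inner)
  qed (use that in auto)
qed

lemma deform_cells:
  assumes "x \<in> cells" "u \<in> {0..1}"
    and \<Phi>: "reparam \<Phi>" and \<Psi>: "reparam \<Psi>" and odd: "\<And>u t. \<Psi> u (1 - t) = 1 - \<Psi> u t"
  shows "deform T \<Phi> \<Psi> (x, u) \<in> cells"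
  using assms(1)
proof (cases rule: cells_cases)
  case (1 v)
  then show ?thesis using assms(1) by simp
next
  case (2 e t)
  then show ?thesis using deform_edge[OF \<Psi>, of t u] assms(2) edge_map_cells by simp
next
  case (3 f i \<rho> a)
  have "(\<Phi> u \<rho>, \<Psi> u a) \<in> sq" using 3 \<Phi> \<Psi> assms(2) by (auto simp: reparam_def)
  then show ?thesis
    using 3 deform_sector[OF 3(1,2) _ _ assms(2) \<Phi> \<Psi> odd, of \<rho> a] sector_cells[OF 3(1,2)] by simp
qed

lemma continuous_reparam_edge:
  assumes "e \<in> edges T" "reparam \<Psi>" "K \<subseteq> {0..1}"
  shows "continuous_map (top_of_set ({0..1} \<times> K)) (realization T) (\<lambda>v. edge_map T e (\<Psi> (snd v) (fst v)))"
proof (rule continuous_map_compose[OF _ continuous_edge_map[OF assms(1)], unfolded o_def])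
  have c: "continuous_on sq (\<lambda>v. \<Psi> (fst v) (snd v))" using assms(2) by (simp add: reparam_def)
  have "continuous_on ({0..1} \<times> K) (\<lambda>v. \<Psi> (fst (snd v, fst v)) (snd (snd v, fst v)))"
    by (rule continuous_on_compose2[OF c]) (use assms(3) in \<open>auto intro!: continuous_intros\<close>)
  then show "continuous_map (top_of_set ({0..1} \<times> K)) (top_of_set {0..1}) (\<lambda>v. \<Psi> (snd v) (fst v))"
    using assms(2,3) by (auto simp: reparam_def)
qed

lemma continuous_reparam_sector:
  assumes "f \<in> faces T" "i < sectors T f" "reparam \<Phi>" "reparam \<Psi>" "K \<subseteq> {0..1}"
  shows "continuous_map (top_of_set (sq \<times> K)) (realization T)
     (\<lambda>v. sector T f i (\<Phi> (snd v) (fst (fst v)), \<Psi> (snd v) (snd (fst v))))"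
proof (rule continuous_map_compose[OF _ continuous_sector[OF assms(1,2)], unfolded o_def])
  have c: "continuous_on sq (\<lambda>v. \<Psi> (fst v) (snd v))" "continuous_on sq (\<lambda>v. \<Phi> (fst v) (snd v))"
    using assms(3,4) by (simp_all add: reparam_def)
  have "continuous_on (sq \<times> K) (\<lambda>v. \<Psi> (fst (snd v, snd (fst v))) (snd (snd v, snd (fst v))))"
    by (rule continuous_on_compose2[OF c(1)]) (use assms(5) in \<open>auto intro!: continuous_intros\<close>)
  moreover have "continuous_on (sq \<times> K) (\<lambda>v. \<Phi> (fst (snd v, fst (fst v))) (snd (snd v, fst (fst v))))"
    by (rule continuous_on_compose2[OF c(2)]) (use assms(5) in \<open>auto intro!: continuous_intros\<close>)
  ultimately have "continuous_on (sq \<times> K) (\<lambda>v. (\<Phi> (snd v) (fst (fst v)), \<Psi> (snd v) (snd (fst v))))"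
    by (intro continuous_on_Pair) auto
  moreover have "(\<lambda>v. (\<Phi> (snd v) (fst (fst v)), \<Psi> (snd v) (snd (fst v)))) \<in> sq \<times> K \<rightarrow> sq"
    using assms(3-5) by (auto simp: reparam_def)
  ultimately show "continuous_map (top_of_set (sq \<times> K)) (top_of_set sq)
     (\<lambda>v. (\<Phi> (snd v) (fst (fst v)), \<Psi> (snd v) (snd (fst v))))"
    by (simp only: continuous_map_subtopology_eu)
qed

text \<open>The realization carries a quotient topology, and its product with the interval is
  controlled through local compactness of the interval: around \<open>u0\<close> a compact
  \<open>K\<close> is chosen such that \<open>x0\<close> stays in \<open>W\<close> during
  \<open>K\<close>, and the points staying in \<open>W\<close> during \<open>K\<close> form an open
  set, by the tube lemma in every chart.\<close>

lemma continuous_deform: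
  assumes \<Phi>: "reparam \<Phi>" and \<Psi>: "reparam \<Psi>" and odd: "\<And>u t. \<Psi> u (1 - t) = 1 - \<Psi> u t"
  shows "continuous_map (prod_topology (realization T) (top_of_set {0..1})) (realization T) (deform T \<Phi> \<Psi>)"
proof -
  let ?D = "deform T \<Phi> \<Psi>"
  have nb: "\<exists>O1 O2. openin (realization T) O1 \<and> openin (top_of_set {0..1}) O2 \<and> x0 \<in> O1 \<and> u0 \<in> O2 \<and>
      (\<forall>x\<in>O1. \<forall>u\<in>O2. ?D (x, u) \<in> W)"
    if W: "openin (realization T) W" and x0: "x0 \<in> cells" and u0: "u0 \<in> {0..1}" and D: "?D (x0, u0) \<in> W"
    for W x0 u0
  proof -
    have "continuous_map (top_of_set {0..1}) (realization T) (\<lambda>u. ?D (x0, u))"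
      using x0
    proof (cases rule: cells_cases)
      case (1 v)
      then show ?thesis using topspace_realization x0 by simp
    next
      case (2 e t)
      have "continuous_map (top_of_set {0..1}) (top_of_set ({0..1} \<times> {0..1})) (\<lambda>u. (t, u))"
        using 2 by (auto intro!: continuous_intros)
      from continuous_map_compose[OF this continuous_reparam_edge[OF 2(1) \<Psi> order_refl]]
      have "continuous_map (top_of_set {0..1}) (realization T) (\<lambda>u. edge_map T e (\<Psi> u t))"
        by (simp add: o_def)
      then show ?thesis
        by (rule continuous_map_eq) (use 2 in \<open>simp add: deform_edge[OF \<Psi>] del: edge_map_simps\<close>)
    next
      case (3 f i \<rho> a)
      have "continuous_map (top_of_set {0..1}) (top_of_set (sq \<times> {0..1})) (\<lambda>u. ((\<rho>, a), u))"
        using 3 by (auto intro!: continuous_intros)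
      from continuous_map_compose[OF this continuous_reparam_sector[OF 3(1,2) \<Phi> \<Psi> order_refl]]
      have "continuous_map (top_of_set {0..1}) (realization T) (\<lambda>u. sector T f i (\<Phi> u \<rho>, \<Psi> u a))"
        by (simp add: o_def)
      then show ?thesis
        by (rule continuous_map_eq) (use 3 in \<open>simp add: deform_sector[OF 3(1,2) _ _ _ \<Phi> \<Psi> odd]\<close>)
    qed
    from openin_continuous_map_preimage[OF this W]
    have "openin (top_of_set {0..1}) {u \<in> {0..1}. ?D (x0, u) \<in> W}" by simp
    moreover have "u0 \<in> {u \<in> {0..1}. ?D (x0, u) \<in> W}" using u0 D by simp
    ultimately obtain \<delta> where "\<delta> > 0"
      "\<forall>u\<in>{0..1}. dist u u0 < \<delta> \<longrightarrow> u \<in> {u \<in> {0..1}. ?D (x0, u) \<in> W}"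
      unfolding openin_euclidean_subtopology_iff by blast
    then have \<delta>: "\<delta> > 0" "\<And>u. u \<in> {0..1} \<Longrightarrow> dist u u0 < \<delta> \<Longrightarrow> ?D (x0, u) \<in> W" by auto
    \<comment> \<open>Half of \<delta> puts the closed ball inside the open ball of radius \<delta>,
      on which the track of \<open>x0\<close> lies in \<open>W\<close>.\<close>
    define K where "K = cball u0 (\<delta>/2) \<inter> {0..1}"
    define O1 where "O1 = {x \<in> cells. \<forall>u\<in>K. ?D (x, u) \<in> W}"
    have K: "compact K" "K \<subseteq> {0..1}" by (auto simp: K_def intro!: compact_Int)
    have "openin (realization T) O1"
      unfolding openin_charts
    proof (intro conjI ballI allI impI)
      show "O1 \<subseteq> cells" by (auto simp: O1_def)
      fix e assume e: "e \<in> edges T"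
      have "{t \<in> {0..1}. edge_map T e t \<in> O1} = {t \<in> {0..1}. \<forall>u\<in>K. edge_map T e (\<Psi> (snd (t, u)) (fst (t, u))) \<in> W}"
      proof (rule Collect_cong, rule conj_cong[OF HOL.refl])
        fix t :: real assume "t \<in> {0..1}"
        then have "?D (edge_map T e t, u) = edge_map T e (\<Psi> u t)" if "u \<in> K" for u
          using that K(2) by (intro deform_edge[OF \<Psi>]) auto
        then show "edge_map T e t \<in> O1 \<longleftrightarrow> (\<forall>u\<in>K. edge_map T e (\<Psi> (snd (t, u)) (fst (t, u))) \<in> W)"
          unfolding O1_def using edge_map_cells[OF e] by simp
      qed
      then show "openin (top_of_set {0..1}) {t \<in> {0..1}. edge_map T e t \<in> O1}"
        using tube_openin[OF K(1) continuous_reparam_edge[OF e \<Psi> K(2)] W] by simp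
    next
      fix f i assume f: "f \<in> faces T" "i < sectors T f"
      have "{v \<in> sq. sector T f i v \<in> O1} = {v \<in> sq. \<forall>u\<in>K.
          sector T f i (\<Phi> (snd (v, u)) (fst (fst (v, u))), \<Psi> (snd (v, u)) (snd (fst (v, u)))) \<in> W}"
      proof (rule Collect_cong, rule conj_cong[OF HOL.refl])
        fix v assume v: "v \<in> sq"
        then have "?D (sector T f i v, u) = sector T f i (\<Phi> u (fst v), \<Psi> u (snd v))" if "u \<in> K" for u
          using that K(2) deform_sector[OF f _ _ _ \<Phi> \<Psi> odd, of "fst v" "snd v" u] by auto
        then show "sector T f i v \<in> O1 \<longleftrightarrow> (\<forall>u\<in>K.
            sector T f i (\<Phi> (snd (v, u)) (fst (fst (v, u))), \<Psi> (snd (v, u)) (snd (fst (v, u)))) \<in> W)"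
          unfolding O1_def using sector_cells[OF f v] by simp
      qed
      then show "openin (top_of_set sq) {v \<in> sq. sector T f i v \<in> O1}"
        using tube_openin[OF K(1) continuous_reparam_sector[OF f \<Phi> \<Psi> K(2)] W] by simp
    qed
    moreover have "openin (top_of_set {0..1}) ({0..1} \<inter> ball u0 (\<delta>/2))" by (intro openin_open_Int) auto
    moreover have "?D (x0, u) \<in> W" if "u \<in> K" for u
      using that \<delta>(1) by (intro \<delta>(2)) (auto simp: K_def dist_commute)
    then have "x0 \<in> O1" using x0 by (simp add: O1_def)
    moreover have "\<forall>x\<in>O1. \<forall>u\<in>{0..1} \<inter> ball u0 (\<delta>/2). ?D (x, u) \<in> W" by (auto simp: O1_def K_def)
    moreover have "u0 \<in> {0..1} \<inter> ball u0 (\<delta>/2)" using \<delta>(1) u0 by simp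
    ultimately show ?thesis by (intro exI[of _ O1] exI[of _ "{0..1} \<inter> ball u0 (\<delta>/2)"] conjI)
  qed
  show ?thesis
    unfolding continuous_map_def
  proof (intro conjI allI impI)
    show "?D \<in> topspace (prod_topology (realization T) (top_of_set {0..1})) \<rightarrow> topspace (realization T)"
      using deform_cells[OF _ _ \<Phi> \<Psi> odd] by (auto simp: topspace_realization)
    fix W assume W: "openin (realization T) W"
    show "openin (prod_topology (realization T) (top_of_set {0..1}))
        {x \<in> topspace (prod_topology (realization T) (top_of_set {0..1})). ?D x \<in> W}"
      unfolding openin_prod_topology_alt
    proof (intro allI impI)
      fix x u assume "(x, u) \<in> {x \<in> topspace (prod_topology (realization T) (top_of_set {0..1})). ?D x \<in> W}"
      then have xu: "x \<in> cells" "u \<in> {0..1}" "?D (x, u) \<in> W" by (auto simp: topspace_realization)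
      obtain O1 O2 where O: "openin (realization T) O1" "openin (top_of_set {0..1}) O2" "x \<in> O1" "u \<in> O2"
        "\<forall>x\<in>O1. \<forall>u\<in>O2. ?D (x, u) \<in> W" using nb[OF W xu] by (elim exE conjE)
      have "O1 \<times> O2 \<subseteq> {x \<in> topspace (prod_topology (realization T) (top_of_set {0..1})). ?D x \<in> W}"
        using O(5) openin_subset[OF O(1)] openin_subset[OF O(2)] by auto
      then show "\<exists>U V. openin (realization T) U \<and> openin (top_of_set {0..1}) V \<and> x \<in> U \<and> u \<in> V \<and>
         U \<times> V \<subseteq> {x \<in> topspace (prod_topology (realization T) (top_of_set {0..1})). ?D x \<in> W}"
        using O(1-4) by (intro exI[of _ O1] exI[of _ O2] conjI)
    qed
  qed
qed

end

section \<open>Neighbourhoods of cells\<close>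

text \<open>Turns a relatively open subset of the 1-skeleton into an open subset of the complex. The
  bound 1/2 is the radius from which \<open>min 1 (2 * t)\<close> in \<open>rad\<close> pushes
  points onto the rim.\<close>

definition collar :: "('v, 'e, 'f) two_complex \<Rightarrow> ('v, 'e, 'f) point set \<Rightarrow> ('v, 'e, 'f) point set" where
  "collar T S = S \<union> {FacePt f z |f z. f \<in> faces T \<and> 1/2 < cmod z \<and> cmod z < 1 \<and>
     attaching_map T f (Arg2pi z / (2 * pi)) \<in> S}"

text \<open>The thirds are the breakpoints of the clamped function \<open>3 * t - 1\<close> in
  \<open>ang\<close>, which sends the first and last third of an edge to its ends.\<close>

definition star :: "('v, 'e, 'f) two_complex \<Rightarrow> 'v \<Rightarrow> ('v, 'e, 'f) point set" where
  "star T c = {VertexPt c} \<union> {EdgePt e t |e t. e \<in> edges T \<and> 0 < t \<and> t < 1 \<and>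
     (src T e = c \<and> t < 1/3 \<or> tgt T e = c \<and> 2/3 < t)}"

text \<open>Points of an open edge come arbitrarily close to its ends, so \<delta> must be allowed
  to vary, and the contraction to the midpoint varies with it.\<close>

definition mid_arc :: "real \<Rightarrow> 'e \<Rightarrow> ('v, 'e, 'f) point set" where
  "mid_arc \<delta> e = {EdgePt e t |t. \<delta> < t \<and> t < 1 - \<delta>}"

text \<open>\<open>rad\<close> and \<open>ang\<close> reparametrize the polar coordinates of the charts so that the neighbourhood of
  a node is contracted to the node.\<close>

definition nodes :: "('v, 'e, 'f) two_complex \<Rightarrow> ('v, 'e, 'f) point set" where
  "nodes T = VertexPt ` verts T \<union> (\<lambda>e. EdgePt e (1/2)) ` edges T \<union> (\<lambda>f. FacePt f 0) ` faces T"

primrec nbhd :: "('v, 'e, 'f) two_complex \<Rightarrow> real \<Rightarrow> ('v, 'e, 'f) point \<Rightarrow> ('v, 'e, 'f) point set" where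
  "nbhd T \<delta> (VertexPt c) = collar T (star T c)"
| "nbhd T \<delta> (EdgePt e s) = collar T (mid_arc \<delta> e)"
| "nbhd T \<delta> (FacePt f z0) = {FacePt f z |z. cmod z < 1 - \<delta>}"

primrec rad :: "real \<Rightarrow> ('v, 'e, 'f) point \<Rightarrow> real \<Rightarrow> real \<Rightarrow> real" where
  "rad \<delta> (VertexPt c) = (\<lambda>u t. (1 - u) * t + u * min 1 (2 * t))"
| "rad \<delta> (EdgePt e s) = (\<lambda>u t. (1 - u) * t + u * min 1 (2 * t))"
| "rad \<delta> (FacePt f z) = (\<lambda>u t. (1 - u) * t + u * max 0 (1 - (1 - t) / \<delta>))"

primrec ang :: "real \<Rightarrow> ('v, 'e, 'f) point \<Rightarrow> real \<Rightarrow> real \<Rightarrow> real" where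
  "ang \<delta> (VertexPt c) = (\<lambda>u t. (1 - u) * t + u * max 0 (min 1 (3 * t - 1)))"
| "ang \<delta> (EdgePt e s) = (\<lambda>u t. (1 - u) * t + u * max (min (t / (2 * \<delta>)) (1/2)) (1 - (1 - t) / (2 * \<delta>)))"
| "ang \<delta> (FacePt f z) = (\<lambda>u t. (1 - u) * t + u * t)"

abbreviation contraction :: "('v, 'e, 'f) two_complex \<Rightarrow> real \<Rightarrow> ('v, 'e, 'f) point \<Rightarrow>
    ('v, 'e, 'f) point \<times> real \<Rightarrow> ('v, 'e, 'f) point" where
  "contraction T \<delta> \<sigma> \<equiv> deform T (rad \<delta> \<sigma>) (ang \<delta> \<sigma>)"

lemma reparam_mix:
  assumes "continuous_on {0..1} h" "h 0 = 0" "h 1 = 1" "\<And>t. 0 \<le> t \<Longrightarrow> t \<le> 1 \<Longrightarrow> 0 \<le> h t \<and> h t \<le> 1"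
  shows "reparam (\<lambda>u t. (1 - u) * t + u * h t)"
proof -
  have "continuous_on sq (\<lambda>v. h (snd v))"
    by (rule continuous_on_compose2[OF assms(1)]) (auto intro!: continuous_intros)
  then have "continuous_on sq (\<lambda>v. (1 - fst v) * snd v + fst v * h (snd v))"
    by (intro continuous_intros)
  moreover have "(1 - u) * t + u * h t \<in> {0..1}" if "u \<in> {0..1}" "t \<in> {0..1}" for u t
    using convexD[of "{0..1::real}" t "h t" "1 - u" u] that assms(4)[of t] by auto
  ultimately show ?thesis using assms(2,3) by (simp add: reparam_def)
qed

lemma reparam_rad:
  assumes "0 < \<delta>" "\<delta> < 1/2" shows "reparam (rad \<delta> \<sigma>)"
proof (cases \<sigma>)
  case (FacePt f z)
  have "1 - (1 - t) / \<delta> \<le> 1" if "t \<le> 1" for t using that assms by simp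
  then show ?thesis
    using FacePt assms by (auto intro!: reparam_mix continuous_intros)
qed (auto intro!: reparam_mix continuous_intros)

lemma reparam_ang:
  assumes "0 < \<delta>" "\<delta> < 1/2" shows "reparam (ang \<delta> \<sigma>)"
proof (cases \<sigma>)
  case (EdgePt e s)
  let ?h = "\<lambda>t::real. max (min (t / (2 * \<delta>)) (1/2)) (1 - (1 - t) / (2 * \<delta>))"
  have d: "1 / (2 * \<delta>) > 1" using assms by simp
  have "reparam (\<lambda>u t. (1 - u) * t + u * ?h t)"
  proof (rule reparam_mix)
    show "continuous_on {0..1} ?h" using assms by (intro continuous_intros) auto
    show "?h 0 = 0" "?h 1 = 1" using d by simp_all
    fix t :: real assume t: "0 \<le> t" "t \<le> 1"
    have "0 \<le> t / (2 * \<delta>)" "0 \<le> (1 - t) / (2 * \<delta>)" using t assms by simp_all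
    then show "0 \<le> ?h t \<and> ?h t \<le> 1" by (simp add: le_max_iff_disj)
  qed
  then show ?thesis using EdgePt by simp
qed (auto intro!: reparam_mix continuous_intros)

lemma ang_odd:
  assumes "0 < \<delta>" "\<delta> < 1/2" shows "ang \<delta> \<sigma> u (1 - t) = 1 - ang \<delta> \<sigma> u t"
proof -
  have mix: "(1 - u) * (1 - t) + u * k = 1 - ((1 - u) * t + u * h)" if "k = 1 - h" for k h
    unfolding that by (simp add: algebra_simps)
  show ?thesis
  proof (cases \<sigma>)
    case (VertexPt c)
    have "max 0 (min 1 (3 * (1 - t) - 1)) = 1 - max 0 (min 1 (3 * t - 1))" by (simp add: max_def min_def)
    then show ?thesis using mix VertexPt by simp
  next
    case (EdgePt e s)
    have "t / (2 * \<delta>) + (1 - t) / (2 * \<delta>) = 1 / (2 * \<delta>)" by (simp add: add_divide_distrib[symmetric])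
    also have "1 / (2 * \<delta>) > 1" using assms by simp
    finally have AB: "t / (2 * \<delta>) + (1 - t) / (2 * \<delta>) > 1" .
    \<comment> \<open>Since \<open>1 - B < A\<close>, the expression is the median of
      \<open>1 - B\<close>, 1/2 and \<open>A\<close>. Reflection at 1/2 turns it into the median of
      \<open>1 - A\<close>, 1/2 and \<open>B\<close>.\<close>
    have med: "max (min B (1/2)) (1 - A) = 1 - max (min A (1/2)) (1 - B)" if "A + B > 1" for A B :: real
      using that by (simp add: max_def min_def)
    note med[OF AB]
    then show ?thesis using mix EdgePt by simp
  qed (simp add: algebra_simps)
qed

context complex2 begin

lemma edge_map_not_face: "edge_map T e t \<noteq> FacePt f z"
  by (simp add: edge_map_def)

lemma rim_not_face:
  assumes "f \<in> faces T" "i < sectors T f" "a \<in> {0..1}" shows "sector T f i (1, a) \<noteq> FacePt g z"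
  using assms by (simp add: sector_rim letter_map_def edge_map_not_face)

lemma sector_collar:
  assumes S: "\<And>g z. FacePt g z \<notin> S" and f: "f \<in> faces T" "i < sectors T f" "\<rho> \<in> {0..1}" "a \<in> {0..1}"
  shows "sector T f i (\<rho>, a) \<in> collar T S \<longleftrightarrow> 1/2 < \<rho> \<and> sector T f i (1, a) \<in> S"
proof (cases "\<rho> = 1")
  case True
  then show ?thesis using rim_not_face[OF f(1,2,4)] by (auto simp: collar_def)
next
  case False
  let ?z = "polar (sectors T f) i (\<rho>, a)"
  have n: "cmod ?z = \<rho>" using f by (simp add: norm_polar)
  have "attaching_map T f (Arg2pi ?z / (2 * pi)) = sector T f i (1, a)" if "1/2 < \<rho>"
  proof -
    have "?z = of_real \<rho> * polar (sectors T f) i (1, a)" by (simp add: polar_def)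
    then have "Arg2pi ?z = Arg2pi (polar (sectors T f) i (1, a))" using that by (simp add: Arg2pi_times_of_real)
    then show ?thesis by (simp add: sector_def face_map_def norm_polar)
  qed
  moreover have "sector T f i (\<rho>, a) = FacePt f ?z" using False f by (intro sector_inner) auto
  ultimately show ?thesis using n False f S by (auto simp: collar_def)
qed

lemma edge_map_star:
  assumes "e \<in> edges T" "t \<in> {0..1}"
  shows "edge_map T e t \<in> star T c \<longleftrightarrow> src T e = c \<and> t < 1/3 \<or> tgt T e = c \<and> 2/3 < t"
proof -
  consider "t = 0" | "t = 1" | "0 < t" "t < 1" using assms by fastforce
  then show ?thesis using assms by cases (auto simp: star_def)
qed

lemma edge_map_mid_arc:
  assumes "t \<in> {0..1}" "0 < \<delta>"
  shows "edge_map T e t \<in> mid_arc \<delta> e' \<longleftrightarrow> e = e' \<and> \<delta> < t \<and> t < 1 - \<delta>"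
proof -
  consider "t = 0" | "t = 1" | "0 < t" "t < 1" using assms by fastforce
  then show ?thesis using assms by cases (auto simp: mid_arc_def)
qed

lemma openin_collar:
  assumes S: "S \<subseteq> cells" "\<And>g z. FacePt g z \<notin> S"
    and o: "\<And>e. e \<in> edges T \<Longrightarrow> openin (top_of_set {0..1}) {t \<in> {0..1}. edge_map T e t \<in> S}"
  shows "openin (realization T) (collar T S)"
  unfolding openin_charts
proof (intro conjI ballI allI impI)
  show "collar T S \<subseteq> cells" using S by (auto simp: collar_def cell_points_def)
  fix e assume e: "e \<in> edges T"
  have "{t \<in> {0..1}. edge_map T e t \<in> collar T S} = {t \<in> {0..1}. edge_map T e t \<in> S}"
    by (auto simp: collar_def edge_map_not_face)
  then show "openin (top_of_set {0..1}) {t \<in> {0..1}. edge_map T e t \<in> collar T S}" using o[OF e] by simp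
next
  fix f i assume f: "f \<in> faces T" "i < sectors T f"
  have eq: "{v \<in> sq. sector T f i v \<in> collar T S} =
      (sq \<inter> {v. 1/2 < fst v}) \<inter> {v \<in> sq. sector T f i (1, snd v) \<in> S}"
    using sector_collar[OF S(2) f] by auto
  have o1: "openin (top_of_set sq) (sq \<inter> {v. 1/2 < fst v})"
    by (intro openin_open_Int open_Collect_less continuous_intros)
  have o2: "openin (top_of_set sq) {v \<in> sq. sector T f i (1, snd v) \<in> S}"
  proof (cases "bdry T f = []")
    case True
    then have "{v \<in> sq. sector T f i (1, snd v) \<in> S} = sq \<or> {v \<in> sq. sector T f i (1, snd v) \<in> S} = {}"
      using sector_rim[OF f] by auto
    then show ?thesis by (elim disjE) (simp_all only: openin_empty openin_subtopology_self)
  next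
    case False
    let ?l = "bdry T f ! i"
    let ?g = "\<lambda>v. if snd ?l then snd v else 1 - snd v :: real"
    have "i < length (bdry T f)" using False f by (simp add: sectors_def max_def split: if_splits)
    then have e: "fst ?l \<in> edges T" using bdry_in[OF f(1)] by simp
    have "continuous_map (top_of_set sq) (top_of_set {0..1}) ?g"
      by (cases "snd ?l") (auto intro!: continuous_intros)
    from openin_continuous_map_preimage[OF this o[OF e]]
    have "openin (top_of_set sq) {v \<in> sq. ?g v \<in> {t \<in> {0..1}. edge_map T (fst ?l) t \<in> S}}" by simp
    moreover have "{v \<in> sq. ?g v \<in> {t \<in> {0..1}. edge_map T (fst ?l) t \<in> S}} =
       {v \<in> sq. sector T f i (1, snd v) \<in> S}"
      using sector_rim[OF f] False by (auto simp: letter_map_def)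
    ultimately show ?thesis by simp
  qed
  show "openin (top_of_set sq) {v \<in> sq. sector T f i v \<in> collar T S}"
    unfolding eq by (rule openin_Int[OF o1 o2])
qed

lemma star_mid_arc_simps [simp]: "FacePt g z \<notin> star T c" "FacePt g z \<notin> mid_arc \<delta> e"
  by (auto simp: star_def mid_arc_def)

lemma openin_nbhd:
  assumes \<sigma>: "\<sigma> \<in> nodes T" and \<delta>: "0 < \<delta>" "\<delta> < 1/2"
  shows "openin (realization T) (nbhd T \<delta> \<sigma>)"
proof -
  have real_open: "openin (top_of_set {0..1}) {t \<in> {0..1::real}. P t}" if "open {t. P t}" for P
  proof -
    have "{t \<in> {0..1::real}. P t} = {0..1} \<inter> {t. P t}" by blast
    then show ?thesis using openin_open_Int[OF that, of "{0..1}"] by simp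
  qed
  consider c where "c \<in> verts T" "\<sigma> = VertexPt c" | e where "e \<in> edges T" "\<sigma> = EdgePt e (1/2)"
    | f where "f \<in> faces T" "\<sigma> = FacePt f 0" using \<sigma> by (auto simp: nodes_def)
  then show ?thesis
  proof cases
    case 1
    have "openin (top_of_set {0..1}) {t \<in> {0..1}. edge_map T e t \<in> star T c}" if "e \<in> edges T" for e
    proof -
      have "open {t::real. src T e = c \<and> t < 1/3 \<or> tgt T e = c \<and> 2/3 < t}"
        by (intro open_Collect_disj open_Collect_conj open_Collect_const open_Collect_less continuous_intros)
      from real_open[OF this] show ?thesis using edge_map_star[OF that] by (simp cong: conj_cong)
    qed
    then show ?thesis using 1 by (auto simp: star_def cell_points_def intro!: openin_collar)
  next
    case 2
    have "openin (top_of_set {0..1}) {t \<in> {0..1}. edge_map T e' t \<in> mid_arc \<delta> e}" for e'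
    proof -
      have "open {t::real. e' = e \<and> \<delta> < t \<and> t < 1 - \<delta>}"
        by (intro open_Collect_disj open_Collect_conj open_Collect_const open_Collect_less continuous_intros)
      from real_open[OF this] show ?thesis
        using edge_map_mid_arc[OF _ \<delta>(1), of _ e' e] by (simp add: eq_commute cong: conj_cong)
    qed
    then show ?thesis using 2 \<delta> by (auto simp: mid_arc_def cell_points_def intro!: openin_collar)
  next
    case 3
    have "openin (realization T) {FacePt f z |z. cmod z < 1 - \<delta>}"
      unfolding openin_charts
    proof (intro conjI ballI allI impI)
      show "{FacePt f z |z. cmod z < 1 - \<delta>} \<subseteq> cells" using 3 \<delta> by (auto simp: cell_points_def)
      fix e
      have "{t \<in> {0..1}. edge_map T e t \<in> {FacePt f z |z. cmod z < 1 - \<delta>}} = {}"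
        by (auto simp: edge_map_not_face)
      then show "openin (top_of_set {0..1}) {t \<in> {0..1}. edge_map T e t \<in> {FacePt f z |z. cmod z < 1 - \<delta>}}"
        by (simp only: openin_empty)
    next
      fix g i assume g: "g \<in> faces T" "i < sectors T g"
      have "sector T g i v \<in> {FacePt f z |z. cmod z < 1 - \<delta>} \<longleftrightarrow> g = f \<and> fst v < 1 - \<delta>"
        if vs: "v \<in> sq" for v
      proof -
        obtain \<rho> a where v: "v = (\<rho>, a)" "\<rho> \<in> {0..1}" "a \<in> {0..1}" using vs by blast
        then show ?thesis
          using \<delta> rim_not_face[OF g, of a] norm_polar[of \<rho>]
          by (cases "\<rho> = 1") (auto simp: sector_inner)
      qed
      then have "{v \<in> sq. sector T g i v \<in> {FacePt f z |z. cmod z < 1 - \<delta>}} = sq \<inter> {v. g = f \<and> fst v < 1 - \<delta>}"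
        by blast
      moreover have "open {v :: real \<times> real. g = f \<and> fst v < 1 - \<delta>}"
        by (intro open_Collect_conj open_Collect_const open_Collect_less continuous_intros)
      ultimately show "openin (top_of_set sq) {v \<in> sq. sector T g i v \<in> {FacePt f z |z. cmod z < 1 - \<delta>}}"
        by (simp only: openin_open_Int)
    qed
    then show ?thesis using 3 by simp
  qed
qed

lemma collar_cases:
  assumes "x \<in> collar T S" "x \<notin> S" "S \<subseteq> cells" "\<And>g z. FacePt g z \<notin> S"
  obtains f i \<rho> a where "f \<in> faces T" "i < sectors T f" "\<rho> \<in> {1/2<..<1}" "a \<in> {0..<1}"
    "x = sector T f i (\<rho>, a)" "sector T f i (1, a) \<in> S"
proof -
  obtain f z where f: "f \<in> faces T" "cmod z < 1" "x = FacePt f z"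
    using assms(1,2) by (auto simp: collar_def)
  obtain i a where ia: "i < sectors T f" "a \<in> {0..<1}" "z = polar (sectors T f) i (cmod z, a)"
    using polar_surj[of "sectors T f" z] by auto
  then have x: "x = sector T f i (cmod z, a)" using f by (simp add: sector_inner)
  then have "1/2 < cmod z \<and> sector T f i (1, a) \<in> S"
    using assms(1) sector_collar[OF assms(4) f(1) ia(1), of "cmod z" a] ia f by simp
  then show ?thesis using that[OF f(1) ia(1), of "cmod z" a] x ia f by auto
qed

text \<open>Reduces a collar to its trace \<open>S\<close> on the 1-skeleton: a point of the collar
  keeps radius above 1/2 and reaches the rim at time 1, while its radial projection follows the
  deformation of \<open>S\<close>.\<close>

lemma contraction_collar:
  assumes S: "S \<subseteq> cells" "\<And>g z. FacePt g z \<notin> S"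
    and \<Phi>: "reparam \<Phi>" "\<And>u \<rho>. u \<in> {0..1} \<Longrightarrow> 1/2 < \<rho> \<Longrightarrow> \<rho> < 1 \<Longrightarrow> 1/2 < \<Phi> u \<rho>"
      "\<And>\<rho>. 1/2 < \<rho> \<Longrightarrow> \<rho> < 1 \<Longrightarrow> \<Phi> 1 \<rho> = 1"
    and \<Psi>: "reparam \<Psi>" and odd: "\<And>u t. \<Psi> u (1 - t) = 1 - \<Psi> u t"
    and D: "\<And>x u. x \<in> S \<Longrightarrow> u \<in> {0..1} \<Longrightarrow> deform T \<Phi> \<Psi> (x, u) \<in> S"
      "\<And>x. x \<in> S \<Longrightarrow> deform T \<Phi> \<Psi> (x, 1) = \<sigma>"
    and x: "x \<in> collar T S" and u: "u \<in> {0..1}"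
  shows "deform T \<Phi> \<Psi> (x, u) \<in> collar T S \<and> deform T \<Phi> \<Psi> (x, 1) = \<sigma>"
proof (cases "x \<in> S")
  case True
  then show ?thesis using D(1)[OF _ u] D(2) by (auto simp: collar_def)
next
  case False
  from collar_cases[OF x False S] obtain f i \<rho> a where f: "f \<in> faces T" "i < sectors T f" "\<rho> \<in> {1/2<..<1}"
    "a \<in> {0..<1}" "x = sector T f i (\<rho>, a)" "sector T f i (1, a) \<in> S" .
  have r: "\<rho> \<in> {0..1}" "a \<in> {0..1}" "1 \<in> {0..1::real}" using f by auto
  have b: "\<Phi> w 1 = 1" "\<Phi> w \<rho> \<in> {0..1}" "\<Psi> w a \<in> {0..1}" if "w \<in> {0..1}" for w
    using \<Phi>(1) \<Psi> that r by (auto simp: reparam_def)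
  note ds = deform_sector[OF f(1,2) _ r(2) _ \<Phi>(1) \<Psi> odd]
  have "deform T \<Phi> \<Psi> (sector T f i (1, a), w) = sector T f i (1, \<Psi> w a)" if "w \<in> {0..1}" for w
    using ds[OF r(3) that] b(1)[OF that] by simp
  moreover have "deform T \<Phi> \<Psi> (x, w) = sector T f i (\<Phi> w \<rho>, \<Psi> w a)" if "w \<in> {0..1}" for w
    using ds[OF r(1) that] f by simp
  ultimately show ?thesis
    using D(1)[OF f(6) u] D(2)[OF f(6)] sector_collar[OF S(2) f(1,2) b(2)[OF u] b(3)[OF u]]
      \<Phi>(2)[OF u, of \<rho>] \<Phi>(3)[of \<rho>] f(3) u by auto
qed

lemma contraction_star:
  assumes \<delta>: "0 < \<delta>" "\<delta> < 1/2" and "x \<in> star T c" "u \<in> {0..1}"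
  shows "contraction T \<delta> (VertexPt c) (x, u) \<in> star T c \<and> contraction T \<delta> (VertexPt c) (x, 1) = VertexPt c"
proof (cases "x = VertexPt c")
  case True
  then show ?thesis by (simp add: star_def)
next
  case False
  then obtain e t where e: "e \<in> edges T" "t \<in> {0..1}" "x = edge_map T e t" "0 < t" "t < 1"
    using assms by (auto simp: star_def)
  then have st: "src T e = c \<and> t < 1/3 \<or> tgt T e = c \<and> 2/3 < t"
    using edge_map_star assms by blast
  let ?\<Psi> = "ang \<delta> (VertexPt c :: ('v, 'e, 'f) point)"
  have r: "reparam ?\<Psi>" using reparam_ang[OF \<delta>] .
  have d: "contraction T \<delta> (VertexPt c) (x, w) = edge_map T e (?\<Psi> w t)" if "w \<in> {0..1}" for w
    unfolding e(3) using deform_edge[OF r e(2) that] .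
  have P: "?\<Psi> w t \<in> {0..1}" if "w \<in> {0..1}" for w using r e that by (auto simp: reparam_def)
  have "edge_map T e (?\<Psi> u t) \<in> star T c \<and> edge_map T e (?\<Psi> 1 t) = VertexPt c"
    using st
  proof
    assume t: "src T e = c \<and> t < 1/3"
    have "?\<Psi> u t = (1 - u) * t" "?\<Psi> 1 t = 0" using t by simp_all
    moreover have "(1 - u) * t \<le> t" using assms e by (simp add: mult_left_le_one_le)
    ultimately show ?thesis using t edge_map_star[OF e(1) P[OF assms(4)], of c] by simp
  next
    assume t: "tgt T e = c \<and> 2/3 < t"
    have "?\<Psi> u t = t + u * (1 - t)" "?\<Psi> 1 t = 1" using t by (simp_all add: algebra_simps)
    moreover have "0 \<le> u * (1 - t)" using assms e by simp
    ultimately show ?thesis using t edge_map_star[OF e(1) P[OF assms(4)], of c] by simp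
  qed
  then show ?thesis using d[OF assms(4)] d[of 1] by (simp del: ang.simps rad.simps)
qed

lemma contraction_mid_arc:
  assumes \<delta>: "0 < \<delta>" "\<delta> < 1/2" and "x \<in> mid_arc \<delta> e" "u \<in> {0..1}"
  shows "contraction T \<delta> (EdgePt e (1/2)) (x, u) \<in> mid_arc \<delta> e \<and> contraction T \<delta> (EdgePt e (1/2)) (x, 1) = EdgePt e (1/2)"
proof -
  obtain t where t: "x = edge_map T e t" "\<delta> < t" "t < 1 - \<delta>" "t \<in> {0..1}"
    using assms by (auto simp: mid_arc_def)
  let ?\<Psi> = "ang \<delta> (EdgePt e (1/2) :: ('v, 'e, 'f) point)"
  have r: "reparam ?\<Psi>" using reparam_ang[OF \<delta>] .
  have d: "contraction T \<delta> (EdgePt e (1/2)) (x, w) = edge_map T e (?\<Psi> w t)" if "w \<in> {0..1}" for w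
    unfolding t(1) using deform_edge[OF r t(4) that] .
  have "1/2 < t / (2 * \<delta>)" "1/2 < (1 - t) / (2 * \<delta>)" using t \<delta> by (auto simp: field_simps)
  then have P: "?\<Psi> w t = (1 - w) * t + w * (1/2)" for w by simp
  have "(1 - u) * t + u * (1/2) \<in> {\<delta><..<1 - \<delta>}"
    using convexD[of "{\<delta><..<1 - \<delta>}" t "1/2" "1 - u" u] assms t by auto
  then have "edge_map T e ((1 - u) * t + u * (1/2)) \<in> mid_arc \<delta> e"
    using \<delta> by (auto simp: mid_arc_def)
  then have m: "edge_map T e (?\<Psi> u t) \<in> mid_arc \<delta> e" "edge_map T e (?\<Psi> 1 t) = EdgePt e (1/2)"
    unfolding P by simp_all
  show ?thesis using d[OF assms(4)] d[of 1] m by (simp del: ang.simps rad.simps)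
qed

text \<open>Invariance of the neighbourhood at every time, and not only the final collapse, is what
  later keeps the contraction inside the complement of a subcomplex.\<close>

lemma contraction_nbhd:
  assumes \<sigma>: "\<sigma> \<in> nodes T" and \<delta>: "0 < \<delta>" "\<delta> < 1/2" and x: "x \<in> nbhd T \<delta> \<sigma>" and u: "u \<in> {0..1}"
  shows "contraction T \<delta> \<sigma> (x, u) \<in> nbhd T \<delta> \<sigma> \<and> contraction T \<delta> \<sigma> (x, 1) = \<sigma>"
proof -
  note r = reparam_rad[OF \<delta>] reparam_ang[OF \<delta>] ang_odd[OF \<delta>]
  have rr: "1/2 < (1 - u) * \<rho> + u * min 1 (2 * \<rho>)" "1 = (1 - 1) * \<rho> + 1 * min 1 (2 * \<rho>)"
    if "u \<in> {0..1}" "1/2 < \<rho>" "\<rho> < 1" for u \<rho> :: real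
  proof -
    have "(1 - u) * \<rho> + u * 1 = \<rho> + u * (1 - \<rho>)" by (simp add: algebra_simps)
    moreover have "0 \<le> u * (1 - \<rho>)" using that by simp
    moreover have "min 1 (2 * \<rho>) = 1" using that by simp
    ultimately show "1/2 < (1 - u) * \<rho> + u * min 1 (2 * \<rho>)" "1 = (1 - 1) * \<rho> + 1 * min 1 (2 * \<rho>)"
      using that(2) by simp_all
  qed
  consider c where "c \<in> verts T" "\<sigma> = VertexPt c" | e where "e \<in> edges T" "\<sigma> = EdgePt e (1/2)"
    | f where "f \<in> faces T" "\<sigma> = FacePt f 0" using \<sigma> by (auto simp: nodes_def)
  then show ?thesis
  proof cases
    case 1
    have "star T c \<subseteq> cells" using 1 by (auto simp: star_def cell_points_def)
    then have "contraction T \<delta> \<sigma> (x, u) \<in> collar T (star T c) \<and> contraction T \<delta> \<sigma> (x, 1) = \<sigma>"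
    proof (rule contraction_collar[OF _ star_mid_arc_simps(1) r(1) _ _ r(2,3)])
      show "1/2 < rad \<delta> \<sigma> u \<rho>" if "u \<in> {0..1}" "1/2 < \<rho>" "\<rho> < 1" for u \<rho>
        unfolding 1(2) rad.simps using rr(1)[OF that] .
      show "rad \<delta> \<sigma> 1 \<rho> = 1" if "1/2 < \<rho>" "\<rho> < 1" for \<rho>
        unfolding 1(2) rad.simps using rr(2)[OF u that] by simp
    qed (use contraction_star[OF \<delta>] 1 x u in \<open>simp_all del: rad.simps ang.simps\<close>)
    then show ?thesis using 1 by simp
  next
    case 2
    have "mid_arc \<delta> e \<subseteq> cells" using 2 \<delta> by (auto simp: mid_arc_def cell_points_def)
    then have "contraction T \<delta> \<sigma> (x, u) \<in> collar T (mid_arc \<delta> e) \<and> contraction T \<delta> \<sigma> (x, 1) = \<sigma>"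
    proof (rule contraction_collar[OF _ star_mid_arc_simps(2) r(1) _ _ r(2,3)])
      show "1/2 < rad \<delta> \<sigma> u \<rho>" if "u \<in> {0..1}" "1/2 < \<rho>" "\<rho> < 1" for u \<rho>
        unfolding 2(2) rad.simps using rr(1)[OF that] .
      show "rad \<delta> \<sigma> 1 \<rho> = 1" if "1/2 < \<rho>" "\<rho> < 1" for \<rho>
        unfolding 2(2) rad.simps using rr(2)[OF u that] by simp
    qed (use contraction_mid_arc[OF \<delta>] 2 x u in \<open>simp_all del: rad.simps ang.simps\<close>)
    then show ?thesis using 2 by simp
  next
    case 3
    then obtain z where z: "x = FacePt f z" "cmod z < 1 - \<delta>" using x by auto
    obtain i a where ia: "i < sectors T f" "a \<in> {0..<1}" "z = polar (sectors T f) i (cmod z, a)"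
      using polar_surj[of "sectors T f" z] by auto
    have xs: "x = sector T f i (cmod z, a)" using z ia \<delta> by (simp add: sector_inner)
    have "1 < (1 - cmod z) / \<delta>" using z \<delta> by (simp add: field_simps)
    then have P: "rad \<delta> \<sigma> w (cmod z) = (1 - w) * cmod z" for w using 3 by simp
    have d: "contraction T \<delta> \<sigma> (x, w) = sector T f i ((1 - w) * cmod z, ang \<delta> \<sigma> w a)" if "w \<in> {0..1}" for w
      unfolding xs using deform_sector[OF 3(1) ia(1) _ _ that r(1,2,3), of "cmod z" a \<sigma> \<sigma>] z ia \<delta> P by simp
    have "(1 - u) * cmod z \<le> cmod z" using u by (simp add: mult_left_le_one_le)
    then show ?thesis
      using d[OF u] d[of 1] z u \<delta> 3 norm_polar[of "(1 - u) * cmod z"] by (simp add: sector_inner)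
  qed
qed

text \<open>The centre belongs to the same open cell as \<open>x\<close>, which is recorded in the
  last clause; hence it avoids a subcomplex whenever \<open>x\<close> does. For edges and 2-cells
  \<delta> shrinks as \<open>x\<close> approaches the boundary of its cell.\<close>

lemma node_in_nbhd:
  assumes "x \<in> cells" obtains \<sigma> \<delta> where "\<sigma> \<in> nodes T" "0 < \<delta>" "\<delta> < 1/2" "x \<in> nbhd T \<delta> \<sigma>"
    "(\<exists>v. \<sigma> = VertexPt v \<and> x = \<sigma>) \<or> (\<exists>e t. \<sigma> = EdgePt e (1/2) \<and> x = EdgePt e t) \<or>
     (\<exists>f z. \<sigma> = FacePt f 0 \<and> x = FacePt f z)"
proof -
  consider v where "v \<in> verts T" "x = VertexPt v"
    | e t where "e \<in> edges T" "0 < t" "t < 1" "x = EdgePt e t"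
    | f z where "f \<in> faces T" "cmod z < 1" "x = FacePt f z"
    using assms by (auto simp: cell_points_def)
  then show ?thesis
  proof cases
    case 1
    then show ?thesis using that[of "VertexPt v" "1/4"] by (auto simp: nodes_def collar_def star_def)
  next
    case 2
    let ?d = "min t (1 - t) / 2"
    have "?d < t" "t < 1 - ?d" "0 < ?d" "?d < 1/2" using 2 by (auto simp: min_def field_simps)
    then show ?thesis using 2 that[of "EdgePt e (1/2)" ?d] by (auto simp: nodes_def collar_def mid_arc_def)
  next
    case 3
    let ?d = "(1 - cmod z) / 3"
    have "cmod z < 1 - ?d" "0 < ?d" "?d < 1/2" using 3(2) norm_ge_zero[of z] by (simp_all add: field_simps, linarith+)
    then show ?thesis using 3 that[of "FacePt f 0" ?d] by (auto simp: nodes_def)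
  qed
qed

end

section \<open>Paths in the complement of a subcomplex\<close>

text \<open>The arcs run from the centre of an edge to its ends, and from the centre of a 2-cell to the
  centres of its boundary edges, or to its base vertex if the boundary word is empty.\<close>

inductive_set arcs :: "('v, 'e, 'f) two_complex \<Rightarrow> (real \<Rightarrow> ('v, 'e, 'f) point) set" for T where
  arc_src: "e \<in> edges T \<Longrightarrow> (\<lambda>t. edge_map T e ((1 - t) / 2)) \<in> arcs T"
| arc_tgt: "e \<in> edges T \<Longrightarrow> (\<lambda>t. edge_map T e ((1 + t) / 2)) \<in> arcs T"
| arc_face: "f \<in> faces T \<Longrightarrow> i < length (bdry T f) \<Longrightarrow> (\<lambda>t. sector T f i (t, 1/2)) \<in> arcs T"
| arc_base: "f \<in> faces T \<Longrightarrow> bdry T f = [] \<Longrightarrow> (\<lambda>t. sector T f 0 (t, 0)) \<in> arcs T"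

inductive_set arc_paths :: "('v, 'e, 'f) two_complex \<Rightarrow> ('v, 'e, 'f) point set \<Rightarrow>
    (real \<Rightarrow> ('v, 'e, 'f) point) set" for T U where
  const: "x \<in> U \<Longrightarrow> (\<lambda>_. x) \<in> arc_paths T U"
| arc: "p \<in> arcs T \<Longrightarrow> p ` {0..1} \<subseteq> U \<Longrightarrow> p \<in> arc_paths T U"
| rv_arc: "p \<in> arcs T \<Longrightarrow> p ` {0..1} \<subseteq> U \<Longrightarrow> rv p \<in> arc_paths T U"
| join: "p \<in> arc_paths T U \<Longrightarrow> q \<in> arc_paths T U \<Longrightarrow> p 1 = q 0 \<Longrightarrow> join_loops p q \<in> arc_paths T U"

lemma arc_paths_rv: "p \<in> arc_paths T U \<Longrightarrow> rv p \<in> arc_paths T U"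
proof (induction rule: arc_paths.induct)
  case (join p q)
  then show ?case by (simp add: rv_join arc_paths.join)
qed (simp_all add: arc_paths.intros)

lemma convex_01:
  assumes "{0<..<1} \<subseteq> S" "S \<subseteq> {0..1::real}" shows "convex S"
proof -
  have "is_interval S"
    unfolding is_interval_1
  proof (intro ballI allI impI)
    fix a b x assume a: "a \<in> S" "b \<in> S" and x: "a \<le> x \<and> x \<le> b"
    then have "a \<in> {0..1}" "b \<in> {0..1}" using assms(2) by auto
    then have "x = a \<or> x = b \<or> x \<in> {0<..<1}" using x by fastforce
    then show "x \<in> S" using a assms(1) by blast
  qed
  then show ?thesis by (simp only: is_interval_convex_1)
qed

text \<open>A proper convex combination lies on the side \<open>fst v = 1\<close> only if both
  points do, and there convexity of \<open>A\<close> takes over.\<close>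

lemma convex_sq:
  assumes "convex A" "A \<subseteq> {0..1::real}" shows "convex {v \<in> sq. fst v < 1 \<or> snd v \<in> A}"
proof (rule convexI)
  fix v w u u' :: real and x y :: "real \<times> real"
  assume x: "x \<in> {v \<in> sq. fst v < 1 \<or> snd v \<in> A}" and y: "y \<in> {v \<in> sq. fst v < 1 \<or> snd v \<in> A}"
    and u: "0 \<le> u" "0 \<le> u'" "u + u' = 1"
  have "convex sq" by (intro convex_Times) auto
  then have s: "u *\<^sub>R x + u' *\<^sub>R y \<in> sq" using x y u by (auto intro!: convexD simp del: mem_Sigma_iff)
  show "u *\<^sub>R x + u' *\<^sub>R y \<in> {v \<in> sq. fst v < 1 \<or> snd v \<in> A}"
  proof (cases "u = 0 \<or> u' = 0")
    case True
    then show ?thesis using x y u by auto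
  next
    case False
    then have pos: "0 < u" "0 < u'" using u by auto
    show ?thesis
    proof (cases "fst x = 1 \<and> fst y = 1")
      case True
      then have "u * snd x + u' * snd y \<in> A" using x y u convexD[OF assms(1), of "snd x" "snd y" u u'] by auto
      then show ?thesis using s by simp
    next
      case False
      have "fst x \<le> 1" "fst y \<le> 1" using x y by auto
      then have "u * (1 - fst x) \<ge> 0" "u' * (1 - fst y) \<ge> 0" "u * (1 - fst x) > 0 \<or> u' * (1 - fst y) > 0"
        using pos False by auto
      then have "u * (1 - fst x) + u' * (1 - fst y) > 0" by linarith
      then have "u * fst x + u' * fst y < 1" using u(3) by (simp add: algebra_simps)
      then show ?thesis using s by simp
    qed
  qed
qed

text \<open>Paths are total functions on the reals; homotopy sees only their values on the unit
  interval.\<close>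

lemma hp_cong:
  assumes "pathin X p" "\<And>t. t \<in> {0..1} \<Longrightarrow> p t = q t" shows "hp X p q"
proof -
  have "homotopic_with (\<lambda>r. r 0 = p 0 \<and> r 1 = p 1) (top_of_set {0..1}) X p q"
    using assms by (intro homotopic_with_equal) (auto simp: pathin_def)
  then show ?thesis using assms(2)[of 0] assms(2)[of 1] by (simp add: hp_def)
qed

locale complement = complex2 T for T :: "('v, 'e, 'f) two_complex" +
  fixes V :: "'v set" and E :: "'e set" and F :: "'f set"
  assumes E_closed: "e \<in> E \<Longrightarrow> e \<in> edges T \<Longrightarrow> src T e \<in> V \<and> tgt T e \<in> V"
    and F_closed: "f \<in> F \<Longrightarrow> f \<in> faces T \<Longrightarrow> base T f \<in> V \<and> fst ` set (bdry T f) \<subseteq> E"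
begin

definition "U = cells - cell_points V E F"

abbreviation "XU \<equiv> subtopology (realization T) (- cell_points V E F)"

lemma topspace_XU [simp]: "topspace XU = U"
  by (simp add: topspace_realization U_def Diff_eq)

lemma U_simps [simp]:
  "VertexPt v \<in> U \<longleftrightarrow> v \<in> verts T \<and> v \<notin> V"
  "EdgePt e t \<in> U \<longleftrightarrow> e \<in> edges T \<and> e \<notin> E \<and> 0 < t \<and> t < 1"
  "FacePt f z \<in> U \<longleftrightarrow> f \<in> faces T \<and> f \<notin> F \<and> cmod z < 1"
  by (auto simp: U_def cell_points_def)

lemma edge_U: "e \<in> edges T \<Longrightarrow> edge_map T e t \<in> U \<Longrightarrow> e \<notin> E"
  using E_closed[of e] by (auto simp: edge_map_def split: if_splits)

lemma bdry_nth:
  assumes "f \<in> faces T" "i < sectors T f" "bdry T f \<noteq> []"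
  shows "i < length (bdry T f)" "fst (bdry T f ! i) \<in> edges T"
proof -
  show "i < length (bdry T f)" using assms by (simp add: sectors_def max_def split: if_splits)
  then show "fst (bdry T f ! i) \<in> edges T" using bdry_in[OF assms(1)] by simp
qed

lemma sector_U:
  assumes "f \<in> faces T" "i < sectors T f" "v \<in> sq"
  shows "sector T f i v \<in> U \<Longrightarrow> f \<notin> F"
    and "f \<notin> F \<Longrightarrow> fst v < 1 \<Longrightarrow> sector T f i v \<in> U"
proof -
  obtain \<rho> a where v: "v = (\<rho>, a)" "\<rho> \<in> {0..1}" "a \<in> {0..1}" using assms(3) by blast
  show "f \<notin> F" if U: "sector T f i v \<in> U"
  proof
    assume F: "f \<in> F"
    then have fcl: "base T f \<in> V" "fst ` set (bdry T f) \<subseteq> E" using F_closed assms(1) by auto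
    have "\<rho> = 1" using F U v by (cases "\<rho> = 1") (auto simp: sector_inner)
    then have r: "(if bdry T f = [] then VertexPt (base T f) else letter_map T (bdry T f ! i) a) \<in> U"
      using U v sector_rim[OF assms(1,2), of a] by simp
    then have "bdry T f \<noteq> []" using fcl by auto
    then have "fst (bdry T f ! i) \<notin> E" "fst (bdry T f ! i) \<in> E"
      using r bdry_nth[OF assms(1,2)] fcl by (auto simp: letter_map_def dest: edge_U)
    then show False ..
  qed
  show "sector T f i v \<in> U" if "f \<notin> F" "fst v < 1"
    using that v assms(1) by (simp add: sector_inner norm_polar)
qed

lemma collar_U:
  assumes "S \<subseteq> U" "\<And>g z. FacePt g z \<notin> S" shows "collar T S \<subseteq> U"
proof
  fix x assume x: "x \<in> collar T S"
  show "x \<in> U"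
  proof (cases "x \<in> S")
    case False
    have "S \<subseteq> cells" using assms(1) by (auto simp: U_def)
    from collar_cases[OF x False this assms(2)] obtain f i \<rho> a where
      f: "f \<in> faces T" "i < sectors T f" "\<rho> \<in> {1/2<..<1}" "a \<in> {0..<1}"
      "x = sector T f i (\<rho>, a)" "sector T f i (1, a) \<in> S" .
    have "f \<notin> F" using f assms(1) sector_U(1)[OF f(1,2), of "(1, a)"] by auto
    then show ?thesis using f sector_U(2)[OF f(1,2), of "(\<rho>, a)"] by auto
  qed (use assms in auto)
qed

text \<open>A subcomplex contains the boundary of each of its cells, so a cell with a boundary cell
  outside is itself outside. The neighbourhood of a centre consists of points in such adjacent
  cells.\<close>

lemma nbhd_U:
  assumes \<sigma>: "\<sigma> \<in> nodes T" "\<sigma> \<in> U" and "0 < \<delta>" "\<delta> < 1/2"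
  shows "nbhd T \<delta> \<sigma> \<subseteq> U"
proof -
  consider c where "c \<in> verts T" "\<sigma> = VertexPt c" | e where "e \<in> edges T" "\<sigma> = EdgePt e (1/2)"
    | f where "f \<in> faces T" "\<sigma> = FacePt f 0" using \<sigma> by (auto simp: nodes_def)
  then show ?thesis
  proof cases
    case 1
    then have "star T c \<subseteq> U" using assms E_closed by (auto simp: star_def)
    then show ?thesis using 1 collar_U by simp
  next
    case 2
    then have "mid_arc \<delta> e \<subseteq> U" using assms by (auto simp: mid_arc_def)
    then show ?thesis using 2 collar_U by simp
  next
    case 3
    then show ?thesis using assms by auto
  qed
qed

abbreviation "edge_dom e \<equiv> {t \<in> {0..1}. edge_map T e t \<in> U}"
abbreviation "sector_dom f i \<equiv> {v \<in> sq. sector T f i v \<in> U}"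

lemma convex_edge_dom: "e \<in> edges T \<Longrightarrow> convex (edge_dom e)"
proof (cases "e \<in> E")
  case True
  assume "e \<in> edges T"
  then have "edge_dom e = {}" using True edge_U by auto
  then show ?thesis by (simp only: convex_empty)
next
  case False
  assume "e \<in> edges T"
  then show ?thesis using False by (intro convex_01) auto
qed

text \<open>For a 2-cell outside the subcomplex only parts of the rim can be missing: all of the
  boundary edge, or at most its two corners. What is left of the rim is empty or contains its
  interior, so \<open>convex_sq\<close> applies.\<close>

lemma convex_sector_dom:
  assumes f: "f \<in> faces T" "i < sectors T f" shows "convex (sector_dom f i)"
proof (cases "f \<in> F")
  case True
  then have "sector_dom f i = {}" using sector_U(1)[OF f] by blast
  then show ?thesis by (simp only: convex_empty)
next
  case False
  let ?A = "{a \<in> {0..1}. sector T f i (1, a) \<in> U}"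
  have "convex ?A"
  proof (cases "bdry T f = []")
    case True
    then have "?A = {} \<or> ?A = {0..1}" using sector_rim[OF f] by auto
    then show ?thesis by (elim disjE) (simp_all only: convex_empty convex_real_interval)
  next
    case ne: False
    let ?e = "fst (bdry T f ! i)"
    note e = bdry_nth(2)[OF f ne]
    have r: "sector T f i (1, a) = edge_map T ?e (if snd (bdry T f ! i) then a else 1 - a)" if "a \<in> {0..1}" for a
      using that ne sector_rim[OF f, of a] by (simp add: letter_map_def)
    show ?thesis
    proof (cases "?e \<in> E")
      case True
      then have "?A = {}" using r edge_U[OF e] by auto
      then show ?thesis by (simp only: convex_empty)
    next
      case False
      then show ?thesis using r e by (intro convex_01) auto
    qed
  qed
  then have "convex {v \<in> sq. fst v < 1 \<or> snd v \<in> ?A}" by (rule convex_sq) auto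
  moreover have "sector_dom f i = {v \<in> sq. fst v < 1 \<or> snd v \<in> ?A}"
  proof (rule Collect_cong, rule conj_cong[OF HOL.refl])
    fix v assume v: "v \<in> sq"
    show "sector T f i v \<in> U \<longleftrightarrow> fst v < 1 \<or> snd v \<in> ?A"
    proof (cases "fst v < 1")
      case True
      then show ?thesis using sector_U(2)[OF f v False] by simp
    next
      case False
      then obtain a where "v = (1, a)" "a \<in> {0..1}" using v by (cases v) auto
      then show ?thesis by simp
    qed
  qed
  ultimately show ?thesis by (simp only:)
qed

lemma continuous_edge_dom: "e \<in> edges T \<Longrightarrow> continuous_map (top_of_set (edge_dom e)) XU (edge_map T e)"
  by (rule continuous_map_into_subtopology[OF continuous_map_from_subtopology_mono[OF continuous_edge_map]])
    (auto simp: U_def)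

lemma continuous_sector_dom:
  "f \<in> faces T \<Longrightarrow> i < sectors T f \<Longrightarrow> continuous_map (top_of_set (sector_dom f i)) XU (sector T f i)"
  by (rule continuous_map_into_subtopology[OF continuous_map_from_subtopology_mono[OF continuous_sector]])
    (auto simp: U_def)

lemma pathin_U: "pathin XU p \<Longrightarrow> p ` {0..1} \<subseteq> U"
  using pathin_in[of XU p] unfolding topspace_XU by blast

definition arc_homotopic :: "(real \<Rightarrow> ('v, 'e, 'f) point) \<Rightarrow> bool" where
  "arc_homotopic p \<longleftrightarrow> (\<exists>q\<in>arc_paths T U. hp XU p q)"

lemma arc_homotopic_hp: "hp XU p q \<Longrightarrow> arc_homotopic q \<Longrightarrow> arc_homotopic p"
  unfolding arc_homotopic_def using hp_trans by blast

lemma arc_homotopic_join: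
  "arc_homotopic p \<Longrightarrow> arc_homotopic q \<Longrightarrow> p 1 = q 0 \<Longrightarrow> arc_homotopic (join_loops p q)"
  unfolding arc_homotopic_def by (metis arc_paths.join hp_0 hp_1 hp_join)

lemma arc_homotopic_rv: "arc_homotopic p \<Longrightarrow> arc_homotopic (rv p)"
  unfolding arc_homotopic_def using arc_paths_rv hp_rv by blast

lemma arc_homotopic_const: "x \<in> nodes T \<Longrightarrow> x \<in> U \<Longrightarrow> arc_homotopic (\<lambda>_. x)"
  unfolding arc_homotopic_def
  by (rule bexI[where x = "\<lambda>_. x"], rule hp_refl, rule pathin_const) (simp_all add: arc_paths.const del: topspace_subtopology)

lemma ex_linepath:
  "path_image (linepath z h) \<subseteq> S \<Longrightarrow> arc_homotopic (f \<circ> linepath z h) \<Longrightarrow>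
    \<exists>\<beta>. path \<beta> \<and> path_image \<beta> \<subseteq> S \<and> \<beta> 0 = z \<and> \<beta> 1 = h \<and> arc_homotopic (f \<circ> \<beta>)"
  by (intro exI[of _ "linepath z h"]) (simp add: linepath_0' linepath_1' del: path_image_linepath)

text \<open>In a convex chart it suffices to join both end points of \<alpha> to one common point
  \<open>h\<close> by good paths: \<alpha> is homotopic to the detour through
  \<open>h\<close>.\<close>

lemma hub:
  fixes S :: "'b::real_normed_vector set"
  assumes f: "continuous_map (top_of_set S) XU f" "convex S"
    and \<alpha>: "path \<alpha>" "path_image \<alpha> \<subseteq> S"
    and h: "\<And>z. z \<in> {\<alpha> 0, \<alpha> 1} \<Longrightarrow>
      \<exists>\<beta>. path \<beta> \<and> path_image \<beta> \<subseteq> S \<and> \<beta> 0 = z \<and> \<beta> 1 = h \<and> arc_homotopic (f \<circ> \<beta>)"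
  shows "arc_homotopic (f \<circ> \<alpha>)"
proof -
  obtain b where b: "path b" "path_image b \<subseteq> S" "b 0 = \<alpha> 0" "b 1 = h" "arc_homotopic (f \<circ> b)"
    using h[of "\<alpha> 0"] by auto
  obtain c where c: "path c" "path_image c \<subseteq> S" "c 0 = \<alpha> 1" "c 1 = h" "arc_homotopic (f \<circ> c)"
    using h[of "\<alpha> 1"] by auto
  have "hp XU (f \<circ> \<alpha>) (f \<circ> (b +++ reversepath c))"
  proof (rule hp_convex[OF f \<alpha>])
    have "pathfinish b = pathstart (reversepath c)"
      using b c by (simp add: pathfinish_def pathstart_def reversepath_def)
    then show "path (b +++ reversepath c)" using b c by simp
    show "path_image (b +++ reversepath c) \<subseteq> S" using b c by (intro subset_path_image_join) auto
    show "\<alpha> 0 = (b +++ reversepath c) 0" "\<alpha> 1 = (b +++ reversepath c) 1"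
      using b c by (simp_all add: joinpaths_def reversepath_def)
  qed
  moreover have "arc_homotopic (f \<circ> (b +++ reversepath c))"
    unfolding join_o[symmetric] rv_o[symmetric] using b c
    by (intro arc_homotopic_join arc_homotopic_rv) auto
  ultimately show ?thesis by (rule arc_homotopic_hp)
qed

lemma edge_map_node:
  assumes "edge_map T e t \<in> nodes T" "t \<in> {0..1}" shows "t \<in> {0, 1/2, 1}"
proof (cases "t = 0 \<or> t = 1")
  case False
  then have "edge_map T e t = EdgePt e t" using assms by simp
  then show ?thesis using assms by (auto simp: nodes_def)
qed auto

lemma edge_end:
  assumes e: "e \<in> edges T" "t \<in> edge_dom e" "edge_map T e t \<in> nodes T"
  shows "path_image (linepath t (1/2)) \<subseteq> edge_dom e" "arc_homotopic (edge_map T e \<circ> linepath t (1/2))"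
proof -
  have E: "e \<notin> E" using e edge_U by auto
  then have "1/2 \<in> edge_dom e" using e by simp
  then show im: "path_image (linepath t (1/2)) \<subseteq> edge_dom e"
    using e convex_edge_dom[OF e(1)] by (simp only: path_image_linepath closed_segment_subset)
  then have p: "pathin XU (edge_map T e \<circ> linepath t (1/2))"
    by (intro pathin_o[OF continuous_edge_dom[OF e(1)]]) auto
  have U: "rv (edge_map T e \<circ> linepath t (1/2)) ` {0..1} \<subseteq> U"
    using pathin_U[OF pathin_rv[OF p]] .
  have "t \<in> {0, 1/2, 1}" using edge_map_node e by blast
  then consider "t = 0" | "t = 1/2" | "t = 1" by blast
  then show "arc_homotopic (edge_map T e \<circ> linepath t (1/2))"
  proof cases
    case 1
    have "edge_map T e \<circ> linepath t (1/2) = rv (\<lambda>t. edge_map T e ((1 - t) / 2))"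
      using 1 by (simp add: fun_eq_iff rv_def linepath_def)
    moreover from this have "(\<lambda>t. edge_map T e ((1 - t) / 2)) ` {0..1} \<subseteq> U" using U by simp
    ultimately have "edge_map T e \<circ> linepath t (1/2) \<in> arc_paths T U"
      by (simp only: arc_paths.rv_arc[OF arc_src[OF e(1)]])
    then show ?thesis unfolding arc_homotopic_def using hp_refl[OF p] by blast
  next
    case 2
    have "edge_map T e \<circ> linepath t (1/2) = (\<lambda>_. EdgePt e (1/2))"
      unfolding 2 linepath_refl by (simp add: fun_eq_iff)
    then show ?thesis using e E by (simp add: arc_homotopic_const nodes_def)
  next
    case 3
    have "edge_map T e \<circ> linepath t (1/2) = rv (\<lambda>t. edge_map T e ((1 + t) / 2))"
      using 3 by (auto simp: fun_eq_iff rv_def linepath_def field_simps intro!: arg_cong[where f = "edge_map T e"])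
    moreover from this have "(\<lambda>t. edge_map T e ((1 + t) / 2)) ` {0..1} \<subseteq> U" using U by simp
    ultimately have "edge_map T e \<circ> linepath t (1/2) \<in> arc_paths T U"
      by (simp only: arc_paths.rv_arc[OF arc_tgt[OF e(1)]])
    then show ?thesis unfolding arc_homotopic_def using hp_refl[OF p] by blast
  qed
qed

lemma edge_link:
  assumes "e \<in> edges T" "path \<alpha>" "path_image \<alpha> \<subseteq> edge_dom e"
    "edge_map T e (\<alpha> 0) \<in> nodes T" "edge_map T e (\<alpha> 1) \<in> nodes T"
  shows "arc_homotopic (edge_map T e \<circ> \<alpha>)"
proof (rule hub[OF continuous_edge_dom[OF assms(1)] convex_edge_dom[OF assms(1)] assms(2,3)])
  fix z assume z: "z \<in> {\<alpha> 0, \<alpha> 1}"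
  then have "z \<in> path_image \<alpha>" by (auto simp: path_image_def)
  then have "z \<in> edge_dom e" "edge_map T e z \<in> nodes T" using z assms by auto
  then show "\<exists>\<beta>. path \<beta> \<and> path_image \<beta> \<subseteq> edge_dom e \<and> \<beta> 0 = z \<and> \<beta> 1 = 1/2 \<and> arc_homotopic (edge_map T e \<circ> \<beta>)"
    by (intro ex_linepath edge_end[OF assms(1)])
qed

lemma sector_link:
  assumes f: "f \<in> faces T" "i < sectors T f" and \<alpha>: "path \<alpha>" "path_image \<alpha> \<subseteq> sector_dom f i"
    "sector T f i (\<alpha> 0) \<in> nodes T" "sector T f i (\<alpha> 1) \<in> nodes T"
  shows "arc_homotopic (sector T f i \<circ> \<alpha>)"
proof -
  let ?S = "sector_dom f i" and ?f = "sector T f i"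
  note cont = continuous_sector_dom[OF f] and conv = convex_sector_dom[OF f]
  \<comment> \<open>The hub of a sector is the centre of its boundary edge if this edge survives,
    and the centre of the 2-cell otherwise. With an empty boundary word the rim is a single vertex,
    approached at angle 0 as in \<open>arc_base\<close>.\<close>
  define k :: real where "k = (if bdry T f = [] then 0 else 1/2)"
  define h :: "real \<times> real" where "h = (if (1, k) \<in> ?S then (1, k) else (0, k))"
  have k: "k \<in> {0..1}" by (simp add: k_def)
  show ?thesis
  proof (rule hub[OF cont conv \<alpha>(1,2), where h = h])
    fix z assume z: "z \<in> {\<alpha> 0, \<alpha> 1}"
    then have "z \<in> path_image \<alpha>" by (auto simp: path_image_def)
    then have zS: "z \<in> ?S" and zn: "?f z \<in> nodes T" using z \<alpha> by auto
    then obtain \<rho> a where za: "z = (\<rho>, a)" "\<rho> \<in> {0..1}" "a \<in> {0..1}" by blast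
    have fF: "f \<notin> F" using sector_U(1)[OF f] zS by blast
    have c0: "FacePt f 0 \<in> nodes T" "FacePt f 0 \<in> U" using f fF by (auto simp: nodes_def)
    have k0: "(0, k) \<in> ?S" using c0 k by simp
    then have hS: "h \<in> ?S" by (simp add: h_def)
    have seg: "path_image (linepath x y) \<subseteq> ?S" if "x \<in> ?S" "y \<in> ?S" for x y
      using that conv by (simp only: path_image_linepath closed_segment_subset)
    show "\<exists>\<beta>. path \<beta> \<and> path_image \<beta> \<subseteq> ?S \<and> \<beta> 0 = z \<and> \<beta> 1 = h \<and> arc_homotopic (?f \<circ> \<beta>)"
    \<comment> \<open>A node in the sector is the centre of the 2-cell or lies on the rim; in the
      latter case the rim point shows that the boundary edge, or the base vertex, has survived, so
      the hub lies on the rim too.\<close>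
    proof (cases "\<rho> = 1")
      case False
      then have "\<rho> < 1" using za by simp
      then have "?f z = FacePt f (polar (sectors T f) i (\<rho>, a))" using za by (simp add: sector_inner)
      then have "cmod (polar (sectors T f) i (\<rho>, a)) = 0" using zn by (auto simp: nodes_def)
      moreover have "cmod (polar (sectors T f) i (\<rho>, a)) = \<rho>" using za by (intro norm_polar) auto
      ultimately have r0: "\<rho> = 0" by simp
      have 1: "arc_homotopic (?f \<circ> linepath z (0, k))"
      proof -
        have "?f \<circ> linepath z (0, k) = (\<lambda>_. FacePt f 0)"
          using za r0 by (simp add: fun_eq_iff linepath_def)
        then show ?thesis using c0 arc_homotopic_const by simp
      qed
      have 2: "arc_homotopic (?f \<circ> linepath (0, k) h)"
      proof (cases "(1, k) \<in> ?S")
        case True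
        have p: "pathin XU (?f \<circ> linepath (0, k) (1, k))"
          using seg[OF k0 True] by (intro pathin_o[OF cont]) auto
        have eq: "?f \<circ> linepath (0, k) (1, k) = (\<lambda>t. ?f (t, k))"
          by (simp add: fun_eq_iff linepath_def algebra_simps)
        have "(\<lambda>t. ?f (t, k)) \<in> arcs T"
        proof (cases "bdry T f = []")
          case True
          then show ?thesis using arc_base[OF f(1)] f(2) by (simp add: k_def sectors_def)
        next
          case False
          then show ?thesis using arc_face[OF f(1) bdry_nth(1)[OF f False]] by (simp add: k_def)
        qed
        moreover have "(\<lambda>t. ?f (t, k)) ` {0..1} \<subseteq> U" using pathin_U[OF p] unfolding eq .
        ultimately have "?f \<circ> linepath (0, k) (1, k) \<in> arc_paths T U" using eq arc_paths.arc by simp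
        then show ?thesis using True hp_refl[OF p] unfolding h_def arc_homotopic_def by auto
      next
        case False
        then have h: "h = (0, k)" by (simp only: h_def if_False)
        have "?f \<circ> linepath (0, k) h = (\<lambda>_. FacePt f 0)"
          unfolding h linepath_refl by (simp add: fun_eq_iff)
        then show ?thesis using c0 arc_homotopic_const by simp
      qed
      have "arc_homotopic (?f \<circ> (linepath z (0, k) +++ linepath (0, k) h))"
        unfolding join_o[symmetric] using 1 2 by (intro arc_homotopic_join) (simp_all add: linepath_def)
      moreover have "path_image (linepath z (0, k) +++ linepath (0, k) h) \<subseteq> ?S"
        using seg[OF zS k0] seg[OF k0 hS] by (intro subset_path_image_join)
      ultimately show ?thesis
        by (intro exI[of _ "linepath z (0, k) +++ linepath (0, k) h"] conjI path_join_imp)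
          (simp_all add: joinpaths_def linepath_0' linepath_1')
    next
      case r1: True
      have rim: "?f (1, b) = (if bdry T f = [] then VertexPt (base T f) else letter_map T (bdry T f ! i) b)"
        if "b \<in> {0..1}" for b using sector_rim[OF f] that by simp
      show ?thesis
      proof (cases "bdry T f = []")
        case True
        then have bU: "VertexPt (base T f) \<in> U" using zS za r1 rim[of a] by simp
        then have "(1, k) \<in> ?S" using rim[of k] k True by simp
        then have h: "h = (1, k)" by (simp add: h_def)
        have p: "pathin XU (?f \<circ> linepath z h)" using seg[OF zS hS] by (intro pathin_o[OF cont]) auto
        have "hp XU (?f \<circ> linepath z h) (\<lambda>_. VertexPt (base T f))"
        proof (rule hp_cong[OF p])
          fix t :: real assume "t \<in> {0..1}"
          then have "(1 - t) * a + t * k \<in> {0..1}" using convexD[of "{0..1}" a k "1 - t" t] za k by auto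
          then show "(?f \<circ> linepath z h) t = VertexPt (base T f)"
            using rim[of "(1 - t) * a + t * k"] True za r1 h by (simp add: linepath_def algebra_simps)
        qed
        then have "arc_homotopic (?f \<circ> linepath z h)"
          by (rule arc_homotopic_hp) (use bU in \<open>auto simp: nodes_def intro!: arc_homotopic_const\<close>)
        then show ?thesis by (intro ex_linepath seg zS hS)
      next
        case False
        let ?l = "bdry T f ! i"
        let ?e = "fst ?l" and ?s = "\<lambda>b. if snd ?l then b else 1 - b :: real"
        note e = bdry_nth(2)[OF f False]
        have k2: "k = 1/2" using False by (simp add: k_def)
        have rim': "?f (1, b) = edge_map T ?e (?s b)" if "b \<in> {0..1}" for b
          using rim[OF that] False by (simp add: letter_map_def)
        have sa: "?s a \<in> edge_dom ?e" "edge_map T ?e (?s a) \<in> nodes T"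
          using zS zn za r1 rim'[of a] by auto
        have "?e \<notin> E" using sa edge_U[OF e] by blast
        moreover have "?s k = 1/2" using k2 by simp
        then have "?f (1, k) = EdgePt ?e (1/2)" using rim'[OF k] by simp
        ultimately have "(1, k) \<in> ?S" using k e by simp
        then have h: "h = (1, k)" by (simp add: h_def)
        have p: "pathin XU (?f \<circ> linepath z h)" using seg[OF zS hS] by (intro pathin_o[OF cont]) auto
        have "hp XU (?f \<circ> linepath z h) (edge_map T ?e \<circ> linepath (?s a) (1/2))"
        proof (rule hp_cong[OF p])
          fix t :: real assume "t \<in> {0..1}"
          then have "(1 - t) * a + t * k \<in> {0..1}" using convexD[of "{0..1}" a k "1 - t" t] za k by auto
          moreover have "?s ((1 - t) * a + t * k) = linepath (?s a) (1/2) t"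
            using k2 by (simp add: linepath_def field_simps)
          moreover have "linepath z h t = (1, (1 - t) * a + t * k)"
            using za r1 h by (simp add: linepath_def algebra_simps)
          ultimately show "(?f \<circ> linepath z h) t = (edge_map T ?e \<circ> linepath (?s a) (1/2)) t"
            using rim' by (simp only: o_apply)
        qed
        then have "arc_homotopic (?f \<circ> linepath z h)"
          using edge_end(2)[OF e sa] by (rule arc_homotopic_hp)
        then show ?thesis by (intro ex_linepath seg zS hS)
      qed
    qed
  qed
qed

end

section \<open>Contraction of paths in the complement to the centres of cells\<close>

context complement begin

lemma deform_0:
  assumes "x \<in> cells" and \<Phi>: "reparam \<Phi>" and \<Psi>: "reparam \<Psi>" and odd: "\<And>u t. \<Psi> u (1 - t) = 1 - \<Psi> u t"
  shows "deform T \<Phi> \<Psi> (x, 0) = x"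
proof -
  have id: "\<Phi> 0 t = t" "\<Psi> 0 t = t" for t using \<Phi> \<Psi> by (simp_all add: reparam_def)
  show ?thesis
    using assms(1)
  proof (cases rule: cells_cases)
    case (2 e t)
    then show ?thesis using deform_edge[OF \<Psi>, of t 0] id by simp
  next
    case (3 f i \<rho> a)
    then show ?thesis using deform_sector[OF 3(1,2) _ _ _ \<Phi> \<Psi> odd, of \<rho> a 0] id by simp
  qed simp
qed

definition track :: "real \<Rightarrow> ('v, 'e, 'f) point \<Rightarrow> ('v, 'e, 'f) point \<Rightarrow> real \<Rightarrow> ('v, 'e, 'f) point" where
  "track \<delta> \<sigma> x = (\<lambda>u. contraction T \<delta> \<sigma> (x, u))"

definition centre :: "real \<Rightarrow> ('v, 'e, 'f) point \<Rightarrow> bool" where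
  "centre \<delta> \<sigma> \<longleftrightarrow> \<sigma> \<in> nodes T \<and> \<sigma> \<in> U \<and> 0 < \<delta> \<and> \<delta> < 1/2"

lemma ex_centre:
  assumes "x \<in> U" shows "\<exists>\<delta> \<sigma>. centre \<delta> \<sigma> \<and> x \<in> nbhd T \<delta> \<sigma>"
proof -
  have "x \<in> cells" using assms by (simp add: U_def)
  then obtain \<sigma> \<delta> where s: "\<sigma> \<in> nodes T" "0 < \<delta>" "\<delta> < 1/2" "x \<in> nbhd T \<delta> \<sigma>"
    "(\<exists>v. \<sigma> = VertexPt v \<and> x = \<sigma>) \<or> (\<exists>e t. \<sigma> = EdgePt e (1/2) \<and> x = EdgePt e t) \<or>
     (\<exists>f z. \<sigma> = FacePt f 0 \<and> x = FacePt f z)" using node_in_nbhd by blast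
  then have "\<sigma> \<in> U" using assms by auto
  then show ?thesis using s unfolding centre_def by (intro exI[of _ \<delta>] exI[of _ \<sigma>] conjI)
qed

lemma continuous_contraction:
  assumes "0 < \<delta>" "\<delta> < 1/2"
  shows "continuous_map (prod_topology (realization T) (top_of_set {0..1})) (realization T) (contraction T \<delta> \<sigma>)"
  by (rule continuous_deform[OF reparam_rad[OF assms] reparam_ang[OF assms] ang_odd[OF assms]])

lemma contraction_U:
  assumes c: "centre \<delta> \<sigma>" and x: "x \<in> nbhd T \<delta> \<sigma>"
  shows "x \<in> U" "contraction T \<delta> \<sigma> (x, 0) = x" "contraction T \<delta> \<sigma> (x, 1) = \<sigma>"
    "u \<in> {0..1} \<Longrightarrow> contraction T \<delta> \<sigma> (x, u) \<in> U"
proof -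
  have s: "\<sigma> \<in> nodes T" "\<sigma> \<in> U" and d: "0 < \<delta>" "\<delta> < 1/2" using c by (auto simp: centre_def)
  note n = nbhd_U[OF s d] contraction_nbhd[OF s(1) d x]
  show xU: "x \<in> U" using n x by blast
  then show "contraction T \<delta> \<sigma> (x, 0) = x"
    by (intro deform_0 reparam_rad reparam_ang ang_odd d) (simp add: U_def)
  show "contraction T \<delta> \<sigma> (x, 1) = \<sigma>" using n(2)[of 1] by simp
  show "contraction T \<delta> \<sigma> (x, u) \<in> U" if "u \<in> {0..1}" using n(1) n(2)[OF that] by blast
qed

lemma track:
  assumes c: "centre \<delta> \<sigma>" and x: "x \<in> nbhd T \<delta> \<sigma>"
  shows "track \<delta> \<sigma> x 0 = x" "track \<delta> \<sigma> x 1 = \<sigma>" "pathin XU (track \<delta> \<sigma> x)"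
proof -
  have d: "0 < \<delta>" "\<delta> < 1/2" using c by (auto simp: centre_def)
  note U = contraction_U[OF c x]
  show "track \<delta> \<sigma> x 0 = x" "track \<delta> \<sigma> x 1 = \<sigma>" using U by (simp_all add: track_def)
  have "continuous_map (top_of_set {0..1}) (prod_topology (realization T) (top_of_set {0..1})) (\<lambda>u. (x, u))"
    using U(1) by (auto simp: continuous_map_pairedI topspace_realization U_def)
  from continuous_map_compose[OF this continuous_contraction[OF d]]
  have "continuous_map (top_of_set {0..1}) (realization T) (track \<delta> \<sigma> x)"
    by (simp add: o_def track_def)
  moreover have "track \<delta> \<sigma> x ` {0..1} \<subseteq> U" using U(4) by (auto simp: track_def)
  ultimately show "pathin XU (track \<delta> \<sigma> x)"
    unfolding pathin_def by (auto simp: continuous_map_in_subtopology U_def)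
qed

lemma path_reparam: "reparam \<Psi> \<Longrightarrow> t \<in> {0..1} \<Longrightarrow> path (\<lambda>u. \<Psi> u t)"
  unfolding path_def reparam_def
  by (elim conjE, rule continuous_on_compose2[where f = "\<lambda>u. (u, t)" and g = "\<lambda>v. \<Psi> (fst v) (snd v)", simplified])
    (auto intro!: continuous_intros)

text \<open>All contractions of \<open>x\<close>, towards whatever centre, run in the chart of the
  cell that contains \<open>x\<close> and start at the same parameter \<open>v0\<close>, so two of
  them can be compared in one chart. The charts of vertices and edges are embedded in the plane to
  give all three cases the same type.\<close>

lemma chart_at:
  assumes "x \<in> U"
  obtains S :: "(real \<times> real) set" and f v0 where "continuous_map (top_of_set S) XU f"
    "\<And>\<alpha>. path \<alpha> \<Longrightarrow> path_image \<alpha> \<subseteq> S \<Longrightarrow> f (\<alpha> 0) \<in> nodes T \<Longrightarrow> f (\<alpha> 1) \<in> nodes T \<Longrightarrow> arc_homotopic (f \<circ> \<alpha>)"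
    "\<And>\<delta> \<sigma>. centre \<delta> \<sigma> \<Longrightarrow> x \<in> nbhd T \<delta> \<sigma> \<Longrightarrow>
      \<exists>\<alpha>. path \<alpha> \<and> path_image \<alpha> \<subseteq> S \<and> \<alpha> 0 = v0 \<and> (\<forall>u\<in>{0..1}. track \<delta> \<sigma> x u = f (\<alpha> u))"
proof -
  have id: "rad \<delta> \<sigma> 0 t = t" "ang \<delta> \<sigma> 0 t = t" if "centre \<delta> \<sigma>" for \<delta> \<sigma> t
    using reparam_rad[of \<delta> \<sigma>] reparam_ang[of \<delta> \<sigma>] that by (auto simp: centre_def reparam_def)
  have "x \<in> cells" using assms by (simp add: U_def)
  then show ?thesis
  proof (cases rule: cells_cases)
    case (1 v)
    show ?thesis
    proof (rule that[of "{(0, 0)}" "\<lambda>_. x" "(0, 0)"])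
      show "continuous_map (top_of_set {(0, 0)}) XU (\<lambda>_. x)"
        using assms unfolding continuous_map_const topspace_XU by simp
      show "arc_homotopic ((\<lambda>_. x) \<circ> \<alpha>)" if "x \<in> nodes T" for \<alpha> :: "real \<Rightarrow> real \<times> real"
        using arc_homotopic_const[OF that assms] by (simp add: o_def)
      fix \<delta> \<sigma>
      have "path (\<lambda>_::real. (0::real, 0::real))" by (simp add: path_def)
      then show "\<exists>\<alpha>. path \<alpha> \<and> path_image \<alpha> \<subseteq> {(0::real, 0::real)} \<and> \<alpha> 0 = (0, 0) \<and>
          (\<forall>u\<in>{0..1}. track \<delta> \<sigma> x u = x)"
        using 1 by (intro exI[of _ "\<lambda>_. (0, 0)"] conjI) (auto simp: track_def path_image_def)
    qed
  next
    case (2 e t)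
    let ?S = "(\<lambda>s. (0::real, s)) ` edge_dom e" and ?f = "\<lambda>v::real \<times> real. edge_map T e (snd v)"
    show ?thesis
    proof (rule that[of ?S ?f "(0, t)"])
      have "continuous_map (top_of_set ?S) (top_of_set (edge_dom e)) snd" by (auto intro!: continuous_intros)
      from continuous_map_compose[OF this continuous_edge_dom[OF 2(1)]]
      show "continuous_map (top_of_set ?S) XU ?f" by (simp add: o_def)
      show "arc_homotopic (?f \<circ> \<alpha>)" if "path \<alpha>" "path_image \<alpha> \<subseteq> ?S" "?f (\<alpha> 0) \<in> nodes T" "?f (\<alpha> 1) \<in> nodes T" for \<alpha>
      proof -
        have "path (snd \<circ> \<alpha>)" using that(1) by (intro path_continuous_image continuous_intros)
        moreover have "path_image (snd \<circ> \<alpha>) \<subseteq> edge_dom e" using that(2) by (auto simp: path_image_def)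
        ultimately have "arc_homotopic (edge_map T e \<circ> (snd \<circ> \<alpha>))" using that(3,4) by (intro edge_link[OF 2(1)]) auto
        then show ?thesis by (simp add: o_def)
      qed
      fix \<delta> \<sigma> assume c: "centre \<delta> \<sigma>" and x: "x \<in> nbhd T \<delta> \<sigma>"
      let ?\<alpha> = "\<lambda>u. (0::real, ang \<delta> \<sigma> u t)"
      have r: "reparam (ang \<delta> \<sigma>)" using c by (intro reparam_ang) (auto simp: centre_def)
      have t01: "t \<in> {0..1}" using 2 by auto
      have tr: "track \<delta> \<sigma> x u = edge_map T e (ang \<delta> \<sigma> u t)" if "u \<in> {0..1}" for u
        unfolding track_def 2(3) by (rule deform_edge[OF r t01 that])
      have "ang \<delta> \<sigma> u t \<in> edge_dom e" if "u \<in> {0..1}" for u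
        using tr[OF that] contraction_U(4)[OF c x that] r t01 that by (auto simp: track_def reparam_def)
      then have "path_image ?\<alpha> \<subseteq> ?S" by (auto simp: path_image_def)
      moreover have "path ?\<alpha>" using path_reparam[OF r t01] unfolding path_def by (intro continuous_intros)
      ultimately show "\<exists>\<alpha>. path \<alpha> \<and> path_image \<alpha> \<subseteq> ?S \<and> \<alpha> 0 = (0, t) \<and> (\<forall>u\<in>{0..1}. track \<delta> \<sigma> x u = ?f (\<alpha> u))"
        using tr id[OF c] by (intro exI[of _ ?\<alpha>] conjI) auto
    qed
  next
    case (3 f i \<rho> a)
    show ?thesis
    proof (rule that[of "sector_dom f i" "sector T f i" "(\<rho>, a)", OF continuous_sector_dom[OF 3(1,2)] sector_link[OF 3(1,2)]])
      fix \<delta> \<sigma> assume c: "centre \<delta> \<sigma>" and x: "x \<in> nbhd T \<delta> \<sigma>"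
      let ?\<alpha> = "\<lambda>u. (rad \<delta> \<sigma> u \<rho>, ang \<delta> \<sigma> u a)"
      have d: "0 < \<delta>" "\<delta> < 1/2" using c by (auto simp: centre_def)
      note r = reparam_rad[OF d, of \<sigma>] reparam_ang[OF d, of \<sigma>]
      have t01: "\<rho> \<in> {0..1}" "a \<in> {0..1}" using 3 by auto
      have tr: "track \<delta> \<sigma> x u = sector T f i (?\<alpha> u)" if "u \<in> {0..1}" for u
        unfolding track_def 3(5) by (rule deform_sector[OF 3(1,2) t01 that r ang_odd[OF d]])
      have "?\<alpha> u \<in> sector_dom f i" if "u \<in> {0..1}" for u
      proof -
        have "?\<alpha> u \<in> sq" using r t01 that by (auto simp: reparam_def)
        moreover have "sector T f i (?\<alpha> u) \<in> U" using tr[OF that] contraction_U(4)[OF c x that] by (simp add: track_def)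
        ultimately show ?thesis by blast
      qed
      then have "path_image ?\<alpha> \<subseteq> sector_dom f i" unfolding path_image_def by blast
      moreover have "path ?\<alpha>" using path_reparam[OF r(1) t01(1)] path_reparam[OF r(2) t01(2)]
        unfolding path_def by (intro continuous_intros)
      ultimately show "\<exists>\<alpha>. path \<alpha> \<and> path_image \<alpha> \<subseteq> sector_dom f i \<and> \<alpha> 0 = (\<rho>, a) \<and>
          (\<forall>u\<in>{0..1}. track \<delta> \<sigma> x u = sector T f i (\<alpha> u))"
        using tr id[OF c] by (intro exI[of _ ?\<alpha>] conjI) auto
    qed
  qed
qed

lemma track_node:
  assumes c: "centre \<delta> \<sigma>" and x: "x \<in> nbhd T \<delta> \<sigma>" "x \<in> nodes T"
  shows "arc_homotopic (track \<delta> \<sigma> x)"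
proof -
  note tr = track[OF c x(1)]
  obtain S :: "(real \<times> real) set" and f v0 where S: "continuous_map (top_of_set S) XU f"
    "\<And>\<alpha>. path \<alpha> \<Longrightarrow> path_image \<alpha> \<subseteq> S \<Longrightarrow> f (\<alpha> 0) \<in> nodes T \<Longrightarrow> f (\<alpha> 1) \<in> nodes T \<Longrightarrow> arc_homotopic (f \<circ> \<alpha>)"
    "\<And>\<delta> \<sigma>. centre \<delta> \<sigma> \<Longrightarrow> x \<in> nbhd T \<delta> \<sigma> \<Longrightarrow>
      \<exists>\<alpha>. path \<alpha> \<and> path_image \<alpha> \<subseteq> S \<and> \<alpha> 0 = v0 \<and> (\<forall>u\<in>{0..1}. track \<delta> \<sigma> x u = f (\<alpha> u))"
    by (rule chart_at[OF contraction_U(1)[OF c x(1)]]) (rule that; assumption)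
  from S(3)[OF c x(1)] obtain \<alpha> where \<alpha>: "path \<alpha>" "path_image \<alpha> \<subseteq> S" "\<forall>u\<in>{0..1}. track \<delta> \<sigma> x u = f (\<alpha> u)"
    by (elim exE conjE)
  have "hp XU (track \<delta> \<sigma> x) (f \<circ> \<alpha>)" using \<alpha>(3) by (intro hp_cong tr) simp
  moreover have "f (\<alpha> 0) = x" "f (\<alpha> 1) = \<sigma>" using \<alpha>(3) tr by force+
  then have "arc_homotopic (f \<circ> \<alpha>)" using c x(2) \<alpha> by (intro S(2)) (simp_all add: centre_def)
  ultimately show ?thesis by (rule arc_homotopic_hp)
qed

text \<open>Changing the centre at \<open>x\<close> costs a path between two centres that lies in a
  single chart, namely one track backwards and the other forwards.\<close>

lemma track_link:
  assumes c: "centre \<delta> \<sigma>" "centre \<epsilon> \<tau>" and x: "x \<in> nbhd T \<delta> \<sigma>" "x \<in> nbhd T \<epsilon> \<tau>"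
  shows "arc_homotopic (join_loops (rv (track \<delta> \<sigma> x)) (track \<epsilon> \<tau> x))"
proof -
  note tr = track[OF c(1) x(1)] track[OF c(2) x(2)]
  obtain S :: "(real \<times> real) set" and f v0 where S: "continuous_map (top_of_set S) XU f"
    "\<And>\<alpha>. path \<alpha> \<Longrightarrow> path_image \<alpha> \<subseteq> S \<Longrightarrow> f (\<alpha> 0) \<in> nodes T \<Longrightarrow> f (\<alpha> 1) \<in> nodes T \<Longrightarrow> arc_homotopic (f \<circ> \<alpha>)"
    "\<And>\<delta> \<sigma>. centre \<delta> \<sigma> \<Longrightarrow> x \<in> nbhd T \<delta> \<sigma> \<Longrightarrow>
      \<exists>\<alpha>. path \<alpha> \<and> path_image \<alpha> \<subseteq> S \<and> \<alpha> 0 = v0 \<and> (\<forall>u\<in>{0..1}. track \<delta> \<sigma> x u = f (\<alpha> u))"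
    by (rule chart_at[OF contraction_U(1)[OF c(1) x(1)]]) (rule that; assumption)
  from S(3)[OF c(1) x(1)] obtain \<alpha> where \<alpha>: "path \<alpha>" "path_image \<alpha> \<subseteq> S" "\<alpha> 0 = v0"
    "\<forall>u\<in>{0..1}. track \<delta> \<sigma> x u = f (\<alpha> u)" by (elim exE conjE)
  from S(3)[OF c(2) x(2)] obtain \<beta> where \<beta>: "path \<beta>" "path_image \<beta> \<subseteq> S" "\<beta> 0 = v0"
    "\<forall>u\<in>{0..1}. track \<epsilon> \<tau> x u = f (\<beta> u)" by (elim exE conjE)
  let ?\<gamma> = "reversepath \<alpha> +++ \<beta>"
  have eq: "join_loops (rv (track \<delta> \<sigma> x)) (track \<epsilon> \<tau> x) t = (f \<circ> ?\<gamma>) t" if "t \<in> {0..1}" for t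
    using that \<alpha>(4) \<beta>(4) by (simp add: join_loops_def joinpaths_def rv_def reversepath_def)
  have "hp XU (join_loops (rv (track \<delta> \<sigma> x)) (track \<epsilon> \<tau> x)) (f \<circ> ?\<gamma>)"
    using eq tr by (intro hp_cong pathin_join pathin_rv) simp_all
  moreover have "arc_homotopic (f \<circ> ?\<gamma>)"
  proof (rule S(2))
    have "pathfinish (reversepath \<alpha>) = pathstart \<beta>"
      using \<alpha> \<beta> by (simp add: pathfinish_def pathstart_def reversepath_def)
    then show "path ?\<gamma>" using \<alpha> \<beta> by (simp only: path_join_imp path_reversepath)
    show "path_image ?\<gamma> \<subseteq> S" using \<alpha> \<beta> by (intro subset_path_image_join) auto
    have "f (?\<gamma> 0) = \<sigma>" "f (?\<gamma> 1) = \<tau>" using eq[of 0] eq[of 1] tr by simp_all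
    then show "f (?\<gamma> 0) \<in> nodes T" "f (?\<gamma> 1) \<in> nodes T" using c by (simp_all add: centre_def)
  qed
  ultimately show ?thesis by (rule arc_homotopic_hp)
qed

text \<open>Applying the contraction along \<open>q\<close> maps a square into the complement: one
  side is \<open>q\<close>, the adjacent sides are the two tracks, and the opposite side collapses
  to \<sigma>.\<close>

lemma sweep:
  assumes c: "centre \<delta> \<sigma>" and q: "pathin XU q" and im: "\<And>s. s \<in> {0..1} \<Longrightarrow> q s \<in> nbhd T \<delta> \<sigma>"
  shows "hp XU q (join_loops (track \<delta> \<sigma> (q 0)) (rv (track \<delta> \<sigma> (q 1))))"
proof -
  have d: "0 < \<delta>" "\<delta> < 1/2" and s: "\<sigma> \<in> U" using c by (auto simp: centre_def)
  let ?H = "\<lambda>v. contraction T \<delta> \<sigma> (q (fst v), snd v)"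
  have qR: "continuous_map (top_of_set {0..1}) (realization T) q"
    using q unfolding pathin_def by (simp add: continuous_map_in_subtopology)
  have "continuous_map (prod_topology (top_of_set {0..1}) (top_of_set {0..1})) (realization T) (\<lambda>v. q (fst v))"
    using continuous_map_compose[OF continuous_map_fst qR] by (simp only: o_def)
  from continuous_map_pairedI[OF this continuous_map_snd]
  have "continuous_map (prod_topology (top_of_set {0..1}) (top_of_set {0..1}))
      (prod_topology (realization T) (top_of_set {0..1})) (\<lambda>v. (q (fst v), snd v))" .
  from continuous_map_compose[OF this continuous_contraction[OF d]]
  have "continuous_map (top_of_set sq) (realization T) ?H"
    by (simp add: o_def prod_topology_subtopology_eu)
  moreover have HU: "?H v \<in> U" if "v \<in> sq" for v
    using contraction_U(4)[OF c im, of "fst v" "snd v"] that by auto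
  ultimately have H: "continuous_map (top_of_set sq) XU ?H"
    by (intro continuous_map_into_subtopology) (auto simp: U_def)
  let ?b = "linepath (0, 0) (0, 1) +++ linepath (0, 1) (1, 1) +++ linepath (1, 1) (1, 0::real) :: real \<Rightarrow> real \<times> real"
  have cs: "convex sq" by (intro convex_Times) auto
  have im_l: "path_image (linepath v w) \<subseteq> sq" if "v \<in> sq" "w \<in> sq" for v w
    using that cs by (simp only: path_image_linepath closed_segment_subset)
  have im_b: "path_image ?b \<subseteq> sq" by (intro subset_path_image_join im_l) auto
  have pb: "path ?b" by (intro path_join_imp) auto
  note tr = track[OF c im[of 0]] track[OF c im[of 1]]
  have "hp XU q (?H \<circ> linepath (0, 0) (1, 0))"
    using contraction_U(2)[OF c im] by (intro hp_cong[OF q]) (simp add: linepath_def)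
  also have "hp XU \<dots> (?H \<circ> ?b)"
    by (rule hp_convex[OF H cs _ im_l pb im_b]) (simp_all add: joinpaths_def linepath_0' linepath_1')
  also have "?H \<circ> ?b = join_loops (track \<delta> \<sigma> (q 0)) (join_loops (?H \<circ> linepath (0, 1) (1, 1)) (rv (track \<delta> \<sigma> (q 1))))"
    unfolding join_o[symmetric] by (auto simp: join_loops_def track_def rv_def linepath_def fun_eq_iff algebra_simps)
  also have "hp XU \<dots> (join_loops (track \<delta> \<sigma> (q 0)) (join_loops (\<lambda>_. \<sigma>) (rv (track \<delta> \<sigma> (q 1)))))"
  proof (intro hp_join hp_refl)
    show "hp XU (?H \<circ> linepath (0, 1) (1, 1)) (\<lambda>_. \<sigma>)"
      by (rule hp_cong[OF pathin_o[OF H path_linepath im_l]])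
        (use contraction_U(3)[OF c im] in \<open>simp_all add: linepath_def algebra_simps\<close>)
  qed (use tr contraction_U(3)[OF c im] in \<open>auto intro: pathin_rv simp: linepath_0' linepath_1'\<close>)
  also have "hp XU \<dots> (join_loops (track \<delta> \<sigma> (q 0)) (rv (track \<delta> \<sigma> (q 1))))"
    using tr by (intro hp_join hp_refl hp_lunit pathin_rv) auto
  finally show ?thesis .
qed

text \<open>A Lebesgue number for the cover of the unit interval by the preimages of the
  neighbourhoods gives the mesh.\<close>

lemma subdivision:
  assumes p: "pathin XU p"
  obtains N :: nat where "0 < N" "\<And>k. k < N \<Longrightarrow>
    \<exists>\<delta> \<sigma>. centre \<delta> \<sigma> \<and> (\<forall>s\<in>{real k / real N..real (Suc k) / real N}. p s \<in> nbhd T \<delta> \<sigma>)"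
proof -
  define C where "C = {B. open B \<and> (\<exists>\<delta> \<sigma>. centre \<delta> \<sigma> \<and> (\<forall>s\<in>{0..1} \<inter> B. p s \<in> nbhd T \<delta> \<sigma>))}"
  have pR: "continuous_map (top_of_set {0..1}) (realization T) p"
    using p unfolding pathin_def by (simp add: continuous_map_in_subtopology)
  have cov: "\<exists>B\<in>C. t \<in> B" if "t \<in> {0..1}" for t
  proof -
    have "p t \<in> U" using pathin_U[OF p] that by blast
    then obtain \<delta> \<sigma> where c: "centre \<delta> \<sigma>" "p t \<in> nbhd T \<delta> \<sigma>" using ex_centre by blast
    then have "openin (realization T) (nbhd T \<delta> \<sigma>)" by (intro openin_nbhd) (auto simp: centre_def)
    from openin_continuous_map_preimage[OF pR this]
    have "openin (top_of_set {0..1}) {s \<in> {0..1}. p s \<in> nbhd T \<delta> \<sigma>}" by simp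
    then obtain B where B: "open B" "{s \<in> {0..1}. p s \<in> nbhd T \<delta> \<sigma>} = {0..1} \<inter> B"
      by (auto simp: openin_open)
    then have "\<forall>s\<in>{0..1} \<inter> B. p s \<in> nbhd T \<delta> \<sigma>" by blast
    moreover have "t \<in> B" using B(2) c(2) that by blast
    ultimately show ?thesis using B(1) c(1) unfolding C_def by blast
  qed
  obtain B0 where "B0 \<in> C" using cov[of 0] by auto
  then have C1: "C \<noteq> {}" by blast
  have C2: "{0..1} \<subseteq> \<Union>C" using cov by blast
  have C3: "open B" if "B \<in> C" for B using that by (simp add: C_def)
  obtain \<eta> where \<eta>: "0 < \<eta>" "\<And>S. S \<subseteq> {0..1::real} \<Longrightarrow> diameter S < \<eta> \<Longrightarrow> \<exists>B\<in>C. S \<subseteq> B"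
    by (rule Lebesgue_number_lemma[OF compact_Icc C1 C2])
      (rule C3, assumption, rule that, assumption, assumption)
  obtain N :: nat where N: "0 < N" "1 / real N < \<eta>"
    using \<eta>(1) by (metis nat_approx_posE zero_less_Suc)
  show ?thesis
  proof (rule that[OF N(1)])
    fix k assume k: "k < N"
    let ?S = "{real k / real N..real (Suc k) / real N}"
    have "real (Suc k) / real N \<le> 1" "real k / real N \<le> real (Suc k) / real N"
      using k by (simp_all add: divide_le_eq divide_right_mono)
    then have S: "?S \<subseteq> {0..1}" "diameter ?S = 1 / real N"
      by (auto simp: diff_divide_distrib[symmetric] intro: order_trans)
    obtain B where B: "B \<in> C" "?S \<subseteq> B" using \<eta>(2)[of ?S] S N(2) by auto
    then obtain \<delta> \<sigma> where c: "centre \<delta> \<sigma>" "\<forall>s\<in>{0..1} \<inter> B. p s \<in> nbhd T \<delta> \<sigma>" unfolding C_def by blast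
    then have "\<forall>s\<in>?S. p s \<in> nbhd T \<delta> \<sigma>" using B(2) S(1) by blast
    then show "\<exists>\<delta> \<sigma>. centre \<delta> \<sigma> \<and> (\<forall>s\<in>?S. p s \<in> nbhd T \<delta> \<sigma>)" using c(1) by blast
  qed
qed

text \<open>Induction along a subdivision. The claim is made for all centres whose neighbourhood
  contains the current point, because the next segment may have to be contracted to a different
  centre; \<open>track_link\<close> performs the change.\<close>

lemma arc_homotopic_track:
  assumes p: "pathin XU p" "p 0 \<in> nodes T" and c: "centre \<delta> \<sigma>" "p 1 \<in> nbhd T \<delta> \<sigma>"
  shows "arc_homotopic (join_loops p (track \<delta> \<sigma> (p 1)))"
proof -
  note of_nat_Suc [simp del]
  have pc: "continuous_map (top_of_set {0..1}) XU p" using p(1) by (simp add: pathin_def)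
  obtain N :: nat where N: "0 < N" "\<And>k. k < N \<Longrightarrow>
    \<exists>\<delta> \<sigma>. centre \<delta> \<sigma> \<and> (\<forall>s\<in>{real k / real N..real (Suc k) / real N}. p s \<in> nbhd T \<delta> \<sigma>)"
    using subdivision[OF p(1)] by blast
  define pre where "pre k = p \<circ> linepath 0 (real k / real N)" for k
  have seg: "path_image (linepath a b) \<subseteq> {0..1}" if "a \<in> {0..1}" "b \<in> {0..1}" for a b :: real
    using that by (simp only: path_image_linepath closed_segment_subset convex_real_interval)
  have k01: "real k / real N \<in> {0..1}" if "k \<le> N" for k using that N(1) by (simp add: divide_le_eq)
  have pre: "pathin XU (pre k)" "pre k 0 = p 0" "pre k 1 = p (real k / real N)" if "k \<le> N" for k
    unfolding pre_def using seg[of 0, OF _ k01[OF that]]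
    by (auto intro!: pathin_o[OF pc] simp: linepath_0' linepath_1')
  have "\<forall>\<delta> \<sigma>. centre \<delta> \<sigma> \<longrightarrow> pre k 1 \<in> nbhd T \<delta> \<sigma> \<longrightarrow> arc_homotopic (join_loops (pre k) (track \<delta> \<sigma> (pre k 1)))"
    if "k \<le> N" for k
    using that
  proof (induction k)
    case 0
    have eq: "pre 0 = (\<lambda>_. p 0)" by (simp add: pre_def linepath_def fun_eq_iff)
    show ?case
    proof (intro allI impI)
      fix \<delta> \<sigma> assume c: "centre \<delta> \<sigma>" "pre 0 1 \<in> nbhd T \<delta> \<sigma>"
      then have x: "p 0 \<in> nbhd T \<delta> \<sigma>" by (simp add: eq)
      have "hp XU (join_loops (\<lambda>_. p 0) (track \<delta> \<sigma> (p 0))) (track \<delta> \<sigma> (p 0))"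
        using track[OF c(1) x] by (intro hp_lunit) auto
      then show "arc_homotopic (join_loops (pre 0) (track \<delta> \<sigma> (pre 0 1)))"
        unfolding eq using track_node[OF c(1) x p(2)] by (rule arc_homotopic_hp)
    qed
  next
    case (Suc k)
    let ?a = "real k / real N" and ?b = "real (Suc k) / real N"
    obtain \<epsilon> \<tau> where t: "centre \<epsilon> \<tau>" "\<forall>s\<in>{?a..?b}. p s \<in> nbhd T \<epsilon> \<tau>" using N(2)[of k] Suc(2) by auto
    have ab: "?a \<in> {0..1}" "?b \<in> {0..1}" "?a \<le> ?b" using k01[of k] k01[of "Suc k"] Suc(2) by (auto simp: divide_right_mono)
    define r where "r = p \<circ> linepath ?a ?b"
    have r: "pathin XU r" "r 0 = pre k 1" "r 1 = pre (Suc k) 1"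
      unfolding r_def using seg[OF ab(1,2)] pre(3)[of k] pre(3)[of "Suc k"] Suc(2)
      by (auto intro!: pathin_o[OF pc] simp: linepath_0' linepath_1' simp del: of_nat_Suc)
    have rn: "r s \<in> nbhd T \<epsilon> \<tau>" if "s \<in> {0..1}" for s
    proof -
      have "linepath ?a ?b s \<in> closed_segment ?a ?b" using that linepath_in_path by blast
      then have "linepath ?a ?b s \<in> {?a..?b}" using ab(3) closed_segment_eq_real_ivl[of ?a ?b] by (simp del: of_nat_Suc)
      then show ?thesis using t(2) by (simp add: r_def)
    qed
    have pj: "path (linepath 0 ?a +++ linepath ?a ?b)" by (intro path_join_imp) auto
    have split: "hp XU (pre (Suc k)) (join_loops (pre k) r)"
      unfolding pre_def r_def join_o
    proof (rule hp_convex[OF pc])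
      show "path_image (linepath 0 ?a +++ linepath ?a ?b) \<subseteq> {0..1}"
        using seg ab by (intro subset_path_image_join) auto
    qed (use seg[of 0, OF _ ab(2)] pj in \<open>simp_all add: linepath_0' linepath_1' joinpaths_def del: path_image_linepath\<close>)
    show ?case
    proof (intro allI impI)
      fix \<delta> \<sigma> assume c: "centre \<delta> \<sigma>" "pre (Suc k) 1 \<in> nbhd T \<delta> \<sigma>"
      let ?x = "pre (Suc k) 1"
      have xt: "?x \<in> nbhd T \<epsilon> \<tau>" "pre k 1 \<in> nbhd T \<epsilon> \<tau>" using rn[of 1] rn[of 0] r by simp_all
      let ?A = "track \<epsilon> \<tau> (pre k 1)" and ?B = "track \<epsilon> \<tau> ?x" and ?C = "track \<delta> \<sigma> ?x"
      note A = track[OF t(1) xt(2)] and B = track[OF t(1) xt(1)] and C = track[OF c]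
      note q = pre(1,2)[of k]
      have "hp XU (join_loops (pre (Suc k)) ?C) (join_loops (join_loops (pre k) r) ?C)"
        using split C by (intro hp_join hp_refl) simp_all
      also have "hp XU \<dots> (join_loops (join_loops (pre k) (join_loops ?A (rv ?B))) ?C)"
        using sweep[OF t(1) r(1) rn] r C q Suc(2) by (intro hp_join hp_refl) simp_all
      also have "hp XU \<dots> (join_loops (join_loops (join_loops (pre k) ?A) (rv ?B)) ?C)"
        using A B C q Suc(2) by (intro hp_join hp_refl hp_sym[OF hp_assoc] pathin_rv) simp_all
      also have "hp XU \<dots> (join_loops (join_loops (pre k) ?A) (join_loops (rv ?B) ?C))"
        using A B C q Suc(2) by (intro hp_assoc pathin_rv pathin_join) simp_all
      finally show "arc_homotopic (join_loops (pre (Suc k)) ?C)"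
      proof (rule arc_homotopic_hp)
        have "arc_homotopic (join_loops (pre k) ?A)" using Suc t(1) xt(2) by simp
        moreover have "arc_homotopic (join_loops (rv ?B) ?C)" by (rule track_link[OF t(1) c(1) xt(1) c(2)])
        ultimately show "arc_homotopic (join_loops (join_loops (pre k) ?A) (join_loops (rv ?B) ?C))"
          by (rule arc_homotopic_join) (use A B in simp)
      qed
    qed
  qed
  moreover have "pre N = p" using N(1) by (simp add: pre_def linepath_def fun_eq_iff)
  ultimately show ?thesis using c by fastforce
qed

text \<open>Cellular approximation for the complement, with half edges and radii in the role of
  edges.\<close>

theorem arc_approximation:
  assumes p: "pathin XU p" "p 0 \<in> nodes T" "p 1 \<in> nodes T"
  shows "arc_homotopic p"
proof -
  have "p 1 \<in> U" using pathin_U[OF p(1)] by auto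
  then obtain \<delta> \<sigma> where c: "centre \<delta> \<sigma>" "p 1 \<in> nbhd T \<delta> \<sigma>" using ex_centre by blast
  note tr = track[OF c]
  have "arc_homotopic (join_loops (join_loops p (track \<delta> \<sigma> (p 1))) (rv (track \<delta> \<sigma> (p 1))))"
    by (rule arc_homotopic_join[OF arc_homotopic_track[OF p(1,2) c] arc_homotopic_rv[OF track_node[OF c p(3)]]])
      (use tr in simp)
  moreover have "hp XU p (join_loops (join_loops p (track \<delta> \<sigma> (p 1))) (rv (track \<delta> \<sigma> (p 1))))"
    using p(1) tr by (intro hp_sym[OF hp_cancel_right]) simp_all
  ultimately show ?thesis by (rule arc_homotopic_hp[rotated])
qed

end

section \<open>Edge paths\<close>

definition lstart :: "('v, 'e, 'f) two_complex \<Rightarrow> 'e \<times> bool \<Rightarrow> 'v" where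
  "lstart T l = (if snd l then src T (fst l) else tgt T (fst l))"

definition lend :: "('v, 'e, 'f) two_complex \<Rightarrow> 'e \<times> bool \<Rightarrow> 'v" where
  "lend T l = (if snd l then tgt T (fst l) else src T (fst l))"

lemma letter_map_ends [simp]:
  "letter_map T l 0 = VertexPt (lstart T l)" "letter_map T l 1 = VertexPt (lend T l)"
  by (simp_all add: letter_map_def lstart_def lend_def)

primrec walk :: "('v, 'e, 'f) two_complex \<Rightarrow> 'v \<Rightarrow> ('e \<times> bool) list \<Rightarrow> 'v \<Rightarrow> bool" where
  "walk T v [] w \<longleftrightarrow> w = v \<and> v \<in> verts T"
| "walk T v (l # ls) w \<longleftrightarrow> fst l \<in> edges T \<and> v \<in> verts T \<and> lstart T l = v \<and> walk T (lend T l) ls w"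

primrec edge_path :: "('v, 'e, 'f) two_complex \<Rightarrow> 'v \<Rightarrow> ('e \<times> bool) list \<Rightarrow> real \<Rightarrow> ('v, 'e, 'f) point" where
  "edge_path T v [] = (\<lambda>_. VertexPt v)"
| "edge_path T v (l # ls) = join_loops (letter_map T l) (edge_path T (lend T l) ls)"

lemma walk_append: "walk T v (xs @ ys) w \<longleftrightarrow> (\<exists>u. walk T v xs u \<and> walk T u ys w)"
proof (induction xs arbitrary: v)
  case Nil
  show ?case by (cases ys) auto
qed auto

lemma walk_nth:
  "walk T v ls w \<Longrightarrow> i < length ls \<Longrightarrow> fst (ls ! i) \<in> edges T \<and>
    lend T (ls ! i) = (if Suc i < length ls then lstart T (ls ! Suc i) else w)"
proof (induction ls arbitrary: v i)
  case (Cons l ls)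
  show ?case
  proof (cases i)
    case 0
    then show ?thesis using Cons(2) by (cases ls) auto
  next
    case (Suc k)
    then show ?thesis using Cons(1)[of "lend T l" k] Cons(2,3) by simp
  qed
qed simp

lemma walk_end: "walk T v ls w \<Longrightarrow> v \<in> verts T \<and> w \<in> verts T"
  by (induction ls arbitrary: v) (auto split: if_splits)

lemma complex2I:
  assumes "\<And>e. e \<in> edges T \<Longrightarrow> src T e \<in> verts T \<and> tgt T e \<in> verts T"
    and w: "\<And>f. f \<in> faces T \<Longrightarrow> walk T (base T f) (bdry T f) (base T f)"
  shows "complex2 T"
proof
  fix f assume f: "f \<in> faces T"
  show "base T f \<in> verts T" using walk_end[OF w[OF f]] by simp
  show "fst l \<in> edges T" if "l \<in> set (bdry T f)" for l
    using that walk_nth[OF w[OF f]] by (metis in_set_conv_nth)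
  show b: "letter_map T (bdry T f ! 0) 0 = VertexPt (base T f)" if "bdry T f \<noteq> []"
    using that w[OF f] by (cases "bdry T f") auto
  show "letter_map T (bdry T f ! i) 1 = letter_map T (bdry T f ! (Suc i mod length (bdry T f))) 0"
    if i: "i < length (bdry T f)" for i
  proof (cases "Suc i < length (bdry T f)")
    case True
    then show ?thesis using walk_nth[OF w[OF f] i] by simp
  next
    case False
    then have "Suc i = length (bdry T f)" "bdry T f \<noteq> []" using i by auto
    then show ?thesis using walk_nth[OF w[OF f] i] b by simp
  qed
qed (use assms in auto)

context complex2 begin

abbreviation "XT \<equiv> realization T"

lemma pathin_o_edge:
  assumes "e \<in> edges T" "path \<alpha>" "path_image \<alpha> \<subseteq> {0..1}"
  shows "pathin XT (\<lambda>t. edge_map T e (\<alpha> t))"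
  using pathin_o[OF continuous_edge_map[OF assms(1)] assms(2,3)] by (simp add: o_def)

lemma hp_o_edge:
  assumes "e \<in> edges T" "path \<alpha>" "path_image \<alpha> \<subseteq> {0..1}" "path \<beta>" "path_image \<beta> \<subseteq> {0..1}"
    "\<alpha> 0 = \<beta> 0" "\<alpha> 1 = \<beta> 1"
  shows "hp XT (\<lambda>t. edge_map T e (\<alpha> t)) (\<lambda>t. edge_map T e (\<beta> t))"
  using hp_convex[OF continuous_edge_map[OF assms(1)] convex_real_interval(5) assms(2-)] by (simp add: o_def)

lemma pathin_o_sector:
  assumes "f \<in> faces T" "i < sectors T f" "path \<alpha>" "path_image \<alpha> \<subseteq> sq"
  shows "pathin XT (\<lambda>t. sector T f i (\<alpha> t))"
  using pathin_o[OF continuous_sector[OF assms(1,2)] assms(3,4)] by (simp add: o_def)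

lemma hp_o_sector:
  assumes "f \<in> faces T" "i < sectors T f" "path \<alpha>" "path_image \<alpha> \<subseteq> sq" "path \<beta>" "path_image \<beta> \<subseteq> sq"
    "\<alpha> 0 = \<beta> 0" "\<alpha> 1 = \<beta> 1"
  shows "hp XT (\<lambda>t. sector T f i (\<alpha> t)) (\<lambda>t. sector T f i (\<beta> t))"
  using hp_convex[OF continuous_sector[OF assms(1,2)] _ assms(3-)] by (simp add: o_def convex_Times)

lemma pathin_letter_map:
  assumes "fst l \<in> edges T" shows "pathin XT (letter_map T l)"
proof (cases "snd l")
  case True
  then show ?thesis
    using pathin_o_edge[OF assms, of "\<lambda>t. t"] by (simp add: letter_map_def[abs_def] path_def path_image_def)
next
  case False
  have "path (\<lambda>t::real. 1 - t)" unfolding path_def by (intro continuous_intros)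
  then show ?thesis
    using False pathin_o_edge[OF assms, of "\<lambda>t. 1 - t"] by (auto simp: letter_map_def[abs_def] path_image_def)
qed

lemma edge_path: "walk T v ls w \<Longrightarrow>
    pathin XT (edge_path T v ls) \<and> edge_path T v ls 0 = VertexPt v \<and> edge_path T v ls 1 = VertexPt w"
proof (induction ls arbitrary: v)
  case Nil
  then show ?case by (auto intro!: pathin_const simp: topspace_realization cell_points_def)
next
  case (Cons l ls)
  then show ?case by (auto intro!: pathin_join pathin_letter_map)
qed

lemma edge_path_append:
  "walk T v xs u \<Longrightarrow> walk T u ys w \<Longrightarrow>
    hp XT (edge_path T v (xs @ ys)) (join_loops (edge_path T v xs) (edge_path T u ys))"
proof (induction xs arbitrary: v)
  case Nil
  then show ?case using edge_path[OF Nil(2)] by (auto intro!: hp_sym[OF hp_lunit])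
next
  case (Cons l xs)
  then have w: "fst l \<in> edges T" "walk T (lend T l) xs u" "lstart T l = v" by auto
  note p = pathin_letter_map[OF w(1)] edge_path[OF w(2)] edge_path[OF Cons(3)]
  have "hp XT (edge_path T v ((l # xs) @ ys))
     (join_loops (letter_map T l) (join_loops (edge_path T (lend T l) xs) (edge_path T u ys)))"
    using Cons(1)[OF w(2) Cons(3)] p by (auto intro!: hp_join hp_refl simp: hp_0)
  also have "hp XT \<dots> (join_loops (edge_path T v (l # xs)) (edge_path T u ys))"
    using p by (auto intro!: hp_sym[OF hp_assoc])
  finally show ?case .
qed

lemma edge_path_single:
  assumes "fst l \<in> edges T" shows "hp XT (edge_path T v [l]) (letter_map T l)"
  using pathin_letter_map[OF assms] by (auto intro!: hp_runit)

text \<open>The index is read cyclically, so that one full turn round the 2-cell leads back to the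
  first spoke.\<close>

definition spoke :: "'f \<Rightarrow> nat \<Rightarrow> real \<Rightarrow> ('v, 'e, 'f) point" where
  "spoke f j = (\<lambda>t. sector T f (j mod sectors T f) (t, 0))"

lemma pathin_spoke:
  assumes "f \<in> faces T" shows "pathin XT (spoke f j)" "spoke f j 0 = FacePt f 0"
proof -
  have "path (\<lambda>t::real. (t, 0::real))" unfolding path_def by (intro continuous_intros)
  then show "pathin XT (spoke f j)"
    unfolding spoke_def using assms by (intro pathin_o_sector) (auto simp: path_image_def)
qed (simp add: spoke_def)

lemma letter_map_sector:
  assumes "f \<in> faces T" "i < length (bdry T f)" "a \<in> {0..1}"
  shows "sector T f i (1, a) = letter_map T (bdry T f ! i) a"
proof -
  have "i < sectors T f" "bdry T f \<noteq> []" using assms(2) by (auto simp: sectors_def less_max_iff_disj)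
  then show ?thesis using assms sector_rim[of f i a] by simp
qed

lemma spoke_1:
  assumes "f \<in> faces T" "j < length (bdry T f)"
  shows "spoke f j 1 = VertexPt (lstart T (bdry T f ! j))"
  using assms letter_map_sector[OF assms, of 0] by (simp add: spoke_def sectors_def max_def)

text \<open>Both paths run from the centre to the rim point at angle \<open>k\<close> within a
  single convex sector.\<close>

lemma spoke_letter:
  assumes f: "f \<in> faces T" "i < length (bdry T f)" and k: "k \<in> {0..1}"
  shows "hp XT (join_loops (spoke f i) (\<lambda>a. letter_map T (bdry T f ! i) (k * a))) (\<lambda>t. sector T f i (t, k))"
proof -
  have i: "i < sectors T f" using f by (auto simp: sectors_def less_max_iff_disj)
  let ?b = "linepath (0, 0) (1, 0) +++ linepath (1, 0) (1::real, k)"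
  have cs: "convex sq" by (intro convex_Times) auto
  have im_l: "path_image (linepath v w) \<subseteq> sq" if "v \<in> sq" "w \<in> sq" for v w
    using that cs by (simp only: path_image_linepath closed_segment_subset)
  let ?c = "linepath (0, 0) (0, k) +++ linepath (0, k) (1::real, k)"
  have im: "path_image ?b \<subseteq> sq" "path_image ?c \<subseteq> sq"
    by (rule subset_path_image_join; rule im_l; use k in simp)+
  have pb: "path ?b" "path ?c" by (intro path_join_imp; simp)+
  have "hp XT (\<lambda>t. sector T f i (?b t)) (\<lambda>t. sector T f i (?c t))"
    by (rule hp_o_sector[OF f(1) i pb(1) im(1) pb(2) im(2)]) (simp_all add: joinpaths_def linepath_0' linepath_1')
  also have "(\<lambda>t. sector T f i ((linepath (0, 0) (0, k) +++ linepath (0, k) (1, k)) t)) =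
      join_loops (\<lambda>_. FacePt f 0) (\<lambda>t. sector T f i (t, k))"
    by (auto simp: joinpaths_def join_loops_def linepath_def fun_eq_iff algebra_simps)
  also have "hp XT \<dots> (\<lambda>t. sector T f i (t, k))"
  proof (rule hp_lunit)
    have "path (\<lambda>t::real. (t, k))" unfolding path_def by (intro continuous_intros)
    then show "pathin XT (\<lambda>t. sector T f i (t, k))"
      using f i k by (intro pathin_o_sector) (auto simp: path_image_def)
  qed simp
  finally have h: "hp XT (\<lambda>t. sector T f i (?b t)) (\<lambda>t. sector T f i (t, k))" .
  have "hp XT (\<lambda>t. sector T f i (?b t)) (join_loops (spoke f i) (\<lambda>a. letter_map T (bdry T f ! i) (k * a)))"
  proof (rule hp_cong[OF hp_path1[OF h]])
    fix t :: real assume t: "t \<in> {0..1}"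
    show "sector T f i (?b t) = join_loops (spoke f i) (\<lambda>a. letter_map T (bdry T f ! i) (k * a)) t"
    proof (cases "t \<le> 1/2")
      case True
      then show ?thesis using i by (simp add: joinpaths_def join_loops_def linepath_def spoke_def)
    next
      case False
      then have "k * (2 * t - 1) \<in> {0..1}" using t k by (auto intro: mult_le_one)
      then show ?thesis using False letter_map_sector[OF f, of "k * (2 * t - 1)"]
        by (simp add: joinpaths_def join_loops_def linepath_def mult.commute)
    qed
  qed
  then show ?thesis using h hp_sym hp_trans by blast
qed

lemma spoke_edge_path:
  assumes f: "f \<in> faces T" and w: "walk T (base T f) (bdry T f) (base T f)" and j: "j \<le> length (bdry T f)"
    and ne: "bdry T f \<noteq> []"
  shows "hp XT (join_loops (spoke f 0) (edge_path T (base T f) (take j (bdry T f)))) (spoke f j)"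
  using j
proof (induction j)
  case 0
  have "spoke f 0 1 = VertexPt (base T f)"
    using spoke_1[OF f, of 0] ne bdry_base[OF f ne] by simp
  then show ?case using pathin_spoke[OF f, of 0] by (auto intro: hp_runit)
next
  case (Suc j)
  let ?l = "bdry T f ! j" and ?P = "edge_path T (base T f) (take j (bdry T f))"
  have j: "j < length (bdry T f)" using Suc by simp
  have sj: "sectors T f = length (bdry T f)" using ne by (auto simp: sectors_def Suc_le_eq)
  have spl: "take (Suc j) (bdry T f) = take j (bdry T f) @ [?l]" using j by (rule take_Suc_conv_app_nth)
  have "bdry T f = take (Suc j) (bdry T f) @ drop (Suc j) (bdry T f)" by simp
  then have "\<exists>v. walk T (base T f) (take (Suc j) (bdry T f)) v"
    using w walk_append by metis
  then obtain u v where u: "walk T (base T f) (take j (bdry T f)) u" "walk T u [?l] v"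
    unfolding spl walk_append by blast
  then have e: "fst ?l \<in> edges T" "lstart T ?l = u" by auto
  note P = edge_path[OF u(1)] and l = pathin_letter_map[OF e(1)] and s = pathin_spoke[OF f, of 0] pathin_spoke[OF f, of j]
  have s1: "spoke f 0 1 = VertexPt (base T f)" using spoke_1[OF f, of 0] ne bdry_base[OF f ne] by simp
  have "hp XT (edge_path T (base T f) (take (Suc j) (bdry T f))) (join_loops ?P (edge_path T u [?l]))"
    unfolding spl by (rule edge_path_append[OF u])
  also have "hp XT \<dots> (join_loops ?P (letter_map T ?l))"
    using P e by (intro hp_join hp_refl edge_path_single) auto
  finally have 1: "hp XT (edge_path T (base T f) (take (Suc j) (bdry T f))) (join_loops ?P (letter_map T ?l))" .
  have "hp XT (join_loops (spoke f 0) (edge_path T (base T f) (take (Suc j) (bdry T f))))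
     (join_loops (spoke f 0) (join_loops ?P (letter_map T ?l)))"
    by (rule hp_join[OF hp_refl[OF s(1)] 1]) (use s1 hp_0[OF 1] P in simp)
  also have "hp XT \<dots> (join_loops (join_loops (spoke f 0) ?P) (letter_map T ?l))"
    using s s1 P l e by (intro hp_sym[OF hp_assoc]) auto
  also have "hp XT \<dots> (join_loops (spoke f j) (letter_map T ?l))"
    using Suc j l P e by (intro hp_join hp_refl) auto
  also have "hp XT \<dots> (\<lambda>t. sector T f j (t, 1))"
    using spoke_letter[OF f j, of 1] by simp
  also have "(\<lambda>t. sector T f j (t, 1)) = spoke f (Suc j)"
    using j sj by (simp add: spoke_def sector_glue)
  finally show ?case .
qed

text \<open>Turning the spoke once round the 2-cell shows that \<open>spoke f 0\<close> followed by
  the boundary path is homotopic to \<open>spoke f 0\<close>; cancelling the spoke leaves a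
  null-homotopy of the boundary.\<close>

lemma bdry_null:
  assumes f: "f \<in> faces T" and w: "walk T (base T f) (bdry T f) (base T f)"
  shows "hp XT (edge_path T (base T f) (bdry T f)) (\<lambda>_. VertexPt (base T f))"
proof (cases "bdry T f = []")
  case True
  then show ?thesis using base_in[OF f] by (auto intro!: hp_refl pathin_const simp: topspace_realization cell_points_def)
next
  case False
  note P = edge_path[OF w]
  note s = pathin_spoke[OF f, of 0]
  have s1: "spoke f 0 1 = VertexPt (base T f)" using spoke_1[OF f, of 0] False bdry_base[OF f False] by simp
  have "spoke f (length (bdry T f)) = spoke f 0" using False by (auto simp: spoke_def sectors_def max_def)
  then have "hp XT (join_loops (spoke f 0) (edge_path T (base T f) (bdry T f))) (spoke f 0)"
    using spoke_edge_path[OF f w order_refl False] by simp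
  then have "hp XT (edge_path T (base T f) (bdry T f)) (join_loops (rv (spoke f 0)) (spoke f 0))"
    using s s1 P by (intro hp_solve_left) auto
  also have "hp XT \<dots> (\<lambda>_. VertexPt (base T f))" using s s1 by (intro hp_linv) auto
  finally show ?thesis .
qed

lemma arcs_path:
  assumes "p \<in> arcs T" shows "pathin XT p" "p 0 \<in> nodes T" "p 1 \<in> nodes T"
proof -
  have 1: "path (\<lambda>t::real. (1 - t) / 2)" "path (\<lambda>t::real. (1 + t) / 2)" "path (\<lambda>t::real. (t, a::real))" for a
    unfolding path_def by (auto intro!: continuous_intros)
  have s: "i < sectors T f" if "i < length (bdry T f)" for i f using that by (auto simp: sectors_def less_max_iff_disj)
  show "pathin XT p"
    using assms
    by cases (auto intro!: pathin_o_edge pathin_o_sector 1 intro: s simp: path_image_def)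
  show "p 0 \<in> nodes T" using assms by cases (auto simp: nodes_def)
  show "p 1 \<in> nodes T"
    using assms
  proof cases
    case (arc_face f i)
    then have "p 1 = letter_map T (bdry T f ! i) (1/2)" using letter_map_sector[of f i "1/2"] by simp
    then show ?thesis using bdry_in[OF arc_face(2), of "bdry T f ! i"] arc_face(3) by (auto simp: letter_map_def nodes_def)
  next
    case (arc_base f)
    then show ?thesis using sector_rim[of f 0 0] base_in by (auto simp: nodes_def)
  qed (use ends in \<open>auto simp: nodes_def\<close>)
qed

end

context complement begin

lemma arc_paths_path: "p \<in> arc_paths T U \<Longrightarrow> pathin XU p"
proof (induction rule: arc_paths.induct)
  case (const x)
  then show ?case by (intro pathin_const) (simp del: topspace_subtopology)
next
  case (arc p)
  then show ?case using arcs_path(1)[OF arc(1)] by (auto simp: pathin_def continuous_map_in_subtopology U_def)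
next
  case (rv_arc p)
  then have "pathin XU p" using arcs_path(1)[OF rv_arc(1)] by (auto simp: pathin_def continuous_map_in_subtopology U_def)
  then show ?case by (rule pathin_rv)
next
  case (join p q)
  then show ?case by (intro pathin_join)
qed

end

section \<open>Presentations\<close>

definition letter_val :: "('a, 'm) monoid_scheme \<Rightarrow> ('x \<Rightarrow> 'a) \<Rightarrow> 'x \<times> bool \<Rightarrow> 'a" where
  "letter_val G \<phi> l = (if snd l then \<phi> (fst l) else inv\<^bsub>G\<^esub> \<phi> (fst l))"

primrec word_val :: "('a, 'm) monoid_scheme \<Rightarrow> ('x \<Rightarrow> 'a) \<Rightarrow> ('x \<times> bool) list \<Rightarrow> 'a" where
  "word_val G \<phi> [] = \<one>\<^bsub>G\<^esub>"
| "word_val G \<phi> (l # w) = letter_val G \<phi> l \<otimes>\<^bsub>G\<^esub> word_val G \<phi> w"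

definition word_inv :: "('x \<times> bool) list \<Rightarrow> ('x \<times> bool) list" where
  "word_inv w = rev (map (\<lambda>(x, b). (x, \<not> b)) w)"

lemma word_inv_lists: "w \<in> lists (letters X) \<Longrightarrow> word_inv w \<in> lists (letters X)"
  by (force simp: word_inv_def letters_def in_lists_conv_set)

locale word_group = group G for G :: "('a, 'm) monoid_scheme" (structure) +
  fixes X :: "'x set" and \<phi> :: "'x \<Rightarrow> 'a"
  assumes gens: "\<phi> \<in> X \<rightarrow> carrier G"
begin

lemma letter_val_closed: "l \<in> letters X \<Longrightarrow> letter_val G \<phi> l \<in> carrier G"
  using gens by (auto simp: letter_val_def letters_def)

lemma word_val_closed: "w \<in> lists (letters X) \<Longrightarrow> word_val G \<phi> w \<in> carrier G"
  by (induction w) (auto simp: letter_val_closed)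

lemma word_val_append:
  "v \<in> lists (letters X) \<Longrightarrow> w \<in> lists (letters X) \<Longrightarrow>
    word_val G \<phi> (v @ w) = word_val G \<phi> v \<otimes> word_val G \<phi> w"
  by (induction v) (auto simp: m_assoc letter_val_closed word_val_closed)

lemma letter_val_inv: "x \<in> X \<Longrightarrow> letter_val G \<phi> (x, b) \<otimes> letter_val G \<phi> (x, \<not> b) = \<one>"
  using funcset_mem[OF gens] by (cases b) (simp_all add: letter_val_def)

lemma word_val_inv:
  assumes "w \<in> lists (letters X)" shows "word_val G \<phi> (word_inv w) = inv (word_val G \<phi> w)"
  using assms
proof (induction w)
  case Nil
  then show ?case by (simp add: word_inv_def)
next
  case (Cons l w)
  obtain x b where l: "l = (x, b)" by (cases l)
  have x: "x \<in> X" using Cons l by (auto simp: letters_def)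
  have c: "letter_val G \<phi> (x, c) \<in> carrier G" for c using x by (intro letter_val_closed) (simp add: letters_def)
  have "letter_val G \<phi> (x, \<not> b) = inv letter_val G \<phi> l"
    using letter_val_inv[OF x, of "\<not> b"] c l by (simp add: inv_equality)
  moreover have "word_inv (l # w) = word_inv w @ [(x, \<not> b)]" by (simp add: word_inv_def l)
  moreover have "[(x, \<not> b)] \<in> lists (letters X)" using x by (simp add: letters_def)
  ultimately show ?case
    using Cons c l word_inv_lists[of w X] by (simp add: word_val_append inv_mult_group word_val_closed)
qed

lemma letter_val_map:
  assumes "group_hom G N j" "\<And>x. x \<in> X \<Longrightarrow> \<psi> (\<epsilon> x) = j (\<phi> x)" "l \<in> letters X"
  shows "letter_val N \<psi> (map_prod \<epsilon> id l) = j (letter_val G \<phi> l)"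
proof -
  interpret h: group_hom G N j by fact
  have "fst l \<in> X" using assms(3) by (auto simp: letters_def)
  then show ?thesis using assms(2) funcset_mem[OF gens] by (simp add: letter_val_def)
qed

lemma word_val_map:
  assumes "group_hom G N j" "\<And>x. x \<in> X \<Longrightarrow> \<psi> (\<epsilon> x) = j (\<phi> x)" "w \<in> lists (letters X)"
  shows "word_val N \<psi> (map (map_prod \<epsilon> id) w) = j (word_val G \<phi> w)"
  using assms(3)
proof (induction w)
  case Nil
  then show ?case using group_hom.hom_one[OF assms(1)] by simp
next
  case (Cons l w)
  interpret h: group_hom G N j by fact
  have "letter_val N \<psi> (map_prod \<epsilon> id l) = j (letter_val G \<phi> l)"
    using Cons by (intro letter_val_map[OF assms(1)] assms(2)) auto
  then show ?case
    using Cons letter_val_closed word_val_closed by (simp add: id_def)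
qed

lemma word_cong_word_val:
  assumes R: "\<And>r. r \<in> R \<Longrightarrow> word_val G \<phi> r = \<one>"
  shows "word_cong (letters X) (group_relations X R) u v \<Longrightarrow> word_val G \<phi> u = word_val G \<phi> v"
proof (induction rule: word_cong.induct)
  case (rewrite u v p q)
  then have "word_val G \<phi> u = word_val G \<phi> v"
    using R gens letter_val_inv by (auto simp: group_relations_def letter_val_closed letters_def)
  then show ?case using rewrite by (simp add: word_val_append word_val_closed)
qed auto

end

text \<open>Word-level form of \<open>finite_presentation\<close>. The last two assumptions together
  say that a word has value one exactly when it is congruent to the empty word.\<close>

locale presentation = word_group G X \<phi> for G :: "('a, 'm) monoid_scheme" (structure) and X :: "'x set" and \<phi> +
  fixes R :: "('x \<times> bool) list set"
  assumes finite_gens: "finite X" and finite_rels: "finite R" and rels: "R \<subseteq> lists (letters X)"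
    and word_val_surj: "g \<in> carrier G \<Longrightarrow> \<exists>w\<in>lists (letters X). word_val G \<phi> w = g"
    and word_val_rel: "r \<in> R \<Longrightarrow> word_val G \<phi> r = \<one>"
    and word_val_one: "w \<in> lists (letters X) \<Longrightarrow> word_val G \<phi> w = \<one> \<Longrightarrow>
      word_cong (letters X) (group_relations X R) w []"

lemma letter_cancel:
  assumes "x \<in> X" shows "word_cong (letters X) (group_relations X R) [(x, b), (x, \<not> b)] []"
  using word_cong.rewrite[of "[(x, b), (x, \<not> b)]" "[]" "group_relations X R" "letters X" "[]" "[]"] assms
  by (auto simp: group_relations_def letters_def)

text \<open>From left to right the isomorphism evaluates the class of a word to
  \<open>word_val\<close>; from right to left evaluation factors through congruence classes and has
  trivial kernel.\<close>

lemma finite_presentation_iff: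
  "finite_presentation G X R \<phi> \<longleftrightarrow> presentation G X \<phi> R"
proof
  let ?A = "letters X" and ?S = "group_relations X R"
  let ?P = "presented_group X R"
  interpret P: group ?P by (rule group_presented_group)
  assume "finite_presentation G X R \<phi>"
  then obtain f where G: "group G" and fin: "finite X" "finite R" "R \<subseteq> lists ?A" and f: "f \<in> iso ?P G"
    and fx: "\<And>x. x \<in> X \<Longrightarrow> f (word_class ?A ?S [(x, True)]) = \<phi> x"
    by (auto simp: finite_presentation_def)
  interpret G: group G by (rule G)
  interpret h: group_hom ?P G f using f by unfold_locales (simp add: iso_def)
  have cl: "word_class ?A ?S w \<in> carrier ?P" if "w \<in> lists ?A" for w
    using that by (auto simp: presented_group_def word_monoid_def)
  have one: "\<one>\<^bsub>?P\<^esub> = word_class ?A ?S []" by (simp add: presented_group_def word_monoid_def)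
  have mult: "word_class ?A ?S u \<otimes>\<^bsub>?P\<^esub> word_class ?A ?S v = word_class ?A ?S (u @ v)"
    if "u \<in> lists ?A" "v \<in> lists ?A" for u v
    using mult_word_monoid[OF that] by (simp add: presented_group_def)
  have l: "f (word_class ?A ?S [(x, b)]) = letter_val G \<phi> (x, b)" if x: "x \<in> X" for x b
  proof (cases b)
    case True
    then show ?thesis using fx[OF x] by (simp add: letter_val_def)
  next
    case False
    have m: "[(x, c)] \<in> lists ?A" for c using x by (simp add: letters_def)
    have "word_class ?A ?S [(x, False)] \<otimes>\<^bsub>?P\<^esub> word_class ?A ?S [(x, True)] = \<one>\<^bsub>?P\<^esub>"
      using mult[OF m m, of False True] letter_cancel[OF x, of R False] m[of True] m[of False]
      by (simp add: one word_class_eq_iff)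
    then have "word_class ?A ?S [(x, False)] = inv\<^bsub>?P\<^esub> word_class ?A ?S [(x, True)]"
      using cl[OF m] by (simp add: P.inv_equality)
    then show ?thesis using False fx[OF x] cl[OF m] by (simp add: letter_val_def)
  qed
  have "\<phi> x \<in> carrier G" if x: "x \<in> X" for x
    using h.hom_closed[OF cl[of "[(x, True)]"]] fx[OF x] x by (simp add: letters_def)
  then interpret word_group G X \<phi> by unfold_locales auto
  have fw: "f (word_class ?A ?S w) = word_val G \<phi> w" if "w \<in> lists ?A" for w
    using that
  proof (induction w)
    case Nil
    then show ?case using h.hom_one one by simp
  next
    case (Cons l' w)
    then obtain x b where l': "l' = (x, b)" "x \<in> X" by (auto simp: letters_def)
    have "word_class ?A ?S (l' # w) = word_class ?A ?S [l'] \<otimes>\<^bsub>?P\<^esub> word_class ?A ?S w"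
      using mult[of "[l']" w] Cons by simp
    then show ?case using Cons l l' cl[of "[l']"] cl[of w] by simp
  qed
  have inj: "word_cong ?A ?S w []" if w: "w \<in> lists ?A" "word_val G \<phi> w = \<one>\<^bsub>G\<^esub>" for w
  proof -
    have "f (word_class ?A ?S w) = f (word_class ?A ?S [])" using fw[OF w(1)] fw[of "[]"] w(2) by simp
    then have "word_class ?A ?S w = word_class ?A ?S []"
      using f cl[OF w(1)] cl[of "[]"] by (auto simp: iso_def bij_betw_def dest: inj_onD)
    then show ?thesis using word_class_eq_iff[OF w(1)] by blast
  qed
  show "presentation G X \<phi> R"
  proof unfold_locales
    fix g assume "g \<in> carrier G"
    then have "g \<in> f ` word_class ?A ?S ` lists ?A"
      using f by (simp add: iso_def bij_betw_def presented_group_def word_monoid_def)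
    then obtain w where "w \<in> lists ?A" "g = f (word_class ?A ?S w)" by blast
    then show "\<exists>w\<in>lists ?A. word_val G \<phi> w = g" using fw[of w] by (intro bexI[of _ w]) simp_all
  next
    fix r assume r: "r \<in> R"
    then have rl: "r \<in> lists ?A" using fin by blast
    have "word_cong ?A ?S r []"
      using word_cong.rewrite[of r "[]" ?S ?A "[]" "[]"] r rl by (auto simp: group_relations_def)
    then have "word_class ?A ?S r = word_class ?A ?S []" using word_class_eq_iff[OF rl] by blast
    then show "word_val G \<phi> r = \<one>\<^bsub>G\<^esub>" using fw[OF rl] fw[of "[]"] by simp
  qed (use fin inj in blast)+
next
  let ?A = "letters X" and ?S = "group_relations X R"
  let ?P = "presented_group X R"
  assume "presentation G X \<phi> R"
  then interpret presentation G X \<phi> R .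
  interpret P: group ?P by (rule group_presented_group)
  \<comment> \<open>Congruent words have equal values, so the image of a class under evaluation is a
    singleton.\<close>
  define f where "f c = the_elem (word_val G \<phi> ` c)" for c
  have fw: "f (word_class ?A ?S w) = word_val G \<phi> w" if "w \<in> lists ?A" for w
  proof -
    have "word_val G \<phi> ` word_class ?A ?S w = {word_val G \<phi> w}"
    proof (rule subset_antisym)
      show "word_val G \<phi> ` word_class ?A ?S w \<subseteq> {word_val G \<phi> w}"
        using word_cong_word_val[OF word_val_rel, of R w] by (auto simp: word_class_def)
      show "{word_val G \<phi> w} \<subseteq> word_val G \<phi> ` word_class ?A ?S w"
        using word_cong.refl[OF that, of ?S] by (auto simp: word_class_def)
    qed
    then show ?thesis by (simp add: f_def)
  qed
  have carr: "carrier ?P = word_class ?A ?S ` lists ?A" by (simp add: presented_group_def word_monoid_def)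
  have mult: "word_class ?A ?S u \<otimes>\<^bsub>?P\<^esub> word_class ?A ?S v = word_class ?A ?S (u @ v)"
    if "u \<in> lists ?A" "v \<in> lists ?A" for u v
    using mult_word_monoid[OF that] by (simp add: presented_group_def)
  have one: "\<one>\<^bsub>?P\<^esub> = word_class ?A ?S []" by (simp add: presented_group_def word_monoid_def)
  have hom: "f \<in> hom ?P G"
  proof (rule homI)
    fix c assume "c \<in> carrier ?P"
    then obtain u where u: "u \<in> lists ?A" "c = word_class ?A ?S u" unfolding carr by blast
    then show "f c \<in> carrier G" using fw word_val_closed by simp
    fix d assume "d \<in> carrier ?P"
    then obtain v where v: "v \<in> lists ?A" "d = word_class ?A ?S v" unfolding carr by blast
    have "u @ v \<in> lists ?A" using u v by simp
    then show "f (c \<otimes>\<^bsub>?P\<^esub> d) = f c \<otimes>\<^bsub>G\<^esub> f d"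
      using u v mult fw word_val_append by simp
  qed
  then interpret h: group_hom ?P G f by unfold_locales
  have "c = \<one>\<^bsub>?P\<^esub>" if c: "c \<in> carrier ?P" "f c = \<one>\<^bsub>G\<^esub>" for c
  proof -
    obtain w where w: "w \<in> lists ?A" "c = word_class ?A ?S w" using c carr by blast
    then have "word_cong ?A ?S w []" using word_val_one[OF w(1)] fw[OF w(1)] c by simp
    then show ?thesis using word_class_eq_iff[OF w(1)] w one by blast
  qed
  then have "inj_on f (carrier ?P)" using h.inj_on_one_iff by blast
  moreover have "f ` carrier ?P = carrier G"
  proof
    show "f ` carrier ?P \<subseteq> carrier G" using h.hom_closed by blast
    show "carrier G \<subseteq> f ` carrier ?P"
    proof
      fix g assume "g \<in> carrier G"
      then obtain w where "w \<in> lists ?A" "word_val G \<phi> w = g" using word_val_surj by blast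
      then show "g \<in> f ` carrier ?P" using fw carr by (metis image_eqI)
    qed
  qed
  ultimately have "f \<in> iso ?P G" using hom by (simp add: iso_def bij_betw_def)
  moreover have "f (word_class ?A ?S [(x, True)]) = \<phi> x" if "x \<in> X" for x
    using fw[of "[(x, True)]"] that gens by (simp add: letters_def letter_val_def Pi_def)
  ultimately show "finite_presentation G X R \<phi>"
    unfolding finite_presentation_def using is_group finite_gens finite_rels rels by blast
qed

section \<open>Cayley complexes\<close>

locale cayley = presentation G X \<phi> R for G :: "('a, 'm) monoid_scheme" (structure) and X :: "'x set" and \<phi> R +
  fixes A :: "'a set"
  assumes A: "subgroup A G"
begin

abbreviation "Cay \<equiv> cayley2 G X R \<phi> A"

lemma Cay_simps [simp]:
  "verts Cay = rcosets A" "edges Cay = (rcosets A) \<times> X" "faces Cay = (rcosets A) \<times> R"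
  "src Cay e = fst e" "tgt Cay e = fst e #> \<phi> (snd e)" "base Cay f = fst f"
  "bdry Cay f = coset_path G \<phi> (fst f) (snd f)"
  by (simp_all add: cayley2_def split_def)

lemma A_sub: "A \<subseteq> carrier G"
  using A by (rule subgroup.subset)

lemma coset_sub: "c \<in> rcosets A \<Longrightarrow> c \<subseteq> carrier G"
  using A A_sub by (auto simp: RCOSETS_def dest: r_coset_subset_G[THEN subsetD])

lemma coset_act: "c \<in> rcosets A \<Longrightarrow> g \<in> carrier G \<Longrightarrow> c #> g \<in> rcosets A"
  using A_sub by (auto simp: RCOSETS_def coset_mult_assoc)

lemma coset_act_assoc:
  "c \<in> rcosets A \<Longrightarrow> g \<in> carrier G \<Longrightarrow> h \<in> carrier G \<Longrightarrow> c #> g #> h = c #> (g \<otimes> h)"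
  using coset_sub by (simp add: coset_mult_assoc)

lemma coset_one: "c \<in> rcosets A \<Longrightarrow> c #> \<one> = c"
  using coset_sub by (simp add: coset_mult_one)

lemma gen_closed: "x \<in> X \<Longrightarrow> \<phi> x \<in> carrier G"
  using gens by auto

lemma coset_path_Cons:
  "coset_path G \<phi> c (l # w) = (if snd l then ((c, fst l), True) else ((c #> inv (\<phi> (fst l)), fst l), False))
    # coset_path G \<phi> (c #> letter_val G \<phi> l) w"
  by (simp add: letter_val_def)

lemma walk_coset_path:
  "c \<in> rcosets A \<Longrightarrow> w \<in> lists (letters X) \<Longrightarrow>
    walk Cay c (coset_path G \<phi> c w) (c #> word_val G \<phi> w)"
proof (induction w arbitrary: c)
  case Nil
  then show ?case by (simp add: coset_one)
next
  case (Cons l w)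
  then have x: "fst l \<in> X" "l \<in> letters X" by (auto simp: letters_def)
  have c': "c #> letter_val G \<phi> l \<in> rcosets A" using Cons x by (intro coset_act letter_val_closed) auto
  have "walk Cay (c #> letter_val G \<phi> l) (coset_path G \<phi> (c #> letter_val G \<phi> l) w)
      (c #> letter_val G \<phi> l #> word_val G \<phi> w)"
    using Cons c' by auto
  moreover have "c #> letter_val G \<phi> l #> word_val G \<phi> w = c #> word_val G \<phi> (l # w)"
    using Cons x by (simp add: coset_act_assoc letter_val_closed word_val_closed)
  ultimately show ?case
    using Cons x gen_closed[OF x(1)]
    by (auto simp: letter_val_def lstart_def lend_def coset_act coset_act_assoc coset_one simp del: coset_path.simps
        simp add: coset_path_Cons)
qed

lemma coset_path_append:
  "c \<in> rcosets A \<Longrightarrow> u \<in> lists (letters X) \<Longrightarrow>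
    coset_path G \<phi> c (u @ v) = coset_path G \<phi> c u @ coset_path G \<phi> (c #> word_val G \<phi> u) v"
proof (induction u arbitrary: c)
  case Nil
  then show ?case by (simp add: coset_one)
next
  case (Cons l w)
  then have l: "l \<in> letters X" "w \<in> lists (letters X)" by auto
  have c': "c #> letter_val G \<phi> l \<in> rcosets A" using Cons l by (intro coset_act letter_val_closed) auto
  show ?case
    using Cons(1)[OF c' l(2)] Cons(2) l
    by (simp add: coset_act_assoc letter_val_closed word_val_closed coset_path_Cons del: coset_path.simps(2))
qed

lemma length_coset_path [simp]: "length (coset_path G \<phi> c w) = length w"
  by (induction w arbitrary: c) auto

sublocale cx: complex2 Cay
proof (rule complex2I)
  fix e assume "e \<in> edges Cay"
  then have "fst e \<in> rcosets A" "snd e \<in> X" by auto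
  then show "src Cay e \<in> verts Cay \<and> tgt Cay e \<in> verts Cay" using coset_act gen_closed by simp
next
  fix f assume "f \<in> faces Cay"
  then have f: "fst f \<in> rcosets A" "snd f \<in> R" by auto
  then have "walk Cay (fst f) (coset_path G \<phi> (fst f) (snd f)) (fst f #> word_val G \<phi> (snd f))"
    using rels by (intro walk_coset_path) auto
  then show "walk Cay (base Cay f) (bdry Cay f) (base Cay f)"
    using f by (simp add: word_val_rel coset_one)
qed

definition epath :: "'a set \<Rightarrow> ('x \<times> bool) list \<Rightarrow> real \<Rightarrow> ('a set, 'a set \<times> 'x, 'a set \<times> ('x \<times> bool) list) point" where
  "epath c w = edge_path Cay c (coset_path G \<phi> c w)"

abbreviation "XC \<equiv> realization Cay"

lemma epath:
  assumes "c \<in> rcosets A" "w \<in> lists (letters X)"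
  shows "pathin XC (epath c w)" "epath c w 0 = VertexPt c" "epath c w 1 = VertexPt (c #> word_val G \<phi> w)"
  using cx.edge_path[OF walk_coset_path[OF assms]] by (simp_all add: epath_def)

lemma epath_append:
  assumes "c \<in> rcosets A" "u \<in> lists (letters X)" "v \<in> lists (letters X)"
  shows "hp XC (epath c (u @ v)) (join_loops (epath c u) (epath (c #> word_val G \<phi> u) v))"
  unfolding epath_def coset_path_append[OF assms(1,2)]
  by (rule cx.edge_path_append[OF walk_coset_path[OF assms(1,2)]
        walk_coset_path[OF coset_act[OF assms(1) word_val_closed[OF assms(2)]] assms(3)]])

lemma epath_Nil: "epath c [] = (\<lambda>_. VertexPt c)"
  by (simp add: epath_def)

text \<open>Each rewriting step lifts to the covering: a cancelling pair is a backtracking along one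
  edge, and a relator is the boundary of the 2-cell attached at the coset where it is read.\<close>

lemma word_cong_epath:
  "word_cong (letters X) (group_relations X R) u v \<Longrightarrow> c \<in> rcosets A \<Longrightarrow> hp XC (epath c u) (epath c v)"
proof (induction arbitrary: c rule: word_cong.induct)
  case (refl w)
  then show ?case by (intro hp_refl epath)
next
  case (sym v w)
  then show ?case by (blast intro: hp_sym)
next
  case (trans u v w)
  then show ?case by (blast intro: hp_trans)
next
  case (rewrite u v p q)
  have uv: "word_val G \<phi> u = word_val G \<phi> v"
    using word_cong_word_val[OF word_val_rel word_cong.rewrite[OF rewrite(1-3), of "[]" "[]"]] by simp
  let ?d = "c #> word_val G \<phi> p"
  have d: "?d \<in> rcosets A" using rewrite by (intro coset_act word_val_closed)
  have main: "hp XC (epath ?d u) (epath ?d v)"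
    using rewrite(1) unfolding group_relations_def
  proof (elim UnE CollectE exE conjE)
    fix x b assume e: "(u, v) = ([(x, b), (x, \<not> b)], [])" and x: "x \<in> X"
    let ?l = "if b then ((?d, x), True) else ((?d #> inv (\<phi> x), x), False)"
    have l: "fst ?l \<in> edges Cay" using d x gen_closed[OF x] by (auto intro: coset_act)
    have "coset_path G \<phi> ?d u = [?l, (fst ?l, \<not> snd ?l)]"
      using e d x gen_closed[OF x] by (auto simp: coset_act_assoc coset_one)
    moreover have "letter_map Cay (fst ?l, \<not> snd ?l) = rv (letter_map Cay ?l)"
      by (auto simp: letter_map_def rv_def fun_eq_iff)
    moreover have "lstart Cay ?l = ?d"
      using d x gen_closed[OF x] by (auto simp: lstart_def coset_act_assoc coset_one)
    ultimately have eq: "epath ?d u = join_loops (letter_map Cay ?l) (join_loops (rv (letter_map Cay ?l)) (\<lambda>_. VertexPt ?d))"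
      by (simp add: epath_def lend_def lstart_def split: if_splits)
    have "hp XC (join_loops (letter_map Cay ?l) (join_loops (rv (letter_map Cay ?l)) (\<lambda>_. VertexPt ?d)))
       (join_loops (letter_map Cay ?l) (rv (letter_map Cay ?l)))"
      using cx.pathin_letter_map[OF l] \<open>lstart Cay ?l = ?d\<close> by (intro hp_join hp_refl hp_runit pathin_rv) simp_all
    also have "hp XC \<dots> (\<lambda>_. VertexPt ?d)"
      using cx.pathin_letter_map[OF l] \<open>lstart Cay ?l = ?d\<close> by (intro hp_rinv) simp_all
    finally have "hp XC (epath ?d u) (\<lambda>_. VertexPt ?d)" unfolding eq .
    moreover have "v = []" using e by simp
    ultimately show ?thesis by (simp only: epath_Nil)
  next
    fix r assume e: "(u, v) = (r, [])" and r: "r \<in> R"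
    have "(?d, r) \<in> faces Cay" using d r by simp
    from cx.bdry_null[OF this] show ?thesis
      using walk_coset_path[OF d, of r] r rels word_val_rel[OF r] e d
      by (auto simp: epath_def coset_one)
  qed
  have split: "hp XC (epath c (p @ x @ q)) (join_loops (epath c p) (join_loops (epath ?d x) (epath (?d #> word_val G \<phi> x) q)))"
    if x: "x \<in> lists (letters X)" for x
  proof -
    have "hp XC (epath c (p @ x @ q)) (join_loops (epath c p) (epath ?d (x @ q)))"
      using rewrite x by (intro epath_append) auto
    also have "hp XC \<dots> (join_loops (epath c p) (join_loops (epath ?d x) (epath (?d #> word_val G \<phi> x) q)))"
      using rewrite x d by (intro hp_join hp_refl epath_append epath) (auto simp: epath)
    finally show ?thesis .
  qed
  have "hp XC (epath c (p @ u @ q)) (join_loops (epath c p) (join_loops (epath ?d u) (epath (?d #> word_val G \<phi> u) q)))"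
    by (rule split[OF rewrite(2)])
  also have "hp XC \<dots> (join_loops (epath c p) (join_loops (epath ?d v) (epath (?d #> word_val G \<phi> v) q)))"
  proof (intro hp_join main)
    have d': "?d #> word_val G \<phi> v \<in> rcosets A" by (rule coset_act[OF d word_val_closed[OF rewrite(3)]])
    show "hp XC (epath (?d #> word_val G \<phi> u) q) (epath (?d #> word_val G \<phi> v) q)"
      unfolding uv using epath(1)[OF d' rewrite(5)] by (rule hp_refl)
    show "hp XC (epath c p) (epath c p)" using epath(1)[OF rewrite(6,4)] by (rule hp_refl)
    show "epath ?d u 1 = epath (?d #> word_val G \<phi> u) q 0"
      unfolding uv using hp_1[OF main] epath(3)[OF d rewrite(3)] epath(2)[OF d' rewrite(5)] by simp
    show "epath c p 1 = join_loops (epath ?d u) (epath (?d #> word_val G \<phi> u) q) 0"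
      using epath(3)[OF rewrite(6,4)] epath(2)[OF d rewrite(2)] by simp
  qed
  also have "hp XC \<dots> (epath c (p @ v @ q))"
    by (rule hp_sym[OF split[OF rewrite(3)]])
  finally show ?case .
qed

text \<open>The word \<open>w\<close> followed by its formal inverse has value one, hence is
  congruent to the empty word, and \<open>word_cong_epath\<close> makes the composite
  null-homotopic.\<close>

lemma rv_epath:
  assumes c: "c \<in> rcosets A" and w: "w \<in> lists (letters X)"
  shows "hp XC (rv (epath c w)) (epath (c #> word_val G \<phi> w) (word_inv w))"
proof -
  let ?d = "c #> word_val G \<phi> w"
  have d: "?d \<in> rcosets A" and wi: "word_inv w \<in> lists (letters X)"
    using coset_act[OF c word_val_closed[OF w]] word_inv_lists[OF w] by auto
  have "word_val G \<phi> (w @ word_inv w) = \<one>"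
    using w wi by (simp add: word_val_append word_val_inv word_val_closed)
  then have "word_cong (letters X) (group_relations X R) (w @ word_inv w) []"
    using w wi by (intro word_val_one) auto
  from word_cong_epath[OF this c]
  have "hp XC (epath c (w @ word_inv w)) (\<lambda>_. VertexPt c)" by (simp add: epath_Nil)
  then have "hp XC (join_loops (epath c w) (epath ?d (word_inv w))) (\<lambda>_. VertexPt c)"
    using epath_append[OF c w wi] hp_sym hp_trans by blast
  from hp_solve_left[OF this epath(1)[OF c w] epath(1)[OF d wi]]
  have "hp XC (epath ?d (word_inv w)) (join_loops (rv (epath c w)) (\<lambda>_. VertexPt c))"
    using epath(3)[OF c w] epath(2)[OF d wi] by simp
  also have "hp XC \<dots> (rv (epath c w))"
    using epath[OF c w] by (intro hp_runit pathin_rv) auto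
  finally show ?thesis by (rule hp_sym)
qed

end

context complex2 begin

lemma spoke_base: "f \<in> faces T \<Longrightarrow> spoke f 0 1 = VertexPt (base T f)"
  using bdry_base[of f] sector_rim[of f 0 0] by (simp add: spoke_def)

end

context cayley begin

lemma nth_coset_path:
  assumes c: "c \<in> rcosets A" and w: "w \<in> lists (letters X)" and i: "i < length w"
  shows "coset_path G \<phi> c w ! i = (let d = c #> word_val G \<phi> (take i w) in
    if snd (w ! i) then ((d, fst (w ! i)), True) else ((d #> inv (\<phi> (fst (w ! i))), fst (w ! i)), False))"
    "take i (coset_path G \<phi> c w) = coset_path G \<phi> c (take i w)"
proof -
  have spl: "take i w @ w ! i # drop (Suc i) w = w" using i by (simp add: id_take_nth_drop[symmetric])
  have t: "take i w \<in> lists (letters X)" using w by (auto dest: in_set_takeD)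
  have eq: "coset_path G \<phi> c w = coset_path G \<phi> c (take i w) @
      coset_path G \<phi> (c #> word_val G \<phi> (take i w)) (w ! i # drop (Suc i) w)"
    using coset_path_append[OF c t, of "w ! i # drop (Suc i) w"] unfolding spl .
  show "coset_path G \<phi> c w ! i = (let d = c #> word_val G \<phi> (take i w) in
    if snd (w ! i) then ((d, fst (w ! i)), True) else ((d #> inv (\<phi> (fst (w ! i))), fst (w ! i)), False))"
    unfolding eq using i by (simp add: nth_append coset_path_Cons Let_def del: coset_path.simps)
  show "take i (coset_path G \<phi> c w) = coset_path G \<phi> c (take i w)"
    unfolding eq using i by simp
qed

section \<open>Arc paths described by words in the generators\<close>

primrec cell_coset :: "('a set, 'a set \<times> 'x, 'a set \<times> ('x \<times> bool) list) point \<Rightarrow> 'a set" where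
  "cell_coset (VertexPt c) = c"
| "cell_coset (EdgePt e t) = fst e"
| "cell_coset (FacePt f z) = fst f"

text \<open>Connects each centre to the vertex assigned to it by \<open>cell_coset\<close>, that is,
  to the source of an edge or the base of a 2-cell. Through these legs, paths between centres are
  compared with edge paths.\<close>

primrec leg :: "('a set, 'a set \<times> 'x, 'a set \<times> ('x \<times> bool) list) point \<Rightarrow> real \<Rightarrow>
    ('a set, 'a set \<times> 'x, 'a set \<times> ('x \<times> bool) list) point" where
  "leg (VertexPt c) = (\<lambda>_. VertexPt c)"
| "leg (EdgePt e s) = (\<lambda>t. edge_map Cay e (t / 2))"
| "leg (FacePt f z) = rv (cx.spoke f 0)"

lemma leg:
  assumes "\<sigma> \<in> nodes Cay"
  shows "pathin XC (leg \<sigma>)" "leg \<sigma> 0 = VertexPt (cell_coset \<sigma>)" "leg \<sigma> 1 = \<sigma>" "cell_coset \<sigma> \<in> rcosets A"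
proof -
  have h: "path (\<lambda>t::real. t / 2)" unfolding path_def by (intro continuous_intros) auto
  have "pathin XC (leg \<sigma>) \<and> leg \<sigma> 0 = VertexPt (cell_coset \<sigma>) \<and> leg \<sigma> 1 = \<sigma> \<and> cell_coset \<sigma> \<in> rcosets A"
    using assms unfolding nodes_def
  proof (elim UnE imageE)
    fix v assume "\<sigma> = VertexPt v" "v \<in> verts Cay"
    then show ?thesis by (simp add: pathin_const cx.topspace_realization cell_points_def)
  next
    fix e assume e: "\<sigma> = EdgePt e (1/2)" "e \<in> edges Cay"
    then have "pathin XC (leg \<sigma>)" using cx.pathin_o_edge[OF e(2) h] by (auto simp: path_image_def)
    then show ?thesis using e by auto
  next
    fix f assume f: "\<sigma> = FacePt f 0" "f \<in> faces Cay"
    then show ?thesis using cx.pathin_spoke[OF f(2)] cx.spoke_base[OF f(2)] by (auto intro: pathin_rv)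
  qed
  then show "pathin XC (leg \<sigma>)" "leg \<sigma> 0 = VertexPt (cell_coset \<sigma>)" "leg \<sigma> 1 = \<sigma>" "cell_coset \<sigma> \<in> rcosets A"
    by auto
qed

text \<open>Up to the legs at its ends, \<open>p\<close> is the edge path of a word. Thus homotopy
  of paths between arbitrary centres is reduced to congruence of words.\<close>

definition follows :: "(real \<Rightarrow> ('a set, 'a set \<times> 'x, 'a set \<times> ('x \<times> bool) list) point) \<Rightarrow> bool" where
  "follows p \<longleftrightarrow> (\<exists>w\<in>lists (letters X). cell_coset (p 1) = cell_coset (p 0) #> word_val G \<phi> w \<and>
     hp XC (join_loops (leg (p 0)) p) (join_loops (epath (cell_coset (p 0)) w) (leg (p 1))))"

lemma follows_const:
  assumes "x \<in> nodes Cay" shows "follows (\<lambda>_. x)"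
  unfolding follows_def
proof (intro bexI[of _ "[]"] conjI)
  note l = leg[OF assms]
  show "cell_coset x = cell_coset x #> word_val G \<phi> []" using coset_one[OF l(4)] by simp
  have "hp XC (join_loops (leg x) (\<lambda>_. x)) (leg x)" using l by (intro hp_runit) auto
  also have "hp XC \<dots> (join_loops (epath (cell_coset x) []) (leg x))"
    unfolding epath_Nil using l by (intro hp_sym[OF hp_lunit]) auto
  finally show "hp XC (join_loops (leg x) (\<lambda>_. x)) (join_loops (epath (cell_coset x) []) (leg x))" .
qed simp

lemma follows_rv:
  assumes p: "pathin XC p" "p 0 \<in> nodes Cay" "p 1 \<in> nodes Cay" and fp: "follows p"
  shows "follows (rv p)"
proof -
  obtain w where w: "w \<in> lists (letters X)" "cell_coset (p 1) = cell_coset (p 0) #> word_val G \<phi> w"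
    and h: "hp XC (join_loops (leg (p 0)) p) (join_loops (epath (cell_coset (p 0)) w) (leg (p 1)))"
    using fp unfolding follows_def by blast
  note l0 = leg[OF p(2)] and l1 = leg[OF p(3)]
  let ?c = "cell_coset (p 0)"
  let ?P = "epath ?c w"
  note P = epath[OF l0(4) w(1)] and wi = word_inv_lists[OF w(1)]
  have P': "hp XC (rv ?P) (epath (cell_coset (p 1)) (word_inv w))"
    using rv_epath[OF l0(4) w(1)] w(2) by simp
  have "hp XC (leg (p 1)) (join_loops (rv ?P) (join_loops (leg (p 0)) p))"
    using P l1 w(2) by (intro hp_solve_left[OF hp_sym[OF h]]) auto
  then have "hp XC (join_loops (leg (p 1)) (rv p)) (join_loops (join_loops (rv ?P) (join_loops (leg (p 0)) p)) (rv p))"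
    using p l1 by (intro hp_join hp_refl pathin_rv) auto
  also have "hp XC \<dots> (join_loops (rv ?P) (join_loops (join_loops (leg (p 0)) p) (rv p)))"
    using p l0 P by (intro hp_assoc pathin_rv pathin_join) auto
  also have "hp XC \<dots> (join_loops (rv ?P) (leg (p 0)))"
    using p l0 P by (intro hp_join hp_refl hp_cancel_right pathin_rv) auto
  also have "hp XC \<dots> (join_loops (epath (cell_coset (p 1)) (word_inv w)) (leg (p 0)))"
    using P' l0 P by (intro hp_join hp_refl) auto
  finally have 1: "hp XC (join_loops (leg (p 1)) (rv p)) (join_loops (epath (cell_coset (p 1)) (word_inv w)) (leg (p 0)))" .
  have 2: "?c = cell_coset (p 1) #> word_val G \<phi> (word_inv w)"
    using w l0(4) by (simp add: word_val_inv word_val_closed coset_act_assoc coset_one)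
  show ?thesis unfolding follows_def using 1 2 wi by (intro bexI[of _ "word_inv w"]) auto
qed

lemma follows_join:
  assumes p: "pathin XC p" "p 0 \<in> nodes Cay" "p 1 \<in> nodes Cay" "follows p"
    and q: "pathin XC q" "q 1 \<in> nodes Cay" "follows q" "p 1 = q 0"
  shows "follows (join_loops p q)"
proof -
  obtain v where v: "v \<in> lists (letters X)" "cell_coset (p 1) = cell_coset (p 0) #> word_val G \<phi> v"
    and hv: "hp XC (join_loops (leg (p 0)) p) (join_loops (epath (cell_coset (p 0)) v) (leg (p 1)))"
    using p(4) unfolding follows_def by blast
  obtain w where w: "w \<in> lists (letters X)" "cell_coset (q 1) = cell_coset (p 1) #> word_val G \<phi> w"
    and hw: "hp XC (join_loops (leg (p 1)) q) (join_loops (epath (cell_coset (p 1)) w) (leg (q 1)))"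
    using q(3,4) unfolding follows_def by auto
  note l0 = leg[OF p(2)] and l1 = leg[OF p(3)] and l2 = leg[OF q(2)]
  note P = epath[OF l0(4) v(1)] and Q = epath[OF l1(4) w(1)]
  let ?P = "epath (cell_coset (p 0)) v" and ?Q = "epath (cell_coset (p 1)) w"
  have "hp XC (join_loops (leg (p 0)) (join_loops p q)) (join_loops (join_loops (leg (p 0)) p) q)"
    using p q l0 by (intro hp_sym[OF hp_assoc]) auto
  also have "hp XC \<dots> (join_loops (join_loops ?P (leg (p 1))) q)"
    by (rule hp_join[OF hv hp_refl[OF q(1)]]) (use q in simp)
  also have "hp XC \<dots> (join_loops ?P (join_loops (leg (p 1)) q))"
    using P l1 q v by (intro hp_assoc) auto
  also have "hp XC \<dots> (join_loops ?P (join_loops ?Q (leg (q 1))))"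
    by (rule hp_join[OF hp_refl[OF P(1)] hw]) (use P l1 v in simp)
  also have "hp XC \<dots> (join_loops (join_loops ?P ?Q) (leg (q 1)))"
    using P Q l2 v w by (intro hp_sym[OF hp_assoc]) auto
  also have "hp XC \<dots> (join_loops (epath (cell_coset (p 0)) (v @ w)) (leg (q 1)))"
    using epath_append[OF l0(4) v(1) w(1)] v(2) l2 Q w by (intro hp_join hp_refl hp_sym[OF epath_append[OF l0(4) v(1) w(1), folded v(2)]]) auto
  finally have 1: "hp XC (join_loops (leg (p 0)) (join_loops p q)) (join_loops (epath (cell_coset (p 0)) (v @ w)) (leg (q 1)))" .
  have 2: "cell_coset (q 1) = cell_coset (p 0) #> word_val G \<phi> (v @ w)"
    using v w l0(4) by (simp add: word_val_append word_val_closed coset_act_assoc)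
  show ?thesis unfolding follows_def using 1 2 v(1) w(1) by (intro bexI[of _ "v @ w"]) auto
qed

lemma hp_edge_line:
  assumes "e \<in> edges Cay" "a \<in> {0..1}" "b \<in> {0..1}" "c \<in> {0..1}"
  shows "hp XC (join_loops (\<lambda>t. edge_map Cay e (linepath a b t)) (\<lambda>t. edge_map Cay e (linepath b c t)))
    (\<lambda>t. edge_map Cay e (linepath a c t))"
proof -
  have im: "path_image (linepath x y) \<subseteq> {0..1}" if "x \<in> {0..1}" "y \<in> {0..1}" for x y :: real
    using that by (simp only: path_image_linepath closed_segment_subset convex_real_interval)
  have j: "path (linepath a b +++ linepath b c)" "path_image (linepath a b +++ linepath b c) \<subseteq> {0..1}"
    using assms by (intro path_join_imp subset_path_image_join im; simp)+
  have "hp XC (\<lambda>t. edge_map Cay e ((linepath a b +++ linepath b c) t)) (\<lambda>t. edge_map Cay e (linepath a c t))"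
    by (rule cx.hp_o_edge[OF assms(1) j path_linepath im[OF assms(2,4)]]) (simp_all add: joinpaths_def linepath_0' linepath_1')
  moreover have "join_loops (\<lambda>t. edge_map Cay e (linepath a b t)) (\<lambda>t. edge_map Cay e (linepath b c t)) =
      (\<lambda>t. edge_map Cay e ((linepath a b +++ linepath b c) t))"
    by (auto simp: join_loops_def joinpaths_def)
  ultimately show ?thesis by simp
qed

text \<open>The word is empty for an arc to a source or a base, one generator for an arc to a
  target, and a prefix of the relator for a radius to a boundary edge.\<close>

lemma follows_arc:
  assumes "p \<in> arcs Cay" shows "follows p"
proof -
  note ap = cx.arcs_path[OF assms]
  note l0 = leg[OF ap(2)] and l1 = leg[OF ap(3)]
  show ?thesis
    using assms
  proof cases
    case (arc_src e)
    have e: "fst e \<in> rcosets A" using arc_src by auto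
    have p: "p 0 = EdgePt e (1/2)" "p 1 = VertexPt (fst e)" using arc_src by auto
    have "hp XC (join_loops (leg (p 0)) p) (\<lambda>t. edge_map Cay e (linepath 0 0 t))"
      using hp_edge_line[OF arc_src(2), of 0 "1/2" 0] arc_src(1) p by (simp add: linepath_def)
    also have "(\<lambda>t. edge_map Cay e (linepath 0 0 t)) = leg (p 1)" using p by (simp add: linepath_def)
    also have "hp XC (leg (p 1)) (join_loops (epath (cell_coset (p 0)) []) (leg (p 1)))"
      unfolding epath_Nil using l1 p by (intro hp_sym[OF hp_lunit]) auto
    finally show ?thesis unfolding follows_def using p e by (intro bexI[of _ "[]"]) (auto simp: coset_one)
  next
    case (arc_tgt e)
    obtain c x where e: "e = (c, x)" "c \<in> rcosets A" "x \<in> X" using arc_tgt(2) by auto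
    have p: "p 0 = EdgePt e (1/2)" "p 1 = VertexPt (c #> \<phi> x)" using arc_tgt e by auto
    have xl: "[(x, True)] \<in> lists (letters X)" using e by (simp add: letters_def)
    have wv: "word_val G \<phi> [(x, True)] = \<phi> x" using gen_closed[OF e(3)] by (simp add: letter_val_def)
    have "hp XC (join_loops (leg (p 0)) p) (\<lambda>t. edge_map Cay e (linepath 0 1 t))"
      using hp_edge_line[OF arc_tgt(2), of 0 "1/2" 1] arc_tgt(1) p by (simp add: linepath_def field_simps)
    also have "(\<lambda>t. edge_map Cay e (linepath 0 1 t)) = letter_map Cay (e, True)" by (simp add: linepath_def letter_map_def[abs_def])
    also have "hp XC (letter_map Cay (e, True)) (epath c [(x, True)])"
      using cx.edge_path_single[of "(e, True)"] arc_tgt(2) e by (simp add: epath_def hp_sym)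
    also have "hp XC (epath c [(x, True)]) (join_loops (epath c [(x, True)]) (leg (p 1)))"
      using p epath[OF e(2) xl] wv by (simp add: hp_sym[OF hp_runit])
    finally show ?thesis unfolding follows_def using p e xl wv by (intro bexI[of _ "[(x, True)]"]) auto
  next
    case (arc_base f)
    have f: "fst f \<in> rcosets A" using arc_base by auto
    have p: "p = cx.spoke f 0" using arc_base by (simp add: cx.spoke_def)
    have p01: "p 0 = FacePt f 0" "p 1 = VertexPt (fst f)" using cx.pathin_spoke[OF arc_base(2)] cx.spoke_base[OF arc_base(2)] p by auto
    have "hp XC (join_loops (leg (p 0)) p) (\<lambda>_. VertexPt (fst f))"
      using p p01 ap(1) by (auto intro!: hp_linv)
    also have "hp XC \<dots> (join_loops (epath (cell_coset (p 0)) []) (leg (p 1)))"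
      unfolding epath_Nil using l1 p01 by (auto intro!: hp_sym[OF hp_lunit])
    finally show ?thesis unfolding follows_def using p01 f by (intro bexI[of _ "[]"]) (auto simp: coset_one)
  next
    case (arc_face f i)
    obtain c r where f: "f = (c, r)" "c \<in> rcosets A" "r \<in> R" using arc_face(2) by auto
    have r: "r \<in> lists (letters X)" "i < length r" using f rels arc_face by auto
    let ?l = "bdry Cay f ! i" and ?d = "c #> word_val G \<phi> (take i r)" and ?x = "fst (r ! i)"
    have t: "take i r \<in> lists (letters X)" "take (Suc i) r \<in> lists (letters X)"
      using r by (auto dest: in_set_takeD)
    have d: "?d \<in> rcosets A" using coset_act[OF f(2) word_val_closed[OF t(1)]] .
    have "r ! i \<in> letters X" using r nth_mem[OF r(2)] by auto
    then have x: "?x \<in> X" by (auto simp: letters_def)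
    have l: "?l = (if snd (r ! i) then ((?d, ?x), True) else ((?d #> inv (\<phi> ?x), ?x), False))"
      using nth_coset_path(1)[OF f(2) r] f by (simp add: Let_def)
    have le: "fst ?l \<in> edges Cay" using d x gen_closed[OF x] l coset_act[OF d] by auto
    have ls: "lstart Cay ?l = ?d"
      using l d gen_closed[OF x] by (auto simp: lstart_def coset_act_assoc coset_one)
    have w: "walk Cay (base Cay f) (bdry Cay f) (base Cay f)"
      using walk_coset_path[OF f(2) r(1)] f word_val_rel[OF f(3)] coset_one[OF f(2)] by simp
    have p01: "p 0 = FacePt f 0" "p 1 = EdgePt (fst ?l) (1/2)"
      using arc_face(1) cx.letter_map_sector[OF arc_face(2,3), of "1/2"] by (auto simp: letter_map_def)
    let ?E = "epath c (take i r)" and ?h = "\<lambda>a. letter_map Cay ?l (1/2 * a)"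
    let ?s = "cx.spoke f 0"
    note s = cx.pathin_spoke[OF arc_face(2), of 0] cx.spoke_base[OF arc_face(2)]
    note E = epath[OF f(2) t(1)]
    have "bdry Cay f \<noteq> []" using arc_face(3) by (metis length_greater_0_conv less_nat_zero_code list.size(3))
    then have SE: "hp XC (join_loops ?s ?E) (cx.spoke f i)"
      using cx.spoke_edge_path[OF arc_face(2) w, of i] nth_coset_path(2)[OF f(2) r] arc_face(3) f
      by (simp add: epath_def)
    have sl: "hp XC (join_loops (cx.spoke f i) ?h) p"
      using cx.spoke_letter[OF arc_face(2,3), of "1/2"] arc_face(1) by simp
    have h: "pathin XC ?h"
    proof -
      have "pathin XC (letter_map Cay ?l \<circ> (\<lambda>a. 1/2 * a))"
        using cx.pathin_letter_map[OF le] unfolding pathin_def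
        by (rule continuous_map_compose[rotated]) (auto intro!: continuous_intros)
      then show ?thesis by (simp add: o_def)
    qed
    have h0: "?h 0 = VertexPt ?d" using ls by simp
    have "hp XC p (join_loops (cx.spoke f i) ?h)" by (rule hp_sym[OF sl])
    also have "hp XC \<dots> (join_loops (join_loops ?s ?E) ?h)"
      by (rule hp_join[OF hp_sym[OF SE] hp_refl[OF h]]) (use hp_1[OF SE] ls E in simp)
    also have "hp XC \<dots> (join_loops ?s (join_loops ?E ?h))"
      using s E h h0 f by (intro hp_assoc) auto
    finally have "hp XC (join_loops ?s (join_loops ?E ?h)) p" by (rule hp_sym)
    then have "hp XC (join_loops ?E ?h) (join_loops (rv ?s) p)"
      using s E h h0 f by (intro hp_solve_left pathin_join) auto
    then have 1: "hp XC (join_loops (leg (p 0)) p) (join_loops ?E ?h)" using p01 by (simp add: hp_sym)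
    show ?thesis
    \<comment> \<open>An edge traversed backwards is based at the far end of the letter. Its centre
      is then reached from its base after \<open>Suc i\<close> letters by going back half the edge,
      whereas a forward letter needs only the first \<open>i\<close> letters.\<close>
    proof (cases "snd (r ! i)")
      case True
      have "?h = leg (p 1)" using p01 l True by (simp add: letter_map_def[abs_def])
      then show ?thesis
        unfolding follows_def using 1 p01 l True t f by (intro bexI[of _ "take i r"]) auto
    next
      case False
      let ?e = "fst ?l"
      have sp: "take (Suc i) r = take i r @ [r ! i]" using r by (simp add: take_Suc_conv_app_nth)
      have ri: "r ! i = (?x, False)" using False by (cases "r ! i") auto
      have ril: "[r ! i] \<in> lists (letters X)" using r nth_mem[of i r] by auto
      have cp: "coset_path G \<phi> ?d [r ! i] = [?l]" using l False by simp
      have wv: "?d #> inv (\<phi> ?x) = c #> word_val G \<phi> (take (Suc i) r)"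
        unfolding sp using t ril f gen_closed[OF x] False
        by (simp add: word_val_append coset_act_assoc word_val_closed letter_val_def)
      have "hp XC (epath c (take (Suc i) r)) (join_loops ?E (epath ?d [r ! i]))"
        unfolding sp by (rule epath_append[OF f(2) t(1) ril])
      also have "hp XC \<dots> (join_loops ?E (letter_map Cay ?l))"
        using E cx.edge_path_single[OF le] epath[OF d ril] cp ls
        by (intro hp_join hp_refl) (auto simp: epath_def)
      finally have 2: "hp XC (epath c (take (Suc i) r)) (join_loops ?E (letter_map Cay ?l))" .
      have lm: "letter_map Cay ?l = (\<lambda>t. edge_map Cay ?e (linepath 1 0 t))" "?h = (\<lambda>t. edge_map Cay ?e (linepath 1 (1/2) t))"
        "leg (p 1) = (\<lambda>t. edge_map Cay ?e (linepath 0 (1/2) t))"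
        using l False p01 by (auto simp: letter_map_def fun_eq_iff linepath_def field_simps intro!: arg_cong[where f = "edge_map Cay ?e"])
      have 3: "hp XC (join_loops (letter_map Cay ?l) (leg (p 1))) ?h"
        unfolding lm(2) unfolding lm(1,3) by (rule hp_edge_line[OF le]) auto
      have lend: "letter_map Cay ?l 1 = leg (p 1) 0" using lm by (simp add: linepath_0' linepath_1')
      have "hp XC (join_loops ?E ?h) (join_loops ?E (join_loops (letter_map Cay ?l) (leg (p 1))))"
        using E h0 3 by (intro hp_join hp_refl hp_sym[OF 3]) auto
      also have "hp XC \<dots> (join_loops (join_loops ?E (letter_map Cay ?l)) (leg (p 1)))"
        using E l1 cx.pathin_letter_map[OF le] ls lend by (intro hp_sym[OF hp_assoc]) auto
      also have "hp XC \<dots> (join_loops (epath c (take (Suc i) r)) (leg (p 1)))"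
        using 2 l1 lend by (intro hp_join hp_refl hp_sym[OF 2]) auto
      finally have 4: "hp XC (join_loops ?E ?h) (join_loops (epath c (take (Suc i) r)) (leg (p 1)))" .
      have cc: "cell_coset (p 1) = ?d #> inv (\<phi> ?x)" "cell_coset (p 0) = c" using p01 l False f by auto
      show ?thesis
        unfolding follows_def cc wv using hp_trans[OF 1 4] t by (intro bexI[of _ "take (Suc i) r"]) auto
    qed
  qed
qed

lemma follows_arc_paths:
  "p \<in> arc_paths Cay S \<Longrightarrow> p 0 \<in> nodes Cay \<Longrightarrow> pathin XC p \<and> p 1 \<in> nodes Cay \<and> follows p"
proof (induction rule: arc_paths.induct)
  case (const x)
  then show ?case using leg[OF const(2)] by (auto intro!: follows_const pathin_const dest: pathin_ends)
next
  case (arc p)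
  then show ?case using cx.arcs_path[OF arc(1)] follows_arc by blast
next
  case (rv_arc p)
  note ap = cx.arcs_path[OF rv_arc(1)]
  show ?case using ap follows_rv[OF ap follows_arc[OF rv_arc(1)]] pathin_rv[OF ap(1)] by auto
next
  case (join p q)
  then have "pathin XC p \<and> p 1 \<in> nodes Cay \<and> follows p" "p 0 \<in> nodes Cay" by auto
  moreover from this have "pathin XC q \<and> q 1 \<in> nodes Cay \<and> follows q" using join by auto
  ultimately show ?case using join(3) follows_join[of p q] pathin_join[of XC p q] by auto
qed

text \<open>Simple connectivity of the universal covering, on the level of arcs: cosets of the
  trivial subgroup are singletons, so the word followed by a closed path has value one and is
  congruent to the empty word.\<close>

lemma arc_paths_null:
  assumes A1: "A = {\<one>}" and p: "p \<in> arc_paths Cay S" "p 0 \<in> nodes Cay" "p 1 = p 0"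
  shows "hp XC p (\<lambda>_. p 0)"
proof -
  note f = follows_arc_paths[OF p(1,2)]
  then obtain w where w: "w \<in> lists (letters X)" "cell_coset (p 0) = cell_coset (p 0) #> word_val G \<phi> w"
    and h: "hp XC (join_loops (leg (p 0)) p) (join_loops (epath (cell_coset (p 0)) w) (leg (p 0)))"
    unfolding follows_def using p(3) by auto
  note l = leg[OF p(2)]
  obtain g where g: "g \<in> carrier G" "cell_coset (p 0) = {g}"
    using l(4) A1 by (auto simp: RCOSETS_def r_coset_def)
  then have "g = g \<otimes> word_val G \<phi> w" using w(2) by (auto simp: r_coset_def)
  then have "word_val G \<phi> w = \<one>" using g(1) word_val_closed[OF w(1)] by (simp only: l_cancel_one')
  then have "word_cong (letters X) (group_relations X R) w []" by (rule word_val_one[OF w(1)])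
  from word_cong_epath[OF this l(4)]
  have n: "hp XC (epath (cell_coset (p 0)) w) (\<lambda>_. VertexPt (cell_coset (p 0)))" by (simp add: epath_Nil)
  have "hp XC (join_loops (leg (p 0)) p) (join_loops (\<lambda>_. VertexPt (cell_coset (p 0))) (leg (p 0)))"
    by (rule hp_trans[OF h hp_join[OF n hp_refl[OF l(1)]]])
      (use epath(3)[OF l(4) w(1)] w(2) l in simp)
  also have "hp XC \<dots> (leg (p 0))" using l by (intro hp_lunit) auto
  finally have "hp XC p (join_loops (rv (leg (p 0))) (leg (p 0)))"
    using l f by (intro hp_solve_left) auto
  also have "hp XC \<dots> (\<lambda>_. p 0)" using l by (intro hp_linv) auto
  finally show ?thesis .
qed

end

section \<open>Paths and connected components\<close>

lemma component_subset:
  assumes L: "L \<in> connected_components_of X" and x: "x \<in> L" and S: "connectedin X S" "x \<in> S"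
  shows "S \<subseteq> L"
proof -
  obtain a where a: "L = Collect (connected_component_of X a)"
    using L by (auto simp: connected_components_of_def)
  then have "connected_component_of X a x" using x by simp
  then have "L = Collect (connected_component_of X x)"
    unfolding a by (auto intro: connected_component_of_trans connected_component_of_sym[THEN iffD1])
  then show ?thesis using connected_component_of_maximal[OF S] by simp
qed

lemma pathin_component:
  assumes L: "L \<in> connected_components_of X" and p: "pathin X p" "p 0 \<in> L"
  shows "pathin (subtopology X L) p"
proof -
  have "connectedin X (p ` {0..1})" using p(1) by (rule connectedin_path_image)
  then have "p ` {0..1} \<subseteq> L" using component_subset[OF L p(2)] by auto
  then show ?thesis using p(1) by (auto simp: pathin_def continuous_map_in_subtopology)
qed

text \<open>The image of the homotopy square is connected, so it cannot leave the component of its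
  starting point.\<close>

lemma hp_component:
  assumes L: "L \<in> connected_components_of X" and h: "hp X p q" "p 0 \<in> L"
  shows "hp (subtopology X L) p q"
proof -
  let ?I = "top_of_set {0..1::real}"
  obtain k where k: "continuous_map (prod_topology ?I ?I) X k" "\<And>x. k (0, x) = p x" "\<And>x. k (1, x) = q x"
    "\<And>t. t \<in> {0..1} \<Longrightarrow> k (t, 0) = p 0 \<and> k (t, 1) = p 1"
    using h(1) unfolding hp_def homotopic_with_def by blast
  have "connected_space (prod_topology ?I ?I)"
    by (simp add: connected_space_prod_topology connected_space_subtopology)
  then have "connectedin X (k ` topspace (prod_topology ?I ?I))"
    by (intro connectedin_continuous_map_image[OF k(1)]) (simp add: connectedin_topspace)
  moreover have "p 0 \<in> k ` topspace (prod_topology ?I ?I)" using k(2)[of 0] by force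
  ultimately have "k ` topspace (prod_topology ?I ?I) \<subseteq> L" by (rule component_subset[OF L h(2)])
  then have "continuous_map (prod_topology ?I ?I) (subtopology X L) k"
    using k(1) by (auto simp: continuous_map_in_subtopology)
  then have "homotopic_with (\<lambda>r. r 0 = p 0 \<and> r 1 = p 1) ?I (subtopology X L) p q"
    unfolding homotopic_with_def by (intro exI[of _ k]) (use k in auto)
  then show ?thesis using h(1) by (simp add: hp_def)
qed

section \<open>Mapping Cayley complexes\<close>

definition restrict_complex :: "('v, 'e, 'f) two_complex \<Rightarrow> 'e set \<Rightarrow> 'f set \<Rightarrow> ('v, 'e, 'f) two_complex" where
  "restrict_complex T E F = T\<lparr>edges := E, faces := F\<rparr>"

lemma restrict_complex_simps [simp]:
  "verts (restrict_complex T E F) = verts T" "edges (restrict_complex T E F) = E"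
  "faces (restrict_complex T E F) = F" "src (restrict_complex T E F) = src T"
  "tgt (restrict_complex T E F) = tgt T" "base (restrict_complex T E F) = base T"
  "bdry (restrict_complex T E F) = bdry T"
  by (simp_all add: restrict_complex_def)

lemma edge_map_restrict [simp]: "edge_map (restrict_complex T E F) = edge_map T"
  by (simp add: edge_map_def fun_eq_iff)

lemma sector_restrict [simp]: "sector (restrict_complex T E F) = sector T"
proof -
  have "attaching_map (restrict_complex T E F) = attaching_map T"
    by (rule ext, rule ext) (simp add: attaching_map_def Let_def)
  then show ?thesis by (simp add: sector_def face_map_def sectors_def fun_eq_iff)
qed

lemma nodes_subset_cells: "nodes T \<subseteq> cell_points (verts T) (edges T) (faces T)"
proof
  fix x assume "x \<in> nodes T"
  then consider c where "c \<in> verts T" "x = VertexPt c" | e where "e \<in> edges T" "x = EdgePt e (1/2)"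
    | f where "f \<in> faces T" "x = FacePt f 0" by (auto simp: nodes_def)
  then show "x \<in> cell_points (verts T) (edges T) (faces T)"
  proof cases
    case 2
    then have "x \<in> {EdgePt e t |e t. e \<in> edges T \<and> 0 < t \<and> t < 1}"
      by (intro CollectI exI[of _ e] exI[of _ "1/2"]) simp
    then show ?thesis unfolding cell_points_def by blast
  qed (auto simp: cell_points_def)
qed

text \<open>\<open>\<epsilon>\<close> renames the generators of the factor as generators of the
  large group. Its injectivity, and the choice of \<open>B\<close> as the stabilizer of the coset of
  \<open>g\<close>, make the induced map of coverings injective on cells.\<close>

locale cayley_map = M: cayley M XM \<phi>M RM B + G: cayley G X \<phi> R A
  for M :: "('b, 'k) monoid_scheme" and XM :: "'y set" and \<phi>M RM B
    and G :: "('a, 'm) monoid_scheme" and X :: "'x set" and \<phi> R A +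
  fixes j :: "'b \<Rightarrow> 'a" and \<epsilon> :: "'y \<Rightarrow> 'x" and g :: 'a
  assumes hom: "j \<in> hom M G" and inj_\<epsilon>: "inj \<epsilon>" and \<epsilon>_X: "x \<in> XM \<Longrightarrow> \<epsilon> x \<in> X"
    and \<phi>_\<epsilon>: "x \<in> XM \<Longrightarrow> \<phi> (\<epsilon> x) = j (\<phi>M x)"
    and enc_R: "r \<in> RM \<Longrightarrow> map (map_prod \<epsilon> id) r \<in> R"
    and g: "g \<in> carrier G"
    and B_eq: "B = {h \<in> carrier M. A #>\<^bsub>G\<^esub> (g \<otimes>\<^bsub>G\<^esub> j h) = A #>\<^bsub>G\<^esub> g}"
begin

abbreviation "enc \<equiv> map (map_prod \<epsilon> (id :: bool \<Rightarrow> bool))"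

sublocale h: group_hom M G j
  using hom by unfold_locales

text \<open>A product of sets avoids choosing representatives of cosets; \<open>iv_coset\<close>
  computes it on the coset of \<open>h\<close> as the coset of
  \<open>g \<otimes> j h\<close>.\<close>

definition iv :: "'b set \<Rightarrow> 'a set" where
  "iv c = (A #>\<^bsub>G\<^esub> g) <#>\<^bsub>G\<^esub> (j ` c)"

definition ie :: "'b set \<times> 'y \<Rightarrow> 'a set \<times> 'x" where
  "ie e = (iv (fst e), \<epsilon> (snd e))"

definition ifc :: "'b set \<times> ('y \<times> bool) list \<Rightarrow> 'a set \<times> ('x \<times> bool) list" where
  "ifc f = (iv (fst f), enc (snd f))"

definition inc where "inc = map_point iv ie ifc"

lemma inc_simps [simp]:
  "inc (VertexPt c) = VertexPt (iv c)" "inc (EdgePt e t) = EdgePt (ie e) t" "inc (FacePt f z) = FacePt (ifc f) z"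
  by (simp_all add: inc_def)

lemma act_g: "h \<in> carrier M \<Longrightarrow> A #>\<^bsub>G\<^esub> g #>\<^bsub>G\<^esub> j h = A #>\<^bsub>G\<^esub> (g \<otimes>\<^bsub>G\<^esub> j h)"
  using G.A_sub g by (simp add: G.coset_mult_assoc)

lemma iv_coset:
  assumes "h \<in> carrier M" shows "iv (B #>\<^bsub>M\<^esub> h) = A #>\<^bsub>G\<^esub> (g \<otimes>\<^bsub>G\<^esub> j h)"
proof (rule subset_antisym)
  have sub: "A #>\<^bsub>G\<^esub> g \<subseteq> carrier G" using G.r_coset_subset_G[OF G.A_sub g] .
  show "iv (B #>\<^bsub>M\<^esub> h) \<subseteq> A #>\<^bsub>G\<^esub> (g \<otimes>\<^bsub>G\<^esub> j h)"
  proof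
    fix x assume "x \<in> iv (B #>\<^bsub>M\<^esub> h)"
    then obtain y b where y: "y \<in> A #>\<^bsub>G\<^esub> g" and b: "b \<in> B" and x: "x = y \<otimes>\<^bsub>G\<^esub> j (b \<otimes>\<^bsub>M\<^esub> h)"
      by (auto simp: iv_def set_mult_def r_coset_def)
    have bc: "b \<in> carrier M" "A #>\<^bsub>G\<^esub> g #>\<^bsub>G\<^esub> j b = A #>\<^bsub>G\<^esub> g" using b B_eq act_g by auto
    have "y \<otimes>\<^bsub>G\<^esub> j b \<in> A #>\<^bsub>G\<^esub> g #>\<^bsub>G\<^esub> j b" using y by (auto simp: r_coset_def)
    then have "y \<otimes>\<^bsub>G\<^esub> j b \<in> A #>\<^bsub>G\<^esub> g" by (simp only: bc(2))
    then have "(y \<otimes>\<^bsub>G\<^esub> j b) \<otimes>\<^bsub>G\<^esub> j h \<in> A #>\<^bsub>G\<^esub> g #>\<^bsub>G\<^esub> j h" by (auto simp: r_coset_def)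
    moreover have "x = (y \<otimes>\<^bsub>G\<^esub> j b) \<otimes>\<^bsub>G\<^esub> j h" using x bc assms y sub by (simp add: G.m_assoc subsetD)
    ultimately show "x \<in> A #>\<^bsub>G\<^esub> (g \<otimes>\<^bsub>G\<^esub> j h)" using act_g[OF assms] by simp
  qed
  show "A #>\<^bsub>G\<^esub> (g \<otimes>\<^bsub>G\<^esub> j h) \<subseteq> iv (B #>\<^bsub>M\<^esub> h)"
  proof
    fix x assume "x \<in> A #>\<^bsub>G\<^esub> (g \<otimes>\<^bsub>G\<^esub> j h)"
    then have "x \<in> A #>\<^bsub>G\<^esub> g #>\<^bsub>G\<^esub> j h" using act_g[OF assms] by simp
    then obtain y where y: "y \<in> A #>\<^bsub>G\<^esub> g" "x = y \<otimes>\<^bsub>G\<^esub> j h" by (auto simp: r_coset_def)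
    have "h \<in> B #>\<^bsub>M\<^esub> h" using M.rcos_self[OF assms M.A] .
    then show "x \<in> iv (B #>\<^bsub>M\<^esub> h)" using y by (auto simp: iv_def set_mult_def)
  qed
qed

lemma rcosets_M: "c \<in> rcosets\<^bsub>M\<^esub> B \<Longrightarrow> \<exists>h\<in>carrier M. c = B #>\<^bsub>M\<^esub> h"
  by (auto simp: RCOSETS_def)

lemma iv_closed: "c \<in> rcosets\<^bsub>M\<^esub> B \<Longrightarrow> iv c \<in> rcosets\<^bsub>G\<^esub> A"
  using rcosets_M[of c] iv_coset g by (auto intro!: G.rcosetsI[OF G.A_sub])

lemma iv_act:
  assumes "c \<in> rcosets\<^bsub>M\<^esub> B" "m \<in> carrier M" shows "iv (c #>\<^bsub>M\<^esub> m) = iv c #>\<^bsub>G\<^esub> j m"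
proof -
  obtain h where h: "h \<in> carrier M" "c = B #>\<^bsub>M\<^esub> h" using rcosets_M assms by blast
  then have "c #>\<^bsub>M\<^esub> m = B #>\<^bsub>M\<^esub> (h \<otimes>\<^bsub>M\<^esub> m)" using assms M.A_sub by (simp add: M.coset_mult_assoc)
  then show ?thesis using h assms g G.A_sub by (simp add: iv_coset G.coset_mult_assoc G.m_assoc)
qed

lemma iv_inj:
  assumes "c \<in> rcosets\<^bsub>M\<^esub> B" "d \<in> rcosets\<^bsub>M\<^esub> B" "iv c = iv d" shows "c = d"
proof -
  obtain h k where h: "h \<in> carrier M" "c = B #>\<^bsub>M\<^esub> h" and k: "k \<in> carrier M" "d = B #>\<^bsub>M\<^esub> k"
    using rcosets_M assms by metis
  have hk: "h \<otimes>\<^bsub>M\<^esub> inv\<^bsub>M\<^esub> k \<in> carrier M" using h k by simp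
  have "A #>\<^bsub>G\<^esub> (g \<otimes>\<^bsub>G\<^esub> j h) = A #>\<^bsub>G\<^esub> (g \<otimes>\<^bsub>G\<^esub> j k)" using assms(3) h k by (simp add: iv_coset)
  then have "A #>\<^bsub>G\<^esub> (g \<otimes>\<^bsub>G\<^esub> j h) #>\<^bsub>G\<^esub> j (inv\<^bsub>M\<^esub> k) = A #>\<^bsub>G\<^esub> (g \<otimes>\<^bsub>G\<^esub> j k) #>\<^bsub>G\<^esub> j (inv\<^bsub>M\<^esub> k)" by simp
  then have "A #>\<^bsub>G\<^esub> (g \<otimes>\<^bsub>G\<^esub> j (h \<otimes>\<^bsub>M\<^esub> inv\<^bsub>M\<^esub> k)) = A #>\<^bsub>G\<^esub> g"
    using h k g G.A_sub by (simp add: G.coset_mult_assoc G.m_assoc)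
  then have "h \<otimes>\<^bsub>M\<^esub> inv\<^bsub>M\<^esub> k \<in> B" using hk B_eq by simp
  then have "B #>\<^bsub>M\<^esub> (h \<otimes>\<^bsub>M\<^esub> inv\<^bsub>M\<^esub> k) = B" using M.coset_join2[OF hk M.A] by simp
  then show ?thesis using h k M.coset_mult_inv1 M.A_sub by simp
qed

text \<open>An orbit can be followed backwards as well. So a cell labelled by the factor lies over
  the orbit as soon as one of the vertices on its boundary path does.\<close>

lemma iv_image_act:
  assumes "c \<in> rcosets\<^bsub>G\<^esub> A" "m \<in> carrier M" "c #>\<^bsub>G\<^esub> j m \<in> iv ` (rcosets\<^bsub>M\<^esub> B)"
  shows "c \<in> iv ` (rcosets\<^bsub>M\<^esub> B)"
proof -
  obtain d where d: "d \<in> rcosets\<^bsub>M\<^esub> B" "c #>\<^bsub>G\<^esub> j m = iv d" using assms by auto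
  have "iv (d #>\<^bsub>M\<^esub> inv\<^bsub>M\<^esub> m) = c #>\<^bsub>G\<^esub> j m #>\<^bsub>G\<^esub> j (inv\<^bsub>M\<^esub> m)" using d assms by (simp add: iv_act)
  also have "\<dots> = c" using assms G.coset_act_assoc[OF assms(1), of "j m" "j (inv\<^bsub>M\<^esub> m)"] G.coset_one by simp
  finally show ?thesis using M.coset_act[OF d(1)] assms(2) by (metis M.inv_closed image_eqI)
qed

lemma letter_val_enc: "l \<in> letters XM \<Longrightarrow> letter_val G \<phi> (map_prod \<epsilon> id l) = j (letter_val M \<phi>M l)"
  by (intro M.letter_val_map[OF h.group_hom_axioms] \<phi>_\<epsilon>)

lemma word_val_enc: "w \<in> lists (letters XM) \<Longrightarrow> word_val G \<phi> (enc w) = j (word_val M \<phi>M w)"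
  by (intro M.word_val_map[OF h.group_hom_axioms] \<phi>_\<epsilon>)

lemma coset_path_enc:
  "c \<in> rcosets\<^bsub>M\<^esub> B \<Longrightarrow> w \<in> lists (letters XM) \<Longrightarrow>
    coset_path G \<phi> (iv c) (enc w) = map (map_prod ie id) (coset_path M \<phi>M c w)"
proof (induction w arbitrary: c)
  case (Cons l w)
  then have l: "l \<in> letters XM" "fst l \<in> XM" "w \<in> lists (letters XM)" by (auto simp: letters_def)
  have c': "c #>\<^bsub>M\<^esub> letter_val M \<phi>M l \<in> rcosets\<^bsub>M\<^esub> B" using M.coset_act[OF Cons(2) M.letter_val_closed[OF l(1)]] .
  have eq1: "iv c #>\<^bsub>G\<^esub> letter_val G \<phi> (map_prod \<epsilon> id l) = iv (c #>\<^bsub>M\<^esub> letter_val M \<phi>M l)"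
    using Cons(2) l by (simp add: letter_val_enc iv_act M.letter_val_closed)
  have "iv c #>\<^bsub>G\<^esub> inv\<^bsub>G\<^esub> \<phi> (\<epsilon> (fst l)) = iv (c #>\<^bsub>M\<^esub> inv\<^bsub>M\<^esub> \<phi>M (fst l))"
    using Cons(2) l M.gen_closed[OF l(2)] by (simp add: \<phi>_\<epsilon> iv_act)
  then have hd: "(if snd (map_prod \<epsilon> id l) then ((iv c, fst (map_prod \<epsilon> id l)), True)
      else ((iv c #>\<^bsub>G\<^esub> inv\<^bsub>G\<^esub> \<phi> (fst (map_prod \<epsilon> id l)), fst (map_prod \<epsilon> id l)), False)) =
     map_prod ie id (if snd l then ((c, fst l), True) else ((c #>\<^bsub>M\<^esub> inv\<^bsub>M\<^esub> \<phi>M (fst l), fst l), False))"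
    by (simp add: ie_def)
  show ?case
    by (simp only: list.map M.coset_path_Cons G.coset_path_Cons hd eq1 Cons(1)[OF c' l(3)])
qed simp

lemma bdry_enc:
  "f \<in> faces M.Cay \<Longrightarrow> bdry G.Cay (ifc f) = map (map_prod ie id) (bdry M.Cay f)"
proof -
  assume "f \<in> faces M.Cay"
  then have "fst f \<in> rcosets\<^bsub>M\<^esub> B" "snd f \<in> lists (letters XM)" using M.rels by auto
  from coset_path_enc[OF this] show ?thesis by (simp only: ifc_def G.Cay_simps M.Cay_simps fst_conv snd_conv)
qed

lemma base_ifc: "base G.Cay (ifc f) = iv (base M.Cay f)"
  by (simp add: ifc_def)

lemma ie_edges: "e \<in> edges M.Cay \<Longrightarrow> ie e \<in> edges G.Cay"
  using iv_closed \<epsilon>_X by (auto simp: ie_def)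

lemma ifc_faces: "f \<in> faces M.Cay \<Longrightarrow> ifc f \<in> faces G.Cay"
  using iv_closed enc_R by (auto simp: ifc_def)

lemma src_ie: "src G.Cay (ie e) = iv (src M.Cay e)"
  by (simp add: ie_def)

lemma tgt_ie: "e \<in> edges M.Cay \<Longrightarrow> tgt G.Cay (ie e) = iv (tgt M.Cay e)"
  using M.gen_closed by (auto simp: ie_def \<phi>_\<epsilon> iv_act)

lemma edge_map_inc: "e \<in> edges M.Cay \<Longrightarrow> inc (edge_map M.Cay e t) = edge_map G.Cay (ie e) t"
  using src_ie[of e] tgt_ie[of e] inc_simps by (simp add: edge_map_def del: M.Cay_simps G.Cay_simps)

lemma face_map_inc:
  assumes f: "f \<in> faces M.Cay" shows "inc (face_map M.Cay f z) = face_map G.Cay (ifc f) z"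
proof (cases "cmod z < 1 \<or> bdry M.Cay f = []")
  case True
  then show ?thesis using bdry_enc[OF f] base_ifc[of f]
    by (auto simp: face_map_def attaching_map_def simp del: M.Cay_simps G.Cay_simps)
next
  case False
  let ?n = "length (bdry M.Cay f)" and ?s = "Arg2pi z / (2 * pi)"
  let ?i = "nat \<lfloor>real ?n * ?s\<rfloor>"
  have "0 \<le> ?s" "?s < 1" using Arg2pi_ge_0[of z] Arg2pi_lt_2pi[of z] by auto
  moreover have "0 < ?n" using False by (simp del: M.Cay_simps G.Cay_simps)
  ultimately have "real ?n * ?s < real ?n * 1" "0 \<le> real ?n * ?s"
    by (intro mult_strict_left_mono mult_nonneg_nonneg; simp del: M.Cay_simps)+
  then have i: "?i < ?n" by linarith
  then have "fst (bdry M.Cay f ! ?i) \<in> edges M.Cay" using M.cx.bdry_in[OF f] by simp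
  then show ?thesis
    using False i bdry_enc[OF f]
    by (simp add: face_map_def attaching_map_def Let_def split_def edge_map_inc del: M.Cay_simps G.Cay_simps)
qed

lemma sector_inc: "f \<in> faces M.Cay \<Longrightarrow> inc (sector M.Cay f i v) = sector G.Cay (ifc f) i v"
  using bdry_enc[of f] by (simp add: sector_def face_map_inc sectors_def del: M.Cay_simps G.Cay_simps)

lemma inc_cells: "x \<in> M.cx.cells \<Longrightarrow> inc x \<in> G.cx.cells"
  unfolding cell_points_def using iv_closed ie_edges ifc_faces by fastforce

lemma inj_enc: "inj enc"
  using inj_\<epsilon> by (intro inj_mapI prod.inj_map) auto

lemma inc_inj:
  assumes "x \<in> M.cx.cells" "y \<in> M.cx.cells" "inc x = inc y" shows "x = y"
proof -
  have ie: "e = e'" if "ie e = ie e'" "e \<in> edges M.Cay" "e' \<in> edges M.Cay" for e e'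
    using that iv_inj[of "fst e" "fst e'"] injD[OF inj_\<epsilon>] by (simp add: ie_def mem_Times_iff prod_eq_iff)
  have ifc: "f = f'" if "ifc f = ifc f'" "f \<in> faces M.Cay" "f' \<in> faces M.Cay" for f f'
    using that iv_inj[of "fst f" "fst f'"] injD[OF inj_enc] by (simp add: ifc_def mem_Times_iff prod_eq_iff)
  show ?thesis
    using assms ie ifc iv_inj unfolding cell_points_def
    by (elim UnE CollectE imageE exE conjE) (simp_all del: M.Cay_simps(2,3) G.Cay_simps)
qed

lemma continuous_inc: "continuous_map M.XC G.XC inc"
  unfolding continuous_map_def
proof (intro conjI allI impI)
  show "inc \<in> topspace M.XC \<rightarrow> topspace G.XC"
    unfolding M.cx.topspace_realization G.cx.topspace_realization using inc_cells by blast
  fix W assume W: "openin G.XC W"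
  then have o: "realization_open G.Cay W" by (simp add: openin_realization)
  let ?W = "{x \<in> M.cx.cells. inc x \<in> W}"
  have "realization_open M.Cay ?W"
    unfolding realization_open_def
  proof (intro conjI ballI)
    fix e assume e: "e \<in> edges M.Cay"
    have "{t \<in> {0..1}. edge_map M.Cay e t \<in> ?W} = {t \<in> {0..1}. edge_map G.Cay (ie e) t \<in> W}"
      using M.cx.edge_map_cells[OF e] edge_map_inc[OF e] by (simp del: M.Cay_simps G.Cay_simps)
    then show "openin (top_of_set {0..1}) {t \<in> {0..1}. edge_map M.Cay e t \<in> ?W}"
      using o ie_edges[OF e] unfolding realization_open_def by (simp only:)
  next
    fix f assume f: "f \<in> faces M.Cay"
    have "{z \<in> cball 0 1. face_map M.Cay f z \<in> ?W} = {z \<in> cball 0 1. face_map G.Cay (ifc f) z \<in> W}"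
      using M.cx.face_map_cells[OF f] face_map_inc[OF f] by (simp del: M.Cay_simps G.Cay_simps cong: conj_cong)
    then show "openin (top_of_set (cball 0 1)) {z \<in> cball 0 1. face_map M.Cay f z \<in> ?W}"
      using o ifc_faces[OF f] unfolding realization_open_def by (simp only:)
  qed auto
  then show "openin M.XC {x \<in> topspace M.XC. inc x \<in> W}"
    by (simp add: openin_realization M.cx.topspace_realization)
qed

text \<open>All cosets are kept, so this is the union of the pieces of all orbits at once; the
  starting point of a path selects the orbit in which it runs.\<close>

definition piece_complex where
  "piece_complex = restrict_complex G.Cay ((rcosets\<^bsub>G\<^esub> A) \<times> \<epsilon> ` XM) ((rcosets\<^bsub>G\<^esub> A) \<times> enc ` RM)"

lemma piece_simps [simp]:
  "edges piece_complex = (rcosets\<^bsub>G\<^esub> A) \<times> \<epsilon> ` XM" "faces piece_complex = (rcosets\<^bsub>G\<^esub> A) \<times> enc ` RM"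
  "bdry piece_complex = bdry G.Cay" "edge_map piece_complex = edge_map G.Cay" "sector piece_complex = sector G.Cay"
  by (simp_all add: piece_complex_def)

abbreviation "Orb \<equiv> iv ` (rcosets\<^bsub>M\<^esub> B)"

lemma nodes_cells: "nodes M.Cay \<subseteq> M.cx.cells"
  by (rule nodes_subset_cells)

text \<open>Cells labelled by the factor do not change the orbit of cosets. One end in the image of
  \<open>inc\<close> therefore places the base of the whole cell in that orbit, and the cell is the
  image of a cell of the covering of \<open>M\<close>.\<close>

lemma arc_lift:
  assumes p: "p \<in> arcs piece_complex" and s: "\<sigma> \<in> nodes M.Cay" "p 0 = inc \<sigma> \<or> p 1 = inc \<sigma>"
  shows "\<exists>q\<in>arcs M.Cay. p = inc \<circ> q \<and> (p 0 = inc \<sigma> \<longrightarrow> q 0 = \<sigma>) \<and> (p 1 = inc \<sigma> \<longrightarrow> q 1 = \<sigma>)"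
proof -
  have "G.cell_coset (inc \<sigma>) \<in> Orb"
    using s(1) unfolding nodes_def by (auto simp: ie_def ifc_def)
  then have im: "G.cell_coset (p 0) \<in> Orb \<or> G.cell_coset (p 1) \<in> Orb" using s(2) by metis
  have "\<exists>q\<in>arcs M.Cay. p = inc \<circ> q"
    using p
  proof cases
    case (arc_src e)
    then obtain c x where e: "e = (c, \<epsilon> x)" "c \<in> rcosets\<^bsub>G\<^esub> A" "x \<in> XM" by auto
    then have "c \<in> Orb" using im arc_src by auto
    then obtain c' where c': "c' \<in> rcosets\<^bsub>M\<^esub> B" "c = iv c'" by auto
    then have e': "(c', x) \<in> edges M.Cay" "ie (c', x) = e" using e by (auto simp: ie_def)
    show ?thesis
      by (rule bexI[OF _ arcs.arc_src[OF e'(1)]]) (simp add: arc_src(1) fun_eq_iff edge_map_inc[OF e'(1)] e'(2))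
  next
    case (arc_tgt e)
    then obtain c x where e: "e = (c, \<epsilon> x)" "c \<in> rcosets\<^bsub>G\<^esub> A" "x \<in> XM" by auto
    then have "c \<in> Orb \<or> c #>\<^bsub>G\<^esub> j (\<phi>M x) \<in> Orb" using im arc_tgt \<phi>_\<epsilon> by auto
    then have "c \<in> Orb" using iv_image_act[OF e(2) M.gen_closed[OF e(3)]] by blast
    then obtain c' where c': "c' \<in> rcosets\<^bsub>M\<^esub> B" "c = iv c'" by auto
    then have e': "(c', x) \<in> edges M.Cay" "ie (c', x) = e" using e by (auto simp: ie_def)
    show ?thesis
      by (rule bexI[OF _ arcs.arc_tgt[OF e'(1)]]) (simp add: arc_tgt(1) fun_eq_iff edge_map_inc[OF e'(1)] e'(2))
  next
    case (arc_base f)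
    then obtain c r where f: "f = (c, enc r)" "c \<in> rcosets\<^bsub>G\<^esub> A" "r \<in> RM" by auto
    then have fG: "f \<in> faces G.Cay" using enc_R by simp
    have "p = G.cx.spoke f 0" using arc_base by (simp add: G.cx.spoke_def)
    then have "p 0 = FacePt f 0" "p 1 = VertexPt c"
      using G.cx.pathin_spoke(2)[OF fG] G.cx.spoke_base[OF fG] f by auto
    then have "c \<in> Orb" using im f by auto
    then obtain c' where c': "c' \<in> rcosets\<^bsub>M\<^esub> B" "c = iv c'" by auto
    then have f': "(c', r) \<in> faces M.Cay" "ifc (c', r) = f" using f by (auto simp: ifc_def)
    then have b: "bdry M.Cay (c', r) = []" using bdry_enc[OF f'(1)] arc_base(3) by (simp del: M.Cay_simps G.Cay_simps)
    show ?thesis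
      by (rule bexI[OF _ arcs.arc_base[OF f'(1) b]]) (simp add: arc_base(1) fun_eq_iff sector_inc[OF f'(1)] f'(2))
  next
    case (arc_face f i)
    then obtain c r where f: "f = (c, enc r)" "c \<in> rcosets\<^bsub>G\<^esub> A" "r \<in> RM" by auto
    then have fG: "f \<in> faces G.Cay" using enc_R by simp
    have i: "i < length (bdry G.Cay f)" "i < length r" using arc_face(3) f by auto
    have r: "r \<in> lists (letters XM)" "enc r \<in> lists (letters X)"
      using f M.rels G.rels enc_R[OF f(3)] by auto
    have p: "p 0 = FacePt f 0" "p 1 = EdgePt (fst (bdry G.Cay f ! i)) (1/2)"
      using arc_face(1) G.cx.letter_map_sector[OF fG i(1), of "1/2"] by (auto simp: letter_map_def)
    have t: "take i r \<in> lists (letters XM)" "r ! i \<in> letters XM" using r i by (auto dest: in_set_takeD)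
    then have x: "fst (r ! i) \<in> XM" by (auto simp: letters_def)
    have w: "word_val G \<phi> (take i (enc r)) = j (word_val M \<phi>M (take i r))"
      using word_val_enc[OF t(1)] by (simp add: take_map)
    have tc: "word_val M \<phi>M (take i r) \<in> carrier M" using M.word_val_closed[OF t(1)] .
    let ?d = "c #>\<^bsub>G\<^esub> j (word_val M \<phi>M (take i r))"
    have d: "?d \<in> rcosets\<^bsub>G\<^esub> A" using G.coset_act[OF f(2)] tc by simp
    have "fst (fst (bdry G.Cay f ! i)) = (if snd (r ! i) then ?d else ?d #>\<^bsub>G\<^esub> j (inv\<^bsub>M\<^esub> \<phi>M (fst (r ! i))))"
      using G.nth_coset_path(1)[OF f(2) r(2), of i] i f w x M.gen_closed[OF x]
      by (simp add: Let_def \<phi>_\<epsilon>)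
    then have "c \<in> Orb \<or> ?d \<in> Orb \<or> ?d #>\<^bsub>G\<^esub> j (inv\<^bsub>M\<^esub> \<phi>M (fst (r ! i))) \<in> Orb"
      using im p f by (auto split: if_splits)
    then have "c \<in> Orb"
      using iv_image_act[OF f(2) tc] iv_image_act[OF d, of "inv\<^bsub>M\<^esub> \<phi>M (fst (r ! i))"] M.gen_closed[OF x]
      by auto
    then obtain c' where c': "c' \<in> rcosets\<^bsub>M\<^esub> B" "c = iv c'" by auto
    then have f': "(c', r) \<in> faces M.Cay" "ifc (c', r) = f" using f by (auto simp: ifc_def)
    have b: "i < length (bdry M.Cay (c', r))" using i by simp
    show ?thesis
      by (rule bexI[OF _ arcs.arc_face[OF f'(1) b]]) (simp add: arc_face(1) fun_eq_iff sector_inc[OF f'(1)] f'(2))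
  qed
  then obtain q where q: "q \<in> arcs M.Cay" "p = inc \<circ> q" by blast
  note aq = M.cx.arcs_path[OF q(1)]
  have "q 0 = \<sigma>" if "p 0 = inc \<sigma>" using that q(2) aq(2) s(1) nodes_cells by (intro inc_inj) auto
  moreover have "q 1 = \<sigma>" if "p 1 = inc \<sigma>" using that q(2) aq(3) s(1) nodes_cells by (intro inc_inj) auto
  ultimately show ?thesis using q by blast
qed

text \<open>Lifting proceeds arc by arc: the end of each lifted arc is the centre at which the next
  lift has to start.\<close>

lemma arc_path_lift:
  assumes "p \<in> arc_paths piece_complex S"
  shows "\<sigma> \<in> nodes M.Cay \<Longrightarrow> p 0 = inc \<sigma> \<Longrightarrow>
    \<exists>q\<in>arc_paths M.Cay {x \<in> M.cx.cells. inc x \<in> S}. p = inc \<circ> q \<and> q 0 = \<sigma> \<and> q 1 \<in> nodes M.Cay"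
  using assms
proof (induction arbitrary: \<sigma> rule: arc_paths.induct)
  case (const x)
  then show ?case
    using nodes_cells by (intro bexI[of _ "\<lambda>_. \<sigma>"] arc_paths.const) (auto simp: fun_eq_iff)
next
  case (arc p)
  obtain q where q: "q \<in> arcs M.Cay" "p = inc \<circ> q" "q 0 = \<sigma>" using arc_lift[OF arc(1,3)] arc(4) by blast
  note aq = M.cx.arcs_path[OF q(1)]
  have "q ` {0..1} \<subseteq> M.cx.cells" using pathin_in[OF aq(1)] unfolding M.cx.topspace_realization by blast
  then have "q ` {0..1} \<subseteq> {x \<in> M.cx.cells. inc x \<in> S}" using arc(2) q(2) by auto
  then show ?case using q aq arc_paths.arc[OF q(1)] by blast
next
  case (rv_arc p)
  obtain q where q: "q \<in> arcs M.Cay" "p = inc \<circ> q" "q 1 = \<sigma>" using arc_lift[OF rv_arc(1,3)] rv_arc(4) by auto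
  note aq = M.cx.arcs_path[OF q(1)]
  have "q ` {0..1} \<subseteq> M.cx.cells" using pathin_in[OF aq(1)] unfolding M.cx.topspace_realization by blast
  then have "q ` {0..1} \<subseteq> {x \<in> M.cx.cells. inc x \<in> S}" using rv_arc(2) q(2) by auto
  then show ?case using q aq arc_paths.rv_arc[OF q(1)] by (intro bexI[of _ "rv q"]) (auto simp: o_rv)
next
  case (join p p')
  have p0: "p 0 = inc \<sigma>" using join(7) by simp
  obtain q where q: "q \<in> arc_paths M.Cay {x \<in> M.cx.cells. inc x \<in> S}" "p = inc \<circ> q" "q 0 = \<sigma>" "q 1 \<in> nodes M.Cay"
    using join(4)[OF join(6) p0] by blast
  have "p' 0 = inc (q 1)" using join(3) q(2) by simp
  then obtain q' where q': "q' \<in> arc_paths M.Cay {x \<in> M.cx.cells. inc x \<in> S}" "p' = inc \<circ> q'" "q' 0 = q 1" "q' 1 \<in> nodes M.Cay"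
    using join(5)[OF q(4)] by blast
  show ?case
    unfolding q(2) q'(2) o_join[symmetric] using arc_paths.join[OF q(1) q'(1) q'(3)[symmetric]] q(3) q'(4)
    by (intro bexI[of _ "join_loops q q'"]) simp_all
qed

end

lemma cell_points_iff:
  "VertexPt v \<in> cell_points V E F \<longleftrightarrow> v \<in> V"
  "EdgePt e t \<in> cell_points V E F \<longleftrightarrow> e \<in> E \<and> 0 < t \<and> t < 1"
  "FacePt f z \<in> cell_points V E F \<longleftrightarrow> f \<in> F \<and> cmod z < 1"
  by (auto simp: cell_points_def)

section \<open>Loops of a piece in the complement of a finite subcomplex\<close>

context cayley_map begin

lemma finite_subcomplex_complement:
  "finite_subcomplex G.Cay V E F \<Longrightarrow> complement G.Cay V E F"
  by unfold_locales (auto simp: finite_subcomplex_def simp del: G.Cay_simps)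

definition "pullV V = {c \<in> verts M.Cay. iv c \<in> V}"
definition "pullE E = {e \<in> edges M.Cay. ie e \<in> E}"
definition "pullF F = {f \<in> faces M.Cay. ifc f \<in> F}"

lemma ie_inj: "e \<in> edges M.Cay \<Longrightarrow> e' \<in> edges M.Cay \<Longrightarrow> ie e = ie e' \<Longrightarrow> e = e'"
  using iv_inj[of "fst e" "fst e'"] injD[OF inj_\<epsilon>] by (simp add: ie_def mem_Times_iff prod_eq_iff)

lemma ifc_inj: "f \<in> faces M.Cay \<Longrightarrow> f' \<in> faces M.Cay \<Longrightarrow> ifc f = ifc f' \<Longrightarrow> f = f'"
  using iv_inj[of "fst f" "fst f'"] injD[OF inj_enc] by (simp add: ifc_def mem_Times_iff prod_eq_iff)

text \<open>Injectivity on cells keeps the preimage finite; closedness holds because sources,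
  targets and boundary words are carried along.\<close>

lemma finite_subcomplex_pull:
  assumes C: "finite_subcomplex G.Cay V E F"
  shows "finite_subcomplex M.Cay (pullV V) (pullE E) (pullF F)"
proof -
  have fin: "finite V" "finite E" "finite F" using C by (auto simp: finite_subcomplex_def)
  have i: "inj_on iv (pullV V)" "inj_on ie (pullE E)" "inj_on ifc (pullF F)"
    by (rule inj_onI, rule iv_inj ie_inj ifc_inj; simp add: pullV_def pullE_def pullF_def)+
  have s: "iv ` pullV V \<subseteq> V" "ie ` pullE E \<subseteq> E" "ifc ` pullF F \<subseteq> F"
    unfolding pullV_def pullE_def pullF_def by blast+
  note fin = inj_on_finite[OF i(1) s(1) fin(1)] inj_on_finite[OF i(2) s(2) fin(2)] inj_on_finite[OF i(3) s(3) fin(3)]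
  have "src M.Cay e \<in> pullV V \<and> tgt M.Cay e \<in> pullV V" if e: "e \<in> pullE E" for e
  proof -
    have "e \<in> edges M.Cay" "ie e \<in> E" using e by (auto simp: pullE_def)
    then have "iv (src M.Cay e) \<in> V" "iv (tgt M.Cay e) \<in> V"
      using C src_ie[of e] tgt_ie[of e] by (auto simp: finite_subcomplex_def simp del: M.Cay_simps G.Cay_simps)
    then show ?thesis using M.cx.ends[OF \<open>e \<in> edges M.Cay\<close>] by (simp add: pullV_def del: M.Cay_simps)
  qed
  moreover have "base M.Cay f \<in> pullV V \<and> fst ` set (bdry M.Cay f) \<subseteq> pullE E" if f: "f \<in> pullF F" for f
  proof -
    have f: "f \<in> faces M.Cay" "ifc f \<in> F" using f by (auto simp: pullF_def)
    then have "iv (base M.Cay f) \<in> V" "fst ` set (bdry G.Cay (ifc f)) \<subseteq> E"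
      using C base_ifc[of f] by (auto simp: finite_subcomplex_def simp del: M.Cay_simps G.Cay_simps)
    moreover from this have "ie (fst l) \<in> E" if "l \<in> set (bdry M.Cay f)" for l
      using that unfolding bdry_enc[OF f(1)] by force
    ultimately show ?thesis
      using M.cx.base_in[OF f(1)] M.cx.bdry_in[OF f(1)] by (auto simp: pullV_def pullE_def simp del: M.Cay_simps)
  qed
  ultimately show ?thesis
    unfolding finite_subcomplex_def using fin by (auto simp: pullV_def pullE_def pullF_def simp del: M.Cay_simps)
qed

lemma inc_cell_points:
  assumes "x \<in> M.cx.cells"
  shows "inc x \<in> cell_points V E F \<longleftrightarrow> x \<in> cell_points (pullV V) (pullE E) (pullF F)"
  using assms by (cases x) (simp_all add: cell_points_iff pullV_def pullE_def pullF_def del: M.Cay_simps)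

context
  fixes V E F L
  assumes C: "finite_subcomplex G.Cay V E F"
    and L: "L \<in> connected_components_of (subtopology G.XC (- cell_points V E F))"
begin

interpretation CG: complement G.Cay V E F
  by (rule finite_subcomplex_complement[OF C])

interpretation CM: complement M.Cay "pullV V" "pullE E" "pullF F"
  using finite_subcomplex_pull[OF C]
  by unfold_locales (auto simp: finite_subcomplex_def simp del: M.Cay_simps)

lemma pull_U: "{x \<in> M.cx.cells. inc x \<in> CG.U} = CM.U"
  unfolding CG.U_def CM.U_def using inc_cell_points inc_cells by blast

lemma continuous_inc_U: "continuous_map CM.XU CG.XU inc"
proof (rule continuous_map_into_subtopology)
  show "continuous_map CM.XU G.XC inc" using continuous_inc by (rule continuous_map_from_subtopology)
  have "topspace CM.XU = CM.U" by (rule CM.topspace_XU)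
  moreover have "inc x \<in> - cell_points V E F" if "x \<in> CM.U" for x
    using that inc_cell_points[of x V E F] unfolding CM.U_def by blast
  ultimately show "inc \<in> topspace CM.XU \<rightarrow> - cell_points V E F" by blast
qed

lemma L_sub: "L \<subseteq> CG.U"
  using connected_components_of_subset[OF L] unfolding CG.topspace_XU .

lemma lift_loop:
  assumes s: "\<sigma> \<in> nodes M.Cay" and p: "p \<in> arc_paths piece_complex CG.U" "p 0 = inc \<sigma>" "p 1 = inc \<sigma>"
  obtains q where "q \<in> arc_paths M.Cay CM.U" "p = inc \<circ> q" "q 0 = \<sigma>" "q 1 = \<sigma>"
proof -
  obtain q where q: "q \<in> arc_paths M.Cay CM.U" "p = inc \<circ> q" "q 0 = \<sigma>" "q 1 \<in> nodes M.Cay"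
    using arc_path_lift[OF p(1) s p(2)] unfolding pull_U by blast
  have "inc (q 1) = inc \<sigma>" using p(3) q(2) by simp
  then have "q 1 = \<sigma>" using q(4) s nodes_cells by (intro inc_inj) auto
  then show ?thesis using that q by blast
qed

text \<open>Every cell of a subcomplex has a vertex in the subcomplex. If the orbit misses
  \<open>V\<close>, nothing is pulled back, and the lifted loop contracts in the whole universal
  covering.\<close>

lemma piece_loops_null:
  assumes s: "\<sigma> \<in> nodes M.Cay" "inc \<sigma> \<in> L"
    and B1: "B = {\<one>\<^bsub>M\<^esub>}" and V: "Orb \<inter> V = {}"
    and p: "p \<in> arc_paths piece_complex CG.U" "p 0 = inc \<sigma>" "p 1 = inc \<sigma>"
  shows "hp (subtopology G.XC L) p (\<lambda>_. inc \<sigma>)"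
proof -
  have pV: "pullV V = {}" using V by (auto simp: pullV_def)
  have pE: "pullE E = {}" using finite_subcomplex_pull[OF C] pV by (auto simp: finite_subcomplex_def simp del: M.Cay_simps)
  have pF: "pullF F = {}" using finite_subcomplex_pull[OF C] pV by (auto simp: finite_subcomplex_def simp del: M.Cay_simps)
  have "- cell_points (pullV V) (pullE E) (pullF F) = UNIV" unfolding pV pE pF by (auto simp: cell_points_def)
  then have XU: "CM.XU = M.XC" by simp
  obtain q where q: "q \<in> arc_paths M.Cay CM.U" "p = inc \<circ> q" "q 0 = \<sigma>" "q 1 = \<sigma>"
    by (rule lift_loop[OF s(1) p])
  have "hp M.XC q (\<lambda>_. q 0)" using M.arc_paths_null[OF B1 q(1)] q s by simp
  then have "hp CM.XU q (\<lambda>_. \<sigma>)" using q(3) XU by simp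
  from hp_map[OF this continuous_inc_U] have "hp CG.XU p (\<lambda>_. inc \<sigma>)" using q(2) by (simp only: o_const)
  from hp_component[OF L this] have "hp (subtopology CG.XU L) p (\<lambda>_. inc \<sigma>)" using p(2) s by simp
  moreover have "subtopology CG.XU L = subtopology G.XC L"
    using L_sub unfolding CG.U_def by (simp add: subtopology_subtopology Int_absorb1 subset_iff)
  ultimately show ?thesis by simp
qed

text \<open>Tameness is applied to the component \<open>L'\<close> of \<sigma> in the complement of
  the pulled-back subcomplex. Its image is connected and contains a point of \<open>L\<close>, hence
  lies in \<open>L\<close>, so its finitely many generators can be pushed forward.\<close>

lemma piece_loops:
  assumes tame: "tame_wrt M XM RM \<phi>M B" and s: "\<sigma> \<in> nodes M.Cay" "inc \<sigma> \<in> L"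
  shows "\<exists>S. finite S \<and> S \<subseteq> loops (subtopology G.XC L) (inc \<sigma>) \<and>
    arc_paths piece_complex CG.U \<inter> loops (subtopology G.XC L) (inc \<sigma>) \<subseteq> loop_span (subtopology G.XC L) (inc \<sigma>) S"
proof -
  have sU: "\<sigma> \<in> CM.U" using s nodes_cells L_sub pull_U by blast
  define L' where "L' = Collect (connected_component_of CM.XU \<sigma>)"
  have L': "L' \<in> connected_components_of CM.XU"
    using sU unfolding L'_def by (simp add: connected_component_in_connected_components_of del: topspace_subtopology)
  have sL': "\<sigma> \<in> L'" using sU unfolding L'_def by (simp add: connected_component_of_refl del: topspace_subtopology)
  have L'U: "L' \<subseteq> CM.U" using connected_components_of_subset[OF L'] unfolding CM.topspace_XU .
  have subM: "subtopology CM.XU L' = subtopology M.XC L'"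
    using L'U unfolding CM.U_def by (simp add: subtopology_subtopology Int_absorb1 subset_iff)
  have subG: "subtopology CG.XU L = subtopology G.XC L"
    using L_sub unfolding CG.U_def by (simp add: subtopology_subtopology Int_absorb1 subset_iff)
  have "connectedin CG.XU (inc ` L')"
    by (rule connectedin_continuous_map_image[OF continuous_inc_U connectedin_connected_components_of[OF L']])
  then have "inc ` L' \<subseteq> L" using component_subset[OF L s(2)] sL' by blast
  then have "continuous_map (subtopology CM.XU L') (subtopology CG.XU L) inc"
    by (intro continuous_map_into_subtopology continuous_map_from_subtopology[OF continuous_inc_U]) auto
  then have cont: "continuous_map (subtopology M.XC L') (subtopology G.XC L) inc" unfolding subM subG .
  have fg: "finitely_generated (fundamental_group (subtopology M.XC L') \<sigma>)"
    by (rule tame[unfolded tame_wrt_def, rule_format, OF finite_subcomplex_pull[OF C] L' sL'])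
  have top: "\<sigma> \<in> topspace (subtopology M.XC L')"
    using sL' L'U unfolding CM.U_def by (auto simp: M.cx.topspace_realization)
  obtain S' where S': "finite S'" "S' \<subseteq> loops (subtopology M.XC L') \<sigma>"
    "loops (subtopology M.XC L') \<sigma> \<subseteq> loop_span (subtopology M.XC L') \<sigma> S'"
    using fg[unfolded finitely_generated_fundamental_group_iff[OF top]] by (elim exE conjE)
  show ?thesis
  proof (intro exI[of _ "(\<circ>) inc ` S'"] conjI subsetI)
    show "finite ((\<circ>) inc ` S')" using S'(1) by simp
    show "x \<in> loops (subtopology G.XC L) (inc \<sigma>)" if "x \<in> (\<circ>) inc ` S'" for x
      using that S'(2) pathin_compose[OF _ cont] by (auto simp: loops_iff)
    fix p assume "p \<in> arc_paths piece_complex CG.U \<inter> loops (subtopology G.XC L) (inc \<sigma>)"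
    then have p: "p \<in> arc_paths piece_complex CG.U" "p 0 = inc \<sigma>" "p 1 = inc \<sigma>" by (auto simp: loops_iff)
    obtain q where q: "q \<in> arc_paths M.Cay CM.U" "p = inc \<circ> q" "q 0 = \<sigma>" "q 1 = \<sigma>"
      by (rule lift_loop[OF s(1) p])
    have "pathin (subtopology CM.XU L') q"
      using pathin_component[OF L' CM.arc_paths_path[OF q(1)]] q(3) sL' by simp
    then have "q \<in> loops (subtopology M.XC L') \<sigma>" using q subM by (simp add: loops_iff)
    then have "q \<in> loop_span (subtopology M.XC L') \<sigma> S'" using S'(3) by blast
    from loop_span_map[OF cont this] show "p \<in> loop_span (subtopology G.XC L) (inc \<sigma>) ((\<circ>) inc ` S')"
      unfolding q(2) .
  qed
qed

end

end

section \<open>Cocycles on words\<close>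

locale word_action =
  fixes L :: "'l set" and S :: "('l list \<times> 'l list) set" and A :: "'l list set set"
  assumes grp: "group (word_monoid L S)" and A: "subgroup A (word_monoid L S)"
    and S_lists: "(u, v) \<in> S \<Longrightarrow> u \<in> lists L \<and> v \<in> lists L"
begin

abbreviation "G \<equiv> word_monoid L S"
abbreviation "cl \<equiv> word_class L S"
abbreviation "Om \<equiv> rcosets\<^bsub>G\<^esub> A"

sublocale G: group G by (rule grp)

lemma cl_closed: "w \<in> lists L \<Longrightarrow> cl w \<in> carrier G"
  by (simp add: word_monoid_def)

lemma cl_surj: "x \<in> carrier G \<Longrightarrow> \<exists>w\<in>lists L. x = cl w"
  by (auto simp: word_monoid_def)

lemma cl_append: "u \<in> lists L \<Longrightarrow> v \<in> lists L \<Longrightarrow> cl (u @ v) = cl u \<otimes>\<^bsub>G\<^esub> cl v"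
  by (simp only: mult_word_monoid)

lemma cl_Nil: "cl [] = \<one>\<^bsub>G\<^esub>"
  by (simp add: word_monoid_def)

lemma A_sub: "A \<subseteq> carrier G"
  using A by (rule subgroup.subset)

lemma Om_sub: "c \<in> Om \<Longrightarrow> c \<subseteq> carrier G"
  using G.r_coset_subset_G[OF A_sub] by (auto simp: RCOSETS_def)

lemma act: "c \<in> Om \<Longrightarrow> x \<in> carrier G \<Longrightarrow> c #>\<^bsub>G\<^esub> x \<in> Om"
  using A_sub by (auto simp: RCOSETS_def G.coset_mult_assoc)

lemma act_assoc: "c \<in> Om \<Longrightarrow> x \<in> carrier G \<Longrightarrow> y \<in> carrier G \<Longrightarrow> c #>\<^bsub>G\<^esub> x #>\<^bsub>G\<^esub> y = c #>\<^bsub>G\<^esub> (x \<otimes>\<^bsub>G\<^esub> y)"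
  using Om_sub by (simp add: G.coset_mult_assoc)

lemma act_one: "c \<in> Om \<Longrightarrow> c #>\<^bsub>G\<^esub> \<one>\<^bsub>G\<^esub> = c"
  using Om_sub by (simp add: G.coset_mult_one)

lemma A_Om: "A \<in> Om"
  using G.coset_mult_one[OF A_sub] by (auto simp: RCOSETS_def intro!: bexI[of _ "\<one>\<^bsub>G\<^esub>"])

lemma A_act: "a \<in> A \<Longrightarrow> A #>\<^bsub>G\<^esub> a = A"
  using G.coset_join2[OF _ A] A_sub by blast

text \<open>A 1-cocycle for the action on cosets, given on letters by the weight \<rho>. If \<rho>
  respects the relations in \<open>S\<close>, the value depends only on the group element
  (\<open>coc_cl_eq\<close>), and at the coset \<open>A\<close> it is multiplicative on words
  representing elements of \<open>A\<close>.\<close>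

primrec coc :: "('n, 'k) monoid_scheme \<Rightarrow> ('l list set set \<Rightarrow> 'l \<Rightarrow> 'n) \<Rightarrow> 'l list set set \<Rightarrow> 'l list \<Rightarrow> 'n" where
  "coc N \<rho> c [] = \<one>\<^bsub>N\<^esub>"
| "coc N \<rho> c (l # w) = \<rho> c l \<otimes>\<^bsub>N\<^esub> coc N \<rho> (c #>\<^bsub>G\<^esub> cl [l]) w"

context
  fixes N :: "('n, 'k) monoid_scheme" and \<rho>
  assumes N: "group N" and \<rho>: "\<And>c l. c \<in> Om \<Longrightarrow> l \<in> L \<Longrightarrow> \<rho> c l \<in> carrier N"
    and resp: "\<And>u v c. (u, v) \<in> S \<Longrightarrow> c \<in> Om \<Longrightarrow> coc N \<rho> c u = coc N \<rho> c v"
begin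

interpretation N: group N by (rule N)

lemma coc_closed: "w \<in> lists L \<Longrightarrow> c \<in> Om \<Longrightarrow> coc N \<rho> c w \<in> carrier N"
proof (induction w arbitrary: c)
  case (Cons l w)
  have "[l] \<in> lists L" using Cons by simp
  from act[OF Cons(3) cl_closed[OF this]] show ?case using Cons \<rho> by simp
qed simp

lemma coc_append:
  "u \<in> lists L \<Longrightarrow> v \<in> lists L \<Longrightarrow> c \<in> Om \<Longrightarrow>
    coc N \<rho> c (u @ v) = coc N \<rho> c u \<otimes>\<^bsub>N\<^esub> coc N \<rho> (c #>\<^bsub>G\<^esub> cl u) v"
proof (induction u arbitrary: c)
  case Nil
  then show ?case using coc_closed by (simp add: cl_Nil act_one)
next
  case (Cons l u)
  then have l: "[l] \<in> lists L" "l \<in> L" "u \<in> lists L" by auto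
  have c': "c #>\<^bsub>G\<^esub> cl [l] \<in> Om" using act[OF Cons(4) cl_closed[OF l(1)]] .
  have eq: "c #>\<^bsub>G\<^esub> cl [l] #>\<^bsub>G\<^esub> cl u = c #>\<^bsub>G\<^esub> cl (l # u)"
    using act_assoc[OF Cons(4) cl_closed[OF l(1)] cl_closed[OF l(3)]] cl_append[OF l(1,3)] by simp
  have d: "c #>\<^bsub>G\<^esub> cl (l # u) \<in> Om" using act[OF Cons(4) cl_closed[OF Cons(2)]] .
  have "coc N \<rho> c ((l # u) @ v) = \<rho> c l \<otimes>\<^bsub>N\<^esub> (coc N \<rho> (c #>\<^bsub>G\<^esub> cl [l]) u \<otimes>\<^bsub>N\<^esub> coc N \<rho> (c #>\<^bsub>G\<^esub> cl (l # u)) v)"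
    using Cons(1)[OF l(3) Cons(3) c'] eq by simp
  also have "\<dots> = coc N \<rho> c (l # u) \<otimes>\<^bsub>N\<^esub> coc N \<rho> (c #>\<^bsub>G\<^esub> cl (l # u)) v"
    using \<rho>[OF Cons(4) l(2)] coc_closed[OF l(3) c'] coc_closed[OF Cons(3) d] by (simp add: N.m_assoc)
  finally show ?case .
qed

lemma cl_cong: "word_cong L S u v \<Longrightarrow> cl u = cl v"
  using word_class_eq_iff[THEN iffD2] word_cong_in_lists[THEN conjunct1] by metis

lemma coc_cong: "word_cong L S u v \<Longrightarrow> c \<in> Om \<Longrightarrow> coc N \<rho> c u = coc N \<rho> c v"
proof (induction arbitrary: c rule: word_cong.induct)
  case (rewrite u v p q)
  have uv: "cl u = cl v"
    using cl_cong[OF word_cong.rewrite[OF rewrite(1-3), of "[]" "[]"]] by simp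
  have d: "c #>\<^bsub>G\<^esub> cl p \<in> Om" using act[OF rewrite(6) cl_closed[OF rewrite(4)]] .
  have "coc N \<rho> c (p @ x @ q) = coc N \<rho> c p \<otimes>\<^bsub>N\<^esub> (coc N \<rho> (c #>\<^bsub>G\<^esub> cl p) x \<otimes>\<^bsub>N\<^esub> coc N \<rho> (c #>\<^bsub>G\<^esub> cl p #>\<^bsub>G\<^esub> cl x) q)"
    if "x \<in> lists L" for x
    using coc_append[OF rewrite(4) _ rewrite(6), of "x @ q"] coc_append[OF that rewrite(5) d] that rewrite(5) by simp
  then show ?case using rewrite uv resp[OF rewrite(1) d] by simp
qed auto

lemma coc_cl_eq: "u \<in> lists L \<Longrightarrow> cl u = cl v \<Longrightarrow> c \<in> Om \<Longrightarrow> coc N \<rho> c u = coc N \<rho> c v"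
  by (rule coc_cong[OF iffD1[OF word_class_eq_iff]])

text \<open>Words representing elements of \<open>A\<close> lead from the coset \<open>A\<close>
  back to itself. On them the cocycle is a homomorphism, determined by its values on the
  generators.\<close>

lemma coc_generate:
  assumes Wd: "Wd \<subseteq> lists L" "cl ` Wd \<subseteq> A" and gen: "generate G (cl ` Wd) = A"
    and w: "w \<in> lists L" "cl w \<in> A"
  shows "coc N \<rho> A w \<in> generate N (coc N \<rho> A ` Wd)"
proof -
  have "\<forall>w\<in>lists L. cl w = a \<longrightarrow> coc N \<rho> A w \<in> generate N (coc N \<rho> A ` Wd)" if "a \<in> generate G (cl ` Wd)" for a
    using that
  proof (induction rule: generate.induct)
    case one
    show ?case
    proof (intro ballI impI)
      fix v assume v: "v \<in> lists L" "cl v = \<one>\<^bsub>G\<^esub>"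
      have "coc N \<rho> A v = coc N \<rho> A []" using v by (intro coc_cl_eq A_Om) (simp_all only: cl_Nil)
      then show "coc N \<rho> A v \<in> generate N (coc N \<rho> A ` Wd)" by (simp add: generate.one)
    qed
  next
    case (incl a)
    then obtain s where s: "s \<in> Wd" "a = cl s" by (rule imageE)
    show ?case
    proof (intro ballI impI)
      fix v assume v: "v \<in> lists L" "cl v = a"
      have "coc N \<rho> A v = coc N \<rho> A s" using v s(2) by (intro coc_cl_eq A_Om) simp_all
      then show "coc N \<rho> A v \<in> generate N (coc N \<rho> A ` Wd)" using s(1) by (simp add: generate.incl)
    qed
  next
    case (inv a)
    then obtain s where s: "s \<in> Wd" "a = cl s" by (rule imageE)
    then have sl: "s \<in> lists L" "cl s \<in> A" using subsetD[OF Wd(1)] subsetD[OF Wd(2)] by (simp_all only: imageI)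
    show ?case
    proof (intro ballI impI)
      fix v assume v: "v \<in> lists L" "cl v = inv\<^bsub>G\<^esub> a"
      have "cl (v @ s) = cl []" using v s sl cl_append[OF v(1) sl(1)] cl_closed[OF sl(1)] by (simp add: cl_Nil)
      then have "coc N \<rho> A (v @ s) = \<one>\<^bsub>N\<^esub>" using coc_cl_eq[of "v @ s" "[]", OF _ _ A_Om] v sl by simp
      moreover have "A #>\<^bsub>G\<^esub> cl v = A" using v(2) s sl subgroup.m_inv_closed[OF A] by (intro A_act) simp
      ultimately have "coc N \<rho> A v \<otimes>\<^bsub>N\<^esub> coc N \<rho> A s = \<one>\<^bsub>N\<^esub>" using coc_append[OF v(1) sl(1) A_Om] by simp
      then have "coc N \<rho> A v = inv\<^bsub>N\<^esub> coc N \<rho> A s"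
        using coc_closed[OF v(1) A_Om] coc_closed[OF sl(1) A_Om] by (simp add: N.inv_equality)
      then show "coc N \<rho> A v \<in> generate N (coc N \<rho> A ` Wd)" using s(1) by (simp add: generate.inv)
    qed
  next
    case (eng a b)
    show ?case
    proof (intro ballI impI)
      fix v assume v: "v \<in> lists L" "cl v = a \<otimes>\<^bsub>G\<^esub> b"
      have ab: "a \<in> A" "b \<in> A" using eng gen by auto
      then obtain x y where xy: "x \<in> lists L" "a = cl x" "y \<in> lists L" "b = cl y"
        using A_sub cl_surj by (meson subsetD)
      have "coc N \<rho> A v = coc N \<rho> A (x @ y)"
        using v xy by (intro coc_cl_eq A_Om) (simp_all add: cl_append)
      also have "\<dots> = coc N \<rho> A x \<otimes>\<^bsub>N\<^esub> coc N \<rho> A y"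
        using coc_append[OF xy(1,3) A_Om] A_act[OF ab(1)] xy by simp
      finally show "coc N \<rho> A v \<in> generate N (coc N \<rho> A ` Wd)" using eng(3,4) xy by (simp add: generate.eng)
    qed
  qed
  then show ?thesis using w unfolding gen by simp
qed

lemma coc_trivial:
  assumes "w \<in> lists L" "c \<in> Om" "\<And>i. i < length w \<Longrightarrow> \<rho> (c #>\<^bsub>G\<^esub> cl (take i w)) (w ! i) = \<one>\<^bsub>N\<^esub>"
  shows "coc N \<rho> c w = \<one>\<^bsub>N\<^esub>"
  using assms
proof (induction w arbitrary: c rule: list.induct)
  case (Cons l w)
  then have l: "[l] \<in> lists L" "w \<in> lists L" by auto
  have c': "c #>\<^bsub>G\<^esub> cl [l] \<in> Om" using act[OF Cons.prems(2) cl_closed[OF l(1)]] .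
  have "\<rho> (c #>\<^bsub>G\<^esub> cl [l] #>\<^bsub>G\<^esub> cl (take i w)) (w ! i) = \<one>\<^bsub>N\<^esub>" if "i < length w" for i
  proof -
    have t: "take i w \<in> lists L" using l(2) by (auto dest: in_set_takeD)
    have "c #>\<^bsub>G\<^esub> cl [l] #>\<^bsub>G\<^esub> cl (take i w) = c #>\<^bsub>G\<^esub> cl (l # take i w)"
      using act_assoc[OF Cons.prems(2) cl_closed[OF l(1)] cl_closed[OF t]] cl_append[OF l(1) t] by simp
    then show ?thesis using Cons.prems(3)[of "Suc i"] that by simp
  qed
  then have "coc N \<rho> (c #>\<^bsub>G\<^esub> cl [l]) w = \<one>\<^bsub>N\<^esub>" by (intro Cons.IH[OF l(2) c'])
  moreover have "\<rho> c l = \<one>\<^bsub>N\<^esub>" using Cons.prems(3)[of 0] Cons.prems(2) by (simp add: cl_Nil act_one)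
  ultimately show ?case by simp
qed simp

end

text \<open>The end point of each path is included, since the weight of a letter may depend on the
  coset after it as well as on the one before it.\<close>

definition visits :: "'l list set \<Rightarrow> 'l list set set set" where
  "visits Wd = (\<Union>w\<in>Wd. (\<lambda>i. A #>\<^bsub>G\<^esub> cl (take i w)) ` {..length w})"

lemma finite_visits: "finite Wd \<Longrightarrow> finite (visits Wd)"
  by (simp add: visits_def)

text \<open>A generating set of \<open>A\<close> gives generators for the stabilizer of \<open>A g\<close> in a factor \<open>M\<close>: cut the
  paths of the generators into the letters that lie in the \<open>M\<close>-orbit of \<open>A g\<close>, and close
  each of them up by a fixed transversal of the orbit.\<close>

lemma stabilizer_generators:
  fixes M :: "('b, 'k) monoid_scheme" and \<kappa> :: "'b \<Rightarrow> 'l"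
  assumes M: "group M" and \<kappa>: "inj \<kappa>" "\<kappa> ` carrier M \<subseteq> L"
    and hom: "(\<lambda>h. cl [\<kappa> h]) \<in> hom M G"
    and rel: "\<And>u v. (u, v) \<in> S \<Longrightarrow>
      (\<exists>a b. a \<in> carrier M \<and> b \<in> carrier M \<and> u = [\<kappa> a, \<kappa> b] \<and> v = [\<kappa> (a \<otimes>\<^bsub>M\<^esub> b)]) \<or>
      (u = [\<kappa> \<one>\<^bsub>M\<^esub>] \<and> v = []) \<or> (set u \<union> set v) \<inter> range \<kappa> = {}"
    and \<kappa>_M: "\<And>l. l \<in> L \<Longrightarrow> l \<in> range \<kappa> \<Longrightarrow> inv_into UNIV \<kappa> l \<in> carrier M"
    and Wd: "finite Wd" "Wd \<subseteq> lists L" "cl ` Wd \<subseteq> A" "generate G (cl ` Wd) = A"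
    and g: "g \<in> carrier G"
    and B: "B = {h \<in> carrier M. A #>\<^bsub>G\<^esub> (g \<otimes>\<^bsub>G\<^esub> cl [\<kappa> h]) = A #>\<^bsub>G\<^esub> g}"
  shows "subgroup B M" "finitely_generated (M\<lparr>carrier := B\<rparr>)"
    "(\<And>h. h \<in> carrier M \<Longrightarrow> A #>\<^bsub>G\<^esub> (g \<otimes>\<^bsub>G\<^esub> cl [\<kappa> h]) \<notin> visits Wd) \<Longrightarrow> B = {\<one>\<^bsub>M\<^esub>}"
proof -
  interpret M: group M by (rule M)
  let ?j = "\<lambda>h. cl [\<kappa> h]"
  interpret h: group_hom M G ?j using hom by unfold_locales
  note h.hom_mult [simp del] and h.hom_one [simp del] and h.hom_inv [simp del]
  define c1 where "c1 = A #>\<^bsub>G\<^esub> g"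
  have c1: "c1 \<in> Om" using act[OF A_Om g] by (simp add: c1_def)
  have c1j: "c1 #>\<^bsub>G\<^esub> ?j h = A #>\<^bsub>G\<^esub> (g \<otimes>\<^bsub>G\<^esub> ?j h)" if "h \<in> carrier M" for h
    unfolding c1_def using act_assoc[OF A_Om g] h.hom_closed[OF that] by simp
  have B': "B = {h \<in> carrier M. c1 #>\<^bsub>G\<^esub> ?j h = c1}" unfolding B using c1j by (auto simp: c1_def)
  have cjj: "c #>\<^bsub>G\<^esub> ?j a #>\<^bsub>G\<^esub> ?j b = c #>\<^bsub>G\<^esub> ?j (a \<otimes>\<^bsub>M\<^esub> b)" if "c \<in> Om" "a \<in> carrier M" "b \<in> carrier M" for c a b
    using act_assoc[OF that(1) h.hom_closed[OF that(2)] h.hom_closed[OF that(3)]] h.hom_mult[OF that(2,3)] by simp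
  have cj1: "c #>\<^bsub>G\<^esub> ?j \<one>\<^bsub>M\<^esub> = c" if "c \<in> Om" for c using act_one[OF that] h.hom_one by simp
  show subB: "subgroup B M"
  proof
    show "B \<subseteq> carrier M" by (auto simp: B')
    show "\<one>\<^bsub>M\<^esub> \<in> B" using cj1[OF c1] by (simp add: B')
    show "x \<otimes>\<^bsub>M\<^esub> y \<in> B" if "x \<in> B" "y \<in> B" for x y
      using that cjj[OF c1, of x y] by (simp add: B')
    show "inv\<^bsub>M\<^esub> x \<in> B" if "x \<in> B" for x
      using that cjj[OF c1, of x "inv\<^bsub>M\<^esub> x"] cj1[OF c1] by (simp add: B')
  qed
  interpret B: subgroup B M by (rule subB)
  define orb where "orb = (\<lambda>h. c1 #>\<^bsub>G\<^esub> ?j h) ` carrier M"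
  define t where "t c = (SOME h. h \<in> carrier M \<and> c1 #>\<^bsub>G\<^esub> ?j h = c)" for c
  have t: "t c \<in> carrier M \<and> c1 #>\<^bsub>G\<^esub> ?j (t c) = c" if "c \<in> orb" for c
  proof -
    obtain h where "h \<in> carrier M" "c = c1 #>\<^bsub>G\<^esub> ?j h" using \<open>c \<in> orb\<close> unfolding orb_def by (rule imageE)
    then have "\<exists>h. h \<in> carrier M \<and> c1 #>\<^bsub>G\<^esub> ?j h = c" by (intro exI[of _ h] conjI) simp_all
    then show ?thesis unfolding t_def by (rule someI_ex)
  qed
  have orb_act: "c #>\<^bsub>G\<^esub> ?j a \<in> orb" if "c \<in> orb" "a \<in> carrier M" for c a
  proof -
    obtain h where h: "h \<in> carrier M" "c = c1 #>\<^bsub>G\<^esub> ?j h" using \<open>c \<in> orb\<close> unfolding orb_def by (rule imageE)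
    have "c #>\<^bsub>G\<^esub> ?j a = c1 #>\<^bsub>G\<^esub> ?j (h \<otimes>\<^bsub>M\<^esub> a)" using cjj[OF c1 h(1) that(2)] h(2) by simp
    then show ?thesis unfolding orb_def using h(1) that(2) by (rule image_eqI[OF _ M.m_closed])
  qed
  have orb_act': "c \<in> orb" if "c \<in> Om" "a \<in> carrier M" "c #>\<^bsub>G\<^esub> ?j a \<in> orb" for c a
  proof -
    have "c #>\<^bsub>G\<^esub> ?j a #>\<^bsub>G\<^esub> ?j (inv\<^bsub>M\<^esub> a) \<in> orb" by (rule orb_act[OF that(3) M.inv_closed[OF that(2)]])
    then show ?thesis unfolding cjj[OF that(1,2) M.inv_closed[OF that(2)]] M.r_inv[OF that(2)] cj1[OF that(1)] .
  qed
  \<comment> \<open>The Schreier element of one step: go from \<open>c1\<close> to \<open>c\<close>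
    by the transversal, take the letter, and return by the transversal from the new coset. Outside
    the orbit, and on letters of the other factor, the weight is trivial.\<close>
  define \<rho> where "\<rho> c l = (if c \<in> orb \<and> l \<in> range \<kappa>
     then t c \<otimes>\<^bsub>M\<^esub> inv_into UNIV \<kappa> l \<otimes>\<^bsub>M\<^esub> inv\<^bsub>M\<^esub> t (c #>\<^bsub>G\<^esub> cl [l]) else \<one>\<^bsub>M\<^esub>)" for c l
  have \<rho>\<kappa>: "\<rho> c (\<kappa> a) = (if c \<in> orb then t c \<otimes>\<^bsub>M\<^esub> a \<otimes>\<^bsub>M\<^esub> inv\<^bsub>M\<^esub> t (c #>\<^bsub>G\<^esub> ?j a) else \<one>\<^bsub>M\<^esub>)" for c a
    using \<kappa>(1) by (simp add: \<rho>_def)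
  have loop: "t c \<otimes>\<^bsub>M\<^esub> a \<otimes>\<^bsub>M\<^esub> inv\<^bsub>M\<^esub> t (c #>\<^bsub>G\<^esub> ?j a) \<in> B" if c: "c \<in> orb" and a: "a \<in> carrier M" for c a
  proof -
    note tc = t[OF c] and td = t[OF orb_act[OF c a]]
    let ?d = "c #>\<^bsub>G\<^esub> ?j a"
    have "c1 #>\<^bsub>G\<^esub> ?j (t c \<otimes>\<^bsub>M\<^esub> a \<otimes>\<^bsub>M\<^esub> inv\<^bsub>M\<^esub> t ?d) = c1 #>\<^bsub>G\<^esub> ?j (t c) #>\<^bsub>G\<^esub> ?j a #>\<^bsub>G\<^esub> ?j (inv\<^bsub>M\<^esub> t ?d)"
      using cjj[OF c1 M.m_closed[OF conjunct1[OF tc] a] M.inv_closed[OF conjunct1[OF td]]]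
        cjj[OF c1 conjunct1[OF tc] a] by simp
    also have "\<dots> = ?d #>\<^bsub>G\<^esub> ?j (inv\<^bsub>M\<^esub> t ?d)" using tc by simp
    also have "\<dots> = c1 #>\<^bsub>G\<^esub> ?j (t ?d) #>\<^bsub>G\<^esub> ?j (inv\<^bsub>M\<^esub> t ?d)" using td by simp
    also have "\<dots> = c1" using cjj[OF c1, of "t ?d" "inv\<^bsub>M\<^esub> t ?d"] td cj1[OF c1] by (simp only: M.inv_closed M.r_inv)
    finally have "c1 #>\<^bsub>G\<^esub> ?j (t c \<otimes>\<^bsub>M\<^esub> a \<otimes>\<^bsub>M\<^esub> inv\<^bsub>M\<^esub> t ?d) = c1" .
    then show ?thesis
      unfolding B' by (intro CollectI conjI M.m_closed M.inv_closed a conjunct1[OF tc] conjunct1[OF td])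
  qed
  have \<rho>_B: "\<rho> c l \<in> B" if "l \<in> L" for c l
  proof (cases "c \<in> orb \<and> l \<in> range \<kappa>")
    case True
    then have c: "c \<in> orb" and l: "l \<in> range \<kappa>" by simp_all
    have "\<rho> c l = t c \<otimes>\<^bsub>M\<^esub> inv_into UNIV \<kappa> l \<otimes>\<^bsub>M\<^esub> inv\<^bsub>M\<^esub> t (c #>\<^bsub>G\<^esub> ?j (inv_into UNIV \<kappa> l))"
      unfolding \<rho>_def f_inv_into_f[OF l] using True by (rule if_P)
    then show ?thesis using loop[OF c \<kappa>_M[OF that l]] by (simp only:)
  next
    case False
    then have "\<rho> c l = \<one>\<^bsub>M\<^esub>" unfolding \<rho>_def by (rule if_not_P)
    then show ?thesis using B.one_closed by (simp only:)
  qed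
  have \<rho>_M: "\<rho> c l \<in> carrier M" if "c \<in> Om" "l \<in> L" for c l using \<rho>_B[OF that(2)] by (rule B.mem_carrier)
  have resp: "coc M \<rho> c u = coc M \<rho> c v" if uv: "(u, v) \<in> S" and c: "c \<in> Om" for u v c
    using rel[OF uv]
  proof (elim disjE exE conjE)
    fix a b assume ab: "a \<in> carrier M" "b \<in> carrier M" "u = [\<kappa> a, \<kappa> b]" "v = [\<kappa> (a \<otimes>\<^bsub>M\<^esub> b)]"
    show ?thesis
    proof (cases "c \<in> orb")
      case True
      note oa = orb_act[OF True ab(1)] and ob = orb_act[OF orb_act[OF True ab(1)] ab(2)]
      have [simp]: "t c \<in> carrier M" "t (c #>\<^bsub>G\<^esub> ?j a) \<in> carrier M" "t (c #>\<^bsub>G\<^esub> ?j (a \<otimes>\<^bsub>M\<^esub> b)) \<in> carrier M"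
        using t[OF True] t[OF oa] t[OF ob] cjj[OF c ab(1,2)] by simp_all
      have [simp]: "inv\<^bsub>M\<^esub> x \<otimes>\<^bsub>M\<^esub> (x \<otimes>\<^bsub>M\<^esub> y) = y" if "x \<in> carrier M" "y \<in> carrier M" for x y
        using that by (simp add: M.m_assoc[symmetric])
      show ?thesis using ab True oa cjj[OF c ab(1,2)] by (simp add: \<rho>\<kappa> M.m_assoc)
    next
      case False
      then have "c #>\<^bsub>G\<^esub> ?j a \<notin> orb" using orb_act'[OF c ab(1)] by blast
      then show ?thesis using ab False by (simp add: \<rho>\<kappa>)
    qed
  next
    assume "u = [\<kappa> \<one>\<^bsub>M\<^esub>]" "v = []"
    then show ?thesis using t[of c] cj1[OF c] by (simp add: \<rho>\<kappa>)
  next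
    assume d: "(set u \<union> set v) \<inter> range \<kappa> = {}"
    have "coc M \<rho> c x = \<one>\<^bsub>M\<^esub>" if "set x \<inter> range \<kappa> = {}" for x c
      using that by (induction x arbitrary: c) (auto simp: \<rho>_def)
    then show ?thesis using d by (simp add: Int_Un_distrib2)
  qed
  note cc = M \<rho>_M resp
  have coc_B: "coc M \<rho> c w \<in> B" if "w \<in> lists L" for c w
    using that by (induction w arbitrary: c) (auto intro: \<rho>_B)
  obtain w1 where w1: "w1 \<in> lists L" "g = cl w1" using cl_surj[OF g] by blast
  obtain w2 where w2: "w2 \<in> lists L" "inv\<^bsub>G\<^esub> g = cl w2" using cl_surj[of "inv\<^bsub>G\<^esub> g"] g by auto
  have c1o: "c1 \<in> orb" unfolding orb_def by (rule image_eqI[where x = "\<one>\<^bsub>M\<^esub>"]) (rule cj1[OF c1, symmetric], rule M.one_closed)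
  \<comment> \<open>The path from \<open>A\<close> to \<open>c1\<close> spelled by \<open>w1\<close>
    contributes to the cocycle, and the transversal need not be trivial at \<open>c1\<close>;
    \<gamma> collects both effects.\<close>
  define \<gamma> where "\<gamma> = coc M \<rho> A w1 \<otimes>\<^bsub>M\<^esub> t c1"
  have t1: "t c1 \<in> B" unfolding B' using t[OF c1o] by (rule CollectI)
  have \<gamma>B: "\<gamma> \<in> B" unfolding \<gamma>_def by (rule B.m_closed[OF coc_B[OF w1(1)] t1])
  \<comment> \<open>The word formed by \<open>w1\<close>, the letter of \<open>h\<close> and
    \<open>w2\<close> represents the conjugate of the image of \<open>h\<close> by \<open>g\<close>.
    This is an element of \<open>A\<close>, and its cocycle is the conjugate of \<open>h\<close> by
    \<gamma>.\<close>
  have conj: "\<gamma> \<otimes>\<^bsub>M\<^esub> h \<otimes>\<^bsub>M\<^esub> inv\<^bsub>M\<^esub> \<gamma> \<in> generate M (coc M \<rho> A ` Wd)" if h: "h \<in> B" for h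
  proof -
    have hM: "h \<in> carrier M" "c1 #>\<^bsub>G\<^esub> ?j h = c1" using CollectD[OF h[unfolded B']] by blast+
    have hl: "[\<kappa> h] \<in> lists L" using subsetD[OF \<kappa>(2) imageI[OF hM(1)]] by simp
    let ?w = "w1 @ [\<kappa> h] @ w2"
    have wl: "?w \<in> lists L" "[\<kappa> h] @ w2 \<in> lists L" using w1(1) w2(1) hl by simp_all
    have clw: "cl ?w = g \<otimes>\<^bsub>G\<^esub> (?j h \<otimes>\<^bsub>G\<^esub> inv\<^bsub>G\<^esub> g)"
      using cl_append[OF w1(1) wl(2)] cl_append[OF hl w2(1)] w1(2) w2(2) by simp
    have "A #>\<^bsub>G\<^esub> cl ?w = c1 #>\<^bsub>G\<^esub> ?j h #>\<^bsub>G\<^esub> inv\<^bsub>G\<^esub> g"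
      unfolding clw c1_def using act_assoc[OF A_Om g] act_assoc[OF act[OF A_Om g]] g h.hom_closed[OF hM(1)]
      by (simp only: G.m_closed G.inv_closed)
    also have "\<dots> = A" unfolding hM(2) unfolding c1_def using act_assoc[OF A_Om g G.inv_closed[OF g]] g
      by (simp only: act_one A_Om G.r_inv)
    finally have "cl ?w \<in> A" using G.coset_join1[OF _ cl_closed[OF wl(1)] A] by simp
    from coc_generate[OF cc Wd(2,3,4) wl(1) this]
    have 1: "coc M \<rho> A ?w \<in> generate M (coc M \<rho> A ` Wd)" by simp
    have cA: "A #>\<^bsub>G\<^esub> cl w1 = c1" using w1 by (simp add: c1_def)
    have 2: "coc M \<rho> A ?w = coc M \<rho> A w1 \<otimes>\<^bsub>M\<^esub> (\<rho> c1 (\<kappa> h) \<otimes>\<^bsub>M\<^esub> coc M \<rho> c1 w2)"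
      using coc_append[OF cc w1(1) wl(2) A_Om] cA hM by simp
    have ww: "w1 @ w2 \<in> lists L" using w1(1) w2(1) by simp
    have cl2: "cl (w1 @ w2) = cl []"
      unfolding cl_append[OF w1(1) w2(1)] w1(2)[symmetric] w2(2)[symmetric] cl_Nil by (rule G.r_inv[OF g])
    have "coc M \<rho> A (w1 @ w2) = coc M \<rho> A []"
      by (rule coc_cl_eq[OF M], erule (1) \<rho>_M, erule (1) resp, rule ww, rule cl2, rule A_Om)
    then have "coc M \<rho> A w1 \<otimes>\<^bsub>M\<^esub> coc M \<rho> c1 w2 = \<one>\<^bsub>M\<^esub>"
      using coc_append[OF cc w1(1) w2(1) A_Om] cA by simp
    then have 3: "coc M \<rho> c1 w2 = inv\<^bsub>M\<^esub> coc M \<rho> A w1"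
      using M.inv_equality[OF M.inv_comm] B.mem_carrier[OF coc_B[OF w1(1)]] B.mem_carrier[OF coc_B[OF w2(1)]] by simp
    have 4: "\<rho> c1 (\<kappa> h) = t c1 \<otimes>\<^bsub>M\<^esub> h \<otimes>\<^bsub>M\<^esub> inv\<^bsub>M\<^esub> t c1"
      unfolding \<rho>\<kappa> hM(2) using c1o by (rule if_P)
    have "coc M \<rho> A ?w = \<gamma> \<otimes>\<^bsub>M\<^esub> h \<otimes>\<^bsub>M\<^esub> inv\<^bsub>M\<^esub> \<gamma>"
      unfolding 2 3 4 \<gamma>_def using B.mem_carrier[OF coc_B[OF w1(1), of A]] B.mem_carrier[OF t1] hM(1)
      by (simp add: M.inv_mult_group M.m_assoc)
    then show ?thesis using 1 by simp
  qed
  have hconj: "h = inv\<^bsub>M\<^esub> \<gamma> \<otimes>\<^bsub>M\<^esub> (\<gamma> \<otimes>\<^bsub>M\<^esub> h \<otimes>\<^bsub>M\<^esub> inv\<^bsub>M\<^esub> \<gamma>) \<otimes>\<^bsub>M\<^esub> \<gamma>" if "h \<in> B" for h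
  proof -
    have [simp]: "inv\<^bsub>M\<^esub> x \<otimes>\<^bsub>M\<^esub> (x \<otimes>\<^bsub>M\<^esub> y) = y" if "x \<in> carrier M" "y \<in> carrier M" for x y
      using that by (simp add: M.m_assoc[symmetric])
    show ?thesis using B.mem_carrier[OF \<gamma>B] B.mem_carrier[OF \<open>h \<in> B\<close>] by (simp add: M.m_assoc)
  qed
  \<comment> \<open>\<gamma> lies in \<open>B\<close> and is added to the generators in order to
    undo the conjugation.\<close>
  let ?D = "insert \<gamma> (coc M \<rho> A ` Wd)"
  have DB: "?D \<subseteq> B" using \<gamma>B coc_B Wd(2) by auto
  have "generate M ?D = B"
  proof
    show "generate M ?D \<subseteq> B" using M.generate_subgroup_incl[OF DB subB] .
    show "B \<subseteq> generate M ?D"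
    proof
      fix h assume h: "h \<in> B"
      have sub: "generate M (coc M \<rho> A ` Wd) \<subseteq> generate M ?D" by (intro M.mono_generate) auto
      have "inv\<^bsub>M\<^esub> \<gamma> \<otimes>\<^bsub>M\<^esub> (\<gamma> \<otimes>\<^bsub>M\<^esub> h \<otimes>\<^bsub>M\<^esub> inv\<^bsub>M\<^esub> \<gamma>) \<otimes>\<^bsub>M\<^esub> \<gamma> \<in> generate M ?D"
        by (intro generate.eng[OF generate.eng[OF generate.inv subsetD[OF sub conj[OF h]]] generate.incl]) simp_all
      then show "h \<in> generate M ?D" using hconj[OF h] by simp
    qed
  qed
  then show "finitely_generated (M\<lparr>carrier := B\<rparr>)"
    unfolding finitely_generated_def using M.generate_consistent[OF DB subB] DB Wd(1)
    by (intro exI[of _ ?D]) auto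
  \<comment> \<open>If the orbit is never visited, all weights along the generators are trivial.
    Then every conjugate provided by \<open>conj\<close> is the identity, and so is
    \<open>h\<close>.\<close>
  show "B = {\<one>\<^bsub>M\<^esub>}" if away: "\<And>h. h \<in> carrier M \<Longrightarrow> A #>\<^bsub>G\<^esub> (g \<otimes>\<^bsub>G\<^esub> cl [\<kappa> h]) \<notin> visits Wd"
  proof -
    have orb_v: "c \<notin> orb" if "c \<in> visits Wd" for c
  proof
    assume "c \<in> orb"
    then obtain h where h: "h \<in> carrier M" "c = c1 #>\<^bsub>G\<^esub> ?j h" unfolding orb_def by (rule imageE)
    then show False using away[OF h(1)] \<open>c \<in> visits Wd\<close> unfolding h(2) c1j[OF h(1)] by simp
  qed
    have "coc M \<rho> A w = \<one>\<^bsub>M\<^esub>" if w: "w \<in> Wd" for w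
    proof (rule coc_trivial[OF cc _ A_Om])
      show "w \<in> lists L" using w Wd(2) by blast
      fix i assume "i < length w"
      then have "A #>\<^bsub>G\<^esub> cl (take i w) \<in> visits Wd"
        unfolding visits_def using w by (intro UN_I[of w] imageI) simp_all
      from orb_v[OF this] show "\<rho> (A #>\<^bsub>G\<^esub> cl (take i w)) (w ! i) = \<one>\<^bsub>M\<^esub>" by (simp add: \<rho>_def)
    qed
    then have *: "generate M (coc M \<rho> A ` Wd) \<subseteq> {\<one>\<^bsub>M\<^esub>}"
      by (intro M.generate_subgroup_incl M.triv_subgroup) auto
    have "h = \<one>\<^bsub>M\<^esub>" if "h \<in> B" for h
    proof -
      have "\<gamma> \<otimes>\<^bsub>M\<^esub> h \<otimes>\<^bsub>M\<^esub> inv\<^bsub>M\<^esub> \<gamma> = \<one>\<^bsub>M\<^esub>" using subsetD[OF * conj[OF that]] by simp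
      then show ?thesis using hconj[OF that] B.mem_carrier[OF \<gamma>B] by simp
    qed
    then show ?thesis using B.one_closed by blast
  qed
qed

text \<open>The weight of a letter in \<open>P\<close> counts leaving \<open>e\<close> minus
  entering \<open>e\<close>. Merging two letters of one factor cancels the intermediate coset, so
  the relations are respected. The potential of a coset is the cocycle of any word that leads to it
  from \<open>A\<close>.\<close>

lemma potential:
  fixes P :: "'l set"
  assumes rel: "\<And>u v. (u, v) \<in> S \<Longrightarrow> cl u = cl v"
    and relP: "\<And>u v. (u, v) \<in> S \<Longrightarrow>
      (\<exists>a b d. u = [a, b] \<and> v = [d] \<and> (a \<in> P \<longleftrightarrow> d \<in> P) \<and> (b \<in> P \<longleftrightarrow> d \<in> P)) \<or> (\<exists>a. u = [a] \<and> v = [])"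
    and Wd: "finite Wd" "Wd \<subseteq> lists L" "cl ` Wd \<subseteq> A" "generate G (cl ` Wd) = A"
    and e: "e \<notin> visits Wd"
  shows "\<exists>s :: 'l list set set \<Rightarrow> int. \<forall>c\<in>Om. \<forall>l\<in>L.
    s (c #>\<^bsub>G\<^esub> cl [l]) = s c + (if l \<in> P then of_bool (c = e) - of_bool (c #>\<^bsub>G\<^esub> cl [l] = e) else 0)"
proof -
  define Z :: "int monoid" where "Z = \<lparr>carrier = UNIV, mult = (+), one = 0\<rparr>"
  have Z [simp]: "carrier Z = UNIV" "x \<otimes>\<^bsub>Z\<^esub> y = x + y" "\<one>\<^bsub>Z\<^esub> = 0" for x y by (simp_all add: Z_def)
  have gZ: "group Z"
  proof (rule groupI)
    show "\<exists>y\<in>carrier Z. y \<otimes>\<^bsub>Z\<^esub> x = \<one>\<^bsub>Z\<^esub>" for x by (intro bexI[of _ "- x"]) simp_all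
  qed simp_all
  define \<rho> :: "'l list set set \<Rightarrow> 'l \<Rightarrow> int" where
    "\<rho> c l = (if l \<in> P then of_bool (c = e) - of_bool (c #>\<^bsub>G\<^esub> cl [l] = e) else 0)" for c l
  have \<rho>_Z: "\<rho> c l \<in> carrier Z" for c l by simp
  have resp: "coc Z \<rho> c u = coc Z \<rho> c v" if uv: "(u, v) \<in> S" and c: "c \<in> Om" for u v c
    using relP[OF uv]
  proof (elim disjE exE conjE)
    fix a b d assume ab: "u = [a, b]" "v = [d]" "(a \<in> P) = (d \<in> P)" "(b \<in> P) = (d \<in> P)"
    have l: "[a] \<in> lists L" "[b] \<in> lists L" using S_lists[OF uv] ab by auto
    have "c #>\<^bsub>G\<^esub> cl [a] #>\<^bsub>G\<^esub> cl [b] = c #>\<^bsub>G\<^esub> cl [d]"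
      using act_assoc[OF c cl_closed[OF l(1)] cl_closed[OF l(2)]] cl_append[OF l] rel[OF uv] ab by simp
    then show ?thesis using ab by (simp add: \<rho>_def)
  next
    fix a assume a: "u = [a]" "v = []"
    have "c #>\<^bsub>G\<^esub> cl [a] = c" using rel[OF uv] a act_one[OF c] by (simp add: cl_Nil)
    then show ?thesis using a by (simp add: \<rho>_def)
  qed
  note cc = gZ \<rho>_Z resp
  have "coc Z \<rho> A w = 0" if w: "w \<in> Wd" for w
  proof -
    have wl: "w \<in> lists L" using w Wd(2) by blast
    have "coc Z \<rho> A w = \<one>\<^bsub>Z\<^esub>"
    proof (rule coc_trivial[OF cc wl A_Om])
      fix i assume i: "i < length w"
      have t: "take i w \<in> lists L" "[w ! i] \<in> lists L" using wl i by (auto dest: in_set_takeD)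
      have "A #>\<^bsub>G\<^esub> cl (take i w) #>\<^bsub>G\<^esub> cl [w ! i] = A #>\<^bsub>G\<^esub> cl (take (Suc i) w)"
        using act_assoc[OF A_Om cl_closed[OF t(1)] cl_closed[OF t(2)]] cl_append[OF t] i
        by (simp add: take_Suc_conv_app_nth)
      moreover have "A #>\<^bsub>G\<^esub> cl (take k w) \<noteq> e" if "k \<le> length w" for k
        using e w that unfolding visits_def by auto
      ultimately show "\<rho> (A #>\<^bsub>G\<^esub> cl (take i w)) (w ! i) = \<one>\<^bsub>Z\<^esub>" using i by (simp add: \<rho>_def)
    qed auto
    then show ?thesis by simp
  qed
  then have "generate Z (coc Z \<rho> A ` Wd) \<subseteq> {\<one>\<^bsub>Z\<^esub>}"
    by (intro group.generate_subgroup_incl[OF gZ] group.triv_subgroup[OF gZ]) auto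
  then have van: "coc Z \<rho> A w = 0" if "w \<in> lists L" "cl w \<in> A" for w
    using coc_generate[OF cc Wd(2,3,4) that] by auto
  \<comment> \<open>Two words that lead to the same coset are closed up by one and the same word
    \<open>x\<close> back to \<open>A\<close>, where the cocycle vanishes.\<close>
  have wd: "coc Z \<rho> A u = coc Z \<rho> A v" if u: "u \<in> lists L" and v: "v \<in> lists L" and eq: "A #>\<^bsub>G\<^esub> cl u = A #>\<^bsub>G\<^esub> cl v" for u v
  proof -
    obtain x where x: "x \<in> lists L" "inv\<^bsub>G\<^esub> cl v = cl x" using cl_surj[OF G.inv_closed[OF cl_closed[OF v]]] by blast
    have "coc Z \<rho> A y + coc Z \<rho> (A #>\<^bsub>G\<^esub> cl v) x = 0" if y: "y \<in> lists L" "A #>\<^bsub>G\<^esub> cl y = A #>\<^bsub>G\<^esub> cl v" for y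
    proof -
      have yx: "y @ x \<in> lists L" using y x by simp
      have "A #>\<^bsub>G\<^esub> cl (y @ x) = A #>\<^bsub>G\<^esub> cl v #>\<^bsub>G\<^esub> cl x"
        using act_assoc[OF A_Om cl_closed[OF y(1)] cl_closed[OF x(1)]] cl_append[OF y(1) x(1)] y(2) by simp
      also have "\<dots> = A"
        unfolding x(2)[symmetric] using act_assoc[OF A_Om] cl_closed[OF v] by (simp add: act_one A_Om)
      finally have "cl (y @ x) \<in> A" using G.coset_join1[OF _ cl_closed[OF yx] A] by simp
      then show ?thesis using van[OF yx] coc_append[OF cc y(1) x(1) A_Om] y(2) by simp
    qed
    from this[OF u eq] this[OF v HOL.refl] show ?thesis by simp
  qed
  define s where "s c = coc Z \<rho> A (SOME w. w \<in> lists L \<and> c = A #>\<^bsub>G\<^esub> cl w)" for c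
  have s: "s (A #>\<^bsub>G\<^esub> cl w) = coc Z \<rho> A w" if "w \<in> lists L" for w
  proof -
    let ?u = "SOME u. u \<in> lists L \<and> A #>\<^bsub>G\<^esub> cl w = A #>\<^bsub>G\<^esub> cl u"
    have u: "?u \<in> lists L \<and> A #>\<^bsub>G\<^esub> cl w = A #>\<^bsub>G\<^esub> cl ?u"
      by (rule someI[of _ w]) (rule conjI[OF that HOL.refl])
    show ?thesis unfolding s_def by (rule wd[OF conjunct1[OF u] that conjunct2[OF u, symmetric]])
  qed
  have "s (c #>\<^bsub>G\<^esub> cl [l]) = s c + \<rho> c l" if c: "c \<in> Om" and l: "l \<in> L" for c l
  proof -
    obtain w where w: "w \<in> lists L" "c = A #>\<^bsub>G\<^esub> cl w"
    proof -
      obtain x where "x \<in> carrier G" "c = A #>\<^bsub>G\<^esub> x" using c unfolding RCOSETS_def by blast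
      then show ?thesis using cl_surj[of x] that by blast
    qed
    have ll: "[l] \<in> lists L" "w @ [l] \<in> lists L" using l w(1) by simp_all
    have "c #>\<^bsub>G\<^esub> cl [l] = A #>\<^bsub>G\<^esub> cl (w @ [l])"
      using w(2) act_assoc[OF A_Om cl_closed[OF w(1)] cl_closed[OF ll(1)]] cl_append[OF w(1) ll(1)] by simp
    then show ?thesis using s[OF ll(2)] s[OF w(1)] coc_append[OF cc w(1) ll(1) A_Om] w(2) by simp
  qed
  then show ?thesis unfolding \<rho>_def by (intro exI[of _ s]) simp
qed

end

section \<open>The presentation of a free product\<close>

lemma word_cong_map:
  assumes f: "f ` A \<subseteq> A'" and S: "\<And>u v. (u, v) \<in> S \<Longrightarrow> (map f u, map f v) \<in> S'"
  shows "word_cong A S u v \<Longrightarrow> word_cong A' S' (map f u) (map f v)"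
proof (induction rule: word_cong.induct)
  case (refl w)
  then show ?case using f by (intro word_cong.refl) (auto simp: image_subset_iff)
next
  case (rewrite u v p q)
  have m: "map f w \<in> lists A'" if "w \<in> lists A" for w
    using that f by (auto simp: image_subset_iff)
  show ?case
    using word_cong.rewrite[OF S[OF rewrite(1)] m[OF rewrite(2)] m[OF rewrite(3)] m[OF rewrite(4)] m[OF rewrite(5)]]
    by simp
qed (blast intro: word_cong.sym word_cong.trans)+

lemma group_relations_map:
  assumes "\<epsilon> ` X \<subseteq> X'" "map (map_prod \<epsilon> id) ` R \<subseteq> R'" "(u, v) \<in> group_relations X R"
  shows "(map (map_prod \<epsilon> id) u, map (map_prod \<epsilon> id) v) \<in> group_relations X' R'"
  using assms(3) unfolding group_relations_def
proof (elim UnE CollectE exE conjE)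
  fix x b assume "(u, v) = ([(x, b), (x, \<not> b)], [])" "x \<in> X"
  then show "(map (map_prod \<epsilon> id) u, map (map_prod \<epsilon> id) v) \<in>
      {([(x, b), (x, \<not> b)], []) |x b. x \<in> X'} \<union> {(r, []) |r. r \<in> R'}"
    using assms(1) by auto
next
  fix r assume "(u, v) = (r, [])" "r \<in> R"
  then show "(map (map_prod \<epsilon> id) u, map (map_prod \<epsilon> id) v) \<in>
      {([(x, b), (x, \<not> b)], []) |x b. x \<in> X'} \<union> {(r, []) |r. r \<in> R'}"
    using assms(2) by blast
qed

context presentation begin

text \<open>The word \<open>u @ ?i @ v\<close> cancels to \<open>u\<close> on the right and to
  \<open>v\<close> on the left.\<close>

lemma word_cong_if_word_val_eq:
  assumes u: "u \<in> lists (letters X)" and v: "v \<in> lists (letters X)" and eq: "word_val G \<phi> u = word_val G \<phi> v"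
  shows "word_cong (letters X) (group_relations X R) u v"
proof -
  let ?c = "word_cong (letters X) (group_relations X R)" and ?i = "word_inv v"
  have i: "?i \<in> lists (letters X)" using word_inv_lists[OF v] .
  have l: "?i @ v \<in> lists (letters X)" "u @ ?i \<in> lists (letters X)" using u v i by simp_all
  note val = word_val_append[OF i v] word_val_append[OF u i] word_val_inv[OF v] word_val_closed[OF v]
  have "?c (?i @ v) []" by (rule word_val_one[OF l(1)]) (simp add: val)
  from word_cong_append_left[OF this u] have "?c (u @ ?i @ v) u" by simp
  moreover have "?c (u @ ?i) []" by (rule word_val_one[OF l(2)]) (simp add: val eq)
  from word_cong_append_right[OF this v] have "?c (u @ ?i @ v) v" by simp
  ultimately show ?thesis using word_cong.sym word_cong.trans by metis
qed

definition spell :: "'a \<Rightarrow> ('x \<times> bool) list" where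
  "spell g = (SOME w. w \<in> lists (letters X) \<and> word_val G \<phi> w = g)"

lemma spell:
  assumes "g \<in> carrier G" shows "spell g \<in> lists (letters X)" "word_val G \<phi> (spell g) = g"
proof -
  have "\<exists>w. w \<in> lists (letters X) \<and> word_val G \<phi> w = g" using word_val_surj[OF assms] by blast
  from someI_ex[OF this] show "spell g \<in> lists (letters X)" "word_val G \<phi> (spell g) = g"
    unfolding spell_def by blast+
qed

end

lemma letter_hom:
  assumes "\<And>a b. a \<in> carrier M \<Longrightarrow> b \<in> carrier M \<Longrightarrow> ([\<kappa> a, \<kappa> b], [\<kappa> (a \<otimes>\<^bsub>M\<^esub> b)]) \<in> S"
    "\<kappa> ` carrier M \<subseteq> L" "monoid M"
  shows "(\<lambda>h. word_class L S [\<kappa> h]) \<in> hom M (word_monoid L S)"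
proof (rule homI)
  fix a assume a: "a \<in> carrier M"
  then have al: "[\<kappa> a] \<in> lists L" using assms(2) by auto
  then show "word_class L S [\<kappa> a] \<in> carrier (word_monoid L S)" by (simp add: word_monoid_def)
  fix b assume b: "b \<in> carrier M"
  then have bl: "[\<kappa> b] \<in> lists L" "[\<kappa> a, \<kappa> b] \<in> lists L" "[\<kappa> (a \<otimes>\<^bsub>M\<^esub> b)] \<in> lists L"
    using assms(2) a monoid.m_closed[OF assms(3) a b] by auto
  have "word_cong L S [\<kappa> a, \<kappa> b] [\<kappa> (a \<otimes>\<^bsub>M\<^esub> b)]"
    using word_cong.rewrite[OF assms(1)[OF a b] bl(2,3), of "[]" "[]"] by simp
  from iffD2[OF word_class_eq_iff[OF bl(2)] this]
  have "word_class L S [\<kappa> (a \<otimes>\<^bsub>M\<^esub> b)] = word_class L S ([\<kappa> a] @ [\<kappa> b])" by simp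
  then show "word_class L S [\<kappa> (a \<otimes>\<^bsub>M\<^esub> b)] = word_class L S [\<kappa> a] \<otimes>\<^bsub>word_monoid L S\<^esub> word_class L S [\<kappa> b]"
    unfolding mult_word_monoid[OF al bl(1)] .
qed

locale free_pair = H: presentation H XH \<phi>H RH + K: presentation K XK \<phi>K RK
  for H :: "('a, 'm) monoid_scheme" and XH :: "nat set" and \<phi>H RH
    and K :: "('b, 'n) monoid_scheme" and XK :: "nat set" and \<phi>K RK
begin

abbreviation "L \<equiv> carrier H <+> carrier K"
abbreviation "S \<equiv> free_product_relations H K"
abbreviation "G \<equiv> word_monoid L S"
abbreviation "cl \<equiv> word_class L S"
abbreviation "jH h \<equiv> cl [Inl h]"
abbreviation "jK h \<equiv> cl [Inr h]"
text \<open>Even and odd numbers realize the disjoint union of the two generating sets inside the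
  natural numbers, over which \<open>locally_tame\<close> takes its generators.\<close>

abbreviation "\<epsilon>H \<equiv> \<lambda>n::nat. 2 * n"
abbreviation "\<epsilon>K \<equiv> \<lambda>n::nat. 2 * n + 1"
abbreviation "encH \<equiv> map (map_prod \<epsilon>H (id :: bool \<Rightarrow> bool))"
abbreviation "encK \<equiv> map (map_prod \<epsilon>K (id :: bool \<Rightarrow> bool))"

definition "X = \<epsilon>H ` XH \<union> \<epsilon>K ` XK"
definition "R = encH ` RH \<union> encK ` RK"
definition "\<phi> n = (if even n then jH (\<phi>H (n div 2)) else jK (\<phi>K (n div 2)))" for n

lemma S_cases:
  assumes "(u, v) \<in> S"
  obtains a b where "a \<in> carrier H" "b \<in> carrier H" "u = [Inl a, Inl b]" "v = [Inl (a \<otimes>\<^bsub>H\<^esub> b)]"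
  | a b where "a \<in> carrier K" "b \<in> carrier K" "u = [Inr a, Inr b]" "v = [Inr (a \<otimes>\<^bsub>K\<^esub> b)]"
  | "u = [Inl \<one>\<^bsub>H\<^esub>]" "v = []" | "u = [Inr \<one>\<^bsub>K\<^esub>]" "v = []"
  using assms unfolding free_product_relations_def by blast

lemma S_lists: assumes "(u, v) \<in> S" shows "u \<in> lists L \<and> v \<in> lists L"
  using assms by (cases rule: S_cases) auto

sublocale G: group G
  using group_free_product[OF H.is_group K.is_group] unfolding free_product_def .

lemma cl_cong: "word_cong L S u v \<Longrightarrow> cl u = cl v"
  using word_class_eq_iff[THEN iffD2] word_cong_in_lists[THEN conjunct1] by metis

lemma cl_S: "(u, v) \<in> S \<Longrightarrow> cl u = cl v"
  using word_cong.rewrite[of u v S L "[]" "[]"] S_lists[of u v] cl_cong[of u v] by simp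

lemma cl_append: "u \<in> lists L \<Longrightarrow> v \<in> lists L \<Longrightarrow> cl (u @ v) = cl u \<otimes>\<^bsub>G\<^esub> cl v"
  by (simp only: mult_word_monoid)

lemma cl_Nil: "cl [] = \<one>\<^bsub>G\<^esub>"
  by (simp add: word_monoid_def)

lemma jH_hom: "jH \<in> hom H G"
  by (rule letter_hom) (auto simp: free_product_relations_def H.is_monoid)

lemma jK_hom: "jK \<in> hom K G"
  by (rule letter_hom) (auto simp: free_product_relations_def K.is_monoid)

sublocale jH: group_hom H G jH using jH_hom by unfold_locales
sublocale jK: group_hom K G jK using jK_hom by unfold_locales

lemma \<phi>_\<epsilon>H: "\<phi> (\<epsilon>H x) = jH (\<phi>H x)" and \<phi>_\<epsilon>K: "\<phi> (\<epsilon>K x) = jK (\<phi>K x)"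
  by (simp_all add: \<phi>_def)

sublocale word_group G X \<phi>
proof (unfold_locales, rule funcsetI)
  fix n assume "n \<in> X"
  then consider x where "x \<in> XH" "n = \<epsilon>H x" | x where "x \<in> XK" "n = \<epsilon>K x" unfolding X_def by blast
  then show "\<phi> n \<in> carrier G"
  proof cases
    case 1
    show ?thesis unfolding 1(2) \<phi>_\<epsilon>H by (rule jH.hom_closed[OF funcset_mem[OF H.gens 1(1)]])
  next
    case 2
    show ?thesis unfolding 2(2) \<phi>_\<epsilon>K by (rule jK.hom_closed[OF funcset_mem[OF K.gens 2(1)]])
  qed
qed

lemma word_val_encH: "w \<in> lists (letters XH) \<Longrightarrow> word_val G \<phi> (encH w) = jH (word_val H \<phi>H w)"
  by (intro H.word_val_map[OF jH.group_hom_axioms] \<phi>_\<epsilon>H)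

lemma word_val_encK: "w \<in> lists (letters XK) \<Longrightarrow> word_val G \<phi> (encK w) = jK (word_val K \<phi>K w)"
  by (intro K.word_val_map[OF jK.group_hom_axioms] \<phi>_\<epsilon>K)

lemma encH_lists: "w \<in> lists (letters XH) \<Longrightarrow> encH w \<in> lists (letters X)"
  by (force simp: letters_def X_def)

lemma encK_lists: "w \<in> lists (letters XK) \<Longrightarrow> encK w \<in> lists (letters X)"
  by (force simp: letters_def X_def)

abbreviation "wc \<equiv> word_cong (letters X) (group_relations X R)"

lemma encH_cong:
  assumes "u \<in> lists (letters XH)" "v \<in> lists (letters XH)" "word_val H \<phi>H u = word_val H \<phi>H v"
  shows "wc (encH u) (encH v)"
  by (rule word_cong_map[OF _ group_relations_map H.word_cong_if_word_val_eq[OF assms]])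
    (auto simp: letters_def X_def R_def)

lemma encK_cong:
  assumes "u \<in> lists (letters XK)" "v \<in> lists (letters XK)" "word_val K \<phi>K u = word_val K \<phi>K v"
  shows "wc (encK u) (encK v)"
  by (rule word_cong_map[OF _ group_relations_map K.word_cong_if_word_val_eq[OF assms]])
    (auto simp: letters_def X_def R_def)

text \<open>The translation from syllables back to generators, by a chosen spelling of each element
  within its own factor. It serves to derive relations between generators from relations in the free
  product.\<close>

definition \<theta> :: "'a + 'b \<Rightarrow> (nat \<times> bool) list" where
  "\<theta> l = (case l of Inl h \<Rightarrow> encH (H.spell h) | Inr k \<Rightarrow> encK (K.spell k))"

definition \<Theta> :: "('a + 'b) list \<Rightarrow> (nat \<times> bool) list" where
  "\<Theta> u = concat (map \<theta> u)"

lemma \<theta>_lists: "l \<in> L \<Longrightarrow> \<theta> l \<in> lists (letters X)"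
  by (elim PlusE) (simp_all only: \<theta>_def sum.case encH_lists encK_lists H.spell(1) K.spell(1))

lemma \<Theta>_simps: "\<Theta> [] = []" "\<Theta> (l # u) = \<theta> l @ \<Theta> u" "\<Theta> (u @ v) = \<Theta> u @ \<Theta> v"
  by (simp_all add: \<Theta>_def)

lemma \<Theta>_lists: "u \<in> lists L \<Longrightarrow> \<Theta> u \<in> lists (letters X)"
proof (induction u)
  case (Cons l u)
  then have "\<theta> l \<in> lists (letters X)" "\<Theta> u \<in> lists (letters X)" using \<theta>_lists[of l] by simp_all
  then show ?case by (simp add: \<Theta>_simps)
qed (simp add: \<Theta>_simps)

lemma word_val_\<Theta>: "u \<in> lists L \<Longrightarrow> word_val G \<phi> (\<Theta> u) = cl u"
proof (induction u)
  case (Cons l u)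
  then have l: "l \<in> L" "[l] \<in> lists L" and u: "u \<in> lists L" by auto
  have "word_val G \<phi> (\<theta> l) = cl [l]"
    using l(1)
  proof (elim PlusE)
    fix h assume h: "l = Inl h" "h \<in> carrier H"
    show ?thesis unfolding h(1) \<theta>_def sum.case word_val_encH[OF H.spell(1)[OF h(2)]] H.spell(2)[OF h(2)] ..
  next
    fix h assume h: "l = Inr h" "h \<in> carrier K"
    show ?thesis unfolding h(1) \<theta>_def sum.case word_val_encK[OF K.spell(1)[OF h(2)]] K.spell(2)[OF h(2)] ..
  qed
  then show ?case
    using Cons word_val_append[OF \<theta>_lists[OF l(1)] \<Theta>_lists[OF u]] cl_append[OF l(2) u] by (simp add: \<Theta>_simps)
qed (simp add: \<Theta>_simps cl_Nil)

text \<open>The spellings of the two sides have the same value in one factor, so they are congruent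
  by the relators of that factor; renaming the generators preserves the congruence.\<close>

lemma \<Theta>_S:
  assumes "(u, v) \<in> S" shows "wc (\<Theta> u) (\<Theta> v)"
  using assms
proof (cases rule: S_cases)
  case (1 a b)
  have ab: "a \<otimes>\<^bsub>H\<^esub> b \<in> carrier H" using 1 by simp
  note s = H.spell[OF 1(1)] H.spell[OF 1(2)] H.spell[OF ab]
  have "wc (encH (H.spell a @ H.spell b)) (encH (H.spell (a \<otimes>\<^bsub>H\<^esub> b)))"
    by (rule encH_cong) (use s H.word_val_append[OF s(1,3)] in simp_all)
  then show ?thesis unfolding 1(3,4) by (simp add: \<Theta>_def \<theta>_def)
next
  case (2 a b)
  have ab: "a \<otimes>\<^bsub>K\<^esub> b \<in> carrier K" using 2 by simp
  note s = K.spell[OF 2(1)] K.spell[OF 2(2)] K.spell[OF ab]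
  have "wc (encK (K.spell a @ K.spell b)) (encK (K.spell (a \<otimes>\<^bsub>K\<^esub> b)))"
    by (rule encK_cong) (use s K.word_val_append[OF s(1,3)] in simp_all)
  then show ?thesis unfolding 2(3,4) by (simp add: \<Theta>_def \<theta>_def)
next
  case 3
  have "wc (encH (H.spell \<one>\<^bsub>H\<^esub>)) (encH [])" by (rule encH_cong) (simp_all add: H.spell[OF H.one_closed] del: in_lists_conv_set)
  then show ?thesis unfolding 3 by (simp add: \<Theta>_def \<theta>_def)
next
  case 4
  have "wc (encK (K.spell \<one>\<^bsub>K\<^esub>)) (encK [])" by (rule encK_cong) (simp_all add: K.spell[OF K.one_closed] del: in_lists_conv_set)
  then show ?thesis unfolding 4 by (simp add: \<Theta>_def \<theta>_def)
qed

lemma \<Theta>_cong: "word_cong L S u v \<Longrightarrow> wc (\<Theta> u) (\<Theta> v)"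
proof (induction rule: word_cong.induct)
  case (refl w)
  then show ?case by (intro word_cong.refl \<Theta>_lists)
next
  case (sym v w)
  show ?case by (rule word_cong.sym[OF sym.IH])
next
  case (trans u v w)
  show ?case by (rule word_cong.trans[OF trans.IH])
next
  case (rewrite u v p q)
  show ?case unfolding \<Theta>_simps
    by (intro word_cong_append_left word_cong_append_right \<Theta>_S \<Theta>_lists rewrite)
qed

definition \<Lambda> :: "nat \<times> bool \<Rightarrow> 'a + 'b" where
  "\<Lambda> l = (if even (fst l) then Inl (letter_val H \<phi>H (fst l div 2, snd l)) else Inr (letter_val K \<phi>K (fst l div 2, snd l)))"

lemma letters_cases:
  assumes "l \<in> letters X"
  obtains x b where "x \<in> XH" "l = (\<epsilon>H x, b)" | x b where "x \<in> XK" "l = (\<epsilon>K x, b)"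
  using assms unfolding letters_def X_def by blast

lemma \<Lambda>:
  assumes "l \<in> letters X" shows "\<Lambda> l \<in> L" "wc [l] (\<theta> (\<Lambda> l))"
proof -
  have "\<Lambda> l \<in> L \<and> wc [l] (\<theta> (\<Lambda> l))"
    using assms
  proof (cases rule: letters_cases)
    case (1 x b)
    have x: "(x, b) \<in> letters XH" "[(x, b)] \<in> lists (letters XH)" using 1 by (simp_all add: letters_def)
    have L: "\<Lambda> l = Inl (letter_val H \<phi>H (x, b))" using 1(2) by (simp add: \<Lambda>_def)
    note c = H.letter_val_closed[OF x(1)]
    have "wc (encH [(x, b)]) (encH (H.spell (letter_val H \<phi>H (x, b))))"
      by (rule encH_cong[OF x(2) H.spell(1)[OF c]]) (use c in \<open>simp add: H.spell(2)[OF c]\<close>)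
    then show ?thesis unfolding L using c 1(2) by (simp add: \<theta>_def InlI)
  next
    case (2 x b)
    have x: "(x, b) \<in> letters XK" "[(x, b)] \<in> lists (letters XK)" using 2 by (simp_all add: letters_def)
    have L: "\<Lambda> l = Inr (letter_val K \<phi>K (x, b))" using 2(2) by (simp add: \<Lambda>_def)
    note c = K.letter_val_closed[OF x(1)]
    have "wc (encK [(x, b)]) (encK (K.spell (letter_val K \<phi>K (x, b))))"
      by (rule encK_cong[OF x(2) K.spell(1)[OF c]]) (use c in \<open>simp add: K.spell(2)[OF c]\<close>)
    then show ?thesis unfolding L using c 2(2) by (simp add: \<theta>_def InrI)
  qed
  then show "\<Lambda> l \<in> L" "wc [l] (\<theta> (\<Lambda> l))" by simp_all
qed

lemma \<Theta>_\<Lambda>: "w \<in> lists (letters X) \<Longrightarrow> wc w (\<Theta> (map \<Lambda> w))"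
proof (induction w)
  case Nil
  then show ?case by (simp add: \<Theta>_simps word_cong.refl)
next
  case (Cons l w)
  have l: "l \<in> letters X" using Cons by simp
  have "wc ([l] @ w) (\<theta> (\<Lambda> l) @ \<Theta> (map \<Lambda> w))"
    using Cons by (intro word_cong_append \<Lambda>(2) l) auto
  then show ?case by (simp add: \<Theta>_simps)
qed

lemma word_val_R:
  assumes "r \<in> R" shows "word_val G \<phi> r = \<one>\<^bsub>G\<^esub>"
  using assms unfolding R_def
proof (elim UnE imageE)
  fix s assume s: "r = encH s" "s \<in> RH"
  show ?thesis unfolding s(1) word_val_encH[OF subsetD[OF H.rels s(2)]] H.word_val_rel[OF s(2)] by (rule jH.hom_one)
next
  fix s assume s: "r = encK s" "s \<in> RK"
  show ?thesis unfolding s(1) word_val_encK[OF subsetD[OF K.rels s(2)]] K.word_val_rel[OF s(2)] by (rule jK.hom_one)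
qed

sublocale presentation G X \<phi> R
proof unfold_locales
  show "finite X" using H.finite_gens K.finite_gens by (simp add: X_def)
  show "finite R" using H.finite_rels K.finite_rels by (simp add: R_def)
  show "R \<subseteq> lists (letters X)"
    unfolding R_def using H.rels K.rels encH_lists encK_lists by blast
  show "\<exists>w\<in>lists (letters X). word_val G \<phi> w = g" if "g \<in> carrier G" for g
  proof -
    obtain u where u: "u \<in> lists L" "g = cl u"
    proof -
      have "g \<in> cl ` lists L" using \<open>g \<in> carrier G\<close> unfolding word_monoid_def by simp
      then show ?thesis using that by blast
    qed
    show ?thesis unfolding u(2) by (rule bexI[where x = "\<Theta> u"]) (rule word_val_\<Theta>[OF u(1)], rule \<Theta>_lists[OF u(1)])
  qed
  show "word_val G \<phi> r = \<one>\<^bsub>G\<^esub>" if "r \<in> R" for r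
    by (rule word_val_R[OF that])
  \<comment> \<open>Read as syllables, \<open>w\<close> is trivial in the free product. Translating
    a derivation of this by \<Theta> shows that the respelled word is congruent to the empty word,
    and \<open>w\<close> is congruent to its respelling.\<close>
  show "wc w []" if w: "w \<in> lists (letters X)" "word_val G \<phi> w = \<one>\<^bsub>G\<^esub>" for w
  proof -
    have m: "map \<Lambda> w \<in> lists L" using w(1) by (induction w) (simp_all add: \<Lambda>(1))
    have c: "wc w (\<Theta> (map \<Lambda> w))" by (rule \<Theta>_\<Lambda>[OF w(1)])
    have "cl (map \<Lambda> w) = cl []"
      using word_cong_word_val[OF word_val_R c] w(2) word_val_\<Theta>[OF m] cl_Nil by simp
    then have "word_cong L S (map \<Lambda> w) []" using word_class_eq_iff[OF m] by blast
    from \<Theta>_cong[OF this] have "wc (\<Theta> (map \<Lambda> w)) []" unfolding \<Theta>_simps .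
    with c show ?thesis by (rule word_cong.trans)
  qed
qed

end

section \<open>Pieces of the covering\<close>

lemma arcs_restrict_sub:
  assumes "E \<subseteq> edges T'" "F \<subseteq> faces T'" "edge_map T = edge_map T'" "sector T = sector T'" "bdry T = bdry T'"
  shows "arcs (restrict_complex T E F) \<subseteq> arcs T'"
proof
  fix p assume "p \<in> arcs (restrict_complex T E F)"
  then show "p \<in> arcs T'"
  proof cases
    case (arc_src e)
    then show ?thesis using assms arcs.arc_src[of e T'] by auto
  next
    case (arc_tgt e)
    then show ?thesis using assms arcs.arc_tgt[of e T'] by auto
  next
    case (arc_face f i)
    then show ?thesis using assms arcs.arc_face[of f T' i] by auto
  next
    case (arc_base f)
    then show ?thesis using assms arcs.arc_base[of f T'] by auto
  qed
qed

lemma arcs_restrict_mono: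
  "E \<subseteq> E' \<Longrightarrow> F \<subseteq> F' \<Longrightarrow> arcs (restrict_complex T E F) \<subseteq> arcs (restrict_complex T E' F')"
  by (rule arcs_restrict_sub) simp_all

lemma arcs_restrict:
  "E \<subseteq> edges T \<Longrightarrow> F \<subseteq> faces T \<Longrightarrow> arcs (restrict_complex T E F) \<subseteq> arcs T"
  by (rule arcs_restrict_sub) simp_all

lemma arcs_restrict_Un:
  assumes "edges T \<subseteq> E \<union> E'" "faces T \<subseteq> F \<union> F'"
  shows "arcs T \<subseteq> arcs (restrict_complex T E F) \<union> arcs (restrict_complex T E' F')"
proof
  let ?T = "restrict_complex T E F" and ?T' = "restrict_complex T E' F'"
  fix p assume "p \<in> arcs T"
  then show "p \<in> arcs ?T \<union> arcs ?T'"
  proof cases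
    case (arc_src e)
    then have "e \<in> E \<or> e \<in> E'" using assms by blast
    then show ?thesis using arc_src(1) arcs.arc_src[of e ?T] arcs.arc_src[of e ?T'] by auto
  next
    case (arc_tgt e)
    then have "e \<in> E \<or> e \<in> E'" using assms by blast
    then show ?thesis using arc_tgt(1) arcs.arc_tgt[of e ?T] arcs.arc_tgt[of e ?T'] by auto
  next
    case (arc_face f i)
    then have "f \<in> F \<or> f \<in> F'" using assms by blast
    then show ?thesis using arc_face(1,3) arcs.arc_face[of f ?T i] arcs.arc_face[of f ?T' i] by auto
  next
    case (arc_base f)
    then have "f \<in> F \<or> f \<in> F'" using assms by blast
    then show ?thesis using arc_base(1,3) arcs.arc_base[of f ?T] arcs.arc_base[of f ?T'] by auto
  qed
qed

lemma arc_paths_mono: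
  assumes "arcs T \<subseteq> arcs T'" "p \<in> arc_paths T U" shows "p \<in> arc_paths T' U"
  using assms(2)
proof (induction rule: arc_paths.induct)
  case (const x)
  then show ?case by (rule arc_paths.const)
next
  case (arc p)
  then show ?case using assms(1) by (intro arc_paths.arc) auto
next
  case (rv_arc p)
  then show ?case using assms(1) by (intro arc_paths.rv_arc) auto
next
  case (join p q)
  then show ?case by (intro arc_paths.join)
qed

lemma arc_paths_invariant:
  assumes "p \<in> arc_paths T U" "\<And>p. p \<in> arcs T \<Longrightarrow> f (p 0) = f (p 1)" shows "f (p 0) = f (p 1)"
  using assms(1) by (induction rule: arc_paths.induct) (simp_all add: assms(2))

text \<open>No arc ends at \<open>d\<close>, so a composite that starts or ends there is built from
  constant paths. Joining these gives the constant function itself, hence an equality and not merely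
  a homotopy.\<close>

lemma arc_paths_constant:
  assumes "p \<in> arc_paths T U" "\<And>p. p \<in> arcs T \<Longrightarrow> p 0 \<noteq> d \<and> p 1 \<noteq> d"
  shows "p 0 = d \<or> p 1 = d \<Longrightarrow> p = (\<lambda>_. d)"
  using assms(1)
proof (induction rule: arc_paths.induct)
  case (const x)
  then show ?case by simp
next
  case (arc p)
  then show ?case using assms(2) by blast
next
  case (rv_arc p)
  then show ?case using assms(2)[of p] by simp
next
  case (join p q)
  have "p = (\<lambda>_. d) \<and> q = (\<lambda>_. d)"
  proof (cases "p 0 = d")
    case True
    then have p: "p = (\<lambda>_. d)" using join.IH(1) by blast
    then have "q 0 = d" using join.hyps(3) by simp
    then show ?thesis using p join.IH(2) by blast
  next
    case False
    then have "q 1 = d" using join.prems by simp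
    then have q: "q = (\<lambda>_. d)" using join.IH(2) by blast
    then have "p 1 = d" using join.hyps(3) by simp
    then show ?thesis using q join.IH(1) by blast
  qed
  then show ?case by (simp add: join_loops_def)
qed

lemma (in complex2) arcs_restrict_ends:
  assumes "E \<subseteq> edges T" "F \<subseteq> faces T" "p \<in> arcs (restrict_complex T E F)"
  obtains e where "e \<in> E" "p 0 = EdgePt e (1/2)" "p 1 = VertexPt (src T e) \<or> p 1 = VertexPt (tgt T e)"
  | f l where "f \<in> F" "p 0 = FacePt f 0" "l \<in> set (bdry T f)" "p 1 = EdgePt (fst l) (1/2)"
  | f where "f \<in> F" "p 0 = FacePt f 0" "bdry T f = []" "p 1 = VertexPt (base T f)"
  using assms(3)
proof cases
  case (arc_src e)
  then show ?thesis by (intro that(1)[of e]) (simp_all add: edge_map_def)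
next
  case (arc_tgt e)
  then show ?thesis by (intro that(1)[of e]) (simp_all add: edge_map_def)
next
  case (arc_face f i)
  then have f: "f \<in> F" and i: "i < length (bdry T f)" and p: "p = (\<lambda>t. sector T f i (t, 1/2))" by simp_all
  have s: "i < sectors T f" using i by (simp add: sectors_def)
  have "bdry T f \<noteq> []" using i by auto
  then have "p 1 = letter_map T (bdry T f ! i) (1/2)"
    using sector_rim[OF subsetD[OF assms(2) f] s, of "1/2"] p by simp
  then have "p 1 = EdgePt (fst (bdry T f ! i)) (1/2)" by (simp add: letter_map_def edge_map_def)
  then show ?thesis using f i p by (intro that(2)[of f "bdry T f ! i"]) simp_all
next
  case (arc_base f)
  then have f: "f \<in> F" and n: "bdry T f = []" and p: "p = (\<lambda>t. sector T f 0 (t, 0))" by simp_all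
  have s: "0 < sectors T f" by simp
  have "p 1 = VertexPt (base T f)" using sector_rim[OF subsetD[OF assms(2) f] s, of 0] n p by simp
  then show ?thesis using f n p by (intro that(3)[of f]) simp_all
qed

text \<open>Before its end at 1 an arc stays in the open cell of its starting point, which lies
  entirely inside or entirely outside the subcomplex.\<close>

lemma (in complement) arc_in_U:
  assumes p: "p \<in> arcs T" and U: "p 0 \<in> U" "p 1 \<in> U" shows "p ` {0..1} \<subseteq> U"
proof (rule image_subsetI)
  fix t :: real assume t: "t \<in> {0..1}"
  show "p t \<in> U"
  proof (cases "t = 1")
    case False
    then have t: "0 \<le> t" "t < 1" using t by auto
    show ?thesis
      using p
    proof cases
      case (arc_src e)
      then show ?thesis using t U by (auto simp: edge_map_def)
    next
      case (arc_tgt e)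
      then show ?thesis using t U by (auto simp: edge_map_def)
    next
      case (arc_face f i)
      then show ?thesis using t U by (simp add: sector_inner norm_polar)
    next
      case (arc_base f)
      then show ?thesis using t U by (simp add: sector_inner norm_polar)
    qed
  qed (use U in simp)
qed

text \<open>Within a contractible neighbourhood any two points are joined through its centre, so the
  set of points reachable from \<open>x\<close> is both open and closed.\<close>

lemma (in complement) component_path_connected:
  assumes Y: "Y \<in> connected_components_of XU" and x: "x \<in> Y" and y: "y \<in> Y"
  shows "\<exists>p. pathin XU p \<and> p 0 = x \<and> p 1 = y"
proof -
  define P where "P = {z. \<exists>p. pathin XU p \<and> p 0 = x \<and> p 1 = z}"
  have YU: "Y \<subseteq> U" using connected_components_of_subset[OF Y] unfolding topspace_XU .
  have N: "\<exists>B. openin XU B \<and> z \<in> B \<and> (\<forall>w\<in>B. w \<in> P \<longleftrightarrow> z \<in> P)" if z: "z \<in> U" for z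
  proof -
    obtain \<delta> \<sigma> where c: "centre \<delta> \<sigma>" and zn: "z \<in> nbhd T \<delta> \<sigma>" using ex_centre[OF z] by blast
    have s: "\<sigma> \<in> nodes T" "\<sigma> \<in> U" "0 < \<delta>" "\<delta> < 1/2" using c by (auto simp: centre_def)
    have nU: "nbhd T \<delta> \<sigma> \<subseteq> U" by (rule nbhd_U[OF s])
    have "openin (realization T) (nbhd T \<delta> \<sigma>)" by (rule openin_nbhd[OF s(1,3,4)])
    moreover have "nbhd T \<delta> \<sigma> \<subseteq> - cell_points V E F" using nU unfolding U_def by blast
    ultimately have o: "openin XU (nbhd T \<delta> \<sigma>)" unfolding openin_subtopology by blast
    have link: "w \<in> P" if w: "w \<in> nbhd T \<delta> \<sigma>" and v: "v \<in> nbhd T \<delta> \<sigma>" "v \<in> P" for v w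
    proof -
      obtain p where p: "pathin XU p" "p 0 = x" "p 1 = v" using v(2) unfolding P_def by blast
      note tv = track[OF c v(1)] and tw = track[OF c w]
      have 1: "pathin XU (join_loops (track \<delta> \<sigma> v) (rv (track \<delta> \<sigma> w)))"
        using tv tw by (intro pathin_join pathin_rv) simp_all
      have "pathin XU (join_loops p (join_loops (track \<delta> \<sigma> v) (rv (track \<delta> \<sigma> w))))"
        using p tv by (intro pathin_join[OF _ 1]) simp_all
      then show ?thesis unfolding P_def using p tw by (intro CollectI exI conjI) (assumption, simp_all)
    qed
    have "\<forall>w\<in>nbhd T \<delta> \<sigma>. w \<in> P \<longleftrightarrow> z \<in> P" using link zn by blast
    then show ?thesis using o zn by blast
  qed
  have PU: "P \<subseteq> U"
  proof
    fix z assume "z \<in> P"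
    then obtain p where "pathin XU p" "p 1 = z" unfolding P_def by blast
    then show "z \<in> U" using pathin_ends(2)[of XU p] unfolding topspace_XU by simp
  qed
  have oP: "openin XU P"
    unfolding openin_subopen[of XU P]
  proof
    fix z assume "z \<in> P"
    then obtain B where "openin XU B" "z \<in> B" "\<forall>w\<in>B. w \<in> P \<longleftrightarrow> z \<in> P" using N PU by blast
    then show "\<exists>B. openin XU B \<and> z \<in> B \<and> B \<subseteq> P" using \<open>z \<in> P\<close> by blast
  qed
  have oQ: "openin XU (U - P)"
    unfolding openin_subopen[of XU "U - P"]
  proof
    fix z assume z: "z \<in> U - P"
    then obtain B where B: "openin XU B" "z \<in> B" "\<forall>w\<in>B. w \<in> P \<longleftrightarrow> z \<in> P" using N by blast
    then have "B \<subseteq> U" using openin_subset[OF B(1)] unfolding topspace_XU by simp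
    then show "\<exists>B. openin XU B \<and> z \<in> B \<and> B \<subseteq> U - P" using B z by blast
  qed
  have "x \<in> P"
    unfolding P_def using x YU by (intro CollectI exI[of _ "\<lambda>_. x"] conjI pathin_const) (auto simp del: topspace_subtopology)
  then have "y \<in> P"
  proof -
    assume "x \<in> P"
    show ?thesis
    proof (rule ccontr)
      assume "y \<notin> P"
      then show False
        using connectedinD[OF connectedin_connected_components_of[OF Y] oP oQ] x y YU \<open>x \<in> P\<close> by blast
    qed
  qed
  then show ?thesis unfolding P_def by blast
qed

text \<open>Conjugation by \<open>p\<close> carries generators at one end to generators at the
  other: every loop at \<open>p 1\<close> is, up to homotopy, the conjugate of a loop at
  \<open>p 0\<close>.\<close>

lemma finitely_generated_base_change:
  assumes p: "pathin X p" and fg: "finitely_generated (fundamental_group X (p 0))"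
  shows "finitely_generated (fundamental_group X (p 1))"
proof -
  note e = pathin_ends[OF p]
  obtain S where S: "finite S" "S \<subseteq> loops X (p 0)" "loops X (p 0) \<subseteq> loop_span X (p 0) S"
    using fg unfolding finitely_generated_fundamental_group_iff[OF e(1)] by blast
  define c where "c r = join_loops (rv p) (join_loops r p)" for r
  have cl: "c r \<in> loops X (p 1)" if "r \<in> loops X (p 0)" for r
    using that p unfolding c_def loops_iff by (intro conjI pathin_join pathin_rv) simp_all
  have loop: "pathin X r \<and> r 0 = p 0 \<and> r 1 = p 0" if "r \<in> loop_span X (p 0) S" for r
    using loop_span_loops[OF that S(2) e(1)] unfolding loops_iff .
  have conj: "c r \<in> loop_span X (p 1) (c ` S)" if "r \<in> loop_span X (p 0) S" for r
    using that
  proof (induction rule: loop_span.induct)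
    case const
    have "hp X (c (\<lambda>_. p 0)) (join_loops (rv p) p)"
      unfolding c_def using p by (intro hp_join hp_refl hp_lunit pathin_rv) simp_all
    also have "hp X \<dots> (\<lambda>_. p 1)" using p by (intro hp_linv) simp_all
    finally show ?case by (rule loop_span.hp[OF loop_span.const hp_sym])
  next
    case (incl r)
    then show ?case by (intro loop_span.incl imageI)
  next
    case (rv r)
    have r: "pathin X r" "r 0 = p 0" "r 1 = p 0" using rv S(2) by (auto simp: loops_iff)
    have "rv (c r) = join_loops (join_loops (rv p) (rv r)) p" using p r by (simp add: c_def rv_join)
    moreover have "hp X (join_loops (join_loops (rv p) (rv r)) p) (c (rv r))"
      unfolding c_def using p r by (intro hp_assoc pathin_rv) simp_all
    ultimately show ?case using loop_span.rv[of "c r" "c ` S" X "p 1"] rv loop_span.hp by (metis imageI)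
  next
    case (join r s)
    note r = loop[OF join(1)] and s = loop[OF join(2)]
    have rp: "pathin X (join_loops r p)" and sp: "pathin X (join_loops s p)" and ps: "pathin X (join_loops p (c s))"
      and cs: "pathin X (c s)"
      unfolding c_def using p r s by (auto intro!: pathin_join pathin_rv)
    have "hp X (join_loops (c r) (c s)) (join_loops (rv p) (join_loops (join_loops r p) (c s)))"
      unfolding c_def[of r] using p r s rp cs by (intro hp_assoc pathin_rv) (simp_all add: c_def)
    also have "hp X \<dots> (join_loops (rv p) (join_loops r (join_loops p (c s))))"
      using p r s rp cs by (intro hp_join hp_refl hp_assoc pathin_rv) (simp_all add: c_def)
    also have "hp X \<dots> (join_loops (rv p) (join_loops r (join_loops s p)))"
    proof -
      have "hp X (join_loops (rv (rv p)) (join_loops (rv p) (join_loops s p))) (join_loops s p)"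
        using p s sp by (intro hp_cancel_left pathin_rv) simp_all
      then have H: "hp X (join_loops p (c s)) (join_loops s p)" by (simp add: c_def)
      show ?thesis
        by (rule hp_join[OF hp_refl[OF pathin_rv[OF p]] hp_join[OF hp_refl[OF conjunct1[OF r]] H]]) (use p r in simp_all)
    qed
    also have "hp X \<dots> (c (join_loops r s))"
      unfolding c_def using p r s
      by (intro hp_join[OF hp_refl[OF pathin_rv[OF p]] hp_sym[OF hp_assoc]]) simp_all
    finally show ?case by (rule loop_span.hp[OF loop_span.join[OF join(3,4)]])
  next
    case (hp r s)
    note r = loop[OF hp(1)]
    have "hp X (c r) (c s)" unfolding c_def
      using p r hp_1[OF hp(2)] by (intro hp_join hp_refl hp(2) pathin_rv) simp_all
    then show ?case by (rule loop_span.hp[OF hp(3)])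
  qed
  have "q \<in> loop_span X (p 1) (c ` S)" if q: "q \<in> loops X (p 1)" for q
  proof -
    have q': "pathin X q" "q 0 = p 1" "q 1 = p 1" using q by (simp_all add: loops_iff)
    let ?r = "join_loops p (join_loops q (rv p))"
    have qp: "pathin X (join_loops q (rv p))" using p q' by (intro pathin_join pathin_rv) simp_all
    have r: "pathin X ?r" using p q' by (intro pathin_join[OF p qp]) simp_all
    then have "?r \<in> loops X (p 0)" by (simp add: loops_iff)
    then have "c ?r \<in> loop_span X (p 1) (c ` S)" using conj S(3) by blast
    moreover have "hp X (c ?r) q"
    proof -
      have "hp X (join_loops ?r p) (join_loops p (join_loops (join_loops q (rv p)) p))"
        using p q' qp by (intro hp_assoc) simp_all
      also have "hp X \<dots> (join_loops p q)"
      proof (intro hp_join hp_refl p)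
        have "hp X (join_loops (join_loops q (rv p)) (rv (rv p))) q"
          using p q' by (intro hp_cancel_right pathin_rv) simp_all
        then show "hp X (join_loops (join_loops q (rv p)) p) q" by simp
      qed (use q' in simp)
      finally have "hp X (c ?r) (join_loops (rv p) (join_loops p q))"
        unfolding c_def by (intro hp_join[OF hp_refl[OF pathin_rv[OF p]]]) simp_all
      also have "hp X \<dots> q" using p q' by (intro hp_cancel_left) simp_all
      finally show ?thesis .
    qed
    ultimately show ?thesis by (rule loop_span.hp)
  qed
  then show ?thesis
    unfolding finitely_generated_fundamental_group_iff[OF e(2)] using S(1,2) cl
    by (intro exI[of _ "c ` S"]) blast
qed

text \<open>An inverse letter uses the edge that ends at the current coset, so the invariance of
  \<open>f\<close> is applied to that earlier coset.\<close>

lemma (in cayley) coset_path_letters: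
  assumes X': "X' \<subseteq> X" and f: "\<And>c x. c \<in> rcosets A \<Longrightarrow> x \<in> X' \<Longrightarrow> f (c #> \<phi> x) = f c"
  shows "c \<in> rcosets A \<Longrightarrow> w \<in> lists (letters X') \<Longrightarrow> l \<in> set (coset_path G \<phi> c w) \<Longrightarrow>
    fst (fst l) \<in> rcosets A \<and> snd (fst l) \<in> X' \<and> f (fst (fst l)) = f c"
proof (induction w arbitrary: c rule: list.induct)
  case (Cons m w)
  obtain x b where m: "m = (x, b)" by (cases m)
  have x: "x \<in> X'" "w \<in> lists (letters X')" using Cons.prems(2) m by (auto simp: letters_def)
  have xc: "\<phi> x \<in> carrier G" using x(1) X' gen_closed by blast
  let ?c = "c #> inv (\<phi> x)"
  have bwd: "?c \<in> rcosets A" "?c #> \<phi> x = c"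
    using Cons.prems(1) xc by (simp_all add: coset_act coset_act_assoc coset_one)
  have fb: "f ?c = f c" using f[OF bwd(1) x(1)] bwd(2) by simp
  have fwd: "c #> \<phi> x \<in> rcosets A" "f (c #> \<phi> x) = f c"
    using coset_act[OF Cons.prems(1) xc] f[OF Cons.prems(1) x(1)] by auto
  show ?case
  proof (cases b)
    case True
    then have "l = ((c, x), True) \<or> l \<in> set (coset_path G \<phi> (c #> \<phi> x) w)" using Cons.prems(3) m by simp
    then show ?thesis using Cons.IH[OF fwd(1) x(2)] fwd Cons.prems(1) x(1) by auto
  next
    case False
    then have "l = ((?c, x), False) \<or> l \<in> set (coset_path G \<phi> ?c w)" using Cons.prems(3) m by simp
    then show ?thesis using Cons.IH[OF bwd(1) x(2)] fb bwd(1) x(1) by auto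
  qed
qed simp

text \<open>The common setting of the two factors. \<open>FM\<close> may be a proper part of the
  relators of the factor, because the 2-cells of a relator word shared by both factors have to be
  assigned to the pieces of only one of them.\<close>

locale factor = C: cayley "word_monoid L S" X \<phi> R A + WA: word_action L S A + M: presentation M XM \<phi>M RM
  for L :: "'l set" and S and X :: "'x set" and \<phi> R A
    and M :: "('b, 'k) monoid_scheme" and XM :: "'y set" and \<phi>M RM +
  fixes \<kappa> :: "'b \<Rightarrow> 'l" and \<epsilon> :: "'y \<Rightarrow> 'x" and FM :: "('x \<times> bool) list set" and Wd :: "'l list set"
  assumes \<kappa>: "inj \<kappa>" "\<kappa> ` carrier M \<subseteq> L"
    and \<kappa>_M: "\<And>l. l \<in> L \<Longrightarrow> l \<in> range \<kappa> \<Longrightarrow> inv_into UNIV \<kappa> l \<in> carrier M"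
    and hom: "(\<lambda>h. word_class L S [\<kappa> h]) \<in> hom M (word_monoid L S)"
    and rel: "\<And>u v. (u, v) \<in> S \<Longrightarrow>
      (\<exists>a b. a \<in> carrier M \<and> b \<in> carrier M \<and> u = [\<kappa> a, \<kappa> b] \<and> v = [\<kappa> (a \<otimes>\<^bsub>M\<^esub> b)]) \<or>
      (u = [\<kappa> \<one>\<^bsub>M\<^esub>] \<and> v = []) \<or> (set u \<union> set v) \<inter> range \<kappa> = {}"
    and Wd: "finite Wd" "Wd \<subseteq> lists L" "word_class L S ` Wd \<subseteq> A" "generate (word_monoid L S) (word_class L S ` Wd) = A"
    and inj_\<epsilon>: "inj \<epsilon>" and \<epsilon>_X: "\<And>x. x \<in> XM \<Longrightarrow> \<epsilon> x \<in> X"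
    and \<phi>_\<epsilon>: "\<And>x. x \<in> XM \<Longrightarrow> \<phi> (\<epsilon> x) = word_class L S [\<kappa> (\<phi>M x)]"
    and enc_R: "\<And>r. r \<in> RM \<Longrightarrow> map (map_prod \<epsilon> id) r \<in> R"
    and FM: "FM \<subseteq> map (map_prod \<epsilon> id) ` RM"
    and tame: "\<And>B. subgroup B M \<Longrightarrow> finitely_generated (M\<lparr>carrier := B\<rparr>) \<Longrightarrow> tame_wrt M XM RM \<phi>M B"
begin

abbreviation "G \<equiv> word_monoid L S"
abbreviation "cl \<equiv> word_class L S"
abbreviation "j h \<equiv> cl [\<kappa> h]"
abbreviation "enc \<equiv> map (map_prod \<epsilon> (id :: bool \<Rightarrow> bool))"

definition "piece = restrict_complex C.Cay ((rcosets\<^bsub>G\<^esub> A) \<times> \<epsilon> ` XM) ((rcosets\<^bsub>G\<^esub> A) \<times> FM)"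

lemma piece_sub:
  "(rcosets\<^bsub>G\<^esub> A) \<times> \<epsilon> ` XM \<subseteq> edges C.Cay" "(rcosets\<^bsub>G\<^esub> A) \<times> FM \<subseteq> faces C.Cay"
  using \<epsilon>_X enc_R FM by auto

lemma FM_lists: "r \<in> FM \<Longrightarrow> r \<in> lists (letters (\<epsilon> ` XM))"
proof -
  assume "r \<in> FM"
  then obtain s where s: "s \<in> RM" "r = enc s" using FM by blast
  then have "s \<in> lists (letters XM)" using M.rels by blast
  then show ?thesis unfolding s(2) by (force simp: letters_def)
qed

lemma arcs_piece: "arcs piece \<subseteq> arcs C.Cay"
  unfolding piece_def by (rule arcs_restrict[OF piece_sub])

lemma nodes_piece:
  "d \<in> nodes piece \<longleftrightarrow> (\<exists>c\<in>rcosets\<^bsub>G\<^esub> A. d = VertexPt c \<or> (\<exists>x\<in>XM. d = EdgePt (c, \<epsilon> x) (1/2)) \<or> (\<exists>r\<in>FM. d = FacePt (c, r) 0))"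
  unfolding nodes_def piece_def restrict_complex_simps C.Cay_simps by blast

text \<open>\<open>f\<close> stands for a function on cosets that is constant along the edges of the
  factor, such as the potential; a constant \<open>f\<close> gives just the statement about
  nodes.\<close>

lemma arc_ends:
  assumes p: "p \<in> arcs piece"
    and f: "\<And>c x. c \<in> rcosets\<^bsub>G\<^esub> A \<Longrightarrow> x \<in> XM \<Longrightarrow> f (c #>\<^bsub>G\<^esub> \<phi> (\<epsilon> x)) = f c"
  shows "p 0 \<in> nodes piece \<and> p 1 \<in> nodes piece \<and> f (C.cell_coset (p 0)) = f (C.cell_coset (p 1))"
  using piece_sub p[unfolded piece_def]
proof (cases rule: C.cx.arcs_restrict_ends)
  case (1 e)
  then obtain c x where e: "e = (c, \<epsilon> x)" "c \<in> rcosets\<^bsub>G\<^esub> A" "x \<in> XM" by auto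
  have "c #>\<^bsub>G\<^esub> \<phi> (\<epsilon> x) \<in> rcosets\<^bsub>G\<^esub> A" using e \<epsilon>_X C.gen_closed by (intro C.coset_act) auto
  then show ?thesis using 1 e f[OF e(2,3)] unfolding nodes_piece by auto
next
  case (2 fc l)
  then obtain c r where fc: "fc = (c, r)" "c \<in> rcosets\<^bsub>G\<^esub> A" "r \<in> FM" by auto
  have l: "l \<in> set (coset_path G \<phi> c r)" using 2(3) fc(1) by simp
  have "fst (fst l) \<in> rcosets\<^bsub>G\<^esub> A \<and> snd (fst l) \<in> \<epsilon> ` XM \<and> f (fst (fst l)) = f c"
    by (rule C.coset_path_letters[OF _ _ fc(2) FM_lists[OF fc(3)] l]) (use \<epsilon>_X f in auto)
  then obtain c' x where l': "fst l = (c', \<epsilon> x)" "c' \<in> rcosets\<^bsub>G\<^esub> A" "x \<in> XM" "f c' = f c" by (cases "fst l") auto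
  show ?thesis unfolding nodes_piece 2(2,4) l'(1) fc(1) using l' fc by auto
next
  case (3 fc)
  then obtain c r where fc: "fc = (c, r)" "c \<in> rcosets\<^bsub>G\<^esub> A" "r \<in> FM" by auto
  show ?thesis unfolding nodes_piece 3(2,4) using fc by auto
qed

lemma arc_path_invariant:
  assumes "p \<in> arc_paths piece U"
    and "\<And>c x. c \<in> rcosets\<^bsub>G\<^esub> A \<Longrightarrow> x \<in> XM \<Longrightarrow> f (c #>\<^bsub>G\<^esub> \<phi> (\<epsilon> x)) = f c"
  shows "f (C.cell_coset (p 0)) = f (C.cell_coset (p 1))"
  by (rule arc_paths_invariant[where f = "\<lambda>y. f (C.cell_coset y)", OF assms(1)]) (use arc_ends[of _ f] assms(2) in blast)

lemma arc_path_off: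
  assumes "p \<in> arc_paths piece U" "d \<notin> nodes piece" "p 0 = d \<or> p 1 = d" shows "p = (\<lambda>_. d)"
  by (rule arc_paths_constant[OF assms(1) _ assms(3)])
    (use arc_ends[where f = "\<lambda>_. ()"] assms(2) in blast)

lemma arc_path_nodes:
  assumes "p \<in> arc_paths piece U" shows "p 0 = p 1 \<or> (p 0 \<in> nodes piece \<and> p 1 \<in> nodes piece)"
  using arc_path_off[OF assms, of "p 0"] arc_path_off[OF assms, of "p 1"] by metis

context
  fixes V E F Y
  assumes C: "finite_subcomplex C.Cay V E F"
    and Y: "Y \<in> connected_components_of (subtopology C.XC (- cell_points V E F))"
begin

interpretation CC: complement C.Cay V E F
  using C by unfold_locales (auto simp: finite_subcomplex_def simp del: C.Cay_simps)

text \<open>Joins the algebra and the topology of one piece: \<open>stabilizer_generators\<close>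
  shows that the stabilizer \<open>B\<close> of the coset of \<open>d\<close> is finitely generated,
  or trivial, and \<open>piece_loops\<close> or \<open>piece_loops_null\<close> turns this into
  information on loops at \<open>d\<close>.\<close>

lemma piece_node:
  assumes d: "d \<in> nodes piece" "d \<in> Y"
  shows "\<exists>T. finite T \<and> T \<subseteq> loops (subtopology C.XC Y) d \<and>
      arc_paths piece CC.U \<inter> loops (subtopology C.XC Y) d \<subseteq> loop_span (subtopology C.XC Y) d T"
    and "(\<And>h. h \<in> carrier M \<Longrightarrow> C.cell_coset d #>\<^bsub>G\<^esub> j h \<notin> V \<union> WA.visits Wd) \<Longrightarrow>
      p \<in> arc_paths piece CC.U \<Longrightarrow> p 0 = d \<Longrightarrow> p 1 = d \<Longrightarrow> hp (subtopology C.XC Y) p (\<lambda>_. d)"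
proof -
  let ?c = "C.cell_coset d"
  have c: "?c \<in> rcosets\<^bsub>G\<^esub> A" using d(1) unfolding nodes_piece by auto
  then obtain g where g: "g \<in> carrier G" "?c = A #>\<^bsub>G\<^esub> g" unfolding RCOSETS_def by blast
  define B where "B = {h \<in> carrier M. A #>\<^bsub>G\<^esub> (g \<otimes>\<^bsub>G\<^esub> j h) = A #>\<^bsub>G\<^esub> g}"
  note sg = WA.stabilizer_generators[OF M.is_group \<kappa> hom rel \<kappa>_M Wd g(1) B_def]
  have B: "subgroup B M" "finitely_generated (M\<lparr>carrier := B\<rparr>)"
    by (rule sg(1); assumption) (rule sg(2); assumption)
  interpret MB: cayley M XM \<phi>M RM B
    by (intro cayley.intro cayley_axioms.intro M.presentation_axioms B(1))
  interpret cm: cayley_map M XM \<phi>M RM B G X \<phi> R A j \<epsilon> g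
    by (intro cayley_map.intro cayley_map_axioms.intro MB.cayley_axioms C.cayley_axioms
        hom inj_\<epsilon> \<epsilon>_X \<phi>_\<epsilon> enc_R g(1) B_def)
  have B1: "B \<in> rcosets\<^bsub>M\<^esub> B" "cm.iv B = ?c"
  proof -
    have "B #>\<^bsub>M\<^esub> \<one>\<^bsub>M\<^esub> = B" using M.coset_mult_one[OF subgroup.subset[OF B(1)]] .
    moreover have "B #>\<^bsub>M\<^esub> \<one>\<^bsub>M\<^esub> \<in> rcosets\<^bsub>M\<^esub> B" by (intro M.rcosetsI subgroup.subset[OF B(1)] M.one_closed)
    ultimately show "B \<in> rcosets\<^bsub>M\<^esub> B" "cm.iv B = ?c"
      using cm.iv_coset[OF M.one_closed] g cm.h.hom_one by simp_all
  qed
  \<comment> \<open>The base coset \<open>B\<close> of the covering of \<open>M\<close> is placed at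
    the coset of \<open>d\<close>, so \<open>d\<close> is the image of the centre with the same
    label at \<open>B\<close>.\<close>
  obtain \<sigma> where s: "\<sigma> \<in> nodes MB.Cay" "cm.inc \<sigma> = d"
  proof -
    obtain c' where c': "c' \<in> rcosets\<^bsub>G\<^esub> A" and
      "d = VertexPt c' \<or> (\<exists>x\<in>XM. d = EdgePt (c', \<epsilon> x) (1/2)) \<or> (\<exists>r\<in>FM. d = FacePt (c', r) 0)"
      using d(1) unfolding nodes_piece by blast
    then consider "d = VertexPt c'" | x where "x \<in> XM" "d = EdgePt (c', \<epsilon> x) (1/2)"
      | r where "r \<in> RM" "d = FacePt (c', enc r) 0" using FM by blast
    then show ?thesis
    proof cases
      case 1
      show ?thesis by (rule that[of "VertexPt B"]) (use 1 B1 in \<open>simp_all add: nodes_def\<close>)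
    next
      case (2 x)
      show ?thesis by (rule that[of "EdgePt (B, x) (1/2)"]) (use 2 B1 in \<open>simp_all add: nodes_def cm.ie_def\<close>)
    next
      case (3 r)
      show ?thesis by (rule that[of "FacePt (B, r) 0"]) (use 3 B1 in \<open>simp_all add: nodes_def cm.ifc_def\<close>)
    qed
  qed
  have sY: "cm.inc \<sigma> \<in> Y" using s d by simp
  have sub: "arcs piece \<subseteq> arcs cm.piece_complex"
    unfolding piece_def cm.piece_complex_def using FM by (intro arcs_restrict_mono) auto
  have "\<exists>T. finite T \<and> T \<subseteq> loops (subtopology C.XC Y) d \<and>
      arc_paths cm.piece_complex CC.U \<inter> loops (subtopology C.XC Y) d \<subseteq> loop_span (subtopology C.XC Y) d T"
    using cm.piece_loops[OF C Y tame[OF B] s(1) sY] unfolding s(2) .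
  then show "\<exists>T. finite T \<and> T \<subseteq> loops (subtopology C.XC Y) d \<and>
      arc_paths piece CC.U \<inter> loops (subtopology C.XC Y) d \<subseteq> loop_span (subtopology C.XC Y) d T"
    using arc_paths_mono[OF sub] by blast
  assume away: "\<And>h. h \<in> carrier M \<Longrightarrow> ?c #>\<^bsub>G\<^esub> j h \<notin> V \<union> WA.visits Wd"
    and p: "p \<in> arc_paths piece CC.U" "p 0 = d" "p 1 = d"
  have gj: "A #>\<^bsub>G\<^esub> (g \<otimes>\<^bsub>G\<^esub> j h) = ?c #>\<^bsub>G\<^esub> j h" if "h \<in> carrier M" for h
    unfolding g(2) using cm.act_g[OF that] by simp
  have triv: "B = {\<one>\<^bsub>M\<^esub>}"
    by (rule sg(3); (assumption | (simp only: gj, use away in blast)))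
  have "cm.Orb \<inter> V = {}"
  proof -
    have "cm.iv b \<notin> V" if b: "b \<in> rcosets\<^bsub>M\<^esub> B" for b
    proof -
      obtain h where h: "h \<in> carrier M" "b = B #>\<^bsub>M\<^esub> h" using cm.rcosets_M[OF b] by blast
      show ?thesis unfolding h(2) cm.iv_coset[OF h(1)] gj[OF h(1)] using away[OF h(1)] by simp
    qed
    then show ?thesis by blast
  qed
  from cm.piece_loops_null[OF C Y s(1) sY triv this arc_paths_mono[OF sub p(1)]]
  show "hp (subtopology C.XC Y) p (\<lambda>_. d)" unfolding s(2) using p(2,3) by blast
qed

text \<open>This is the link relation of the later path system for a single factor, with the end
  points not yet restricted to one component.\<close>

definition lk where "lk d y \<longleftrightarrow> (\<exists>p\<in>arc_paths piece CC.U. p 0 = d \<and> p 1 = y)"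

lemma lk_refl: "d \<in> CC.U \<Longrightarrow> lk d d"
  unfolding lk_def by (rule bexI[where x = "\<lambda>_. d"]) (simp_all add: arc_paths.const)

lemma lk_sym: "lk d y \<Longrightarrow> lk y d"
  unfolding lk_def using arc_paths_rv rv_0 rv_1 by metis

lemma lk_trans: "lk d y \<Longrightarrow> lk y z \<Longrightarrow> lk d z"
  unfolding lk_def using arc_paths.join join_loops_0 join_loops_1 by metis

lemma lk_arc:
  assumes "p \<in> arcs piece" "p 0 \<in> CC.U" "p 1 \<in> CC.U" shows "lk (p 0) (p 1)"
  unfolding lk_def
  using arc_paths.arc[OF assms(1) CC.arc_in_U[OF subsetD[OF arcs_piece assms(1)] assms(2,3)]] by blast

lemma edge_not_E: "e \<in> E \<Longrightarrow> fst e \<in> V \<and> fst e #>\<^bsub>G\<^esub> \<phi> (snd e) \<in> V"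
  using C by (simp add: finite_subcomplex_def)

lemma lk_half_edge:
  assumes e: "c \<in> rcosets\<^bsub>G\<^esub> A" "x \<in> XM" and v: "v = c \<or> v = c #>\<^bsub>G\<^esub> \<phi> (\<epsilon> x)" "v \<notin> V"
  shows "lk (EdgePt (c, \<epsilon> x) (1/2)) (VertexPt v)"
proof -
  let ?e = "(c, \<epsilon> x)"
  have ee: "?e \<in> edges piece" using e by (simp add: piece_def)
  have eC: "?e \<in> edges C.Cay" using e \<epsilon>_X by simp
  have em: "edge_map piece = edge_map C.Cay" unfolding piece_def by simp
  have vv: "v \<in> rcosets\<^bsub>G\<^esub> A" using v(1) e C.coset_act C.gen_closed \<epsilon>_X by blast
  have "?e \<notin> E" using edge_not_E[of ?e] v by auto
  then have U: "EdgePt ?e (1/2) \<in> CC.U" "VertexPt v \<in> CC.U" using eC vv v(2) by simp_all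
  show ?thesis
    using v(1)
  proof
    assume "v = c"
    then show ?thesis
      using lk_arc[OF arcs.arc_src[OF ee]] U unfolding em by (simp add: edge_map_def)
  next
    assume "v = c #>\<^bsub>G\<^esub> \<phi> (\<epsilon> x)"
    then show ?thesis
      using lk_arc[OF arcs.arc_tgt[OF ee]] U unfolding em by (simp add: edge_map_def)
  qed
qed

lemma j_letter: "x \<in> XM \<Longrightarrow> j (letter_val M \<phi>M (x, b)) = (if b then \<phi> (\<epsilon> x) else inv\<^bsub>G\<^esub> \<phi> (\<epsilon> x))"
proof -
  assume x: "x \<in> XM"
  interpret h: group_hom M G j using hom by unfold_locales
  show ?thesis using h.hom_inv[OF funcset_mem[OF M.gens x]] \<phi>_\<epsilon>[OF x] by (simp add: letter_val_def)
qed

text \<open>Finitely many centres, chosen so that a class contains one of them whenever its orbit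
  meets \<open>V\<close> or a visited coset: vertices one step away from \<open>V\<close> in either
  direction, visited vertices, and centres of edges and 2-cells based in \<open>V\<close>.\<close>

definition "guards =
  VertexPt ` (\<Union>x\<in>XM. (\<lambda>v. v #>\<^bsub>G\<^esub> \<phi> (\<epsilon> x)) ` V \<union> (\<lambda>v. v #>\<^bsub>G\<^esub> inv\<^bsub>G\<^esub> \<phi> (\<epsilon> x)) ` V) \<union>
  VertexPt ` WA.visits Wd \<union> (\<lambda>(c, x). EdgePt (c, \<epsilon> x) (1/2)) ` (V \<times> XM) \<union> (\<lambda>f. FacePt f 0) ` (V \<times> FM)"

lemma finite_guards: "finite guards"
proof -
  have "finite V" "finite FM"
    using C finite_subset[OF FM finite_imageI[OF M.finite_rels]] by (simp_all add: finite_subcomplex_def)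
  then show ?thesis unfolding guards_def using M.finite_gens WA.finite_visits[OF Wd(1)] by simp
qed

text \<open>Follow the word from \<open>c\<close>. Either a visited coset is reached, or the next
  step would enter \<open>V\<close> and the current vertex is a guard. Up to that moment each edge
  used has an end outside \<open>V\<close>, so it lies outside the subcomplex.\<close>

lemma vertex_walk:
  assumes "w \<in> lists (letters XM)" "c \<in> rcosets\<^bsub>G\<^esub> A" "c \<notin> V"
    "c #>\<^bsub>G\<^esub> j (word_val M \<phi>M w) \<in> V \<union> WA.visits Wd"
  shows "\<exists>y\<in>guards. lk (VertexPt c) y"
  using assms
proof (induction w arbitrary: c rule: list.induct)
  case Nil
  interpret h: group_hom M G j using hom by unfold_locales
  have "c #>\<^bsub>G\<^esub> j \<one>\<^bsub>M\<^esub> = c" unfolding h.hom_one by (rule C.coset_one[OF Nil.prems(2)])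
  then have "c \<in> WA.visits Wd" using Nil.prems by simp
  then have "VertexPt c \<in> guards" unfolding guards_def by blast
  moreover have "VertexPt c \<in> CC.U" using Nil.prems by simp
  ultimately show ?case using lk_refl by blast
next
  case (Cons l w)
  interpret h: group_hom M G j using hom by unfold_locales
  obtain x b where l: "l = (x, b)" by (cases l)
  have x: "x \<in> XM" and w: "w \<in> lists (letters XM)" using Cons.prems(1) l by (auto simp: letters_def)
  have lM: "letter_val M \<phi>M l \<in> carrier M" "word_val M \<phi>M w \<in> carrier M"
    using Cons.prems(1) w by (auto intro!: M.letter_val_closed M.word_val_closed)
  have pc: "\<phi> (\<epsilon> x) \<in> carrier G" using C.gen_closed[OF \<epsilon>_X[OF x]] .
  let ?c = "c #>\<^bsub>G\<^esub> j (letter_val M \<phi>M l)"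
  have cG: "?c \<in> rcosets\<^bsub>G\<^esub> A" by (rule C.coset_act[OF Cons.prems(2) h.hom_closed[OF lM(1)]])
  have eq: "c #>\<^bsub>G\<^esub> j (word_val M \<phi>M (l # w)) = ?c #>\<^bsub>G\<^esub> j (word_val M \<phi>M w)"
    using C.coset_act_assoc[OF Cons.prems(2) h.hom_closed[OF lM(1)] h.hom_closed[OF lM(2)]] h.hom_mult[OF lM]
    by simp
  have c1: "?c = c #>\<^bsub>G\<^esub> \<phi> (\<epsilon> x)" if b
    using that l j_letter[OF x] by simp
  have c2: "?c = c #>\<^bsub>G\<^esub> inv\<^bsub>G\<^esub> \<phi> (\<epsilon> x)" if "\<not> b"
    using that l j_letter[OF x] by simp
  have r1: "?c #>\<^bsub>G\<^esub> inv\<^bsub>G\<^esub> \<phi> (\<epsilon> x) = c" if b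
    unfolding c1[OF that] using C.coset_act_assoc[OF Cons.prems(2) pc] C.coset_one[OF Cons.prems(2)] pc by simp
  have r2: "?c #>\<^bsub>G\<^esub> \<phi> (\<epsilon> x) = c" if "\<not> b"
    unfolding c2[OF that] using C.coset_act_assoc[OF Cons.prems(2) C.inv_closed[OF pc] pc] C.coset_one[OF Cons.prems(2)] pc by simp
  show ?case
  proof (cases "?c \<in> V")
    case True
    have "c \<in> (\<lambda>v. v #>\<^bsub>G\<^esub> \<phi> (\<epsilon> x)) ` V \<union> (\<lambda>v. v #>\<^bsub>G\<^esub> inv\<^bsub>G\<^esub> \<phi> (\<epsilon> x)) ` V"
    proof (cases b)
      case b: True
      show ?thesis using r1[OF b, symmetric] True by (rule UnI2[OF image_eqI])
    next
      case b: False
      show ?thesis using r2[OF b, symmetric] True by (rule UnI1[OF image_eqI])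
    qed
    then have "VertexPt c \<in> guards" unfolding guards_def using x by blast
    moreover have "VertexPt c \<in> CC.U" using Cons.prems by simp
    ultimately show ?thesis using lk_refl by blast
  next
    case False
    have "lk (VertexPt c) (VertexPt ?c)"
    proof (cases b)
      case b: True
      show ?thesis
        using lk_half_edge[OF Cons.prems(2) x, of c] lk_half_edge[OF Cons.prems(2) x, of ?c] c1[OF b] Cons.prems(3) False
          lk_sym lk_trans by metis
    next
      case b: False
      show ?thesis
        using lk_half_edge[OF cG x, of c] lk_half_edge[OF cG x, of ?c] r2[OF b] Cons.prems(3) False
          lk_sym lk_trans by metis
    qed
    moreover have "?c #>\<^bsub>G\<^esub> j (word_val M \<phi>M w) \<in> V \<union> WA.visits Wd" using Cons.prems(4) unfolding eq .
    from Cons.IH[OF w cG False this] obtain y where "y \<in> guards" "lk (VertexPt ?c) y" by blast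
    ultimately show ?thesis using lk_trans by blast
  qed
qed

text \<open>If the vertex is outside \<open>V\<close>, so are the edges and 2-cells touching it
  outside the subcomplex. The centre of a 2-cell reaches it along the radius to the first boundary
  edge and half of that edge, or along a radius to the vertex if the relator is empty.\<close>

lemma lk_vertex:
  assumes d: "d \<in> nodes piece" "d \<in> CC.U" and V: "C.cell_coset d \<notin> V"
  shows "lk d (VertexPt (C.cell_coset d))"
proof -
  obtain c where c: "c \<in> rcosets\<^bsub>G\<^esub> A" and
    "d = VertexPt c \<or> (\<exists>x\<in>XM. d = EdgePt (c, \<epsilon> x) (1/2)) \<or> (\<exists>r\<in>FM. d = FacePt (c, r) 0)"
    using d(1) unfolding nodes_piece by blast
  then consider "d = VertexPt c" | x where "x \<in> XM" "d = EdgePt (c, \<epsilon> x) (1/2)"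
    | r where "r \<in> FM" "d = FacePt (c, r) 0" by blast
  then show ?thesis
  proof cases
    case 1
    then show ?thesis using lk_refl[OF d(2)] by simp
  next
    case (2 x)
    then show ?thesis using lk_half_edge[OF c 2(1), of c] V by simp
  next
    case (3 r)
    have cV: "c \<notin> V" using V 3 by simp
    have fp: "(c, r) \<in> faces piece" using c 3 by (simp add: piece_def)
    have fC: "(c, r) \<in> faces C.Cay" using piece_sub(2) c 3(1) by blast
    have st: "sector piece = sector C.Cay" "bdry piece = bdry C.Cay" unfolding piece_def by simp_all
    show ?thesis
    proof (cases r)
      case Nil
      have b: "bdry piece (c, r) = []" unfolding st using Nil by simp
      have e1: "sector C.Cay (c, r) 0 (1, 0) = VertexPt c"
        using C.cx.sector_rim[OF fC, of 0 0] Nil by simp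
      have "lk (sector C.Cay (c, r) 0 (0, 0)) (sector C.Cay (c, r) 0 (1, 0))"
        using lk_arc[OF arcs.arc_base[OF fp b]] d(2) c cV unfolding st e1 3(2) by simp
      then show ?thesis unfolding e1 3(2) by simp
    next
      case (Cons l w)
      have b: "0 < length (bdry piece (c, r))" unfolding st using Cons by simp
      have lX: "fst l \<in> \<epsilon> ` XM" using FM_lists[OF 3(1)] Cons by (auto simp: letters_def)
      then obtain x where x: "x \<in> XM" "fst l = \<epsilon> x" by blast
      have pc: "\<phi> (\<epsilon> x) \<in> carrier G" using C.gen_closed[OF \<epsilon>_X[OF x(1)]] .
      \<comment> \<open>The source of the first boundary edge: this is \<open>c\<close> itself
        unless the relator begins with an inverse letter.\<close>
      define c' where "c' = (if snd l then c else c #>\<^bsub>G\<^esub> inv\<^bsub>G\<^esub> \<phi> (\<epsilon> x))"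
      have c': "c' \<in> rcosets\<^bsub>G\<^esub> A" unfolding c'_def using c pc by (simp add: C.coset_act)
      have cc: "c = c' \<or> c = c' #>\<^bsub>G\<^esub> \<phi> (\<epsilon> x)"
        unfolding c'_def using C.coset_act_assoc[OF c C.inv_closed[OF pc] pc] C.coset_one[OF c] pc by simp
      have b0: "fst (bdry C.Cay (c, r) ! 0) = (c', \<epsilon> x)"
        using Cons x(2) by (simp add: c'_def)
      have s0: "0 < sectors C.Cay (c, r)" by simp
      have e1: "sector C.Cay (c, r) 0 (1, 1/2) = EdgePt (c', \<epsilon> x) (1/2)"
        using C.cx.sector_rim[OF fC s0, of "1/2"] b b0 unfolding st by (auto simp: letter_map_def edge_map_def simp del: C.Cay_simps)
      have "(c', \<epsilon> x) \<notin> E" using edge_not_E[of "(c', \<epsilon> x)"] cc cV by auto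
      then have "EdgePt (c', \<epsilon> x) (1/2) \<in> CC.U" using c' x \<epsilon>_X by simp
      then have "lk (sector C.Cay (c, r) 0 (0, 1/2)) (sector C.Cay (c, r) 0 (1, 1/2))"
        using lk_arc[OF arcs.arc_face[OF fp b]] d(2) unfolding st e1 3(2) by simp
      then have "lk d (EdgePt (c', \<epsilon> x) (1/2))" unfolding e1 3(2) by simp
      then show ?thesis using lk_trans[OF _ lk_half_edge[OF c' x(1) cc cV]] 3(2) by simp
    qed
  qed
qed

text \<open>If the vertex of \<open>d\<close> lies in \<open>V\<close>, then \<open>d\<close> is the
  centre of an edge or 2-cell based in \<open>V\<close> and is itself a guard. Otherwise
  \<open>d\<close> is linked to its vertex and the walk applies.\<close>

lemma guarded:
  assumes d: "d \<in> nodes piece" "d \<in> CC.U" and h: "h \<in> carrier M"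
    and meets: "C.cell_coset d #>\<^bsub>G\<^esub> j h \<in> V \<union> WA.visits Wd"
  shows "\<exists>y\<in>guards. lk d y"
proof (cases "C.cell_coset d \<in> V")
  case True
  have "VertexPt (C.cell_coset d) \<notin> CC.U" using True by simp
  then have "d \<noteq> VertexPt (C.cell_coset d)" using d(2) by metis
  then have "d \<in> guards" using d(1) True unfolding nodes_piece guards_def by auto
  then show ?thesis using lk_refl[OF d(2)] by blast
next
  case False
  have c: "C.cell_coset d \<in> rcosets\<^bsub>G\<^esub> A" using d(1) unfolding nodes_piece by auto
  obtain w where w: "w \<in> lists (letters XM)" "word_val M \<phi>M w = h" using M.word_val_surj[OF h] by blast
  obtain y where "y \<in> guards" "lk (VertexPt (C.cell_coset d)) y"
    using vertex_walk[OF w(1) c False] meets w(2) by blast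
  then show ?thesis using lk_trans[OF lk_vertex[OF d False]] by blast
qed

end

end

section \<open>Free products\<close>

context free_pair begin

context
  fixes A Wd
  assumes A: "subgroup A G"
    and Wd: "finite Wd" "Wd \<subseteq> lists L" "cl ` Wd \<subseteq> A" "generate G (cl ` Wd) = A"
    and tame_H: "\<And>B. subgroup B H \<Longrightarrow> finitely_generated (H\<lparr>carrier := B\<rparr>) \<Longrightarrow> tame_wrt H XH RH \<phi>H B"
    and tame_K: "\<And>B. subgroup B K \<Longrightarrow> finitely_generated (K\<lparr>carrier := B\<rparr>) \<Longrightarrow> tame_wrt K XK RK \<phi>K B"
begin

interpretation C: cayley G X \<phi> R A
  by (intro cayley.intro cayley_axioms.intro presentation_axioms A)

interpretation WA: word_action L S A
  by (intro word_action.intro G.is_group A S_lists)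

interpretation FH: factor L S X \<phi> R A H XH \<phi>H RH Inl \<epsilon>H "encH ` RH" Wd
proof (intro factor.intro factor_axioms.intro C.cayley_axioms WA.word_action_axioms H.presentation_axioms jH_hom Wd tame_H)
  show "inj (Inl :: 'a \<Rightarrow> 'a + 'b)" "Inl ` carrier H \<subseteq> L" "inj \<epsilon>H" by (auto simp: inj_def)
  show "inv_into UNIV Inl l \<in> carrier H" if "l \<in> L" "l \<in> range Inl" for l
    using that by (auto simp: inv_f_f)
  show "(\<exists>a b. a \<in> carrier H \<and> b \<in> carrier H \<and> u = [Inl a, Inl b] \<and> v = [Inl (a \<otimes>\<^bsub>H\<^esub> b)]) \<or>
      u = [Inl \<one>\<^bsub>H\<^esub>] \<and> v = [] \<or> (set u \<union> set v) \<inter> range Inl = {}" if "(u, v) \<in> S" for u v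
    using that by (cases rule: S_cases) auto
  show "\<epsilon>H x \<in> X" if "x \<in> XH" for x using that by (simp add: X_def)
  show "\<phi> (\<epsilon>H x) = jH (\<phi>H x)" for x by (rule \<phi>_\<epsilon>H)
  show "encH r \<in> R" if "r \<in> RH" for r using that by (simp add: R_def)
  show "encH ` RH \<subseteq> encH ` RH" by simp
qed

text \<open>The empty word may be a relator of both factors; its cells then belong to the pieces of
  \<open>H\<close> only.\<close>

interpretation FK: factor L S X \<phi> R A K XK \<phi>K RK Inr \<epsilon>K "encK ` RK - encH ` RH" Wd
proof (intro factor.intro factor_axioms.intro C.cayley_axioms WA.word_action_axioms K.presentation_axioms jK_hom Wd tame_K)
  show "inj (Inr :: 'b \<Rightarrow> 'a + 'b)" "Inr ` carrier K \<subseteq> L" "inj \<epsilon>K" by (auto simp: inj_def)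
  show "inv_into UNIV Inr l \<in> carrier K" if "l \<in> L" "l \<in> range Inr" for l
    using that by (auto simp: inv_f_f)
  show "(\<exists>a b. a \<in> carrier K \<and> b \<in> carrier K \<and> u = [Inr a, Inr b] \<and> v = [Inr (a \<otimes>\<^bsub>K\<^esub> b)]) \<or>
      u = [Inr \<one>\<^bsub>K\<^esub>] \<and> v = [] \<or> (set u \<union> set v) \<inter> range Inr = {}" if "(u, v) \<in> S" for u v
    using that by (cases rule: S_cases) auto
  show "\<epsilon>K x \<in> X" if "x \<in> XK" for x using that by (simp add: X_def)
  show "\<phi> (\<epsilon>K x) = jK (\<phi>K x)" for x by (rule \<phi>_\<epsilon>K)
  show "encK r \<in> R" if "r \<in> RK" for r using that by (simp add: R_def)
  show "encK ` RK - encH ` RH \<subseteq> encK ` RK" by blast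
qed

lemma arcs_pieces: "arcs C.Cay \<subseteq> arcs FH.piece \<union> arcs FK.piece"
  unfolding FH.piece_def FK.piece_def
proof (rule arcs_restrict_Un)
  show "edges C.Cay \<subseteq> (rcosets\<^bsub>G\<^esub> A) \<times> \<epsilon>H ` XH \<union> (rcosets\<^bsub>G\<^esub> A) \<times> \<epsilon>K ` XK"
    unfolding C.Cay_simps unfolding X_def by blast
  show "faces C.Cay \<subseteq> (rcosets\<^bsub>G\<^esub> A) \<times> encH ` RH \<union> (rcosets\<^bsub>G\<^esub> A) \<times> (encK ` RK - encH ` RH)"
    unfolding C.Cay_simps unfolding R_def by blast
qed

text \<open>Parity separates the labels of edges, and relators common to both factors were removed
  from the pieces of \<open>K\<close>.\<close>

lemma piece_types:
  assumes "d \<in> nodes C.Cay" "\<And>c. d \<noteq> VertexPt c" shows "d \<notin> nodes FH.piece \<or> d \<notin> nodes FK.piece"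
proof (rule ccontr)
  assume "\<not> ?thesis"
  then have H: "d \<in> nodes FH.piece" and K: "d \<in> nodes FK.piece" by simp_all
  from H assms(2) consider c x where "d = EdgePt (c, \<epsilon>H x) (1/2)" | c r where "r \<in> encH ` RH" "d = FacePt (c, r) 0"
    unfolding FH.nodes_piece by blast
  then show False
  proof cases
    case 1
    then obtain x' where "\<epsilon>H x = \<epsilon>K x'" using K unfolding FK.nodes_piece by auto
    then show False by presburger
  next
    case 2
    then show False using K unfolding FK.nodes_piece by auto
  qed
qed

text \<open>Crossing \<open>e\<close> inside a piece of type \<open>H\<close> changes \<open>s\<close> by one, while \<open>s\<close> is constant along the
  pieces of type \<open>K\<close>.\<close>

definition lift_potential where
  "lift_potential e s y = (case y of VertexPt c \<Rightarrow> s c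
    | EdgePt f t \<Rightarrow> if even (snd f) then s (fst f) + of_bool (fst f = e) else s (fst f)
    | FacePt f z \<Rightarrow> if snd f \<in> encH ` RH then s (fst f) + of_bool (fst f = e) else (s (fst f) :: int))"

lemma lift_potential_H:
  assumes "y \<in> nodes FH.piece"
  shows "lift_potential e s y + of_bool (y = VertexPt e) = s (C.cell_coset y) + of_bool (C.cell_coset y = e)"
  using assms unfolding FH.nodes_piece lift_potential_def by auto

lemma lift_potential_K:
  assumes "y \<in> nodes FK.piece" shows "lift_potential e s y = s (C.cell_coset y)"
  using assms unfolding FK.nodes_piece lift_potential_def by auto

text \<open>Along edges of \<open>H\<close> the sum of \<open>s\<close> and the indicator of
  \<open>e\<close> is invariant, along edges of \<open>K\<close> it is \<open>s\<close> itself. The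
  lifted potential extends both invariants from vertices to all centres and so yields the bridge
  condition of the criterion at \<open>VertexPt e\<close>.\<close>

lemma vertex_potential:
  assumes e: "e \<notin> WA.visits Wd"
  shows "\<exists>s. (\<forall>p U. p \<in> arc_paths FK.piece U \<longrightarrow> s (p 0) = s (p 1)) \<and>
    (\<forall>p U. p \<in> arc_paths FH.piece U \<longrightarrow>
      s (p 0) + of_bool (p 0 = VertexPt e) = s (p 1) + (of_bool (p 1 = VertexPt e) :: int))"
proof -
  have relP: "(\<exists>a b d. u = [a, b] \<and> v = [d] \<and> (a \<in> range Inl \<longleftrightarrow> d \<in> range Inl) \<and> (b \<in> range Inl \<longleftrightarrow> d \<in> range Inl)) \<or>
      (\<exists>a. u = [a] \<and> v = [])" if "(u, v) \<in> S" for u v :: "('a + 'b) list"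
    using that by (cases rule: S_cases) auto
  have "\<exists>s :: ('a + 'b) list set set \<Rightarrow> int. \<forall>c\<in>rcosets\<^bsub>G\<^esub> A. \<forall>l\<in>L.
    s (c #>\<^bsub>G\<^esub> cl [l]) = s c + (if l \<in> range Inl then of_bool (c = e) - of_bool (c #>\<^bsub>G\<^esub> cl [l] = e) else 0)"
    by (rule WA.potential[OF cl_S _ Wd e]; (assumption | erule relP))
  then obtain s :: "('a + 'b) list set set \<Rightarrow> int" where s: "\<And>c l. c \<in> rcosets\<^bsub>G\<^esub> A \<Longrightarrow> l \<in> L \<Longrightarrow>
    s (c #>\<^bsub>G\<^esub> cl [l]) = s c + (if l \<in> range Inl then of_bool (c = e) - of_bool (c #>\<^bsub>G\<^esub> cl [l] = e) else 0)"
    by blast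
  define f where "f c = s c + of_bool (c = e)" for c
  have fH: "f (c #>\<^bsub>G\<^esub> \<phi> (\<epsilon>H x)) = f c" if "c \<in> rcosets\<^bsub>G\<^esub> A" "x \<in> XH" for c x
    unfolding f_def \<phi>_\<epsilon>H using s[OF that(1) InlI[OF funcset_mem[OF H.gens that(2)]]] by simp
  have sK: "s (c #>\<^bsub>G\<^esub> \<phi> (\<epsilon>K x)) = s c" if "c \<in> rcosets\<^bsub>G\<^esub> A" "x \<in> XK" for c x
    unfolding \<phi>_\<epsilon>K using s[OF that(1) InrI[OF funcset_mem[OF K.gens that(2)]]] by (simp add: image_iff)
  show ?thesis
  proof (rule exI[of _ "lift_potential e s"], intro conjI allI impI)
    fix p U assume p: "p \<in> arc_paths FK.piece U"
    from FK.arc_path_nodes[OF p] show "lift_potential e s (p 0) = lift_potential e s (p 1)"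
    proof
      assume n: "p 0 \<in> nodes FK.piece \<and> p 1 \<in> nodes FK.piece"
      show ?thesis
        using lift_potential_K[OF conjunct1[OF n]] lift_potential_K[OF conjunct2[OF n]]
          FK.arc_path_invariant[OF p sK] by simp
    qed simp
  next
    fix p U assume p: "p \<in> arc_paths FH.piece U"
    from FH.arc_path_nodes[OF p]
    show "lift_potential e s (p 0) + of_bool (p 0 = VertexPt e) = lift_potential e s (p 1) + of_bool (p 1 = VertexPt e)"
    proof
      assume n: "p 0 \<in> nodes FH.piece \<and> p 1 \<in> nodes FH.piece"
      show ?thesis
        unfolding lift_potential_H[OF conjunct1[OF n]] lift_potential_H[OF conjunct2[OF n]]
        using FH.arc_path_invariant[OF p fH] unfolding f_def .
    qed simp
  qed
qed

section \<open>One component of the complement of a finite subcomplex\<close>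

context
  fixes V E F Y
  assumes C: "finite_subcomplex C.Cay V E F"
    and Y: "Y \<in> connected_components_of (subtopology C.XC (- cell_points V E F))"
begin

interpretation CC: complement C.Cay V E F
  using C by unfold_locales (auto simp: finite_subcomplex_def simp del: C.Cay_simps)

abbreviation "XY \<equiv> subtopology C.XC Y"

lemma Y_sub: "Y \<subseteq> CC.U"
  using connected_components_of_subset[OF Y] unfolding CC.topspace_XU .

lemma XY_eq: "subtopology CC.XU Y = XY"
  using Y_sub unfolding CC.U_def by (simp add: subtopology_subtopology Int_absorb1 subset_iff)

lemma topspace_XY: "topspace XY = Y"
  using Y_sub unfolding CC.U_def C.cx.topspace_realization topspace_subtopology by blast

definition "nds = nodes C.Cay \<inter> Y"
definition "typ i = (if i then FH.piece else FK.piece)"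
text \<open>Paths are asked to run in the whole complement only; since they start in the component,
  they cannot leave it.\<close>

definition "Q i = {p \<in> arc_paths (typ i) CC.U. p 0 \<in> nds \<and> p 1 \<in> nds}"

lemma arcs_typ: "arcs (typ i) \<subseteq> arcs C.Cay"
  unfolding typ_def using FH.arcs_piece FK.arcs_piece by simp

lemma arc_path_XY:
  assumes "p \<in> arc_paths C.Cay CC.U" "p 0 \<in> Y" shows "pathin XY p" "p 1 \<in> Y"
proof -
  show p: "pathin XY p"
    using pathin_component[OF Y CC.arc_paths_path[OF assms(1)] assms(2)] unfolding XY_eq .
  show "p 1 \<in> Y" using pathin_ends(2)[OF p] unfolding topspace_XY .
qed

text \<open>Only the starting point has to be checked: a path whose ends differ runs between nodes
  of its pieces, and connectedness keeps it in the component.\<close>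

lemma typ_arc_path:
  assumes "p \<in> arc_paths (typ i) CC.U" "p 0 \<in> nds" shows "p \<in> Q i"
proof -
  have pC: "p \<in> arc_paths C.Cay CC.U" by (rule arc_paths_mono[OF arcs_typ assms(1)])
  have "p 1 \<in> Y" using arc_path_XY(2)[OF pC] assms(2) by (simp add: nds_def)
  moreover have "p 1 \<in> nodes C.Cay"
  proof -
    have "p 0 = p 1 \<or> p 1 \<in> nodes (typ i)"
      using assms(1) FH.arc_path_nodes[of p] FK.arc_path_nodes[of p] unfolding typ_def by (auto split: if_splits)
    moreover have "nodes (typ i) \<subseteq> nodes C.Cay"
    proof -
      have "nodes (restrict_complex C.Cay E' F') \<subseteq> nodes C.Cay" if "E' \<subseteq> edges C.Cay" "F' \<subseteq> faces C.Cay" for E' F'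
        using that unfolding nodes_def restrict_complex_simps by blast
      then show ?thesis
        using FH.piece_sub FK.piece_sub unfolding typ_def FH.piece_def FK.piece_def by (cases i) (simp_all only: if_True if_False)
    qed
    ultimately show ?thesis using assms(2) unfolding nds_def by auto
  qed
  ultimately show ?thesis using assms unfolding Q_def nds_def by simp
qed

lemma arc_typ:
  assumes "p \<in> arcs C.Cay" obtains i where "p \<in> arcs (typ i)"
proof -
  have "p \<in> arcs FH.piece \<or> p \<in> arcs FK.piece" using assms arcs_pieces by blast
  then show ?thesis using that[of True] that[of False] by (auto simp: typ_def)
qed

text \<open>Same closure as \<open>comp\<close> of the path system. It is introduced separately
  because the connectedness assumption of that system is itself proved with such composites.\<close>

inductive_set cmp where
  base: "p \<in> Q i \<Longrightarrow> p \<in> cmp"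
| join: "p \<in> cmp \<Longrightarrow> q \<in> cmp \<Longrightarrow> p 1 = q 0 \<Longrightarrow> join_loops p q \<in> cmp"

lemma cmp_ends: "p \<in> cmp \<Longrightarrow> p 0 \<in> nds \<and> p 1 \<in> nds"
  by (induction rule: cmp.induct) (simp_all add: Q_def)

lemma arc_path_cmp: "p \<in> arc_paths C.Cay CC.U \<Longrightarrow> p 0 \<in> nds \<Longrightarrow> p \<in> cmp"
proof (induction rule: arc_paths.induct)
  case (const x)
  then show ?case by (intro cmp.base[OF typ_arc_path] arc_paths.const)
next
  case (arc p)
  obtain i where "p \<in> arcs (typ i)" by (rule arc_typ[OF arc.hyps(1)])
  then show ?case using arc by (intro cmp.base[OF typ_arc_path] arc_paths.arc)
next
  case (rv_arc p)
  obtain i where "p \<in> arcs (typ i)" by (rule arc_typ[OF rv_arc.hyps(1)])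
  then show ?case using rv_arc by (intro cmp.base[OF typ_arc_path] arc_paths.rv_arc)
next
  case (join p q)
  have p: "p \<in> cmp" using join.IH(1) join.prems by simp
  have "q 0 \<in> nds" using cmp_ends[OF p] join.hyps(3) by simp
  then show ?case using join.IH(2) p join.hyps(3) by (intro cmp.join)
qed

lemma cmp_linked: "p \<in> cmp \<Longrightarrow> (p 0, p 1) \<in> (\<Union>i. {(p 0, p 1) |p. p \<in> Q i})\<^sup>*"
proof (induction rule: cmp.induct)
  case (base p i)
  then show ?case by (intro r_into_rtrancl) blast
next
  case (join p q)
  from rtrancl_trans[OF join.IH(1) join.IH(2)[folded join.hyps(3)]]
  show ?case by (simp only: join_loops_0 join_loops_1)
qed

lemma path_cmp:
  assumes "pathin CC.XU p" "p 0 \<in> nds" "p 1 \<in> nds" obtains q where "q \<in> cmp" "hp XY p q"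
proof -
  obtain q where q: "q \<in> arc_paths C.Cay CC.U" "hp CC.XU p q"
    using CC.arc_approximation[OF assms(1)] assms(2,3) unfolding CC.arc_homotopic_def nds_def by blast
  have "q \<in> cmp" using arc_path_cmp[OF q(1)] hp_0[OF q(2)] assms(2) by simp
  moreover have "hp XY p q" using hp_component[OF Y q(2)] assms(2) unfolding nds_def XY_eq by blast
  ultimately show ?thesis by (rule that)
qed

text \<open>At a node of a piece this is \<open>piece_node\<close>; at a centre that belongs to no
  piece of type \<open>i\<close> the only path in \<open>Q i\<close> is constant.\<close>

lemma node_loops:
  assumes d: "d \<in> nds"
  shows "\<exists>T. finite T \<and> T \<subseteq> loops XY d \<and> Q i \<inter> loops XY d \<subseteq> loop_span XY d T"
proof (cases "d \<in> nodes (typ i)")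
  case True
  have dY: "d \<in> Y" using d by (simp add: nds_def)
  have "\<exists>T. finite T \<and> T \<subseteq> loops XY d \<and> arc_paths (typ i) CC.U \<inter> loops XY d \<subseteq> loop_span XY d T"
    using FH.piece_node(1)[OF C Y _ dY] FK.piece_node(1)[OF C Y _ dY] True unfolding typ_def by (cases i) simp_all
  then show ?thesis unfolding Q_def by blast
next
  case False
  have "p = (\<lambda>_. d)" if "p \<in> arc_paths (typ i) CC.U" "p 0 = d" for p
    using FH.arc_path_off[of p _ d] FK.arc_path_off[of p _ d] that False unfolding typ_def by (cases i) simp_all
  then have c: "p = (\<lambda>_. d)" if "p \<in> Q i" "p \<in> loops XY d" for p
    using that unfolding Q_def loops_iff by simp
  have "Q i \<inter> loops XY d \<subseteq> loop_span XY d {}"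
  proof
    fix p assume "p \<in> Q i \<inter> loops XY d"
    then have "p = (\<lambda>_. d)" using c by blast
    then show "p \<in> loop_span XY d {}" using loop_span.const by (simp only:)
  qed
  then show ?thesis by (intro exI[of _ "{}"]) simp
qed

text \<open>Contrapositive of \<open>guarded\<close>: an orbit meeting \<open>V\<close> or a visited
  coset would link \<open>d\<close> to a guard. So the orbit avoids both, and loops in its piece are
  null-homotopic.\<close>

lemma off_guards:
  assumes d: "d \<in> nds" and p: "p \<in> Q i" "p \<in> loops XY d"
    and off: "\<And>y. y \<in> FH.guards V \<union> FK.guards V \<Longrightarrow> (d, y) \<notin> {(p 0, p 1) |p. p \<in> Q i}"
  shows "hp XY p (\<lambda>_. d)"
proof -
  have dY: "d \<in> Y" "d \<in> CC.U" using d Y_sub by (auto simp: nds_def)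
  have pp: "p \<in> arc_paths (typ i) CC.U" "p 0 = d" "p 1 = d" using p unfolding Q_def loops_iff by simp_all
  have noq: "\<not> (\<exists>q\<in>arc_paths (typ i) CC.U. q 0 = d \<and> q 1 = y)" if "y \<in> FH.guards V \<union> FK.guards V" for y
  proof
    assume "\<exists>q\<in>arc_paths (typ i) CC.U. q 0 = d \<and> q 1 = y"
    then obtain q where q: "q \<in> arc_paths (typ i) CC.U" "q 0 = d" "q 1 = y" by blast
    then have "q \<in> Q i" using typ_arc_path[OF q(1)] d by simp
    then have "(d, y) \<in> {(p 0, p 1) |p. p \<in> Q i}" using q by blast
    then show False using off[OF that] by simp
  qed
  show ?thesis
  proof (cases "d \<in> nodes (typ i)")
    case False
    have "p = (\<lambda>_. d)"
      using FH.arc_path_off[of p _ d] FK.arc_path_off[of p _ d] pp False unfolding typ_def by (cases i) simp_all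
    moreover have "pathin XY (\<lambda>_. d)" by (rule pathin_const) (simp only: topspace_XY dY)
    ultimately show ?thesis using hp_refl by (simp only:)
  next
    case n: True
    show ?thesis
    proof (cases i)
      case True
      have n: "d \<in> nodes FH.piece" and pH: "p \<in> arc_paths FH.piece CC.U" using n pp True by (simp_all add: typ_def)
      have "C.cell_coset d #>\<^bsub>G\<^esub> jH h \<notin> V \<union> WA.visits Wd" if h: "h \<in> carrier H" for h
        using FH.guarded[OF C Y n dY(2) h] noq True unfolding FH.lk_def[OF C Y] typ_def by auto
      from FH.piece_node(2)[OF C Y n dY(1) this pH pp(2,3)] show ?thesis .
    next
      case False
      have n: "d \<in> nodes FK.piece" and pK: "p \<in> arc_paths FK.piece CC.U" using n pp False by (simp_all add: typ_def)
      have "C.cell_coset d #>\<^bsub>G\<^esub> jK h \<notin> V \<union> WA.visits Wd" if h: "h \<in> carrier K" for h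
        using FK.guarded[OF C Y n dY(2) h] noq False unfolding FK.lk_def[OF C Y] typ_def by auto
      from FK.piece_node(2)[OF C Y n dY(1) this pK pp(2,3)] show ?thesis .
    qed
  qed
qed

lemma component_finitely_generated:
  assumes x: "x \<in> Y" shows "finitely_generated (fundamental_group XY x)"
proof -
  \<comment> \<open>The base point is moved to the centre of a neighbourhood containing it, because
    the path system needs a base point in \<open>nds\<close>; the reversed track leads back at the
    end.\<close>
  obtain \<delta> \<sigma> where c: "CC.centre \<delta> \<sigma>" "x \<in> nbhd C.Cay \<delta> \<sigma>" using CC.ex_centre x Y_sub by blast
  note tr = CC.track[OF c]
  have trY: "pathin XY (CC.track \<delta> \<sigma> x)"
    using pathin_component[OF Y tr(3)] tr(1) x unfolding XY_eq by simp
  have "\<sigma> \<in> Y" using pathin_ends(2)[OF trY] tr(2) unfolding topspace_XY by simp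
  then have s: "\<sigma> \<in> nds" using c(1) unfolding CC.centre_def nds_def by simp
  interpret P: path_system XY nds Q \<sigma>
  proof
    show "nds \<subseteq> topspace XY" unfolding topspace_XY nds_def by blast
    show "\<sigma> \<in> nds" by (rule s)
    show "pathin XY p" if "p \<in> Q i" for p i
      using that arc_path_XY(1)[OF arc_paths_mono[OF arcs_typ]] unfolding Q_def nds_def by blast
    show "p 0 \<in> nds \<and> p 1 \<in> nds" if "p \<in> Q i" for p i using that by (simp add: Q_def)
    show "(\<lambda>_. d) \<in> Q i" if "d \<in> nds" for d i
      using that Y_sub by (intro typ_arc_path arc_paths.const) (auto simp: nds_def)
    show "rv p \<in> Q i" if "p \<in> Q i" for p i using that arc_paths_rv[of p "typ i" CC.U] by (simp add: Q_def)
    show "join_loops p q \<in> Q i" if "p \<in> Q i" "q \<in> Q i" "p 1 = q 0" for p q i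
      using that arc_paths.join[of p "typ i" CC.U q] by (simp add: Q_def)
    show "(\<sigma>, d) \<in> (\<Union>i. {(p 0, p 1) |p. p \<in> Q i})\<^sup>*" if d: "d \<in> nds" for d
    proof -
      obtain p where p: "pathin CC.XU p" "p 0 = \<sigma>" "p 1 = d"
        using CC.component_path_connected[OF Y, of \<sigma> d] s d unfolding nds_def by blast
      obtain q where q: "q \<in> cmp" "hp XY p q" by (rule path_cmp[OF p(1)]) (use p s d in simp_all)
      show ?thesis using cmp_linked[OF q(1)] hp_0[OF q(2)] hp_1[OF q(2)] p by simp
    qed
  qed
  have cmp: "q \<in> P.comp" if "q \<in> cmp" for q
    using that by (induction rule: cmp.induct) (auto intro: P.comp.intros)
  have "finitely_generated (fundamental_group XY \<sigma>)"
  proof (rule P.finitely_generated_criterion)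
    show "\<exists>q\<in>P.comp. hp XY p q" if p: "p \<in> loops XY \<sigma>" for p
    proof -
      have p': "pathin XY p" "p 0 = \<sigma>" "p 1 = \<sigma>" using p by (simp_all add: loops_iff)
      have "pathin CC.XU p" using p'(1) unfolding XY_eq[symmetric] pathin_def continuous_map_in_subtopology by blast
      then obtain q where "q \<in> cmp" "hp XY p q" by (rule path_cmp) (use p' s in simp_all)
      then show ?thesis using cmp by blast
    qed
    show "\<exists>T. finite T \<and> T \<subseteq> loops XY d \<and> Q i \<inter> loops XY d \<subseteq> loop_span XY d T" if "d \<in> nds" for i d
      by (rule node_loops[OF that])
    show "finite (FH.guards V \<union> FK.guards V)"
      using FH.finite_guards[OF C Y] FK.finite_guards[OF C Y] by simp
    show "hp XY p (\<lambda>_. d)" if "d \<in> nds" "\<And>y. y \<in> FH.guards V \<union> FK.guards V \<Longrightarrow> (d, y) \<notin> P.lnk i" "p \<in> Q i" "p \<in> loops XY d" for i d p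
      by (rule off_guards[OF that(1,3,4) that(2)[unfolded P.lnk_def]])
    show "finite (VertexPt ` WA.visits Wd)" using WA.finite_visits[OF Wd(1)] by simp
    fix d assume d: "d \<in> nds - VertexPt ` WA.visits Wd"
    show "(\<exists>i. \<forall>y. (d, y) \<in> P.lnk i \<longrightarrow> y = d) \<or>
        (\<exists>s. (\<forall>(a, b) \<in> P.lnk False. s a = s b) \<and>
          (\<forall>(a, b) \<in> P.lnk True. s a + of_bool (a = d) = s b + (of_bool (b = d) :: int)))"
    \<comment> \<open>An unvisited vertex carries a potential. The centre of an edge or 2-cell
      belongs to pieces of at most one type, so it is alone in its class of another type.\<close>
    proof (cases "\<exists>e. d = VertexPt e")
      case True
      then obtain e where e: "d = VertexPt e" "e \<notin> WA.visits Wd" using d by blast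
      obtain s :: "_ \<Rightarrow> int" where s: "\<And>p U. p \<in> arc_paths FK.piece U \<Longrightarrow> s (p 0) = s (p 1)"
        "\<And>p U. p \<in> arc_paths FH.piece U \<Longrightarrow> s (p 0) + of_bool (p 0 = VertexPt e) = s (p 1) + of_bool (p 1 = VertexPt e)"
        using vertex_potential[OF e(2)] by blast
      have sK: "s a = s b" if ab: "(a, b) \<in> P.lnk False" for a b
      proof -
        obtain p where p: "p \<in> arc_paths FK.piece CC.U" "a = p 0" "b = p 1"
          using ab unfolding P.lnk_def Q_def typ_def by auto
        show ?thesis unfolding p(2,3) by (rule s(1)[OF p(1)])
      qed
      have sH: "s a + of_bool (a = d) = s b + of_bool (b = d)" if ab: "(a, b) \<in> P.lnk True" for a b
      proof -
        obtain p where p: "p \<in> arc_paths FH.piece CC.U" "a = p 0" "b = p 1"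
          using ab unfolding P.lnk_def Q_def typ_def by auto
        show ?thesis unfolding p(2,3) e(1) by (rule s(2)[OF p(1)])
      qed
      have "\<forall>(a, b) \<in> P.lnk False. s a = s b" by (clarify, rule sK)
      moreover have "\<forall>(a, b) \<in> P.lnk True. s a + of_bool (a = d) = s b + of_bool (b = d)" by (clarify, rule sH)
      ultimately show ?thesis by blast
    next
      case False
      have "d \<notin> nodes FH.piece \<or> d \<notin> nodes FK.piece"
        using piece_types[of d] False d unfolding nds_def by blast
      then have "d \<notin> nodes (typ True) \<or> d \<notin> nodes (typ False)" by (simp only: typ_def if_True if_False simp_thms)
      then obtain i where i: "d \<notin> nodes (typ i)" by (elim disjE) (rule that, assumption)+
      have "y = d" if dy: "(d, y) \<in> P.lnk i" for y
      proof -
        obtain p where p: "p \<in> arc_paths (typ i) CC.U" "p 0 = d" "p 1 = y"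
          using dy unfolding P.lnk_def Q_def by blast
        have "p = (\<lambda>_. d)"
          using FH.arc_path_off[of p _ d] FK.arc_path_off[of p _ d] p i unfolding typ_def by (cases i) simp_all
        then show ?thesis using p(3) by simp
      qed
      then show ?thesis by blast
    qed
  qed
  then have "finitely_generated (fundamental_group XY (rv (CC.track \<delta> \<sigma> x) 0))" using tr(2) by simp
  from finitely_generated_base_change[OF pathin_rv[OF trY] this] show ?thesis using tr(1) by simp
qed

end

lemma tame_subgroup: "tame_wrt G X R \<phi> A"
  unfolding tame_wrt_def using component_finitely_generated by blast

end

end

theorem theorem2:
  fixes H :: "('a, 'm) monoid_scheme" and K :: "('b, 'n) monoid_scheme"
  assumes "locally_tame H" and "locally_tame K"
  shows "locally_tame (free_product H K)"
proof -
  obtain XH :: "nat set" and RH \<phi>H where H: "finite_presentation H XH RH \<phi>H"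
    and tame_H: "\<And>B. subgroup B H \<Longrightarrow> finitely_generated (H\<lparr>carrier := B\<rparr>) \<Longrightarrow> tame_wrt H XH RH \<phi>H B"
    using assms(1) unfolding locally_tame_def by blast
  obtain XK :: "nat set" and RK \<phi>K where K: "finite_presentation K XK RK \<phi>K"
    and tame_K: "\<And>B. subgroup B K \<Longrightarrow> finitely_generated (K\<lparr>carrier := B\<rparr>) \<Longrightarrow> tame_wrt K XK RK \<phi>K B"
    using assms(2) unfolding locally_tame_def by blast
  interpret free_pair H XH \<phi>H RH K XK \<phi>K RK
    using H K unfolding finite_presentation_iff by (rule free_pair.intro)
  have "tame_wrt G X R \<phi> A" if A: "subgroup A G" "finitely_generated (G\<lparr>carrier := A\<rparr>)" for A
  proof -
    obtain T where T: "finite T" "T \<subseteq> A" "generate (G\<lparr>carrier := A\<rparr>) T = A"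
      using A(2) unfolding finitely_generated_def by auto
    \<comment> \<open>Generators of \<open>A\<close> are represented by words in syllables, since
      the visited cosets are read off from the prefixes of such words.\<close>
    have "T \<subseteq> cl ` lists L" using T(2) subgroup.subset[OF A(1)] by (auto simp: word_monoid_def)
    then obtain Wd where Wd: "Wd \<subseteq> lists L" "finite Wd" "T = cl ` Wd" using finite_subset_image[OF T(1)] by metis
    have "generate G (cl ` Wd) = A"
      using G.generate_consistent[OF T(2) A(1)] T(3) Wd(3) by simp
    then show ?thesis using tame_subgroup[OF A(1) Wd(2,1) _ _ tame_H tame_K] T(2) Wd(3) by blast
  qed
  moreover have "finite_presentation (free_product H K) X R \<phi>"
    unfolding free_product_def finite_presentation_iff by (rule presentation_axioms)
  ultimately show ?thesis
    unfolding locally_tame_def free_product_def by blast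
qed

end
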